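(* Let $X$ be a compact submanifold of $\mathbb{R}^d$ that is either a compact body ($\dim X=d$) or a closed submanifold ($\partial X=\emptyset$, $\dim X<d$). Let $r>0$. Then balls, circles and $2$-spheres can be identified by the interpoint distance distribution; that is, the following hold, where equality of $X$ with a ball, circle or sphere means equality up to congruence (motions) of $\mathbb{R}^d$. (1) If $X$ is a compact body of class $C^2$ and $f_X(t)=f_{B^d(r)}(t)$ for every $t\ge 0$, then $X=B^d(r)$. (2) If $X$ is of class $C^3$ and, for some $n$, $f_X(t)=f_{B^n(r)}(t)$ for every $t\ge0$, then $n=d$ and $X=B^d(r)$. (3) If $X$ is of class $C^3$ and $f_X(t)=f_{S^1(r)}(t)$ for every $t\ge0$, then $X=S^1(r)$. (4) If $X$ is of class $C^4$, $d-\dim X\le1$ and $f_X(t)=f_{S^2(r)}(t)$ for every $t\ge0$, then $d=3$ and $X=S^2(r)$.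
   Context: A compact body in $\mathbb{R}^d$ is the closure of a bounded open set of $\mathbb{R}^d$; it is of class $C^k$ if it is a $d$-dimensional $C^k$ submanifold with boundary (so its boundary is a $C^k$ hypersurface). A closed submanifold is a compact submanifold without boundary. Submanifolds are embedded and need not be connected. $B^n(r)$, $S^1(r)$, $S^2(r)$ denote a (solid) round $n$-ball, a round circle and a round $2$-sphere of radius $r$ in Euclidean space. The interpoint distance distribution of $X$ is $f_X(t)=\mathrm{Vol}\left(\{(x,y)\in X\times X : |x-y|\le t\}\right)$, where $\mathrm{Vol}$ is the product of the Lebesgue measures on $X$ (the $(\dim X)$-dimensional volume induced from $\mathbb{R}^d$). *)

theory Defs
  imports "HOL-Analysis.Analysis" "HOL-Combinatorics.Permutations"
begin

section \<open>Maps of class $C^k$ and submanifolds\<close>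

text \<open>Meaningful for open \<open>S\<close> only. In finite dimension, continuity of all directional
  derivatives is the same as continuity of the total derivative.\<close>

primrec Ck_on :: "nat \<Rightarrow> 'a::euclidean_space set \<Rightarrow> ('a \<Rightarrow> 'b::real_normed_vector) \<Rightarrow> bool" where
  "Ck_on 0 S f \<longleftrightarrow> continuous_on S f"
| "Ck_on (Suc k) S f \<longleftrightarrow>
     (\<forall>x\<in>S. f differentiable (at x)) \<and>
     (\<forall>v. Ck_on k S (\<lambda>x. frechet_derivative f (at x) v))"

definition Ck_diffeo ::
  "nat \<Rightarrow> 'a::euclidean_space set \<Rightarrow> 'a set \<Rightarrow> ('a \<Rightarrow> 'a) \<Rightarrow> ('a \<Rightarrow> 'a) \<Rightarrow> bool" where
  "Ck_diffeo k U V \<Phi> \<Psi> \<longleftrightarrow>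
     open U \<and> open V \<and> homeomorphism U V \<Phi> \<Psi> \<and> Ck_on k U \<Phi> \<and> Ck_on k V \<Psi>"

text \<open>The coordinate subspace \<open>span B\<close>, with \<open>B\<close> a set of \<open>m\<close> vectors of the standard basis, is a
  copy of $\mathbb{R}^m$ in the ambient space; its closed coordinate half-spaces are the models
  for boundary points. For \<open>m = 0\<close> there are no half-spaces.\<close>

definition half_spaces :: "'a::euclidean_space set \<Rightarrow> 'a set set" where
  "half_spaces B = {{x \<in> span B. 0 \<le> x \<bullet> b} | b. b \<in> B}"

text \<open>A $C^k$ diffeomorphism \<open>\<Phi>\<close> between open sets of the ambient space, with inverse \<open>\<Psi>\<close>, that
  straightens \<open>X\<close> to the model \<open>H\<close>.\<close>

definition adapted_chart ::
  "nat \<Rightarrow> 'a::euclidean_space set \<Rightarrow> 'a set \<Rightarrow> 'a set \<Rightarrow> 'a set \<Rightarrow> ('a \<Rightarrow> 'a) \<Rightarrow> ('a \<Rightarrow> 'a) \<Rightarrow> bool" where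
  "adapted_chart k X H U V \<Phi> \<Psi> \<longleftrightarrow> Ck_diffeo k U V \<Phi> \<Psi> \<and> \<Phi> ` (U \<inter> X) = V \<inter> H"

definition submanifold :: "nat \<Rightarrow> nat \<Rightarrow> 'a::euclidean_space set \<Rightarrow> bool" where
  "submanifold k m X \<longleftrightarrow>
     (\<forall>p\<in>X. \<exists>B U V \<Phi> \<Psi>. B \<subseteq> Basis \<and> card B = m \<and> p \<in> U \<and> adapted_chart k X (span B) U V \<Phi> \<Psi>)"

definition submanifold_with_boundary :: "nat \<Rightarrow> nat \<Rightarrow> 'a::euclidean_space set \<Rightarrow> bool" where
  "submanifold_with_boundary k m X \<longleftrightarrow>
     (\<forall>p\<in>X. \<exists>B H U V \<Phi> \<Psi>. B \<subseteq> Basis \<and> card B = m \<and> H \<in> insert (span B) (half_spaces B) \<and>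
        p \<in> U \<and> adapted_chart k X H U V \<Phi> \<Psi>)"

definition compact_body :: "nat \<Rightarrow> 'a::euclidean_space set \<Rightarrow> bool" where
  "compact_body k X \<longleftrightarrow>
     (\<exists>W. open W \<and> bounded W \<and> X = closure W) \<and> submanifold_with_boundary k DIM('a) X"

definition closed_submanifold :: "nat \<Rightarrow> nat \<Rightarrow> 'a::euclidean_space set \<Rightarrow> bool" where
  "closed_submanifold k m X \<longleftrightarrow> compact X \<and> submanifold k m X"

definition body_or_closed_submanifold :: "nat \<Rightarrow> nat \<Rightarrow> 'a::euclidean_space set \<Rightarrow> bool" where
  "body_or_closed_submanifold k m X \<longleftrightarrow>
     m = DIM('a) \<and> compact_body k X \<or> m < DIM('a) \<and> closed_submanifold k m X"


section \<open>Induced volume and interpoint distances\<close>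

text \<open>Lebesgue measure of \<open>span B\<close> as a Borel measure on the ambient space, following the
  definition of \<^const>\<open>lborel\<close>.\<close>

definition lborel_span :: "'a::euclidean_space set \<Rightarrow> 'a measure" where
  "lborel_span B = distr (\<Pi>\<^sub>M b\<in>B. lborel) borel (\<lambda>f. \<Sum>b\<in>B. f b *\<^sub>R b)"

lemma lborel_span_Basis: "lborel_span Basis = lborel"
  by (simp add: lborel_span_def lborel_eq[symmetric])

text \<open>Leibniz formula for the determinant of the first fundamental form
  $(\langle \partial_b \Psi, \partial_c \Psi\rangle)_{b,c \in B}$ at \<open>x\<close>; \<^const>\<open>det\<close> is
  available only for matrices indexed by a type.\<close>

definition gram_det :: "'a::euclidean_space set \<Rightarrow> ('a \<Rightarrow> 'a) \<Rightarrow> 'a \<Rightarrow> real" where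
  "gram_det B \<Psi> x =
     (\<Sum>\<pi> | \<pi> permutes B. of_int (sign \<pi>) *
        (\<Prod>b\<in>B. frechet_derivative \<Psi> (at x) b \<bullet> frechet_derivative \<Psi> (at x) (\<pi> b)))"

text \<open>The volume induced on \<open>X\<close> by the Euclidean metric: the Borel measure on \<open>X\<close> whose density in
  the coordinates of every adapted chart is the square root of the Gram determinant. It is
  uniquely determined when \<open>X\<close> is compact and covered by such charts, in particular for the compact
  bodies and closed submanifolds above with \<open>k \<ge> 1\<close>. Charts of class $C^1$ are enough
  whatever the class of \<open>X\<close>. For \<open>m = DIM('a)\<close> it is the restriction of \<^const>\<open>lborel\<close>
  and for \<open>m = 0\<close> the counting measure.\<close>

definition induced_volume :: "nat \<Rightarrow> 'a::euclidean_space set \<Rightarrow> 'a measure" where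
  "induced_volume m X =
     (THE \<mu>. sets \<mu> = sets (restrict_space borel X) \<and>
        (\<forall>B H U V \<Phi> \<Psi> A.
           B \<subseteq> Basis \<longrightarrow> card B = m \<longrightarrow> H \<in> insert (span B) (half_spaces B) \<longrightarrow>
           adapted_chart 1 X H U V \<Phi> \<Psi> \<longrightarrow> A \<in> sets borel \<longrightarrow> A \<subseteq> V \<inter> H \<longrightarrow>
           emeasure \<mu> (\<Psi> ` A) = (\<integral>\<^sup>+x\<in>A. ennreal (sqrt (gram_det B \<Psi> x)) \<partial>lborel_span B)))"

text \<open>The function $f_X$, where \<open>m\<close> is the dimension of \<open>X\<close>.\<close>

definition distance_distribution :: "nat \<Rightarrow> 'a::euclidean_space set \<Rightarrow> real \<Rightarrow> ennreal" where
  "distance_distribution m X t =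
     emeasure (induced_volume m X \<Otimes>\<^sub>M induced_volume m X)
       {(x, y). x \<in> X \<and> y \<in> X \<and> dist x y \<le> t}"

text \<open>\<open>X\<close> is a copy of \<open>Y\<close> under an isometric embedding of the Euclidean space of \<open>Y\<close> into that of
  \<open>X\<close>. If both spaces are the same this is congruence by a motion; the copies of a round circle in
  the plane are exactly the round circles of the same radius in 2-planes of the target.\<close>

definition congruent_copy :: "'a::euclidean_space set \<Rightarrow> 'b::euclidean_space set \<Rightarrow> bool" where
  "congruent_copy X Y \<longleftrightarrow>
     (\<exists>g :: 'b \<Rightarrow> 'a. (\<forall>x y. dist (g x) (g y) = dist x y) \<and> X = g ` Y)"

end

theory Submission
 imports Defs
begin

text \<open>The distribution determines the dimension \<open>m\<close>, because it has order $t^m$ at \<open>0\<close>, and the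
  integral of every function of \<open>|x - y|\<close> over \<open>X \<times> X\<close>: the volume \<open>V\<close>, the moment
  of inertia about the centroid \<open>c\<close>, and all higher moments of the distance.

  Balls: by the bathtub principle a ball minimizes the moment of inertia among bodies of the same volume,
  with equality only for a ball. A closed submanifold is excluded by the next order at \<open>0\<close>: its
  distribution is at least $V \omega_m t^m - O(t^{m+2})$, but that of a ball loses a term of order
  $t^{m+1}$ along the boundary.

  Circles: the $t^5$ coefficient of the integral of \<open>max 0 (t\<^sup>2 - |x - y|\<^sup>2)\<close>
  controls $\int |\kappa|^2$ for the curvature vector $\kappa$. As $\int |x - c|^2 = r^2 V$ and
  $\int \kappa \cdot (x - c) = -V$ by the first variation of length, the case of equality in the
  Cauchy--Schwarz inequality gives $\kappa = -(x - c)/r^2$, and \<open>X\<close> consists of round circles;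
  the length leaves only one.

  2-spheres: by the Cauchy--Schwarz inequality the second and fourth moments force \<open>|x - c| = r\<close>
  almost everywhere in dimension at most three, and a closed surface in the sphere is open and closed in it.\<close>

subsection \<open>Change of variables for the Lebesgue integral\<close>

text \<open>Beyond the order at 0 only one-sided estimates enter: a lower bound on the side of
  \<open>X\<close> against an upper bound on the side of the explicit model. For circles the
  obstacle is that the curvature term of the distribution, of order \<open>t ^ 3\<close>, has the
  size of the error made in deciding where a curve leaves a ball of radius \<open>t\<close>. The
  kernel \<open>cap_kernel\<close> vanishes at distance \<open>t\<close>, which pushes this error
  two orders below the curvature term. The first variation of length would need an integration by
  parts over a closed curve of unknown topology. It is replaced by the weight
  \<open>moment_weight\<close>: its antisymmetric part leaves the double integral unchanged but adds
  a multiple of \<open>1 + ka \<bullet> (x - c)\<close> to the local coefficient, for the curvature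
  vector \<open>ka\<close>. With the factor \<open>1 / (4 * r\<^sup>2)\<close> the local coefficient
  completes to a square, and Fatou's lemma turns the comparison of integrals into the curvature
  equation almost everywhere, hence everywhere by continuity. The induced volume is known only
  through its values in charts, so every measure theoretic fact is derived from that
  characterization.\<close>

text \<open>The change of variables theorem of the library needs a wellordered index type; the copy
 \<open>'a wo\<close> of a finite type carries an arbitrary wellorder.\<close>

typedef 'a wo = "UNIV :: 'a set" by simp

instance wo :: (finite) finite
proof
 have "range (Abs_wo :: 'a => 'a wo) = UNIV"
  by (metis Rep_wo_inverse surjI)
 then show "finite (UNIV :: 'a wo set)"
  by (metis finite_code finite_imageI)
qed

definition wo_index :: "'a::finite wo => nat" where
 "wo_index x = (SOME f :: 'a => nat. inj f) (Rep_wo x)"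

lemma inj_wo_index: "inj (wo_index :: 'a::finite wo => nat)"
proof -
 have "\<exists>f :: 'a => nat. inj f"
  using finite_imp_inj_to_nat_seg by fastforce
 then have "inj (SOME f :: 'a => nat. inj f)"
  by (rule someI_ex)
 from inj_compose[OF this, of Rep_wo] show ?thesis
  using Rep_wo_inject by (force simp: wo_index_def[abs_def] o_def inj_on_def)
qed

instantiation wo :: (finite) wellorder
begin
definition less_eq_wo :: "'a wo => 'a wo => bool" where "x <= y \<longleftrightarrow> wo_index x <= wo_index y"
definition less_wo :: "'a wo => 'a wo => bool" where "x < y \<longleftrightarrow> wo_index x < wo_index y"
instance
proof
 fix P :: "'a wo => bool" and a
 assume *: "!!x. (!!y. y < x ==> P y) ==> P x"
 show "P a"
  by (induction a rule: measure_induct_rule[of wo_index]) (use * in \<open>auto simp: less_wo_def\<close>)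
qed (use inj_wo_index in \<open>auto simp: less_eq_wo_def less_wo_def dest: injD\<close>)
end

text \<open>Relabelling coordinates carries boxes to boxes with the same side lengths, and
  \<open>lborel\<close> is determined by its values on boxes.\<close>

lemma lborel_distr_Basis_bij:
 fixes be :: "'a::euclidean_space => 'b::euclidean_space"
 assumes be: "bij_betw be Basis Basis"
 shows "distr lborel borel (\<lambda>x. \<Sum>b\<in>Basis. (x \<bullet> b) *\<^sub>R be b) = lborel"
proof (rule lborel_eqI[symmetric])
 let ?f = "\<lambda>x. \<Sum>b\<in>Basis. (x \<bullet> b) *\<^sub>R be b"
 have beB: "be b \<in> Basis" "be b = be c \<longleftrightarrow> b = c" if "b \<in> Basis" "c \<in> Basis" for b c
  using that bij_betwE[OF be] inj_on_eq_iff[OF bij_betw_imp_inj_on[OF be]] by auto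
 have f: "?f x \<bullet> be c = x \<bullet> c" if "c \<in> Basis" for x c
 proof -
  have "?f x \<bullet> be c = (\<Sum>b\<in>Basis. if b = c then x \<bullet> b else 0)"
   unfolding inner_sum_left using beB that by (intro sum.cong refl) (auto simp: inner_Basis)
  then show ?thesis using that by simp
 qed
 fix l u :: 'b assume lu: "!!b. b \<in> Basis ==> l \<bullet> b <= u \<bullet> b"
 define g where "g x = (\<Sum>b\<in>Basis. (x \<bullet> be b) *\<^sub>R b)" for x
 have g: "g x \<bullet> b = x \<bullet> be b" if "b \<in> Basis" for x b using that by (simp add: g_def)
 have "?f -` box l u = box (g l) (g u)"
  unfolding box_def bij_betw_imp_surj_on[OF be, symmetric] ball_simps by (auto simp: f g)
 then have "emeasure (distr lborel borel ?f) (box l u) = emeasure lborel (box (g l) (g u))"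
  by (subst emeasure_distr) auto
 also have "... = (\<Prod>b\<in>Basis. (u - l) \<bullet> be b)"
  using lu beB by (subst emeasure_lborel_box) (auto simp: g inner_diff_left intro!: arg_cong[where f = ennreal] prod.cong)
 also have "... = (\<Prod>b\<in>Basis. (u - l) \<bullet> b)" by (subst prod.reindex_bij_betw[OF be]) simp
 finally show "emeasure (distr lborel borel ?f) (box l u) = (\<Prod>b\<in>Basis. (u - l) \<bullet> b)" .
qed simp

text \<open>Conjugating a permutation by the bijection preserves its sign, so the Leibniz sums agree
  term by term.\<close>

lemma det_reindex:
 fixes be :: "'a::finite => 'b::finite" and A :: "real^'b^'b"
 assumes "bij be"
 shows "det (\<chi> i j. A $ be i $ be j) = det A"
proof -
 let ?m = "map_permutation UNIV be"
 have inj: "inj be" using assms bij_is_inj by blast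
 have m: "?m p = be \<circ> p \<circ> inv be" for p
  using assms by (auto simp: map_permutation_def fun_eq_iff restrict_id_def bij_def)
 have bij: "bij_betw ?m {p. p permutes UNIV} {p. p permutes UNIV}"
  using bij_betw_permutations[of be UNIV UNIV] assms by (simp add: m[abs_def] o_def)
 show ?thesis
  unfolding det_def
 proof (subst sum.reindex_bij_betw[OF bij, symmetric], intro sum.cong refl)
  fix p assume "p \<in> {p :: 'a => 'a. p permutes UNIV}"
  then have p: "p permutes UNIV" by simp
  have "(\<Prod>i\<in>UNIV. (\<chi> i j. A $ be i $ be j) $ i $ p i) = (\<Prod>i\<in>UNIV. A $ i $ ?m p i)"
   using assms by (subst prod.reindex_bij_betw[OF assms, symmetric]) (simp add: m inj)
  then show "of_int (sign p) * (\<Prod>i\<in>UNIV. (\<chi> i j. A $ be i $ be j) $ i $ p i) =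
    of_int (sign (?m p)) * (\<Prod>i\<in>UNIV. A $ i $ ?m p i)"
   using sign_map_permutation[OF inj p] by simp
 qed
qed

definition to_wo :: "real^'d => real^'d wo" where "to_wo x = (\<chi> i. x $ Rep_wo i)"
definition of_wo :: "real^'d wo => real^'d" where "of_wo x = (\<chi> i. x $ Abs_wo i)"

lemma of_to_wo[simp]: "of_wo (to_wo x) = x" "to_wo (of_wo y) = y"
 by (simp_all add: to_wo_def of_wo_def vec_eq_iff Abs_wo_inverse Rep_wo_inverse)

lemma bij_Rep_wo: "bij (Rep_wo :: 'a wo => 'a)"
 by (metis Abs_wo_inverse Rep_wo_inverse UNIV_I bij_betw_def inj_on_inverseI surjI)

lemma linear_to_wo: "linear to_wo" and linear_of_wo: "linear of_wo"
 by (auto intro!: linearI simp: to_wo_def of_wo_def vec_eq_iff)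

lemma det_to_wo:
 fixes L :: "real^'d => real^'d"
 assumes "linear L"
 shows "det (matrix (\<lambda>x. to_wo (L (of_wo x)))) = det (matrix L)"
proof -
 have ax: "of_wo (axis j 1) = axis (Rep_wo j) 1" for j :: "'d wo"
  by (auto simp: of_wo_def vec_eq_iff axis_def Abs_wo_inverse Rep_wo_inverse)
 have "matrix (\<lambda>x. to_wo (L (of_wo x))) = (\<chi> i j. matrix L $ Rep_wo i $ Rep_wo j)"
  by (simp add: matrix_def ax vec_eq_iff) (simp add: to_wo_def)
 then show ?thesis using det_reindex[OF bij_Rep_wo, of "matrix L"] by simp
qed

lemma distr_to_wo: "distr lborel borel (to_wo :: real^'d => _) = lborel"
 and distr_of_wo: "distr lborel borel (of_wo :: _ => real^'d) = lborel"
proof -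
 let ?be = "to_wo :: real^'d => real^'d wo" and ?ga = "of_wo :: real^'d wo => _"
 have ax: "of_wo (axis j 1) = axis (Rep_wo j) 1" for j :: "'d wo"
  by (auto simp: of_wo_def vec_eq_iff axis_def Abs_wo_inverse Rep_wo_inverse)
 have ax': "to_wo (axis j 1) = axis (Abs_wo j) 1" for j :: 'd
  by (metis ax of_to_wo(2) Abs_wo_inverse UNIV_I)
 have "bij_betw ?be Basis Basis"
  by (rule bij_betw_byWitness[where f' = ?ga]) (auto simp: Basis_vec_def ax ax')
 from lborel_distr_Basis_bij[OF this]
 show "distr lborel borel ?be = lborel"
  by (simp add: linear_scale[OF linear_to_wo, symmetric] linear_sum[OF linear_to_wo, symmetric]
    euclidean_representation)
 have "bij_betw ?ga Basis Basis"
  by (rule bij_betw_byWitness[where f' = ?be]) (auto simp: Basis_vec_def ax ax')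
 from lborel_distr_Basis_bij[OF this]
 show "distr lborel borel ?ga = lborel"
  by (simp add: linear_scale[OF linear_of_wo, symmetric] linear_sum[OF linear_of_wo, symmetric]
    euclidean_representation)
qed

text \<open>\<open>has_measure_differentiable_image\<close> equates the two sides as soon as one of
  them is finite; the equivalence \<open>iff\<close> then leaves infinity on both sides in the other
  case.\<close>

lemma emeasure_lebesgue_image:
 fixes G :: "real^'n::{finite,wellorder} => real^'n::_"
 assumes S: "S \<in> sets lebesgue"
  and der: "!!x. x \<in> S ==> (G has_derivative G' x) (at x within S)"
  and inj: "inj_on G S"
 shows "emeasure lebesgue (G ` S) = (\<integral>\<^sup>+x\<in>S. ennreal \<bar>det (matrix (G' x))\<bar> \<partial>lborel)"
proof -
 let ?f = "\<lambda>x. if x \<in> S then \<bar>det (matrix (G' x))\<bar> else 0"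
 have "(\<lambda>x. \<bar>det (matrix (G' x))\<bar>) \<in> borel_measurable (lebesgue_on S)"
  using borel_measurable_det_Jacobian[OF S der] by measurable
 then have fm: "?f \<in> borel_measurable lebesgue"
  by (subst borel_measurable_if[OF S])
 have int: "(\<integral>\<^sup>+x\<in>S. ennreal \<bar>det (matrix (G' x))\<bar> \<partial>lborel) = integral\<^sup>N lebesgue ?f"
  by (subst nn_integral_completion) (auto intro!: nn_integral_cong split: split_indicator)
 have im: "G ` S \<in> sets lebesgue"
  by (rule differentiable_image_in_sets_lebesgue[OF S])
    (use der in \<open>auto simp: differentiable_on_def differentiable_def\<close>)
 have iff: "G ` S \<in> lmeasurable \<and> measure lebesgue (G ` S) = m \<longleftrightarrow>
   integral\<^sup>N lebesgue ?f = ennreal m \<and> 0 <= m" for m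
  using has_measure_differentiable_image[OF S _ inj, of G' m] der fm has_integral_restrict_UNIV[of S "\<lambda>x. \<bar>det (matrix (G' x))\<bar>" m]
   has_integral_iff_nn_integral_lebesgue[of ?f m] by simp
 show ?thesis
 proof (cases "G ` S \<in> lmeasurable")
  case True
  then show ?thesis using iff[of "measure lebesgue (G ` S)"] int
   by (simp add: emeasure_eq_measure2)
 next
  case False
  then have "emeasure lebesgue (G ` S) = \<infinity>"
   using im by (simp add: fmeasurable_def less_top[symmetric] del: emeasure_completion)
  moreover have "integral\<^sup>N lebesgue ?f = \<infinity>"
   using iff False by (cases "integral\<^sup>N lebesgue ?f" rule: ennreal_cases) auto
  ultimately show ?thesis using int by simp
 qed
qed

text \<open>The form needed for the projection to a tangent space, which is not shown to be
  injective; overlaps only make the right side larger.\<close>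

lemma emeasure_lebesgue_image_le:
 fixes G :: "real^'n::{finite,wellorder} => real^'n::_"
 assumes S: "S \<in> sets lebesgue"
  and der: "!!x. x \<in> S ==> (G has_derivative G' x) (at x within S)"
 shows "emeasure lebesgue (G ` S) <= (\<integral>\<^sup>+x\<in>S. ennreal \<bar>det (matrix (G' x))\<bar> \<partial>lborel)"
proof -
 let ?f = "\<lambda>x. if x \<in> S then \<bar>det (matrix (G' x))\<bar> else 0"
 have "(\<lambda>x. \<bar>det (matrix (G' x))\<bar>) \<in> borel_measurable (lebesgue_on S)"
  using borel_measurable_det_Jacobian[OF S der] by measurable
 then have fm: "?f \<in> borel_measurable lebesgue"
  by (subst borel_measurable_if[OF S])
 have int: "(\<integral>\<^sup>+x\<in>S. ennreal \<bar>det (matrix (G' x))\<bar> \<partial>lborel) = integral\<^sup>N lebesgue ?f"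
  by (subst nn_integral_completion) (auto intro!: nn_integral_cong split: split_indicator)
 show ?thesis
 proof (cases "integral\<^sup>N lebesgue ?f" rule: ennreal_cases)
  case (real r)
  then have "(?f has_integral r) UNIV"
   using fm by (subst has_integral_iff_nn_integral_lebesgue) auto
  then have I: "((\<lambda>x. \<bar>det (matrix (G' x))\<bar>) has_integral r) S"
   by (simp only: has_integral_restrict_UNIV)
  have "G ` S \<in> lmeasurable" "measure lebesgue (G ` S) <= r"
   using measurable_differentiable_image[OF S der]
    measure_differentiable_image[OF S der] I by (auto simp: has_integral_iff)
  then show ?thesis using real int by (simp add: emeasure_eq_measure2 ennreal_leI)
 qed (simp add: int)
qed

lemma derivative_to_wo:
 assumes "(G has_derivative G') (at (of_wo x) within of_wo ` S)"
 shows "((\<lambda>x. to_wo (G (of_wo x))) has_derivative (\<lambda>h. to_wo (G' (of_wo h)))) (at x within S)"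
proof -
 have "(of_wo has_derivative of_wo) (at x within S)"
  using linear_of_wo linear_conv_bounded_linear bounded_linear_imp_has_derivative by blast
 from has_derivative_in_compose[OF this assms]
 have "((\<lambda>x. G (of_wo x)) has_derivative (\<lambda>h. G' (of_wo h))) (at x within S)" .
 moreover have "bounded_linear to_wo"
  using linear_to_wo linear_conv_bounded_linear by blast
 ultimately show ?thesis using bounded_linear.has_derivative by blast
qed

lemma measurable_to_wo[measurable]: "to_wo \<in> borel_measurable borel"
 and measurable_of_wo[measurable]: "of_wo \<in> borel_measurable borel"
 using linear_to_wo linear_of_wo
 by (auto intro!: borel_measurable_continuous_onI linear_continuous_on simp: linear_conv_bounded_linear)

lemma vimage_of_wo: "of_wo -` S = to_wo ` S" and vimage_to_wo: "to_wo -` T = of_wo ` T"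
 by (auto simp: image_iff) (metis of_to_wo)+

lemma emeasure_lborel_to_wo:
 assumes "S \<in> sets borel"
 shows "emeasure lborel (to_wo ` S) = emeasure lborel S"
proof -
 have "emeasure lborel S = emeasure (distr lborel borel of_wo) S"
  by (simp add: distr_of_wo)
 also have "... = emeasure lborel (to_wo ` S)"
  using assms by (subst emeasure_distr) (auto simp: vimage_of_wo)
 finally show ?thesis by simp
qed

context
 fixes G :: "real^'d => real^'d" and G' S
 assumes S: "S \<in> sets borel"
  and der: "!!x. x \<in> S ==> (G has_derivative G' x) (at x within S)"
  and im: "G ` S \<in> sets borel"
begin

private definition "T = (to_wo ` S :: (real^'d wo) set)"
private definition "H x = (to_wo (G (of_wo x)) :: real^'d wo)"
private definition "H' x h = (to_wo (G' (of_wo x) (of_wo h)) :: real^'d wo)"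

private lemma of_wo_T: "of_wo ` T = S"
 by (simp add: T_def image_image)

private lemma T: "T \<in> sets borel"
proof -
 have "T = of_wo -` S Int space borel" by (simp add: T_def vimage_of_wo)
 then show ?thesis using measurable_sets[OF measurable_of_wo S] by simp
qed

private lemma H_der: "x \<in> T ==> (H has_derivative H' x) (at x within T)"
 unfolding H_def[abs_def] H'_def[abs_def]
 by (rule derivative_to_wo) (use der of_wo_T in \<open>auto\<close>)

private lemma H_image: "H ` T = to_wo ` G ` S"
 by (simp add: H_def T_def image_image)

private lemma emeasure_H_image: "emeasure lebesgue (H ` T) = emeasure lborel (G ` S)"
proof -
 have "to_wo ` G ` S = of_wo -` (G ` S) Int space borel" by (simp add: vimage_of_wo)
 then have "to_wo ` G ` S \<in> sets borel" using measurable_sets[OF measurable_of_wo im] by simp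
 then show ?thesis by (simp add: H_image emeasure_lborel_to_wo im)
qed

private lemma det_H': "x \<in> T ==> det (matrix (H' x)) = det (matrix (G' (of_wo x)))"
proof -
 assume "x \<in> T"
 then have "linear (G' (of_wo x))"
  using der[of "of_wo x"] of_wo_T has_derivative_linear by (metis imageI)
 then show ?thesis unfolding H'_def[abs_def] by (rule det_to_wo)
qed

text \<open>The Jacobian is only known to be Lebesgue measurable. A Borel function equal to it
  almost everywhere is chosen on the wellordered side, and since relabelling coordinates preserves
  null sets the same function serves on both sides.\<close>

private lemma det_H'_borel:
 obtains f' :: "real^'d wo => real" where "f' \<in> borel_measurable borel"
  "AE x in lborel. (if x \<in> T then \<bar>det (matrix (H' x))\<bar> else 0) = f' x"
  "AE x in lborel. (if x \<in> S then \<bar>det (matrix (G' x))\<bar> else 0) = f' (to_wo x)"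
proof -
 have "(\<lambda>x. det (matrix (H' x))) \<in> borel_measurable (lebesgue_on T)"
  by (rule borel_measurable_det_Jacobian[OF _ H_der]) (use T in auto)
 then have "(\<lambda>x. if x \<in> T then \<bar>det (matrix (H' x))\<bar> else 0) \<in> borel_measurable lebesgue"
  using T by (subst borel_measurable_if) auto
 then obtain f' :: "real^'d wo => real" where f'[measurable]: "f' \<in> borel_measurable borel"
  and eq: "AE x in lborel. (if x \<in> T then \<bar>det (matrix (H' x))\<bar> else 0) = f' x"
  using completion_ex_borel_measurable_real by fastforce
 from eq obtain N where N: "N \<in> null_sets lborel"
  and sub: "{x. (if x \<in> T then \<bar>det (matrix (H' x))\<bar> else 0) \<noteq> f' x} \<subseteq> N"
  by (auto elim!: AE_E simp: null_sets_def)
 have "emeasure lborel (to_wo -` N) = emeasure (distr lborel borel (to_wo :: real^'d => _)) N"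
  using N by (subst emeasure_distr) (auto simp: null_sets_def)
 then have null: "to_wo -` N \<in> null_sets lborel"
  using N measurable_sets[OF measurable_to_wo, of N] by (auto simp: distr_to_wo null_sets_def)
 have "(if x \<in> S then \<bar>det (matrix (G' x))\<bar> else 0) = f' (to_wo x)" if "x \<notin> to_wo -` N" for x
 proof -
  have "to_wo x \<in> T \<longleftrightarrow> x \<in> S" by (metis T_def image_iff of_to_wo(1))
  moreover have "(if to_wo x \<in> T then \<bar>det (matrix (H' (to_wo x)))\<bar> else 0) = f' (to_wo x)"
   using that sub by blast
  ultimately show ?thesis using det_H'[of "to_wo x"] by (auto split: if_splits)
 qed
 then have "{x. (if x \<in> S then \<bar>det (matrix (G' x))\<bar> else 0) \<noteq> f' (to_wo x)} \<subseteq> to_wo -` N"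
  by blast
 then have "AE x in lborel. (if x \<in> S then \<bar>det (matrix (G' x))\<bar> else 0) = f' (to_wo x)"
  using null by (intro AE_I'[of "to_wo -` N"]) auto
 with f' eq show thesis by (rule that)
qed

private lemma integral_H':
 "(\<integral>\<^sup>+x\<in>T. ennreal \<bar>det (matrix (H' x))\<bar> \<partial>lborel) = (\<integral>\<^sup>+x\<in>S. ennreal \<bar>det (matrix (G' x))\<bar> \<partial>lborel)"
proof -
 from det_H'_borel obtain f' :: "real^'d wo => real"
  where [measurable]: "f' \<in> borel_measurable borel"
   and eq: "AE x in lborel. (if x \<in> T then \<bar>det (matrix (H' x))\<bar> else 0) = f' x"
    "AE x in lborel. (if x \<in> S then \<bar>det (matrix (G' x))\<bar> else 0) = f' (to_wo x)" .
 have "(\<integral>\<^sup>+x\<in>T. ennreal \<bar>det (matrix (H' x))\<bar> \<partial>lborel) = (\<integral>\<^sup>+x. ennreal (f' x) \<partial>lborel)"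
  using eq(1) by (intro nn_integral_cong_AE) (auto split: if_splits split_indicator)
 also have "... = (\<integral>\<^sup>+x. ennreal (f' x) \<partial>distr lborel borel to_wo)"
  by (simp add: distr_to_wo)
 also have "... = (\<integral>\<^sup>+x. ennreal (f' (to_wo x)) \<partial>lborel)"
  by (subst nn_integral_distr) auto
 also have "... = (\<integral>\<^sup>+x\<in>S. ennreal \<bar>det (matrix (G' x))\<bar> \<partial>lborel)"
  using eq(2) by (intro nn_integral_cong_AE) (auto split: if_splits split_indicator)
 finally show ?thesis .
qed

lemma abs_det_derivative_borel:
 obtains J :: "real^'d => real" where "J \<in> borel_measurable borel"
  "AE x in lborel. (if x \<in> S then \<bar>det (matrix (G' x))\<bar> else 0) = J x"
proof -
 from det_H'_borel obtain f' :: "real^'d wo => real"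
  where [measurable]: "f' \<in> borel_measurable borel"
   and eq: "AE x in lborel. (if x \<in> S then \<bar>det (matrix (G' x))\<bar> else 0) = f' (to_wo x)" .
 show thesis by (rule that[OF _ eq]) measurable
qed

lemma emeasure_image_le_integral_det:
 "emeasure lborel (G ` S) <= (\<integral>\<^sup>+x\<in>S. ennreal \<bar>det (matrix (G' x))\<bar> \<partial>lborel)"
proof -
 have "emeasure lebesgue (H ` T) <= (\<integral>\<^sup>+x\<in>T. ennreal \<bar>det (matrix (H' x))\<bar> \<partial>lborel)"
  by (rule emeasure_lebesgue_image_le) (use T H_der in auto)
 then show ?thesis by (simp add: emeasure_H_image integral_H')
qed

lemma emeasure_image_eq_integral_det:
 assumes "inj_on G S"
 shows "emeasure lborel (G ` S) = (\<integral>\<^sup>+x\<in>S. ennreal \<bar>det (matrix (G' x))\<bar> \<partial>lborel)"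
proof -
 have "inj_on H T"
  using assms unfolding inj_on_def H_def T_def by clarsimp (metis of_to_wo(1))
 then have "emeasure lebesgue (H ` T) = (\<integral>\<^sup>+x\<in>T. ennreal \<bar>det (matrix (H' x))\<bar> \<partial>lborel)"
  by (intro emeasure_lebesgue_image) (use T H_der in auto)
 then show ?thesis by (simp add: emeasure_H_image integral_H')
qed

end

text \<open>Applied to all Borel subsets of the image, the formula for the measure of an image says
  that two measures coincide: \<open>lborel\<close> restricted to the image, and the push-forward of
  the Jacobian density. Integrating \<open>f\<close> against both gives the claim.\<close>

lemma nn_integral_change_of_variables:
 fixes G :: "real^'d => real^'d"
 assumes S: "S \<in> sets borel"
  and der: "!!x. x \<in> S ==> (G has_derivative G' x) (at x within S)"
  and inj: "inj_on G S" and im: "G ` S \<in> sets borel"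
  and f: "f \<in> borel_measurable borel"
 shows "(\<integral>\<^sup>+y\<in>G ` S. f y \<partial>lborel) = (\<integral>\<^sup>+x\<in>S. ennreal \<bar>det (matrix (G' x))\<bar> * f (G x) \<partial>lborel)"
proof -
 obtain J :: "real^'d => real" where J[measurable]: "J \<in> borel_measurable borel"
  and J_eq: "AE x in lborel. (if x \<in> S then \<bar>det (matrix (G' x))\<bar> else 0) = J x"
  using abs_det_derivative_borel[OF S der im] by blast
 let ?J = "\<lambda>x. ennreal (J x)"
 \<comment> \<open>The value off \<open>S\<close> is irrelevant because the density vanishes there
   almost everywhere; fixing it makes the map Borel on the whole space.\<close>
 let ?g = "\<lambda>x. if x \<in> S then G x else undefined"
 have "continuous_on S G"
  using der has_derivative_continuous_on by blast
 then have g[measurable]: "?g \<in> borel_measurable borel"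
  using S borel_measurable_continuous_on_if[OF S _ continuous_on_const, of G undefined]
  by simp
 note S[measurable] im[measurable] f[measurable]
 have eq: "density lborel (indicator (G ` S)) = distr (density lborel ?J) borel ?g"
 proof (rule measure_eqI)
  fix D assume "D \<in> sets (density lborel (indicator (G ` S)))"
  then have D[measurable]: "D \<in> sets borel" by simp
  let ?S = "S Int (?g -` D)"
  have "?g -` D \<in> sets borel" using measurable_sets[OF g D] by simp
  then have S'[measurable]: "?S \<in> sets borel" by simp
  have im': "G ` ?S = G ` S Int D" by auto
  have der': "x \<in> ?S ==> (G has_derivative G' x) (at x within ?S)" for x
   by (rule has_derivative_subset[OF der]) auto
  have "emeasure (density lborel (indicator (G ` S))) D = emeasure lborel (G ` ?S)"
   by (subst emeasure_density) (auto simp: im' indicator_inter_arith[symmetric] Int_commute)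
  also have "... = (\<integral>\<^sup>+x\<in>?S. ennreal \<bar>det (matrix (G' x))\<bar> \<partial>lborel)"
   by (intro emeasure_image_eq_integral_det S' der')
     (use inj D im in \<open>auto simp: im' intro: inj_on_subset\<close>)
  also have "... = (\<integral>\<^sup>+x. ?J x * indicator D (?g x) \<partial>lborel)"
   using J_eq by (intro nn_integral_cong_AE) (auto split: split_indicator if_splits)
  also have "... = emeasure (distr (density lborel ?J) borel ?g) D"
   by (subst emeasure_distr, measurable, subst emeasure_density, measurable)
     (auto intro!: nn_integral_cong split: split_indicator)
  finally show "emeasure (density lborel (indicator (G ` S))) D =
    emeasure (distr (density lborel ?J) borel ?g) D" .
 qed simp
 have "(\<integral>\<^sup>+y\<in>G ` S. f y \<partial>lborel) = integral\<^sup>N (density lborel (indicator (G ` S))) f"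
  by (subst nn_integral_density) (auto simp: mult.commute)
 also have "... = integral\<^sup>N (density lborel ?J) (\<lambda>x. f (?g x))"
  unfolding eq by (subst nn_integral_distr) auto
 also have "... = (\<integral>\<^sup>+x. ?J x * f (?g x) \<partial>lborel)"
  by (subst nn_integral_density) auto
 also have "... = (\<integral>\<^sup>+x\<in>S. ennreal \<bar>det (matrix (G' x))\<bar> * f (G x) \<partial>lborel)"
  using J_eq by (intro nn_integral_cong_AE) (auto split: split_indicator if_splits)
 finally show ?thesis .
qed

subsection \<open>Coordinate subspaces and Gram determinants\<close>

definition proj :: "'a::euclidean_space set => 'a => 'a" where
 "proj B z = (\<Sum>b\<in>B. (z \<bullet> b) *\<^sub>R b)"

text \<open>This is \<open>span B\<close> times the unit cube in the remaining coordinates. The cube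
  has volume 1, so integrals over the coordinate subspace become integrals over the slab in full
  dimension, where the change of variables theorem is available.\<close>

definition slab :: "'a::euclidean_space set => 'a set" where
 "slab B = {z. \<forall>b\<in>Basis - B. 0 <= z \<bullet> b \<and> z \<bullet> b <= 1}"

definition gram :: "'a::euclidean_space set => ('a => 'b::real_inner) => real" where
 "gram B L = (\<Sum>\<pi> | \<pi> permutes B. of_int (sign \<pi>) * (\<Prod>b\<in>B. L b \<bullet> L (\<pi> b)))"

lemma gram_det_eq: "gram_det B Ps x = gram B (frechet_derivative Ps (at x))"
 by (simp add: gram_det_def gram_def)

lemma finite_subset_Basis: "B \<subseteq> Basis ==> finite B"
 using finite_subset finite_Basis by blast

lemma linear_proj: "linear (proj B)"
 by (auto intro!: linearI simp: proj_def inner_add_left scaleR_add_left sum.distrib scaleR_sum_right)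

lemma continuous_on_proj[continuous_intros]: "continuous_on S f ==> continuous_on S (\<lambda>x. proj B (f x))"
 unfolding proj_def by (intro continuous_intros)

lemma measurable_proj[measurable]: "proj B \<in> borel_measurable borel"
 by (intro borel_measurable_continuous_onI continuous_intros)

lemma has_derivative_proj: "(proj B has_derivative proj B) F"
 using linear_proj linear_conv_bounded_linear bounded_linear_imp_has_derivative by blast

context
 fixes B :: "'a::euclidean_space set"
 assumes B: "B \<subseteq> Basis"
begin

lemma inner_proj: "c \<in> Basis ==> proj B z \<bullet> c = (if c \<in> B then z \<bullet> c else 0)"
proof -
 assume c: "c \<in> Basis"
 have "proj B z \<bullet> c = (\<Sum>b\<in>B. if b = c then z \<bullet> c else 0)"
  unfolding proj_def inner_sum_left using B c
  by (intro sum.cong) (auto simp: inner_Basis subset_iff)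
 then show ?thesis using finite_subset_Basis[OF B] by simp
qed

lemma proj_span: "proj B z \<in> span B"
 unfolding proj_def by (intro span_sum span_scale span_base)

lemma proj_id:
 assumes "z \<in> span B"
 shows "proj B z = z"
proof -
 have "subspace {z. proj B z = z}"
  using linear_proj[of B] by (simp add: subspace_def linear_0 linear_add linear_scale)
 moreover have "proj B b = b" if "b \<in> B" for b
 proof (rule euclidean_eqI)
  fix c :: 'a assume c: "c \<in> Basis"
  have "b \<in> Basis" using that B by blast
  with c that show "proj B b \<bullet> c = b \<bullet> c" by (auto simp: inner_proj inner_Basis)
 qed
 ultimately show ?thesis using assms span_induct[of z B "\<lambda>z. proj B z = z"] by blast
qed

lemma proj_proj[simp]: "proj B (proj B z) = proj B z"
 by (simp add: proj_id proj_span)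

lemma span_iff: "z \<in> span B \<longleftrightarrow> (\<forall>c\<in>Basis - B. z \<bullet> c = 0)"
proof
 assume "z \<in> span B"
 then have "z = proj B z" by (simp add: proj_id)
 then show "\<forall>c\<in>Basis - B. z \<bullet> c = 0" by (metis DiffE inner_proj)
next
 assume *: "\<forall>c\<in>Basis - B. z \<bullet> c = 0"
 have "z = proj B z" by (rule euclidean_eqI) (use * in \<open>simp add: inner_proj\<close>)
 then show "z \<in> span B" by (metis proj_span)
qed

lemma closed_span_Basis: "closed (span B)"
 by (simp add: closed_subspace)

lemma sets_slab[measurable]: "slab B \<in> sets borel"
 unfolding slab_def by measurable

lemma space_lborel_span[simp]: "space (lborel_span B) = UNIV"
 and sets_lborel_span[measurable_cong, simp]: "sets (lborel_span B) = sets borel"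
 by (simp_all add: lborel_span_def)

text \<open>Tonelli's theorem for the splitting of the coordinates into \<open>B\<close> and its
  complement.\<close>

lemma nn_integral_proj_prod:
 assumes [measurable]: "f \<in> borel_measurable borel" "!!c. k c \<in> borel_measurable borel"
 shows "(\<integral>\<^sup>+z. f (proj B z) * (\<Prod>c\<in>Basis - B. k c (z \<bullet> c)) \<partial>lborel) =
  (\<integral>\<^sup>+x. f x \<partial>lborel_span B) * (\<Prod>c\<in>Basis - B. \<integral>\<^sup>+x. k c x \<partial>(lborel :: real measure))"
proof -
 interpret product_sigma_finite "\<lambda>_. lborel :: real measure" ..
 let ?C = "Basis - B" and ?s = "\<lambda>f. \<Sum>b\<in>Basis. f b *\<^sub>R b :: 'a"
 have fin: "finite B" "finite ?C" using B by (auto intro: finite_subset_Basis)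
 have un: "B \<union> ?C = Basis" using B by auto
 let ?h = "\<lambda>g. f (proj B (?s g)) * (\<Prod>c\<in>?C. k c (?s g \<bullet> c))"
 have inner: "(?s g) \<bullet> b = g b" if "b \<in> Basis" for g b
  using that by (simp add: inner_sum_left inner_Basis if_distrib cong: if_cong)
 have sum_merge: "(\<Sum>b\<in>B. merge B ?C (x, y) b *\<^sub>R b) = (\<Sum>b\<in>B. x b *\<^sub>R b)" for x y
  by (intro sum.cong) (auto simp: merge_def)
 have merge: "?h (merge B ?C (x, y)) = f (\<Sum>b\<in>B. x b *\<^sub>R b) * (\<Prod>c\<in>?C. k c (y c))" for x y
 proof -
  have "proj B (?s (merge B ?C (x, y))) = (\<Sum>b\<in>B. x b *\<^sub>R b)"
   unfolding proj_def using B by (subst sum_merge[of x y, symmetric], intro sum.cong) (auto simp: inner)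
  moreover have "(\<Prod>c\<in>?C. k c (?s (merge B ?C (x, y)) \<bullet> c)) = (\<Prod>c\<in>?C. k c (y c))"
   by (intro prod.cong refl) (auto simp: inner merge_def)
  ultimately show ?thesis by simp
 qed
 have "(\<integral>\<^sup>+z. f (proj B z) * (\<Prod>c\<in>?C. k c (z \<bullet> c)) \<partial>lborel) = (\<integral>\<^sup>+g. ?h g \<partial>(\<Pi>\<^sub>M b\<in>Basis. lborel))"
  by (subst lborel_eq, subst nn_integral_distr) auto
 also have "... = (\<integral>\<^sup>+g. ?h g \<partial>(\<Pi>\<^sub>M b\<in>B \<union> ?C. lborel))"
  by (simp only: un)
 also have "... = (\<integral>\<^sup>+x. (\<integral>\<^sup>+y. ?h (merge B ?C (x, y)) \<partial>Pi\<^sub>M ?C (\<lambda>_. lborel)) \<partial>Pi\<^sub>M B (\<lambda>_. lborel))"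
  by (rule product_nn_integral_fold) (use fin un in \<open>auto simp: un\<close>)
 also have "... = (\<integral>\<^sup>+x. f (\<Sum>b\<in>B. x b *\<^sub>R b) * (\<Prod>c\<in>?C. \<integral>\<^sup>+x. k c x \<partial>lborel) \<partial>Pi\<^sub>M B (\<lambda>_. lborel))"
  unfolding merge
  by (subst nn_integral_cmult, measurable, subst product_nn_integral_prod[OF fin(2)]) auto
 also have "... = (\<integral>\<^sup>+x. f (\<Sum>b\<in>B. x b *\<^sub>R b) \<partial>Pi\<^sub>M B (\<lambda>_. lborel)) * (\<Prod>c\<in>?C. \<integral>\<^sup>+x. k c x \<partial>lborel)"
  by (rule nn_integral_multc) measurable
 also have "(\<integral>\<^sup>+x. f (\<Sum>b\<in>B. x b *\<^sub>R b) \<partial>Pi\<^sub>M B (\<lambda>_. lborel)) = (\<integral>\<^sup>+x. f x \<partial>lborel_span B)"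
  unfolding lborel_span_def by (subst nn_integral_distr) auto
 finally show ?thesis by simp
qed

lemma nn_integral_lborel_span:
 assumes [measurable]: "f \<in> borel_measurable borel"
 shows "(\<integral>\<^sup>+x. f x \<partial>lborel_span B) = (\<integral>\<^sup>+z\<in>slab B. f (proj B z) \<partial>lborel)"
proof -
 \<comment> \<open>The indicator of the slab is a product over the complementary coordinates, each
   factor having integral 1.\<close>
 have ind: "indicator (slab B) z = (\<Prod>c\<in>Basis - B. indicator {0..1} (z \<bullet> c) :: ennreal)" for z
  by (auto simp: slab_def indicator_def prod_zero_iff intro!: prod.neutral[symmetric])
 show ?thesis
  unfolding ind by (subst nn_integral_proj_prod) auto
qed

end

lemma set_nn_integral_lborel_span:
 fixes f :: "'a::euclidean_space => ennreal"
 assumes "B \<subseteq> Basis" "A \<in> sets borel" and [measurable]: "(\<lambda>x. f x * indicator A x) \<in> borel_measurable borel"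
 shows "(\<integral>\<^sup>+x\<in>A. f x \<partial>lborel_span B) = (\<integral>\<^sup>+z\<in>slab B Int proj B -` A. f (proj B z) \<partial>lborel)"
 by (subst nn_integral_lborel_span[OF assms(1)])
   (auto intro!: nn_integral_cong split: split_indicator)

text \<open>The remaining basis vectors go to an orthonormal family orthogonal to the image of
  \<open>B\<close>. Hence the transposed matrix times the matrix of \<open>K\<close> consists of the
  Gram matrix on \<open>B\<close> and an identity block, and its determinant is both
  \<open>gram B L\<close> and the square of \<open>det (matrix K)\<close>.\<close>

lemma gram_eq_det_square:
 fixes K :: "real^'d => real^'d"
 assumes B: "B \<subseteq> Basis" and K: "linear K" and KL: "!!b. b \<in> B ==> K b = L b"
  and orth: "!!b c. b \<in> Basis ==> c \<in> Basis - B ==> K b \<bullet> K c = (if b = c then 1 else 0)"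
 shows "gram B L = (det (matrix K))\<^sup>2"
proof -
 define I where "I = {i :: 'd. axis i (1::real) \<in> B}"
 let ?a = "\<lambda>i :: 'd. axis i (1::real)"
 have inj: "inj_on ?a J" for J by (auto simp: inj_on_def axis_eq_axis)
 have BI: "B = ?a ` I" using B by (auto simp: I_def Basis_vec_def)
 have bij: "bij_betw ?a I B" using inj BI by (simp add: bij_betw_def)
 let ?A = "transpose (matrix K) ** matrix K"
 have A: "?A $ i $ j = K (?a i) \<bullet> K (?a j)" for i j
  by (simp add: matrix_matrix_mult_def transpose_def matrix_def inner_vec_def)
 have ax: "?a i \<in> Basis" for i by (auto simp: Basis_vec_def)
 \<comment> \<open>A permutation that moves an index outside \<open>I\<close> meets an off-diagonal
   zero of the block structure.\<close>
 have zero: "(\<Prod>i\<in>UNIV. ?A $ i $ p i) = 0" if p: "p permutes UNIV" "\<not> p permutes I" for p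
 proof -
  obtain i where i: "i \<notin> I" "p i \<noteq> i"
   using p permutes_superset[of p UNIV I] by blast
  have "?A $ inv p i $ p (inv p i) = 0"
  proof -
   have "p (inv p i) = i" using permutes_inverses(1)[OF p(1)] by simp
   moreover have "inv p i \<noteq> i" using i \<open>p (inv p i) = i\<close> by metis
   moreover have "?a i \<in> Basis - B" using i(1) ax by (simp add: I_def)
   ultimately show ?thesis using orth[OF ax, of "?a i" "inv p i"] by (simp add: A axis_eq_axis)
  qed
  then show ?thesis by (metis UNIV_I finite prod_zero)
 qed
 have "(det (matrix K))\<^sup>2 = det ?A"
  by (simp add: det_mul det_transpose power2_eq_square)
 also have "... = (\<Sum>p | p permutes UNIV. of_int (sign p) * (\<Prod>i\<in>UNIV. ?A $ i $ p i))"
  by (simp add: det_def)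
 also have "... = (\<Sum>p | p permutes I. of_int (sign p) * (\<Prod>i\<in>UNIV. ?A $ i $ p i))"
 proof (rule sum.mono_neutral_right)
  show "\<forall>p\<in>{p. p permutes UNIV} - {p. p permutes I}.
    of_int (sign p) * (\<Prod>i\<in>UNIV. ?A $ i $ p i) = 0"
  proof
   fix p assume "p \<in> {p. p permutes UNIV} - {p. p permutes I}"
   then have "(\<Prod>i\<in>UNIV. ?A $ i $ p i) = 0" by (intro zero) auto
   then show "of_int (sign p) * (\<Prod>i\<in>UNIV. ?A $ i $ p i) = 0" by (simp only: mult_zero_right)
  qed
 qed (auto simp: finite_permutations intro: permutes_subset)
 also have "... = (\<Sum>p | p permutes I. of_int (sign p) * (\<Prod>i\<in>I. ?A $ i $ p i))"
 proof (intro sum.cong refl arg_cong2[where f = "(*)"])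
  fix p assume "p \<in> {p. p permutes I}"
  then have p: "p permutes I" by simp
  have "?A $ i $ p i = 1" if "i \<notin> I" for i
   using permutes_not_in[OF p that] orth[OF ax, of "?a i" i] that ax by (simp add: A I_def)
  then show "(\<Prod>i\<in>UNIV. ?A $ i $ p i) = (\<Prod>i\<in>I. ?A $ i $ p i)"
   by (intro prod.mono_neutral_right) auto
 qed
 also have "... = gram B L"
 proof -
  have m: "map_permutation I ?a p (?a i) = ?a (p i)" if "i \<in> I" for p i
   using that inv_into_f_f[OF inj that] by (simp add: map_permutation_def BI restrict_id_def)
  have "bij_betw (map_permutation I ?a) {p. p permutes I} {p. p permutes B}"
   using bij_betw_permutations[OF bij] by (simp add: map_permutation_def[abs_def] restrict_id_def BI o_def)
  then show ?thesis
   unfolding gram_def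
  proof (subst sum.reindex_bij_betw[symmetric], assumption, intro sum.cong refl)
   fix p assume "p \<in> {p. p permutes I}"
   then have p: "p permutes I" by simp
   have "(\<Prod>b\<in>B. L b \<bullet> L (map_permutation I ?a p b)) = (\<Prod>i\<in>I. L (?a i) \<bullet> L (?a (p i)))"
    by (subst prod.reindex_bij_betw[symmetric, OF bij]) (auto simp: m intro!: prod.cong)
   also have "... = (\<Prod>i\<in>I. ?A $ i $ p i)"
    using permutes_in_image[OF p] by (intro prod.cong) (auto simp: A KL I_def)
   finally show "of_int (sign p) * (\<Prod>i\<in>I. ?A $ i $ p i) = of_int (sign (map_permutation I ?a p)) *
     (\<Prod>b\<in>B. L b \<bullet> L (map_permutation I ?a p b))"
    using sign_map_permutation[OF inj p] by simp
  qed
 qed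
 finally show ?thesis ..
qed

text \<open>A full-dimensional completion of \<open>L\<close> by unit normals to its image: its
  ordinary determinant measures the \<open>card B\<close>-dimensional volume distortion of
  \<open>L\<close>.\<close>

definition normal_extension :: "'a::euclidean_space set => ('a => 'a) => ('a => 'a) => bool" where
 "normal_extension B L K \<longleftrightarrow> linear K \<and> (\<forall>b\<in>B. K b = L b) \<and>
   (\<forall>b\<in>Basis. \<forall>c\<in>Basis - B. K b \<bullet> K c = (if b = c then 1 else 0))"

lemma gram_normal_extension:
 fixes K :: "real^'d => real^'d"
 assumes "B \<subseteq> Basis" "normal_extension B L K"
 shows "gram B L = (det (matrix K))\<^sup>2"
 by (rule gram_eq_det_square) (use assms in \<open>auto simp: normal_extension_def\<close>)

lemma linear_eq_on_span_Basis:
 assumes "linear f" "linear g" "!!b. b \<in> B ==> f b = g b" "x \<in> span B"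
 shows "f x = g x"
 using linear_eq_on_span[OF assms(1,2,3,4)] .

lemma isometry_inner:
 fixes f :: "'a::real_inner => 'b::real_inner"
 assumes "linear f" "subspace S" "!!x. x \<in> S ==> norm (f x) = norm x" "x \<in> S" "y \<in> S"
 shows "f x \<bullet> f y = x \<bullet> y"
proof -
 have "norm (f x + f y) = norm (x + y)"
  using assms by (metis linear_add subspace_add)
 moreover have "norm (f x) = norm x" "norm (f y) = norm y" using assms by auto
 ultimately show ?thesis by (simp add: dot_norm)
qed

text \<open>The orthogonal complement of the image has the same dimension as the span of the
  remaining basis vectors, so an isometry \<open>f\<close> between them supplies the
  normals.\<close>

lemma normal_extension_exists:
 assumes B: "B \<subseteq> Basis" and L: "linear L" and inj: "inj_on L (span B)"
 obtains K where "normal_extension B L K"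
proof -
 let ?N = "{y \<in> UNIV. \<forall>x\<in>L ` span B. orthogonal x y}"
 have sub: "subspace (L ` span B)" using L by (simp add: linear_subspace_image)
 have indep: "independent A" if "A \<subseteq> Basis" for A :: "'a set"
  using that independent_Basis independent_mono by blast
 have "dim (L ` span B) = card B"
  using dim_image_eq[OF L, of "span B"] inj dim_eq_card_independent[OF indep[OF B]]
  by (simp only: span_span dim_span)
 then have dimN: "dim ?N = DIM('a) - card B"
  using dim_subspace_orthogonal_to_vectors[OF sub, of UNIV] by simp
 have "dim (span (Basis - B)) = card (Basis - B :: 'a set)"
  using indep[of "Basis - B"] by (simp add: dim_eq_card_independent)
 also have "... = DIM('a) - card B"
  using B by (simp add: card_Diff_subset finite_subset_Basis)
 finally have "dim (span (Basis - B)) = dim ?N" unfolding dimN .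
 moreover have "subspace ?N"
  by (auto simp: subspace_def orthogonal_def inner_add_right)
 ultimately obtain f where f: "linear f" "f ` span (Basis - B) = ?N"
  "!!x. x \<in> span (Basis - B) ==> norm (f x) = norm x"
  using isometry_subspaces[OF subspace_span, of ?N "Basis - B"] by blast
 define K where "K = (\<lambda>z. L (proj B z) + f (z - proj B z))"
 have zero: "proj B c = 0" if "c \<in> Basis - B" for c
  by (rule euclidean_eqI) (use that B in \<open>auto simp: inner_proj inner_Basis\<close>)
 have KB: "K b = L b" if "b \<in> B" for b
  using that B by (simp add: K_def proj_id span_base linear_0[OF f(1)])
 have KC: "K c = f c" if "c \<in> Basis - B" for c
  using that by (simp add: K_def zero linear_0[OF L])
 have "linear K"
  unfolding K_def
  by (auto intro!: linearI simp: linear_add[OF linear_proj] linear_scale[OF linear_proj]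
    linear_add[OF L] linear_scale[OF L] linear_add[OF f(1)] linear_diff[OF f(1)]
    linear_scale[OF f(1)] algebra_simps)
 moreover have "K b \<bullet> K c = (if b = c then 1 else 0)" if "b \<in> Basis" "c \<in> Basis - B" for b c
 proof (cases "b \<in> B")
  case True
  then have "b \<noteq> c" using that by auto
  have "f c \<in> f ` span (Basis - B)" using that(2) by (simp add: span_base)
  then have "L b \<bullet> f c = 0"
   using True unfolding f(2) by (auto simp: orthogonal_def span_base)
  with \<open>b \<noteq> c\<close> show ?thesis using True that(2) by (simp add: KB KC)
 next
  case False
  then have "K b \<bullet> K c = b \<bullet> c"
   using that isometry_inner[OF f(1) subspace_span f(3), where x = b and y = c] by (simp add: KC span_base)
  then show ?thesis using that by (simp add: inner_Basis)
 qed
 ultimately show thesis by (intro that[of K]) (auto simp: normal_extension_def KB)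
qed

text \<open>Pairing \<open>K z\<close> with the normal \<open>K c\<close> recovers the coordinate of
  \<open>z\<close> along \<open>c\<close>; a vector of the kernel thus lies in
  \<open>span B\<close>, where \<open>K\<close> agrees with the injective \<open>L\<close>.\<close>

lemma normal_extension_inj:
 assumes B: "B \<subseteq> Basis" and L: "linear L" and inj: "inj_on L (span B)" and K: "normal_extension B L K"
 shows "inj K"
proof -
 have lin: "linear K" using K by (simp add: normal_extension_def)
 have "z = 0" if z: "K z = 0" for z
 proof -
  have sum: "K z = (\<Sum>b\<in>Basis. (z \<bullet> b) *\<^sub>R K b)"
   by (metis (no_types, lifting) euclidean_representation lin linear_scale linear_sum sum.cong)
  have c0: "z \<bullet> c = 0" if c: "c \<in> Basis - B" for c
  proof -
   have "0 = K z \<bullet> K c" using z by simp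
   also have "... = (\<Sum>b\<in>Basis. (z \<bullet> b) * (if b = c then 1 else 0))"
    unfolding sum inner_sum_left using K c by (intro sum.cong) (auto simp: normal_extension_def)
   also have "... = z \<bullet> c" using c by (simp add: if_distrib cong: if_cong)
   finally show ?thesis by simp
  qed
  then have zB: "z \<in> span B" by (simp add: span_iff[OF B])
  moreover have "K z = L z"
   using linear_eq_on_span_Basis[OF lin L _ zB] K by (auto simp: normal_extension_def)
  ultimately show "z = 0" using inj z linear_0[OF L] by (metis inj_onD span_zero)
 qed
 then show ?thesis using linear_injective_0[OF lin] by blast
qed

text \<open>The block map that is \<open>D\<close> on the coordinate subspace and a bijection of the
  remaining basis vectors across, followed by a completion of \<open>L2\<close>, is a completion of
  \<open>L1\<close>. Multiplicativity of the determinant then relates the two Gram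
  determinants.\<close>

lemma normal_extension_transition:
 assumes B1: "B1 \<subseteq> Basis" and B2: "B2 \<subseteq> Basis"
  and be: "bij_betw be (Basis - B1) (Basis - B2)"
  and K: "normal_extension B2 L2 K" and L: "linear L1" "linear L2"
  and D: "linear D" "D ` span B1 \<subseteq> span B2"
  and LD: "!!h. h \<in> span B1 ==> L1 h = L2 (D h)"
 shows "normal_extension B1 L1
  (\<lambda>h. K (D (proj B1 h) + (\<Sum>b\<in>Basis - B1. (h \<bullet> b) *\<^sub>R be b)))"
proof -
 let ?si = "\<lambda>h. \<Sum>b\<in>Basis - B1. (h \<bullet> b) *\<^sub>R be b" and ?G = "\<lambda>h. D (proj B1 h) + (\<Sum>b\<in>Basis - B1. (h \<bullet> b) *\<^sub>R be b)"
 have lin: "linear K" using K by (simp add: normal_extension_def)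
 have KL2: "K v = L2 v" if "v \<in> span B2" for v
  using linear_eq_on_span_Basis[OF lin L(2) _ that] K by (auto simp: normal_extension_def)
 have si0: "?si b = 0" if "b \<in> B1" for b
  using that B1 by (intro sum.neutral) (auto simp: inner_Basis)
 have si1: "?si c = be c" if "c \<in> Basis - B1" for c
 proof -
  have "?si c = (\<Sum>b\<in>Basis - B1. if b = c then be c else 0)"
   using that by (intro sum.cong) (auto simp: inner_Basis)
  then show ?thesis using that by simp
 qed
 have p0: "proj B1 c = 0" if "c \<in> Basis - B1" for c
  by (rule euclidean_eqI) (use that B1 in \<open>auto simp: inner_proj inner_Basis\<close>)
 have G1: "K (?G b) = K (D b)" if "b \<in> B1" for b
  using that si0 B1 by (simp add: proj_id span_base)
 have G2: "K (?G c) = K (be c)" if "c \<in> Basis - B1" for c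
  using that by (simp add: p0 linear_0[OF D(1)] si1)
 have orth: "K v \<bullet> K c = 0" if "v \<in> span B2" "c \<in> Basis - B2" for v c
 proof -
  have "subspace {v. K v \<bullet> K c = 0}"
   using lin by (auto simp: subspace_def linear_0 linear_add linear_scale inner_add_left)
  moreover have "K b \<bullet> K c = 0" if "b \<in> B2" for b
  proof -
   have "\<forall>b\<in>Basis. \<forall>c\<in>Basis - B2. K b \<bullet> K c = (if b = c then 1 else 0)"
    using K by (simp add: normal_extension_def)
   moreover have "b \<in> Basis" "b \<noteq> c" using that \<open>c \<in> Basis - B2\<close> B2 by auto
   ultimately show ?thesis using \<open>c \<in> Basis - B2\<close> by metis
  qed
  ultimately show ?thesis using span_induct[OF that(1), of "\<lambda>v. K v \<bullet> K c = 0"] by blast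
 qed
 have bein: "be c \<in> Basis - B2" if "c \<in> Basis - B1" for c
  using be that by (meson bij_betwE)
 show ?thesis
  unfolding normal_extension_def
 proof (intro conjI ballI)
  show "linear (\<lambda>h. K (?G h))"
   by (auto intro!: linearI simp: linear_add[OF linear_proj] linear_scale[OF linear_proj]
    linear_add[OF D(1)] linear_scale[OF D(1)] linear_add[OF lin]
    linear_scale[OF lin, symmetric] scaleR_sum_right inner_add_left scaleR_add_left sum.distrib algebra_simps)
 next
  fix b assume b: "b \<in> B1"
  then have "D b \<in> span B2" using D(2) by (meson image_subset_iff span_base)
  then show "K (?G b) = L1 b" using b by (simp add: G1 KL2 LD span_base)
 next
  fix b c assume b: "b \<in> (Basis :: 'a set)" and c: "c \<in> Basis - B1"
  show "K (?G b) \<bullet> K (?G c) = (if b = c then 1 else 0)"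
  proof (cases "b \<in> B1")
   case True
   then have "D b \<in> span B2" using D(2) by (meson image_subset_iff span_base)
   then show ?thesis using True c orth[OF _ bein[OF c]] G1[OF True] G2[OF c] by auto
  next
   case False
   then have b': "b \<in> Basis - B1" using b by auto
   then have "K (?G b) \<bullet> K (?G c) = (if be b = be c then 1 else 0)"
    unfolding G2[OF b'] G2[OF c] using K bein[OF b'] bein[OF c] by (auto simp: normal_extension_def)
   moreover have "be b = be c \<longleftrightarrow> b = c"
    using be b' c by (meson bij_betw_def inj_on_eq_iff)
   ultimately show ?thesis by simp
  qed
 qed
qed

text \<open>The change of variables between coordinate subspaces reduces to the one in full
  dimension by thickening with a unit cube: the map \<open>G\<close> acts as \<open>ta\<close> on
  the subspace and relabels the cube coordinates. Its Jacobian converts one Gram density into the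
  other, because completing both parametrizations by unit normals turns the chain rule into a
  product of determinants.\<close>

proposition nn_integral_transition:
 fixes ta :: "real^'d => real^'d" and L1 L2 :: "real^'d => real^'d => real^'d"
 assumes B1: "B1 \<subseteq> Basis" and B2: "B2 \<subseteq> Basis" and card: "card B1 = card B2"
  and A: "A \<subseteq> span B1" "A \<in> sets borel" and taA: "ta ` A \<subseteq> span B2" "ta ` A \<in> sets borel"
  and inj: "inj_on ta A" and der: "!!x. x \<in> A ==> (ta has_derivative D x) (at x)"
  and D: "!!x. x \<in> A ==> D x ` span B1 \<subseteq> span B2"
  and L: "!!x. x \<in> A ==> linear (L1 x)" "!!x. x \<in> A ==> linear (L2 x)"
  and L2: "!!x. x \<in> A ==> inj_on (L2 x) (span B2)"
  and LD: "!!x h. x \<in> A ==> h \<in> span B1 ==> L1 x h = L2 x (D x h)"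
  and g1: "(\<lambda>x. ennreal (g1 x) * indicator A x) \<in> borel_measurable borel"
   "!!x. x \<in> A ==> g1 x = sqrt (gram B1 (L1 x))"
  and g2: "(\<lambda>x. ennreal (g2 x) * indicator (ta ` A) x) \<in> borel_measurable borel"
   "!!x. x \<in> A ==> g2 (ta x) = sqrt (gram B2 (L2 x))"
 shows "(\<integral>\<^sup>+y\<in>ta ` A. ennreal (g2 y) \<partial>lborel_span B2) = (\<integral>\<^sup>+x\<in>A. ennreal (g1 x) \<partial>lborel_span B1)"
proof -
 have "card (Basis - B1) = card (Basis - B2)"
  using B1 B2 card by (simp add: card_Diff_subset finite_subset_Basis)
 then obtain be where be: "bij_betw be (Basis - B1) (Basis - B2)"
  by (metis finite_Basis finite_Diff finite_same_card_bij)
 define si where "si h = (\<Sum>b\<in>Basis - B1. (h \<bullet> b) *\<^sub>R be b)" for h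
 define G where "G z = ta (proj B1 z) + si z" for z
 define S1 where "S1 = slab B1 Int proj B1 -` A"
 define S2 where "S2 = slab B2 Int proj B2 -` (ta ` A)"
 have bein: "be c \<in> Basis - B2" if "c \<in> Basis - B1" for c
  using be that by (meson bij_betwE)
 have surj: "c \<in> be ` (Basis - B1)" if "c \<in> Basis - B2" for c
  using be that by (simp add: bij_betw_def)
 have sig1: "si z \<bullet> be c = z \<bullet> c" if c: "c \<in> Basis - B1" for z c
 proof -
  have "si z \<bullet> be c = (\<Sum>b\<in>Basis - B1. if b = c then z \<bullet> c else 0)"
   unfolding si_def inner_sum_left
  proof (intro sum.cong refl)
   fix b assume b: "b \<in> Basis - B1"
   have "be b = be c \<longleftrightarrow> b = c"
    using be b c by (meson bij_betw_def inj_on_eq_iff)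
   then show "(z \<bullet> b) *\<^sub>R be b \<bullet> be c = (if b = c then z \<bullet> c else 0)"
    using bein[OF b] bein[OF c] by (simp add: inner_Basis)
  qed
  then show ?thesis using c by simp
 qed
 have sig2: "si z \<bullet> b = 0" if "b \<in> B2" for z b
  unfolding si_def inner_sum_left using bein that B2
  by (intro sum.neutral) (auto simp: inner_Basis subset_iff)
 have proj_ta: "proj B2 (ta x) = ta x" if "x \<in> A" for x
  using taA that by (intro proj_id[OF B2]) auto
 have ta0: "ta x \<bullet> c = 0" if "x \<in> A" "c \<in> Basis - B2" for x c
  using taA that span_iff[OF B2] by blast
 have projG: "proj B2 (G z) = ta (proj B1 z)" if "proj B1 z \<in> A" for z
 proof (rule euclidean_eqI)
  fix c :: "real^'d" assume c: "c \<in> Basis"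
  show "proj B2 (G z) \<bullet> c = ta (proj B1 z) \<bullet> c"
   using c ta0[OF that, of c] sig2[of c z] by (simp add: inner_proj[OF B2] G_def inner_add_left)
 qed
 have Gbe: "G z \<bullet> be c = z \<bullet> c" if "proj B1 z \<in> A" "c \<in> Basis - B1" for z c
  using that ta0[OF that(1) bein[OF that(2)]] by (simp add: G_def inner_add_left sig1)
 have im: "G ` S1 = S2"
 proof (intro set_eqI iffI)
  fix w assume "w \<in> G ` S1"
  then obtain z where z: "z \<in> S1" "w = G z" by auto
  have zA: "proj B1 z \<in> A" using z by (simp add: S1_def)
  have "0 <= w \<bullet> c \<and> w \<bullet> c <= 1" if "c \<in> Basis - B2" for c
  proof -
   obtain b where b: "b \<in> Basis - B1" "c = be b" using surj[OF \<open>c \<in> Basis - B2\<close>] by blast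
   then show ?thesis using z Gbe[OF zA b(1)] by (simp add: S1_def slab_def)
  qed
  then show "w \<in> S2" using z projG[OF zA] zA by (auto simp: S2_def slab_def)
 next
  fix w assume w: "w \<in> S2"
  then obtain a where a: "a \<in> A" "proj B2 w = ta a" by (auto simp: S2_def)
  \<comment> \<open>The preimage of \<open>w\<close>: the subspace part is the point
    \<open>a\<close>, and the cube coordinates of \<open>w\<close> are carried back along
    \<open>be\<close>.\<close>
  define z where "z = a + (\<Sum>b\<in>Basis - B1. (w \<bullet> be b) *\<^sub>R b)"
  have za: "z \<bullet> b = a \<bullet> b" if "b \<in> B1" for b
   unfolding z_def inner_add_left inner_sum_left using that B1
   by (subst sum.neutral) (auto simp: inner_Basis subset_iff)
  have zc: "z \<bullet> c = w \<bullet> be c" if c: "c \<in> Basis - B1" for c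
  proof -
   have "a \<bullet> c = 0" using a(1) A(1) c span_iff[OF B1] by blast
   moreover have "(\<Sum>b\<in>Basis - B1. (w \<bullet> be b) *\<^sub>R b) \<bullet> c = (\<Sum>b\<in>Basis - B1. if b = c then w \<bullet> be c else 0)"
    unfolding inner_sum_left using c by (intro sum.cong) (auto simp: inner_Basis)
   ultimately show ?thesis using c by (simp add: z_def inner_add_left)
  qed
  have pz: "proj B1 z = a"
  proof (rule euclidean_eqI)
   fix c :: "real^'d" assume c: "c \<in> Basis"
   have "c \<notin> B1 ==> a \<bullet> c = 0" using a(1) A(1) c span_iff[OF B1] by blast
   then show "proj B1 z \<bullet> c = a \<bullet> c" using c za by (simp add: inner_proj[OF B1])
  qed
  have "z \<in> S1" using w a pz zc bein by (auto simp: S1_def S2_def slab_def)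
  moreover have "G z = w"
  proof (rule euclidean_eqI)
   fix c :: "real^'d" assume c: "c \<in> Basis"
   show "G z \<bullet> c = w \<bullet> c"
   proof (cases "c \<in> B2")
    case True
    have "G z \<bullet> c = proj B2 w \<bullet> c"
     using True c sig2[of c z] by (simp add: G_def pz a inner_add_left)
    then show ?thesis using True c by (simp add: inner_proj[OF B2])
   next
    case False
    then obtain b where b: "b \<in> Basis - B1" "c = be b" using surj[of c] c by blast
    then show ?thesis using Gbe[of z b] pz a zc by simp
   qed
  qed
  ultimately show "w \<in> G ` S1" by blast
 qed
 have injG: "inj_on G S1"
 proof (rule inj_onI)
  fix z z' assume z: "z \<in> S1" "z' \<in> S1" "G z = G z'"
  have A': "proj B1 z \<in> A" "proj B1 z' \<in> A" using z by (auto simp: S1_def)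
  have "proj B1 z = proj B1 z'"
   using projG[OF A'(1)] projG[OF A'(2)] z(3) inj A' by (metis inj_onD)
  show "z = z'"
  proof (rule euclidean_eqI)
   fix c :: "real^'d" assume c: "c \<in> Basis"
   show "z \<bullet> c = z' \<bullet> c"
   proof (cases "c \<in> B1")
    case True
    then show ?thesis using \<open>proj B1 z = proj B1 z'\<close> c inner_proj[OF B1 c, of z] inner_proj[OF B1 c, of z'] by simp
   next
    case False
    then show ?thesis using Gbe[OF A'(1), of c] Gbe[OF A'(2), of c] z(3) c by simp
   qed
  qed
 qed
 have S1: "S1 \<in> sets borel" and S2: "S2 \<in> sets borel"
  unfolding S1_def S2_def using A(2) taA(2) B1 B2
  by (auto intro!: sets.Int simp: sets_slab measurable_sets_borel[OF measurable_proj])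
 let ?G' = "\<lambda>z h. D (proj B1 z) (proj B1 h) + si h"
 have linsi: "linear si"
  unfolding si_def by (auto intro!: linearI simp: inner_add_left scaleR_add_left sum.distrib scaleR_sum_right)
 have derG: "(G has_derivative ?G' z) (at z within S1)" if "z \<in> S1" for z
 proof -
  have "proj B1 z \<in> A" using that by (simp add: S1_def)
  from has_derivative_compose[OF has_derivative_proj[of B1 "at z within S1"] der[OF this]]
  have "((\<lambda>z. ta (proj B1 z)) has_derivative (\<lambda>h. D (proj B1 z) (proj B1 h))) (at z within S1)" .
  moreover have "(si has_derivative si) (at z within S1)"
   using linsi linear_conv_bounded_linear bounded_linear_imp_has_derivative by blast
  ultimately show ?thesis unfolding G_def[abs_def] by (rule has_derivative_add)
 qed
 have det: "g1 (proj B1 z) = \<bar>det (matrix (?G' z))\<bar> * g2 (ta (proj B1 z))" if "z \<in> S1" for z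
 proof -
  let ?x = "proj B1 z"
  have x: "?x \<in> A" using that by (simp add: S1_def)
  obtain K where K: "normal_extension B2 (L2 ?x) K"
   using normal_extension_exists[OF B2 L(2)[OF x] L2[OF x]] .
  have lin: "linear K" "linear (?G' z)"
   using K derG[OF that] has_derivative_linear by (auto simp: normal_extension_def)
  have "normal_extension B1 (L1 ?x) (\<lambda>h. K (?G' z h))"
   unfolding si_def
   by (rule normal_extension_transition[OF B1 B2 be K L(1)[OF x] L(2)[OF x] _ D[OF x] LD[OF x]])
     (use der[OF x] has_derivative_linear in auto)
  then have "gram B1 (L1 ?x) = (det (matrix (K \<circ> ?G' z)))\<^sup>2"
   using gram_normal_extension[OF B1] by (simp add: o_def)
  also have "... = (det (matrix (?G' z)))\<^sup>2 * gram B2 (L2 ?x)"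
   using gram_normal_extension[OF B2 K] lin
   by (simp add: matrix_compose det_mul power_mult_distrib)
  finally show ?thesis by (simp add: g1(2) g2(2) x real_sqrt_mult)
 qed
 let ?f = "\<lambda>w. ennreal (g2 (proj B2 w)) * indicator (ta ` A) (proj B2 w)"
 have f: "?f \<in> borel_measurable borel"
  using measurable_compose[OF measurable_proj g2(1)] .
 have "(\<integral>\<^sup>+y\<in>ta ` A. ennreal (g2 y) \<partial>lborel_span B2) = (\<integral>\<^sup>+w\<in>S2. ennreal (g2 (proj B2 w)) \<partial>lborel)"
  unfolding S2_def by (rule set_nn_integral_lborel_span[OF B2 taA(2) g2(1)])
 also have "... = (\<integral>\<^sup>+w\<in>G ` S1. ?f w \<partial>lborel)"
  by (intro nn_integral_cong) (auto simp: im S2_def split: split_indicator)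
 also have "... = (\<integral>\<^sup>+z\<in>S1. ennreal \<bar>det (matrix (?G' z))\<bar> * ?f (G z) \<partial>lborel)"
  by (rule nn_integral_change_of_variables[OF S1 derG injG _ f]) (use S2 im in auto)
 also have "... = (\<integral>\<^sup>+z\<in>S1. ennreal (g1 (proj B1 z)) \<partial>lborel)"
 proof (intro nn_integral_cong)
  fix z :: "real^'d"
  show "ennreal \<bar>det (matrix (?G' z))\<bar> * ?f (G z) * indicator S1 z = ennreal (g1 (proj B1 z)) * indicator S1 z"
   using det[of z] projG[of z] by (auto simp: S1_def ennreal_mult' split: split_indicator)
 qed
 also have "... = (\<integral>\<^sup>+x\<in>A. ennreal (g1 x) \<partial>lborel_span B1)"
  unfolding S1_def by (rule set_nn_integral_lborel_span[OF B1 A(2) g1(1), symmetric])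
 finally show ?thesis .
qed

subsection \<open>Existence and uniqueness of the induced volume\<close>

abbreviation "ivol \<equiv> induced_volume"

text \<open>Collects the conditions on the charts quantified over in
  \<open>induced_volume\<close>.\<close>

definition C1chart ::
 "nat => 'a::euclidean_space set => 'a set => 'a set => 'a set => 'a set => ('a => 'a) => ('a => 'a) => bool"
 where "C1chart m X B H U V Ph Ps \<longleftrightarrow> B \<subseteq> Basis \<and> card B = m \<and>
  H \<in> insert (span B) (half_spaces B) \<and> adapted_chart 1 X H U V Ph Ps"

definition charted :: "nat => 'a::euclidean_space set => bool" where
 "charted m X \<longleftrightarrow> (\<forall>p\<in>X. \<exists>B H U V Ph Ps. C1chart m X B H U V Ph Ps \<and> p \<in> U)"

abbreviation D :: "('a::real_normed_vector => 'b::real_normed_vector) => 'a => 'a => 'b" where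
 "D f x \<equiv> frechet_derivative f (at x)"

lemma Ck_on_SucD: "Ck_on (Suc k) S f ==> open S ==> Ck_on k S f"
proof (induction k arbitrary: f)
 case 0
 then show ?case
  by (auto intro!: continuous_at_imp_continuous_on differentiable_imp_continuous_within)
next
 case (Suc k)
 then show ?case by (metis Ck_on.simps(2))
qed

lemma Ck_on_mono: "Ck_on k S f ==> open S ==> j <= k ==> Ck_on j S f"
 by (induction k) (auto simp: le_Suc_eq simp del: Ck_on.simps dest: Ck_on_SucD)

lemma Ck_on_1D:
 assumes "Ck_on 1 S f"
 shows "x \<in> S ==> (f has_derivative D f x) (at x)" "continuous_on S (\<lambda>x. D f x v)"
 using assms by (auto simp: frechet_derivative_works)

lemma continuous_on_vimage_borel:
 assumes "continuous_on S f" "S \<in> sets borel" "A \<in> sets borel"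
 shows "S Int f -` A \<in> sets borel"
proof -
 have "f \<in> borel_measurable (restrict_space borel S)"
  using assms(1) by (rule borel_measurable_continuous_on_restrict)
 from measurable_sets[OF this assms(3)] show ?thesis
  using assms(2) by (auto simp: sets_restrict_space_iff space_restrict_space Int_commute)
qed

text \<open>The models are closed convex cones, and even a half-space yields all of
  \<open>span B\<close> by differences.\<close>

lemma model_facts:
 assumes "B \<subseteq> Basis" "H \<in> insert (span B) (half_spaces B)"
 shows closed_model: "closed H" and model_subset: "H \<subseteq> span B"
  and model_add: "x \<in> H ==> h \<in> H ==> 0 <= s ==> x + s *\<^sub>R h \<in> H"
  and model_diff: "v \<in> span B ==> \<exists>h1\<in>H. \<exists>h2\<in>H. v = h1 - h2"
proof -
 from assms(2) have H: "H = span B \<or> (\<exists>b\<in>B. H = span B Int {x. 0 <= b \<bullet> x})"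
  by (auto simp: half_spaces_def inner_commute)
 then show "closed H"
  using closed_subspace[OF subspace_span] closed_halfspace_ge by (metis closed_Int)
 show "H \<subseteq> span B" using H by auto
 show "x \<in> H ==> h \<in> H ==> 0 <= s ==> x + s *\<^sub>R h \<in> H"
  using H by (auto intro!: span_add span_scale simp: inner_add_right)
 show "\<exists>h1\<in>H. \<exists>h2\<in>H. v = h1 - h2" if v: "v \<in> span B"
  using H
 proof
  assume "\<exists>b\<in>B. H = span B Int {x. 0 <= b \<bullet> x}"
  then obtain b where b: "b \<in> B" "H = span B Int {x. 0 <= b \<bullet> x}" by blast
  then have "b \<bullet> b = 1" using assms(1) by (auto intro: inner_same_Basis)
  have "\<bar>b \<bullet> v\<bar> *\<^sub>R b \<in> span B" using b(1) by (intro span_scale span_base)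
  then have "v + \<bar>b \<bullet> v\<bar> *\<^sub>R b \<in> H" "\<bar>b \<bullet> v\<bar> *\<^sub>R b \<in> H"
   using b(2) span_add[OF v] \<open>b \<bullet> b = 1\<close> by (auto simp: inner_add_right)
  then show ?thesis by (metis add_diff_cancel)
 qed (use v in \<open>metis diff_zero span_zero\<close>)
qed

text \<open>At a boundary point of a half-space only the one-sided difference quotients along
  directions in \<open>H\<close> are known to lie in \<open>T\<close>. As \<open>T\<close> is
  closed, the derivative maps \<open>H\<close> into \<open>T\<close>, and every vector of
  \<open>span B\<close> is a difference of two vectors of \<open>H\<close>.\<close>

lemma derivative_in_subspace:
 fixes F :: "'a::euclidean_space => 'b::euclidean_space"
 assumes B: "B \<subseteq> Basis" "H \<in> insert (span B) (half_spaces B)"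
  and F: "(F has_derivative F') (at x)" and x: "x \<in> W" "open W" "x \<in> H"
  and T: "subspace T" "!!z. z \<in> W Int H ==> F z \<in> T" and v: "v \<in> span B"
 shows "F' v \<in> T"
proof -
 have lin: "linear F'" using F has_derivative_linear by blast
 have main: "F' h \<in> T" if h: "h \<in> H" for h
 proof -
  have "((\<lambda>s. x + s *\<^sub>R h) has_derivative (\<lambda>s. s *\<^sub>R h)) (at 0 within {0<..})"
   by (auto intro!: derivative_eq_intros)
  then have "((\<lambda>s. F (x + s *\<^sub>R h)) has_derivative (\<lambda>s. F' (s *\<^sub>R h))) (at 0 within {0<..})"
   by (rule has_derivative_compose) (use F in simp)
  then have "((\<lambda>s. (1 / norm (s - 0)) *\<^sub>R (F (x + s *\<^sub>R h) - (F (x + 0 *\<^sub>R h) + F' ((s - 0) *\<^sub>R h)))) \<longlongrightarrow> 0)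
    (at_right 0)"
   unfolding has_derivative_within by blast
  then have "((\<lambda>s. (F (x + s *\<^sub>R h) - F x) /\<^sub>R s - F' h) \<longlongrightarrow> 0) (at_right 0)"
  proof (rule Lim_transform_eventually)
   show "\<forall>\<^sub>F s in at_right 0. (1 / norm (s - 0)) *\<^sub>R (F (x + s *\<^sub>R h) - (F (x + 0 *\<^sub>R h) + F' ((s - 0) *\<^sub>R h))) =
     (F (x + s *\<^sub>R h) - F x) /\<^sub>R s - F' h"
    using eventually_at_right_less[of 0]
    by eventually_elim (simp add: linear_scale[OF lin] scaleR_diff_right scaleR_add_right divide_inverse diff_diff_eq)
  qed
  then have lim: "((\<lambda>s. (F (x + s *\<^sub>R h) - F x) /\<^sub>R s) \<longlongrightarrow> F' h) (at_right 0)"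
   by (rule LIM_zero_cancel)
  have "\<forall>\<^sub>F s in at_right 0. (F (x + s *\<^sub>R h) - F x) /\<^sub>R s \<in> T"
  proof -
   have "((\<lambda>s. x + s *\<^sub>R h) \<longlongrightarrow> x + 0 *\<^sub>R h) (at_right 0)" by (intro tendsto_intros)
   then have "\<forall>\<^sub>F s in at_right 0. x + s *\<^sub>R h \<in> W"
    using x by (auto dest: topological_tendstoD)
   then show ?thesis
    using eventually_at_right_less[of 0]
   proof eventually_elim
    case (elim s)
    then have "F (x + s *\<^sub>R h) \<in> T" using T(2) model_add[OF B x(3) h, of s] by auto
    moreover have "F x \<in> T" using T(2) x by auto
    ultimately show ?case using T(1) by (simp add: subspace_diff subspace_scale)
   qed
  qed
  from Lim_in_closed_set[OF closed_subspace[OF T(1)] this _ lim] show ?thesis by simp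
 qed
 obtain h1 h2 where "h1 \<in> H" "h2 \<in> H" "v = h1 - h2" using model_diff[OF B v] by blast
 then show ?thesis using main T(1) by (simp add: linear_diff[OF lin] subspace_diff)
qed

context
 fixes m and X :: "(real^'d) set" and B H U V and Ph Ps :: "real^'d => real^'d"
 assumes chart: "C1chart m X B H U V Ph Ps"
begin

lemma chartD:
 shows chart_B: "B \<subseteq> Basis" and chart_card: "card B = m" and chart_H: "H \<in> insert (span B) (half_spaces B)"
  and chart_open: "open U" "open V" and chart_hom: "homeomorphism U V Ph Ps"
  and chart_C1: "Ck_on 1 U Ph" "Ck_on 1 V Ps" and chart_image: "Ph ` (U Int X) = V Int H"
 using chart by (auto simp: C1chart_def adapted_chart_def Ck_diffeo_def simp del: Ck_on.simps)

lemma chart_inverse: "x \<in> U ==> Ps (Ph x) = x" "y \<in> V ==> Ph (Ps y) = y"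
  "x \<in> U ==> Ph x \<in> V" "y \<in> V ==> Ps y \<in> U"
 using chart_hom by (auto simp: homeomorphism_def)

lemma chart_H_iff: "x \<in> U ==> Ph x \<in> H \<longleftrightarrow> x \<in> X" "y \<in> V ==> Ps y \<in> X \<longleftrightarrow> y \<in> H"
proof -
 show 1: "Ph x \<in> H \<longleftrightarrow> x \<in> X" if "x \<in> U" for x
 proof
  assume "Ph x \<in> H"
  then have "Ph x \<in> Ph ` (U Int X)" using chart_image chart_inverse that by auto
  then obtain x' where "x' \<in> U" "x' \<in> X" "Ph x = Ph x'" by auto
  then show "x \<in> X" using chart_inverse(1) that by metis
 qed (use chart_image that in blast)
 show "Ps y \<in> X \<longleftrightarrow> y \<in> H" if "y \<in> V" using 1[of "Ps y"] chart_inverse that by simp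
qed

lemma chart_derivative:
 "x \<in> U ==> (Ph has_derivative D Ph x) (at x)" "y \<in> V ==> (Ps has_derivative D Ps y) (at y)"
 using Ck_on_1D(1)[OF chart_C1(1)] Ck_on_1D(1)[OF chart_C1(2)] by auto

lemma chart_linear: "x \<in> U ==> linear (D Ph x)" "y \<in> V ==> linear (D Ps y)"
 by (blast intro: has_derivative_linear chart_derivative)+

lemma chart_continuous: "continuous_on U Ph" "continuous_on V Ps"
 using chart_hom by (auto simp: homeomorphism_def)

lemma chart_D_inverse: "y \<in> V ==> D Ph (Ps y) (D Ps y v) = v" "x \<in> U ==> D Ps (Ph x) (D Ph x v) = v"
proof -
 assume y: "y \<in> V"
 have "((\<lambda>y. Ph (Ps y)) has_derivative (\<lambda>v. D Ph (Ps y) (D Ps y v))) (at y)"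
  using has_derivative_compose chart_derivative chart_inverse y by blast
 moreover have "((\<lambda>y. Ph (Ps y)) has_derivative (\<lambda>v. v)) (at y)"
  by (rule has_derivative_transform_within_open[OF has_derivative_ident chart_open(2) y])
    (simp add: chart_inverse)
 ultimately show "D Ph (Ps y) (D Ps y v) = v" using has_derivative_unique by metis
next
 assume x: "x \<in> U"
 have "((\<lambda>x. Ps (Ph x)) has_derivative (\<lambda>v. D Ps (Ph x) (D Ph x v))) (at x)"
  using has_derivative_compose chart_derivative chart_inverse x by blast
 moreover have "((\<lambda>x. Ps (Ph x)) has_derivative (\<lambda>v. v)) (at x)"
  by (rule has_derivative_transform_within_open[OF has_derivative_ident chart_open(1) x])
    (simp add: chart_inverse)
 ultimately show "D Ps (Ph x) (D Ph x v) = v" using has_derivative_unique by metis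
qed

lemma chart_D_inj: "y \<in> V ==> inj (D Ps y)" "x \<in> U ==> inj (D Ph x)"
 using chart_D_inverse by (metis injI)+

lemma continuous_on_gram_det: "continuous_on V (gram_det B Ps)"
 unfolding gram_det_def[abs_def] using Ck_on_1D(2)[OF chart_C1(2)]
 by (intro continuous_on_sum continuous_on_mult continuous_on_prod continuous_on_inner continuous_on_const)

text \<open>The density is controlled only on \<open>V\<close>; the indicator makes it a Borel
  function on the whole space.\<close>

lemma measurable_gram_det:
 assumes "A \<in> sets borel" "A \<subseteq> V"
 shows "(\<lambda>x. ennreal (sqrt (gram_det B Ps x)) * indicator A x) \<in> borel_measurable borel"
proof -
 have "continuous_on A (\<lambda>x. sqrt (gram_det B Ps x))"
  using continuous_on_gram_det assms(2) by (auto intro!: continuous_intros intro: continuous_on_subset)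
 then have "(\<lambda>x. indicator A x *\<^sub>R sqrt (gram_det B Ps x)) \<in> borel_measurable borel"
  using assms(1) by (rule borel_measurable_continuous_on_indicator[rotated])
 then have "(\<lambda>x. ennreal (indicator A x *\<^sub>R sqrt (gram_det B Ps x))) \<in> borel_measurable borel"
  by measurable
 then show ?thesis
  by (rule measurable_cong[THEN iffD1, rotated]) (auto split: split_indicator)
qed

text \<open>Images under \<open>Ps\<close> are preimages under the continuous \<open>Ph\<close>, cut
  with \<open>X\<close>.\<close>

lemma chart_borel_image:
 assumes "X \<in> sets borel" "A \<in> sets borel" "A \<subseteq> V Int H"
 shows "Ps ` A \<in> sets borel" "Ps ` A \<subseteq> U Int X"
proof -
 have "Ps ` A = X Int (U Int Ph -` A)"
  using assms(3) chart_inverse chart_H_iff by (auto simp: image_iff subset_iff) metis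
 then show "Ps ` A \<in> sets borel"
  using continuous_on_vimage_borel[OF chart_continuous(1) _ assms(2)] chart_open assms(1) by auto
 show "Ps ` A \<subseteq> U Int X" using assms(3) chart_inverse(4) chart_H_iff(2) by blast
qed

end

text \<open>On \<open>A\<close> the map \<open>Ps1\<close> is \<open>Ps2\<close> after the
  transition map \<open>ta\<close>, so its derivative factors through \<open>E\<close>. At boundary
  points only the half-spaces correspond; that \<open>E x\<close> still maps \<open>span B1\<close>
  into \<open>span B2\<close> is \<open>derivative_in_subspace\<close>.\<close>

lemma chart_compat:
 fixes X :: "(real^'d) set"
 assumes c1: "C1chart m X B1 H1 U1 V1 Ph1 Ps1" and c2: "C1chart m X B2 H2 U2 V2 Ph2 Ps2"
  and A: "A \<in> sets borel" "A \<subseteq> V1 Int H1" "Ps1 ` A \<subseteq> U2"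
 shows "(\<integral>\<^sup>+y\<in>Ph2 ` Ps1 ` A. ennreal (sqrt (gram_det B2 Ps2 y)) \<partial>lborel_span B2) =
     (\<integral>\<^sup>+x\<in>A. ennreal (sqrt (gram_det B1 Ps1 x)) \<partial>lborel_span B1)"
proof -
 define ta where "ta x = Ph2 (Ps1 x)" for x
 define E where "E x h = D Ph2 (Ps1 x) (D Ps1 x h)" for x h
 note i1 = chart_inverse[OF c1] and i2 = chart_inverse[OF c2]
 have AV: "x \<in> V1" "x \<in> H1" "Ps1 x \<in> U1" "Ps1 x \<in> U2" "Ps1 x \<in> X" "ta x \<in> V2" "ta x \<in> H2" "Ps2 (ta x) = Ps1 x"
  if "x \<in> A" for x
 proof -
  show 1: "x \<in> V1" "x \<in> H1" "Ps1 x \<in> U2" using that A by auto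
  then show 2: "Ps1 x \<in> U1" "ta x \<in> V2" "Ps2 (ta x) = Ps1 x" using i1 i2 by (auto simp: ta_def)
  show 3: "Ps1 x \<in> X" using chart_H_iff(2)[OF c1 1(1)] 1(2) by simp
  show "ta x \<in> H2" using chart_H_iff(1)[OF c2 1(3)] 3 by (simp add: ta_def)
 qed
 have op: "open (V1 Int Ps1 -` U2)"
  using continuous_on_open_vimage[OF chart_open(2)[OF c1], of Ps1] chart_continuous(2)[OF c1] chart_open(1)[OF c2]
  by (auto simp: Int_commute)
 have taA: "ta ` A \<in> sets borel"
 proof -
  \<comment> \<open>The image is Borel because it is the preimage of \<open>A\<close> under the
    opposite transition map, which is continuous on the open set \<open>?W\<close>.\<close>
  let ?W = "V2 Int Ps2 -` U1"
  have opW: "open ?W"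
   using continuous_on_open_vimage[OF chart_open(2)[OF c2], of Ps2] chart_continuous(2)[OF c2] chart_open(1)[OF c1]
   by (auto simp: Int_commute)
  have cont: "continuous_on ?W (Ph1 \<circ> Ps2)"
   by (rule continuous_on_compose)
     (auto intro: continuous_on_subset[OF chart_continuous(2)[OF c2]] continuous_on_subset[OF chart_continuous(1)[OF c1]])
  have 1: "?W Int (Ph1 \<circ> Ps2) -` A \<in> sets borel"
   by (rule continuous_on_vimage_borel[OF cont borel_open[OF opW] A(1)])
  have "ta ` A = ?W Int (Ph1 \<circ> Ps2) -` A"
  proof (intro set_eqI iffI)
   fix y assume "y \<in> ta ` A"
   then obtain x where "x \<in> A" "y = ta x" by auto
   then show "y \<in> ?W Int (Ph1 \<circ> Ps2) -` A" using AV[of x] i1 by simp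
  next
   fix y assume y: "y \<in> ?W Int (Ph1 \<circ> Ps2) -` A"
   then have "ta (Ph1 (Ps2 y)) = y" using i1 i2 by (simp add: ta_def)
   then show "y \<in> ta ` A" using y by (metis IntD2 comp_apply image_eqI vimage_eq)
  qed
  with 1 show ?thesis by simp
 qed
 have inj: "inj_on ta A"
 proof (rule inj_onI)
  fix x x' assume x: "x \<in> A" "x' \<in> A" "ta x = ta x'"
  then have "Ps1 x = Ps1 x'" using AV(8)[of x] AV(8)[of x'] by simp
  then show "x = x'" using AV(1) x i1(2) by metis
 qed
 have der: "(ta has_derivative E x) (at x)" if "x \<in> A" for x
  unfolding ta_def[abs_def] E_def[abs_def]
  by (rule has_derivative_compose[OF chart_derivative(2)[OF c1] chart_derivative(1)[OF c2]]) (use AV that in auto)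
 have E: "E x ` span B1 \<subseteq> span B2" if "x \<in> A" for x
 proof (rule image_subsetI)
  fix v assume v: "v \<in> span B1"
  show "E x v \<in> span B2"
  proof (rule derivative_in_subspace[OF chart_B[OF c1] chart_H[OF c1] der[OF that] _ op _ subspace_span _ v])
   fix z assume z: "z \<in> V1 Int Ps1 -` U2 Int H1"
   then have "ta z \<in> H2" using chart_H_iff[OF c1] chart_H_iff[OF c2] by (auto simp: ta_def)
   then show "ta z \<in> span B2" using model_subset[OF chart_B[OF c2] chart_H[OF c2]] by auto
  qed (use AV that in auto)
 qed
 have "(\<integral>\<^sup>+y\<in>ta ` A. ennreal (sqrt (gram_det B2 Ps2 y)) \<partial>lborel_span B2) =
     (\<integral>\<^sup>+x\<in>A. ennreal (sqrt (gram_det B1 Ps1 x)) \<partial>lborel_span B1)"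
 proof (rule nn_integral_transition[where D = E and ?L1.0 = "D Ps1" and ?L2.0 = "\<lambda>x. D Ps2 (ta x)"])
  show "B1 \<subseteq> Basis" "B2 \<subseteq> Basis" "card B1 = card B2"
   using c1 c2 by (simp_all add: C1chart_def)
  show "A \<subseteq> span B1" using model_subset[OF chart_B[OF c1] chart_H[OF c1]] A(2) by auto
  show "ta ` A \<subseteq> span B2" using model_subset[OF chart_B[OF c2] chart_H[OF c2]] AV by auto
  show "linear (D Ps1 x)" if "x \<in> A" for x using chart_linear(2)[OF c1] AV that by auto
  show "linear (D Ps2 (ta x))" if "x \<in> A" for x using chart_linear(2)[OF c2] AV that by auto
  show "inj_on (D Ps2 (ta x)) (span B2)" if "x \<in> A" for x
   by (rule inj_on_subset[OF chart_D_inj(1)[OF c2]]) (use AV that in auto)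
  show "D Ps1 x h = D Ps2 (ta x) (E x h)" if "x \<in> A" for x h
   using chart_D_inverse(2)[OF c2, of "Ps1 x" "D Ps1 x h"] AV that by (simp add: ta_def E_def)
  show "(\<lambda>x. ennreal (sqrt (gram_det B1 Ps1 x)) * indicator A x) \<in> borel_measurable borel"
   by (rule measurable_gram_det[OF c1 A(1)]) (use A in auto)
  show "(\<lambda>x. ennreal (sqrt (gram_det B2 Ps2 x)) * indicator (ta ` A) x) \<in> borel_measurable borel"
   by (rule measurable_gram_det[OF c2 taA]) (use AV in auto)
 qed (use A taA inj der E in \<open>auto simp: gram_det_eq\<close>)
 then show ?thesis by (simp add: ta_def image_image)
qed

definition is_induced_volume :: "nat => 'a::euclidean_space set => 'a measure => bool" where
 "is_induced_volume m X mu \<longleftrightarrow> sets mu = sets (restrict_space borel X) \<and>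
   (\<forall>B H U V Ph Ps A. C1chart m X B H U V Ph Ps --> A \<in> sets borel --> A \<subseteq> V Int H -->
    emeasure mu (Ps ` A) = (\<integral>\<^sup>+x\<in>A. ennreal (sqrt (gram_det B Ps x)) \<partial>lborel_span B))"

lemma induced_volume_eq_The: "ivol m X = (THE mu. is_induced_volume m X mu)"
 unfolding induced_volume_def is_induced_volume_def C1chart_def by (simp only: imp_conjL)

lemma is_induced_volumeD:
 assumes "is_induced_volume m X mu"
 shows "sets mu = sets (restrict_space borel X)"
  "C1chart m X B H U V Ph Ps ==> A \<in> sets borel ==> A \<subseteq> V Int H ==>
   emeasure mu (Ps ` A) = (\<integral>\<^sup>+x\<in>A. ennreal (sqrt (gram_det B Ps x)) \<partial>lborel_span B)"
 using assms unfolding is_induced_volume_def by blast+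

lemma emeasure_eq_of_cover:
 fixes N :: nat
 assumes sets: "sets mu = sets nu" and E: "E \<in> sets mu" "E \<subseteq> (\<Union>i<N. W i)"
  and W: "!!i. i < N ==> E Int W i \<in> sets mu"
  and eq: "!!i E'. i < N ==> E' \<in> sets mu ==> E' \<subseteq> E Int W i ==> emeasure mu E' = emeasure nu E'"
 shows "emeasure mu E = emeasure nu E"
proof -
 let ?P = "disjointed (\<lambda>i. E Int W i)"
 have P: "?P i \<in> sets mu" "?P i \<subseteq> E Int W i" if "i < N" for i
 proof -
  have "(\<Union>j\<in>{0..<i}. E Int W j) \<in> sets mu"
   using W that by (intro sets.finite_UN) auto
  then show "?P i \<in> sets mu" using W[OF that] by (auto simp: disjointed_def intro!: sets.Diff)
  show "?P i \<subseteq> E Int W i" by (rule disjointed_subset)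
 qed
 have E_eq: "E = (\<Union>i\<in>{0..<N}. ?P i)"
  using E(2) by (simp add: finite_UN_disjointed_eq) (auto simp: lessThan_atLeast0)
 have disj: "disjoint_family_on ?P {0..<N}"
  by (rule disjoint_family_on_mono[OF subset_UNIV disjoint_family_disjointed])
 have "emeasure mu E = (\<Sum>i\<in>{0..<N}. emeasure mu (?P i))"
  by (subst E_eq, subst sum_emeasure[OF _ disj]) (use P in auto)
 also have "... = (\<Sum>i\<in>{0..<N}. emeasure nu (?P i))"
  using P eq by (intro sum.cong) auto
 also have "... = emeasure nu E"
  by (subst sum_emeasure[OF _ disj]) (use P E_eq sets in auto)
 finally show ?thesis .
qed

text \<open>Indexing by an initial segment of the naturals makes \<open>disjointed\<close> available
  for cutting \<open>X\<close> into pieces that lie in one chart domain each.\<close>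

lemma finite_chart_cover:
 fixes X :: "'a::euclidean_space set"
 assumes "compact X" "charted m X"
 obtains N :: nat and B H U V Ph Ps where
  "!!i. i < N ==> C1chart m X (B i) (H i) (U i) (V i) (Ph i) (Ps i)" "X \<subseteq> (\<Union>i<N. U i)"
proof -
 from assms(2) have "\<forall>p. \<exists>B H U V Ph Ps. p \<in> X --> C1chart m X B H U V Ph Ps \<and> p \<in> U"
  unfolding charted_def by blast
 then obtain B H U V Ph Ps where c: "!!p. p \<in> X ==> C1chart m X (B p) (H p) (U p) (V p) (Ph p) (Ps p)"
  "!!p. p \<in> X ==> p \<in> U p"
  by metis
 have "open (U p)" if "p \<in> X" for p
  using c(1)[OF that] by (simp add: C1chart_def adapted_chart_def Ck_diffeo_def)
 moreover have "X \<subseteq> (\<Union>p\<in>X. U p)" using c(2) by blast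
 ultimately obtain F where F: "F \<subseteq> X" "finite F" "X \<subseteq> (\<Union>p\<in>F. U p)"
  using compactE_image[OF assms(1), of X U] by blast
 obtain N and e :: "nat => 'a" where e: "F = e ` {i. i < N}"
  using F(2) unfolding finite_conv_nat_seg_image by blast
 show thesis
 proof (rule that[of N "B \<circ> e" "H \<circ> e" "U \<circ> e" "V \<circ> e" "Ph \<circ> e" "Ps \<circ> e"])
  show "C1chart m X ((B \<circ> e) i) ((H \<circ> e) i) ((U \<circ> e) i) ((V \<circ> e) i) ((Ph \<circ> e) i) ((Ps \<circ> e) i)" if "i < N" for i
   using c(1)[of "e i"] F(1) e that by auto
  show "X \<subseteq> (\<Union>i<N. (U \<circ> e) i)" using F(3) unfolding e by (auto simp: lessThan_def)
 qed
qed

lemma sets_restrict_borel: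
 "X \<in> sets borel ==> E \<in> sets (restrict_space borel X) \<longleftrightarrow> E \<in> sets borel \<and> E \<subseteq> X"
 by (simp add: sets_restrict_space_iff conj_commute)

lemma chart_preimage:
 fixes X :: "(real^'d) set"
 assumes c: "C1chart m X B H U V Ph Ps" and X: "X \<in> sets borel" and E: "E \<in> sets borel" "E \<subseteq> U Int X"
 shows "V Int Ps -` E \<in> sets borel" "V Int Ps -` E \<subseteq> V Int H" "Ps ` (V Int Ps -` E) = E" "Ph ` E = V Int Ps -` E"
proof -
 note i = chart_inverse[OF c]
 show "V Int Ps -` E \<in> sets borel"
  by (rule continuous_on_vimage_borel[OF chart_continuous(2)[OF c] borel_open[OF chart_open(2)[OF c]] E(1)])
 show "V Int Ps -` E \<subseteq> V Int H" using E(2) chart_H_iff(2)[OF c] by auto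
 show 1: "Ph ` E = V Int Ps -` E"
 proof (intro set_eqI iffI)
  fix y assume "y \<in> V Int Ps -` E"
  then show "y \<in> Ph ` E" using i(2)[of y] by (metis IntD1 IntD2 image_eqI vimageD)
 qed (use E(2) i in auto)
 show "Ps ` (V Int Ps -` E) = E"
 proof -
  have "(\<lambda>x. Ps (Ph x)) ` E = (\<lambda>x. x) ` E"
   by (rule image_cong) (use E(2) i(1) in auto)
  then show ?thesis unfolding 1[symmetric] image_image by simp
 qed
qed

text \<open>A Borel subset of \<open>X\<close> inside one chart domain is the image of a Borel set
  in the model, so its measure is prescribed; a finite cover by charts does the rest.\<close>

lemma is_induced_volume_unique:
 fixes X :: "(real^'d) set"
 assumes X: "compact X" "charted m X" and mu: "is_induced_volume m X mu" and nu: "is_induced_volume m X nu"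
 shows "mu = nu"
proof (rule measure_eqI)
 note muD = is_induced_volumeD[OF mu] and nuD = is_induced_volumeD[OF nu]
 show sets: "sets mu = sets nu" using muD(1) nuD(1) by simp
 have Xb: "X \<in> sets borel" using X(1) by (simp add: borel_closed compact_imp_closed)
 fix E assume E: "E \<in> sets mu"
 obtain N :: nat and B H U V Ph Ps where
  c: "!!i. i < N ==> C1chart m X (B i) (H i) (U i) (V i) (Ph i) (Ps i)" and cover: "X \<subseteq> (\<Union>i<N. U i)"
  by (rule finite_chart_cover[OF X]) (rule that)
 have mem: "E \<in> sets mu \<longleftrightarrow> E \<in> sets borel \<and> E \<subseteq> X" for E
  using sets_restrict_borel[OF Xb] muD(1) by simp
 show "emeasure mu E = emeasure nu E"
 proof (rule emeasure_eq_of_cover[OF sets E, where N = N and W = U])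
  show "E \<subseteq> (\<Union>i<N. U i)" using E cover mem by blast
  show "E Int U i \<in> sets mu" if "i < N" for i
   using E chart_open(1)[OF c[OF that]] unfolding mem by auto
  fix i E' assume i: "i < N" and E': "E' \<in> sets mu" "E' \<subseteq> E Int U i"
  then have E'': "E' \<in> sets borel" "E' \<subseteq> U i Int X" using mem by auto
  note p = chart_preimage[OF c[OF i] Xb E'']
  show "emeasure mu E' = emeasure nu E'"
   using muD(2)[OF c[OF i] p(1,2)] nuD(2)[OF c[OF i] p(1,2)] p(3) by simp
 qed
qed

text \<open>\<open>X\<close> is cut into finitely many Borel pieces, each inside one chart domain;
  the chart densities are pushed forward piece by piece and added. By \<open>chart_compat\<close>
  the result has the prescribed values in every chart, not only in the chosen ones.\<close>

lemma is_induced_volume_exists: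
 fixes X :: "(real^'d) set"
 assumes X: "compact X" "charted m X"
 obtains mu where "is_induced_volume m X mu"
proof -
 have Xb: "X \<in> sets borel" using X(1) by (simp add: borel_closed compact_imp_closed)
 obtain N :: nat and B H U V Ph Ps where
  c: "!!i. i < N ==> C1chart m X (B i) (H i) (U i) (V i) (Ph i) (Ps i)" and cover: "X \<subseteq> (\<Union>i<N. U i)"
  by (rule finite_chart_cover[OF X]) (rule that)
 define P where "P i = X Int disjointed U i" for i
 have P: "P i \<in> sets borel" "P i \<subseteq> U i Int X" if "i < N" for i
 proof -
  have "disjointed U i \<in> sets borel"
   unfolding disjointed_def using chart_open(1)[OF c] that
   by (intro sets.Diff sets.finite_UN) (auto intro: borel_open)
  then show "P i \<in> sets borel" using Xb by (simp add: P_def)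
  show "P i \<subseteq> U i Int X" using disjointed_subset[of U i] by (auto simp: P_def)
 qed
 have P_disj: "disjoint_family_on P {0..<N}"
  using disjoint_family_disjointed[of U] unfolding disjoint_family_on_def P_def by blast
 have P_un: "(\<Union>i\<in>{0..<N}. P i) = X"
  using cover finite_UN_disjointed_eq[of U N] by (auto simp: P_def lessThan_atLeast0)
 \<comment> \<open>A measure on the ambient space; the default value of the map off
   \<open>V i\<close> is harmless since the density is supported in
   \<open>V i Int H i\<close>.\<close>
 define M where "M i = distr (density (lborel_span (B i))
   (\<lambda>x. ennreal (sqrt (gram_det (B i) (Ps i) x)) * indicator (V i Int H i) x)) borel
   (\<lambda>x. if x \<in> V i then Ps i x else undefined)" for i
 have M: "emeasure (M i) E = (\<integral>\<^sup>+x\<in>V i Int Ps i -` E. ennreal (sqrt (gram_det (B i) (Ps i) x)) \<partial>lborel_span (B i))"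
  if i: "i < N" and E: "E \<in> sets borel" "E \<subseteq> U i Int X" for i E
 proof -
  note ci = c[OF i]
  note sp = space_lborel_span[OF chart_B[OF ci]] sets_lborel_span[OF chart_B[OF ci]]
  have VH: "V i Int H i \<in> sets borel"
   using chart_open(2)[OF ci] closed_model[OF chart_B[OF ci] chart_H[OF ci]] by auto
  have g: "(\<lambda>x. ennreal (sqrt (gram_det (B i) (Ps i) x)) * indicator (V i Int H i) x) \<in> borel_measurable borel"
   by (rule measurable_gram_det[OF ci VH]) auto
  have f: "(\<lambda>x. if x \<in> V i then Ps i x else undefined) \<in> borel_measurable borel"
   by (rule borel_measurable_continuous_on_if)
     (use chart_open(2)[OF ci] chart_continuous(2)[OF ci] in \<open>auto intro: borel_open continuous_intros\<close>)
  have pre: "(\<lambda>x. if x \<in> V i then Ps i x else undefined) -` E \<in> sets borel"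
   using measurable_sets[OF f E(1)] by simp
  have "emeasure (M i) E = (\<integral>\<^sup>+x. ennreal (sqrt (gram_det (B i) (Ps i) x)) * indicator (V i Int H i) x *
    indicator ((\<lambda>x. if x \<in> V i then Ps i x else undefined) -` E) x \<partial>lborel_span (B i))"
   unfolding M_def
   by (subst emeasure_distr) (use f E pre g sp in \<open>auto simp: emeasure_density cong: measurable_cong_sets\<close>)
  also have "... = (\<integral>\<^sup>+x\<in>V i Int Ps i -` E. ennreal (sqrt (gram_det (B i) (Ps i) x)) \<partial>lborel_span (B i))"
   using chart_preimage(2)[OF ci Xb E] by (intro nn_integral_cong) (auto split: split_indicator)
  finally show ?thesis .
 qed
 define nu where "nu E = (\<Sum>i\<in>{0..<N}. emeasure (M i) (E Int P i))" for E
 define mu where "mu = measure_of X (sets (restrict_space borel X)) nu"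
 have space: "space (restrict_space borel X) = X" by (simp add: space_restrict_space)
 have sa: "sigma_algebra X (sets (restrict_space borel X))"
  using sets.sigma_algebra_axioms[of "restrict_space borel X"] by (simp add: space)
 have sets: "sets mu = sets (restrict_space borel X)"
  using sets.sets_measure_of_eq[of "restrict_space borel X" nu] by (simp add: mu_def space)
 have ca: "countably_additive (sets (restrict_space borel X)) nu"
 proof (rule countably_additiveI)
  fix A :: "nat => _" assume A: "range A \<subseteq> sets (restrict_space borel X)" "disjoint_family A"
  have 1: "(\<Sum>n. emeasure (M i) (A n Int P i)) = emeasure (M i) ((\<Union>n. A n) Int P i)" if "i \<in> {0..<N}" for i
  proof -
   have "A n Int P i \<in> sets borel" for n
    using A(1) P(1)[of i] that sets_restrict_borel[OF Xb] by (auto simp: image_subset_iff)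
   moreover have "disjoint_family (\<lambda>n. A n Int P i)"
    using A(2) by (auto simp: disjoint_family_on_def)
   ultimately have "(\<Sum>n. emeasure (M i) (A n Int P i)) = emeasure (M i) (\<Union>n. A n Int P i)"
    by (intro suminf_emeasure) (auto simp: M_def)
   then show ?thesis by simp
  qed
  have "(\<Sum>n. nu (A n)) = (\<Sum>i\<in>{0..<N}. \<Sum>n. emeasure (M i) (A n Int P i))"
   unfolding nu_def by (rule suminf_sum) auto
  then show "(\<Sum>n. nu (A n)) = nu (\<Union>n. A n)" using 1 by (simp add: nu_def)
 qed
 have em: "emeasure mu E = nu E" if "E \<in> sets (restrict_space borel X)" for E
 proof (rule emeasure_measure_of[OF mu_def])
  show "sets (restrict_space borel X) \<subseteq> Pow X" using sets.sets_into_space[of _ "restrict_space borel X"] space by auto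
  show "positive (sets mu) nu" by (simp add: positive_def nu_def)
  show "countably_additive (sets mu) nu" using ca by (simp add: sets)
  show "E \<in> sets mu" using that by (simp add: sets)
 qed
 have "is_induced_volume m X mu"
  unfolding is_induced_volume_def
 proof (intro conjI allI impI sets)
  fix B' H' U' V' Ph' Ps' A
  assume c': "C1chart m X B' H' U' V' Ph' Ps'" and A: "A \<in> sets borel" "A \<subseteq> V' Int H'"
  let ?E = "Ps' ` A" and ?g = "\<lambda>x. ennreal (sqrt (gram_det B' Ps' x))"
  note sp = space_lborel_span[OF chart_B[OF c']] sets_lborel_span[OF chart_B[OF c']]
  have E: "?E \<in> sets borel" "?E \<subseteq> U' Int X" using chart_borel_image[OF c' Xb A] by auto
  have g: "(\<lambda>x. ?g x * indicator A x) \<in> borel_measurable borel"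
   by (rule measurable_gram_det[OF c' A(1)]) (use A in auto)
  let ?M = "density (lborel_span B') (\<lambda>x. ?g x * indicator A x)"
  have pre: "A Int Ps' -` P i \<in> sets borel" if "i < N" for i
  proof -
   have "A Int Ps' -` P i = A Int (V' Int Ps' -` P i)" using A(2) by auto
   then show ?thesis
    using continuous_on_vimage_borel[OF chart_continuous(2)[OF c'] borel_open[OF chart_open(2)[OF c']] P(1)[OF that]] A(1)
    by simp
  qed
  have piece: "emeasure (M i) (?E Int P i) = emeasure ?M (A Int Ps' -` P i)" if i: "i < N" for i
  proof -
   have Ei: "?E Int P i \<in> sets borel" "?E Int P i \<subseteq> U i Int X" using E P[OF i] by auto
   note p = chart_preimage[OF c[OF i] Xb Ei]
   have "Ph' ` (?E Int P i) = A Int Ps' -` P i"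
   proof -
    have id: "Ph' (Ps' x) = x" if "x \<in> A" for x
     using A(2) chart_inverse(2)[OF c'] that by auto
    show ?thesis
    proof (intro set_eqI iffI)
     fix y assume "y \<in> A Int Ps' -` P i"
     then show "y \<in> Ph' ` (?E Int P i)" using id[of y] by (intro image_eqI[of _ _ "Ps' y"]) auto
    qed (auto simp: id)
   qed
   moreover have "(\<integral>\<^sup>+y\<in>Ph' ` Ps i ` (V i Int Ps i -` (?E Int P i)). ?g y \<partial>lborel_span B') =
     (\<integral>\<^sup>+x\<in>V i Int Ps i -` (?E Int P i). ennreal (sqrt (gram_det (B i) (Ps i) x)) \<partial>lborel_span (B i))"
    by (rule chart_compat[OF c[OF i] c' p(1,2)]) (use p(3) E in auto)
   ultimately have "emeasure (M i) (?E Int P i) = (\<integral>\<^sup>+y\<in>A Int Ps' -` P i. ?g y \<partial>lborel_span B')"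
    using M[OF i Ei] p(3) by simp
   also have "... = emeasure ?M (A Int Ps' -` P i)"
    by (subst emeasure_density) (use g pre[OF i] sp in \<open>auto intro!: nn_integral_cong split: split_indicator cong: measurable_cong_sets\<close>)
   finally show ?thesis .
  qed
  have "emeasure mu ?E = (\<Sum>i\<in>{0..<N}. emeasure ?M (A Int Ps' -` P i))"
   using E by (subst em) (auto simp: nu_def piece sets_restrict_borel[OF Xb])
  also have "... = emeasure ?M (\<Union>i\<in>{0..<N}. A Int Ps' -` P i)"
  proof (rule sum_emeasure)
   show "(\<lambda>i. A Int Ps' -` P i) ` {0..<N} \<subseteq> sets ?M" using pre sp by auto
   show "disjoint_family_on (\<lambda>i. A Int Ps' -` P i) {0..<N}"
    using P_disj unfolding disjoint_family_on_def by blast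
  qed simp
  also have "(\<Union>i\<in>{0..<N}. A Int Ps' -` P i) = A"
  proof -
   have "Ps' x \<in> (\<Union>i\<in>{0..<N}. P i)" if "x \<in> A" for x using E(2) that unfolding P_un by auto
   then show ?thesis by auto
  qed
  also have "emeasure ?M A = (\<integral>\<^sup>+x\<in>A. ?g x \<partial>lborel_span B')"
   by (subst emeasure_density) (use g A sp in \<open>auto intro!: nn_integral_cong split: split_indicator cong: measurable_cong_sets\<close>)
  finally show "emeasure mu ?E = (\<integral>\<^sup>+x\<in>A. ?g x \<partial>lborel_span B')" .
 qed
 then show thesis by (rule that)
qed

lemma induced_volumeI:
 fixes X :: "(real^'d) set"
 assumes "compact X" "charted m X" "is_induced_volume m X mu"
 shows "ivol m X = mu"
 unfolding induced_volume_eq_The using is_induced_volume_unique[OF assms(1,2)] assms(3) by blast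

lemma is_induced_volume_induced_volume:
 fixes X :: "(real^'d) set"
 assumes "compact X" "charted m X"
 shows "is_induced_volume m X (ivol m X)"
 using is_induced_volume_exists[OF assms] induced_volumeI[OF assms] by metis

subsection \<open>Charts of balls and spheres\<close>

text \<open>Used for continuity: the inverse of a linear map becomes a quotient of polynomials in
  the matrix entries.\<close>

lemma linear_inj_cramer:
 fixes L :: "real^'d => real^'d"
 assumes "linear L" "inj L"
 shows "inv L v = (\<chi> k. det (\<chi> i j. if j = k then v $ i else L (axis j 1) $ i) / det (matrix L))"
proof -
 have det: "det (matrix L) \<noteq> 0" using assms det_nz_iff_inj by blast
 have "L (inv L v) = v" using assms linear_inj_imp_surj surj_f_inv_f by metis
 then have "matrix L *v inv L v = v" using assms(1) by (simp add: matrix_works)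
 then have "inv L v = (\<chi> k. det (\<chi> i j. if j = k then v $ i else matrix L $ i $ j) / det (matrix L))"
  using cramer[OF det] by simp
 moreover have "matrix L $ i $ j = L (axis j 1) $ i" for i j by (simp add: matrix_def)
 ultimately show ?thesis by (simp only:)
qed

lemma continuous_on_det:
 fixes A :: "'a::topological_space => real^'d^'d"
 assumes "!!i j. continuous_on S (\<lambda>x. A x $ i $ j)"
 shows "continuous_on S (\<lambda>x. det (A x))"
 unfolding det_def by (intro continuous_on_sum continuous_on_mult continuous_on_prod continuous_on_const assms)

lemma D_eqI: "(f has_derivative f') (at x) ==> D f x = f'"
 using frechet_derivative_at by metis

text \<open>Invariance of domain makes the image open and the inverse continuous, from which
  differentiability of the inverse follows; Cramer's rule gives continuity of its
  derivative.\<close>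

lemma C1_diffeoI:
 fixes G :: "real^'d => real^'d"
 assumes U: "open U" and inj: "inj_on G U" and C1: "Ck_on 1 U G" and D: "!!x. x \<in> U ==> inj (D G x)"
 shows "Ck_diffeo 1 U (G ` U) G (inv_into U G)"
  and "x \<in> U ==> (inv_into U G has_derivative inv (D G x)) (at (G x))"
proof -
 have cont: "continuous_on U G"
  using Ck_on_1D(1)[OF C1] by (meson continuous_at_imp_continuous_on has_derivative_continuous)
 have opV: "open (G ` U)" by (rule invariance_of_domain[OF cont U inj])
 obtain g where g: "homeomorphism U (G ` U) G g" by (rule invariance_of_domain_homeomorphism[OF U cont order_refl inj])
 have hom: "homeomorphism U (G ` U) G (inv_into U G)"
 proof (rule homeomorphism_cong[OF g])
  fix y assume "y \<in> G ` U"
  then obtain x where "x \<in> U" "y = G x" by auto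
  then show "inv_into U G y = g y" using g inj by (simp add: homeomorphism_def)
 qed auto
 have lin: "linear (D G x)" if "x \<in> U" for x using Ck_on_1D(1)[OF C1 that] has_derivative_linear by blast
 show der: "(inv_into U G has_derivative inv (D G x)) (at (G x))" if "x \<in> U" for x
 proof (rule has_derivative_inverse_strong[OF U that cont _ Ck_on_1D(1)[OF C1 that]])
  show "D G x \<circ> inv (D G x) = id"
   using linear_inj_imp_surj[OF lin[OF that] D[OF that]] by (simp add: surj_iff)
 qed (use inj in auto)
 let ?g = "inv_into U G"
 have gU: "?g y \<in> U" if "y \<in> G ` U" for y using that by (simp add: inv_into_into)
 have Dg: "D ?g y v = inv (D G (?g y)) v" if "y \<in> G ` U" for y v
  using D_eqI[OF der[OF gU[OF that]]] that by (simp add: f_inv_into_f)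
 have contg: "continuous_on (G ` U) ?g" using hom by (simp add: homeomorphism_def)
 have contD: "continuous_on (G ` U) (\<lambda>y. D G (?g y) v $ i)" for v i
  by (intro continuous_on_component continuous_on_compose2[OF Ck_on_1D(2)[OF C1] contg]) (use gU in auto)
 have contdet: "continuous_on (G ` U) (\<lambda>y. det (matrix (D G (?g y))))"
  by (intro continuous_on_det) (use contD in \<open>simp add: matrix_def\<close>)
 have det: "det (matrix (D G (?g y))) \<noteq> 0" if "y \<in> G ` U" for y
  using det_nz_iff_inj[OF lin[OF gU[OF that]]] D[OF gU[OF that]] by simp
 have "continuous_on (G ` U) (\<lambda>y. D ?g y v)" for v
 proof -
  let ?h = "\<lambda>y. (\<chi> k. det (\<chi> i j. if j = k then v $ i else D G (?g y) (axis j 1) $ i) / det (matrix (D G (?g y))))"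
  have "continuous_on (G ` U) ?h"
  proof (intro continuous_on_vec_lambda continuous_on_divide contdet)
   fix k :: 'd
   show "continuous_on (G ` U) (\<lambda>x. det (\<chi> i j. if j = k then v $ i else D G (?g x) (axis j 1) $ i))"
   proof (rule continuous_on_det)
    fix i j :: 'd
    show "continuous_on (G ` U) (\<lambda>x. (\<chi> i j. if j = k then v $ i else D G (?g x) (axis j 1) $ i) $ i $ j)"
     using contD by (cases "j = k") auto
   qed
  qed (use det in auto)
  moreover have "D ?g y v = ?h y" if "y \<in> G ` U" for y
   using Dg[OF that] linear_inj_cramer[OF lin[OF gU[OF that]] D[OF gU[OF that]]] by simp
  ultimately show ?thesis by (metis (no_types, lifting) continuous_on_cong)
 qed
 moreover have "?g differentiable (at y)" if "y \<in> G ` U" for y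
  using der that by (auto simp: differentiable_def)
 ultimately have "Ck_on 1 (G ` U) ?g" by simp
 then show "Ck_diffeo 1 U (G ` U) G ?g"
  using U opV hom C1 by (simp add: Ck_diffeo_def)
qed

lemma Ck_on_1I:
 assumes "!!x. x \<in> S ==> (f has_derivative f' x) (at x)" "!!v. continuous_on S (\<lambda>x. f' x v)"
 shows "Ck_on 1 S f"
proof -
 have "D f x v = f' x v" if "x \<in> S" for x v using D_eqI[OF assms(1)[OF that]] by simp
 then have "continuous_on S (\<lambda>x. D f x v)" for v
  using assms(2)[of v] by (metis (no_types, lifting) continuous_on_cong)
 then show ?thesis using assms(1) by (auto simp: differentiable_def)
qed

text \<open>Replacing the coordinate \<open>b\<close> by $r^2 - |z - c|^2$ straightens the sphere in each of the two
 half-spaces where the coordinate \<open>b\<close> of \<open>z - c\<close> has a sign.\<close>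

lemma sphere_ball_chart:
 fixes c :: "real^'d" and r s :: real
 assumes b: "b \<in> Basis" and s: "s = 1 \<or> s = -1"
 defines "U \<equiv> {z. 0 < s * ((z - c) \<bullet> b)}" and "Ph \<equiv> \<lambda>z. z + (r\<^sup>2 - (z - c) \<bullet> (z - c) - z \<bullet> b) *\<^sub>R b"
 shows "Ck_diffeo 1 U (Ph ` U) Ph (inv_into U Ph)"
  and "Ph z \<bullet> b = r\<^sup>2 - (z - c) \<bullet> (z - c)"
proof -
 let ?L = "\<lambda>z h. h + (- (2 * ((z - c) \<bullet> h)) - h \<bullet> b) *\<^sub>R b"
 have bb: "b \<bullet> b = 1" using b by (simp add: inner_same_Basis)
 show Phb: "Ph z \<bullet> b = r\<^sup>2 - (z - c) \<bullet> (z - c)" for z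
  by (simp add: Ph_def inner_add_left bb)
 have Phc: "Ph z \<bullet> b' = z \<bullet> b'" if "b' \<in> Basis" "b' \<noteq> b" for z b'
  using that b by (simp add: Ph_def inner_add_left inner_not_same_Basis)
 have U: "open U" unfolding U_def by (intro open_Collect_less continuous_intros)
 have split: "x \<bullet> x = (x \<bullet> b)\<^sup>2 + (\<Sum>b'\<in>Basis - {b}. (x \<bullet> b')\<^sup>2)" for x :: "real^'d"
  by (subst euclidean_inner) (simp add: sum.remove[OF _ b] power2_eq_square)
 \<comment> \<open>The other coordinates and the norm of \<open>z - c\<close> are determined, hence
   the square of the coordinate of \<open>z - c\<close> along \<open>b\<close>; its sign is fixed on
   \<open>U\<close>.\<close>
 have inj: "inj_on Ph U"
 proof (rule inj_onI)
  fix z w assume z: "z \<in> U" "w \<in> U" "Ph z = Ph w"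
  have other: "z \<bullet> b' = w \<bullet> b'" if "b' \<in> Basis - {b}" for b'
   using Phc[of b' z] Phc[of b' w] z(3) that by simp
  have "(z - c) \<bullet> (z - c) = (w - c) \<bullet> (w - c)" using Phb[of z] Phb[of w] z(3) by simp
  moreover have "(\<Sum>b'\<in>Basis - {b}. ((z - c) \<bullet> b')\<^sup>2) = (\<Sum>b'\<in>Basis - {b}. ((w - c) \<bullet> b')\<^sup>2)"
   using other by (intro sum.cong refl) (simp add: inner_diff_left)
  ultimately have "((z - c) \<bullet> b)\<^sup>2 = ((w - c) \<bullet> b)\<^sup>2"
   using split[of "z - c"] split[of "w - c"] by linarith
  then have "z \<bullet> b = w \<bullet> b"
   using z(1,2) s unfolding U_def power2_eq_iff by (auto simp: inner_diff_left)
  then show "z = w" using other by (intro euclidean_eqI[where 'a = "real^'d"]) auto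
 qed
 have der: "(Ph has_derivative ?L z) (at z)" for z
  unfolding Ph_def by (auto intro!: derivative_eq_intros simp: inner_commute algebra_simps)
 have C1: "Ck_on 1 U Ph"
  by (rule Ck_on_1I[OF der]) (intro continuous_intros)
 \<comment> \<open>The infinitesimal version: \<open>h\<close> has no component except along
   \<open>b\<close>, and it is orthogonal to \<open>z - c\<close>, whose coordinate along
   \<open>b\<close> is nonzero on \<open>U\<close>.\<close>
 have injD: "inj (D Ph z)" if z: "z \<in> U" for z
 proof -
  have lin: "linear (?L z)" using der has_derivative_linear by blast
  have "h = 0" if h: "?L z h = 0" for h
  proof -
   have "?L z h \<bullet> b' = h \<bullet> b'" if "b' \<in> Basis" "b' \<noteq> b" for b'
    using that b by (simp add: inner_add_left inner_not_same_Basis)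
   then have other: "h \<bullet> b' = 0" if "b' \<in> Basis - {b}" for b' using h that by simp
   have "?L z h \<bullet> b = - (2 * ((z - c) \<bullet> h))" by (simp add: inner_add_left bb)
   then have "(z - c) \<bullet> h = 0" using h by simp
   moreover have "(z - c) \<bullet> h = ((z - c) \<bullet> b) * (h \<bullet> b)"
    using other by (subst euclidean_inner) (simp add: sum.remove[OF _ b])
   ultimately have "h \<bullet> b = 0" using z by (auto simp: U_def)
   then show "h = 0" using other by (intro euclidean_eqI[where 'a = "real^'d"]) auto
  qed
  then show ?thesis unfolding D_eqI[OF der] using linear_injective_0[OF lin] by blast
 qed
 show "Ck_diffeo 1 U (Ph ` U) Ph (inv_into U Ph)" by (rule C1_diffeoI(1)[OF U inj C1 injD])
qed

lemma sphere_cover: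
 assumes "z \<noteq> (c :: 'a::euclidean_space)"
 obtains b s where "b \<in> Basis" "s = 1 \<or> s = -1" "0 < s * ((z - c) \<bullet> b)"
proof -
 obtain b where b: "b \<in> Basis" "(z - c) \<bullet> b \<noteq> 0"
  using assms by (metis euclidean_all_zero_iff right_minus_eq)
 show thesis
 proof (cases "0 < (z - c) \<bullet> b")
  case True
  then show ?thesis using that[of b 1] b by simp
 next
  case False
  then show ?thesis using that[of b "-1"] b by simp
 qed
qed

lemma charted_sphere:
 fixes c :: "real^'d"
 assumes "r > 0"
 shows "charted (CARD('d) - 1) (sphere c r)"
 unfolding charted_def
proof
 fix p assume p: "p \<in> sphere c r"
 then have "p \<noteq> c" using assms by auto
 then obtain b s where b: "b \<in> Basis" "s = 1 \<or> s = -1" "0 < s * ((p - c) \<bullet> b)" by (rule sphere_cover)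
 let ?U = "{z. 0 < s * ((z - c) \<bullet> b)}" and ?Ph = "\<lambda>z. z + (r\<^sup>2 - (z - c) \<bullet> (z - c) - z \<bullet> b) *\<^sub>R b"
 note ch = sphere_ball_chart[OF b(1,2), where c = c and r = r]
 have mem: "?Ph z \<in> span (Basis - {b}) \<longleftrightarrow> z \<in> sphere c r" for z
 proof -
  have "?Ph z \<in> span (Basis - {b}) \<longleftrightarrow> ?Ph z \<bullet> b = 0" using b(1) by (subst span_iff) auto
  also have "... \<longleftrightarrow> r\<^sup>2 = (norm (z - c))\<^sup>2" unfolding ch(2) by (simp add: power2_norm_eq_inner)
  also have "... \<longleftrightarrow> z \<in> sphere c r"
   using assms by (auto simp: dist_norm norm_minus_commute power2_eq_iff_nonneg)
  finally show ?thesis .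
 qed
 have "adapted_chart 1 (sphere c r) (span (Basis - {b})) ?U (?Ph ` ?U) ?Ph (inv_into ?U ?Ph)"
  unfolding adapted_chart_def using ch(1) mem by blast
 moreover have "card (Basis - {b}) = CARD('d) - 1" using b(1) by (simp add: card_Diff_singleton)
 ultimately have "C1chart (CARD('d) - 1) (sphere c r) (Basis - {b}) (span (Basis - {b})) ?U (?Ph ` ?U) ?Ph (inv_into ?U ?Ph)"
  by (simp add: C1chart_def)
 then show "\<exists>B H U V Ph Ps. C1chart (CARD('d) - 1) (sphere c r) B H U V Ph Ps \<and> p \<in> U"
  using b(3) by blast
qed

text \<open>Interior points are covered by the identity. Elsewhere the map that straightens the
  sphere sends the ball to the half-space \<open>0 <= x \<bullet> b\<close>, because the new
  coordinate \<open>r\<^sup>2 - (z - c) \<bullet> (z - c)\<close> is nonnegative exactly on the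
  ball.\<close>

lemma charted_cball:
 fixes c :: "real^'d"
 assumes "r > 0"
 shows "charted CARD('d) (cball c r)"
 unfolding charted_def
proof
 fix p assume p: "p \<in> cball c r"
 show "\<exists>B H U V Ph Ps. C1chart CARD('d) (cball c r) B H U V Ph Ps \<and> p \<in> U"
 proof (cases "p \<in> ball c r")
  case True
  have "Ck_on 1 (ball c r) (\<lambda>z :: real^'d. z)"
   by (rule Ck_on_1I[OF has_derivative_ident]) (rule continuous_on_const)
  then have "adapted_chart 1 (cball c r) (span Basis) (ball c r) (ball c r) (\<lambda>z. z) (\<lambda>z. z)"
   by (auto simp: adapted_chart_def Ck_diffeo_def homeomorphism_ident simp del: Ck_on.simps)
  then have "C1chart CARD('d) (cball c r) Basis (span Basis) (ball c r) (ball c r) (\<lambda>z. z) (\<lambda>z. z)"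
   by (simp add: C1chart_def)
  then show ?thesis using True by blast
 next
  case False
  then have "p \<noteq> c" using assms by auto
  then obtain b s where b: "b \<in> Basis" "s = 1 \<or> s = -1" "0 < s * ((p - c) \<bullet> b)" by (rule sphere_cover)
  let ?U = "{z. 0 < s * ((z - c) \<bullet> b)}" and ?Ph = "\<lambda>z. z + (r\<^sup>2 - (z - c) \<bullet> (z - c) - z \<bullet> b) *\<^sub>R b"
  note ch = sphere_ball_chart[OF b(1,2), where c = c and r = r]
  let ?H = "{x \<in> span Basis. 0 <= x \<bullet> b}"
  have mem: "?Ph z \<in> ?H \<longleftrightarrow> z \<in> cball c r" for z
  proof -
   have "?Ph z \<in> ?H \<longleftrightarrow> (norm (z - c))\<^sup>2 <= r\<^sup>2" using ch(2)[of z] by (simp add: power2_norm_eq_inner)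
   also have "... \<longleftrightarrow> z \<in> cball c r"
    using assms by (auto simp: dist_norm norm_minus_commute power2_le_iff_abs_le)
   finally show ?thesis .
  qed
  have "adapted_chart 1 (cball c r) ?H ?U (?Ph ` ?U) ?Ph (inv_into ?U ?Ph)"
   unfolding adapted_chart_def using ch(1) mem by blast
  then have "C1chart CARD('d) (cball c r) Basis ?H ?U (?Ph ` ?U) ?Ph (inv_into ?U ?Ph)"
   using b(1) by (auto simp: C1chart_def half_spaces_def)
  then show ?thesis using b(3) by blast
 qed
qed

lemma adapted_chart_mono: "adapted_chart k X H U V Ph Ps ==> j <= k ==> adapted_chart j X H U V Ph Ps"
 unfolding adapted_chart_def Ck_diffeo_def using Ck_on_mono by blast

lemma charted_submanifold_with_boundary:
 assumes "submanifold_with_boundary k m X" "1 <= k"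
 shows "charted m X"
 unfolding charted_def
proof
 fix p assume "p \<in> X"
 then obtain B H U V Ph Ps where "B \<subseteq> Basis" "card B = m" "H \<in> insert (span B) (half_spaces B)" "p \<in> U"
  "adapted_chart k X H U V Ph Ps"
  using assms(1) unfolding submanifold_with_boundary_def by meson
 then have "C1chart m X B H U V Ph Ps \<and> p \<in> U"
  using adapted_chart_mono assms(2) unfolding C1chart_def by blast
 then show "\<exists>B H U V Ph Ps. C1chart m X B H U V Ph Ps \<and> p \<in> U" by blast
qed

lemma charted_submanifold:
 assumes "submanifold k m X" "1 <= k"
 shows "charted m X"
 unfolding charted_def
proof
 fix p assume "p \<in> X"
 then obtain B U V Ph Ps where "B \<subseteq> Basis" "card B = m" "p \<in> U"
  "adapted_chart k X (span B) U V Ph Ps"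
  using assms(1) unfolding submanifold_def by meson
 then have "C1chart m X B (span B) U V Ph Ps \<and> p \<in> U"
  using adapted_chart_mono assms(2) unfolding C1chart_def by blast
 then show "\<exists>B H U V Ph Ps. C1chart m X B H U V Ph Ps \<and> p \<in> U" by blast
qed

subsection \<open>The induced volume of bodies and spheres\<close>

lemma compact_closure_body: "compact_body k X ==> compact X"
 unfolding compact_body_def by auto

text \<open>In full dimension a chart uses the whole basis and the Gram density is the absolute
  Jacobian, so the change of variables formula says that Lebesgue measure has the defining property
  of the induced volume.\<close>

lemma induced_volume_full:
 fixes X :: "(real^'d) set"
 assumes X: "compact X" "charted CARD('d) X"
 shows "ivol CARD('d) X = restrict_space lborel X"
proof (rule induced_volumeI[OF X])
 have Xb: "X \<in> sets borel" using X(1) by (simp add: borel_closed compact_imp_closed)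
 show "is_induced_volume CARD('d) X (restrict_space lborel X)"
  unfolding is_induced_volume_def
 proof (intro conjI allI impI)
  show "sets (restrict_space lborel X) = sets (restrict_space borel X)"
   by (rule sets_restrict_space_cong) simp
  fix B H U V Ph Ps A
  assume c: "C1chart CARD('d) X B H U V Ph Ps" and A: "A \<in> sets borel" "A \<subseteq> V Int H"
  note im = chart_borel_image[OF c Xb A]
  have B: "B = Basis"
   using chart_B[OF c] chart_card[OF c] by (intro card_subset_eq) auto
  have inj: "inj_on Ps A"
   using A(2) chart_inverse(2)[OF c] by (intro inj_on_inverseI[of _ Ph]) auto
  have sq: "sqrt (gram_det B Ps x) = \<bar>det (matrix (D Ps x))\<bar>" if "x \<in> A" for x
  proof -
   have "gram Basis (D Ps x) = (det (matrix (D Ps x)))\<^sup>2"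
    by (rule gram_eq_det_square) (use chart_linear(2)[OF c, of x] A that in auto)
   then show ?thesis by (simp add: gram_det_eq B)
  qed
  have "emeasure (restrict_space lborel X) (Ps ` A) = emeasure lborel (Ps ` A)"
   using im Xb by (intro emeasure_restrict_space) auto
  also have "... = (\<integral>\<^sup>+x\<in>A. ennreal \<bar>det (matrix (D Ps x))\<bar> \<partial>lborel)"
   by (rule emeasure_image_eq_integral_det[OF A(1) _ im(1) inj])
     (use chart_derivative(2)[OF c] A in \<open>auto intro: has_derivative_at_withinI\<close>)
  also have "... = (\<integral>\<^sup>+x\<in>A. ennreal (sqrt (gram_det B Ps x)) \<partial>lborel_span B)"
   unfolding B lborel_span_Basis using sq by (intro nn_integral_cong) (auto simp: B split: split_indicator)
  finally show "emeasure (restrict_space lborel X) (Ps ` A) =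
    (\<integral>\<^sup>+x\<in>A. ennreal (sqrt (gram_det B Ps x)) \<partial>lborel_span B)" .
 qed
qed

subsection \<open>The law of the distance\<close>

lemma nn_integral_mult_le:
 fixes f :: "'a => ennreal"
 assumes "!!x. x \<in> A ==> f x <= M" "A \<in> sets N"
 shows "(\<integral>\<^sup>+x\<in>A. f x \<partial>N) <= M * emeasure N A"
proof -
 have "(\<integral>\<^sup>+x\<in>A. f x \<partial>N) <= (\<integral>\<^sup>+x. M * indicator A x \<partial>N)"
  by (intro nn_integral_mono) (use assms(1) in \<open>auto split: split_indicator\<close>)
 then show ?thesis using assms(2) by (simp add: nn_integral_cmult_indicator)
qed

lemma emeasure_lborel_span:
 assumes "B \<subseteq> Basis" "A \<in> sets borel"
 shows "emeasure (lborel_span B) A = emeasure lborel (slab B Int proj B -` A)"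
proof -
 have "emeasure (lborel_span B) A = (\<integral>\<^sup>+x\<in>A. 1 \<partial>lborel_span B)"
  using assms by (simp add: sets_lborel_span)
 also have "... = (\<integral>\<^sup>+z\<in>slab B Int proj B -` A. 1 \<partial>lborel)"
  by (rule set_nn_integral_lborel_span[OF assms]) (use assms in measurable)
 also have "... = emeasure lborel (slab B Int proj B -` A)"
  using assms measurable_sets_borel[OF measurable_proj assms(2)]
  by (subst nn_integral_cmult_indicator) (auto simp: sets_slab)
 finally show ?thesis .
qed

lemma finite_emeasure_lborel_span:
 fixes B :: "'a::euclidean_space set"
 assumes B: "B \<subseteq> Basis" and A: "A \<in> sets borel" "bounded A"
 shows "emeasure (lborel_span B) A < \<infinity>"
proof -
 obtain M where M: "!!x. x \<in> A ==> norm x <= M" using A(2) by (auto simp: bounded_iff)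
 have "norm z <= M + DIM('a)" if z: "z \<in> slab B" "proj B z \<in> A" for z
 proof -
  have "norm (z - proj B z) <= (\<Sum>b\<in>Basis. \<bar>(z - proj B z) \<bullet> b\<bar>)" by (rule norm_le_l1)
  also have "... <= (\<Sum>b\<in>(Basis :: 'a set). 1)"
   using z(1) by (intro sum_mono) (auto simp: inner_diff_left inner_proj[OF B] slab_def)
  finally have "norm (z - proj B z) <= DIM('a)" by simp
  moreover have "norm z <= norm (proj B z) + norm (z - proj B z)"
   using norm_triangle_ineq[of "proj B z" "z - proj B z"] by simp
  ultimately show ?thesis using M[OF z(2)] by simp
 qed
 then have "bounded (slab B Int proj B -` A)"
  unfolding bounded_iff by blast
 then have "emeasure lborel (slab B Int proj B -` A) < \<infinity>"
  by (rule emeasure_bounded_finite)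
 then show ?thesis by (simp add: emeasure_lborel_span[OF B A(1)])
qed

context
 fixes X :: "(real^'d) set" and m :: nat
 assumes X: "compact X" "charted m X"
begin

lemma borel_X: "X \<in> sets borel"
 using X(1) by (simp add: borel_closed compact_imp_closed)

lemma sets_ivol: "E \<in> sets (ivol m X) \<longleftrightarrow> E \<in> sets borel \<and> E \<subseteq> X"
 using is_induced_volumeD(1)[OF is_induced_volume_induced_volume[OF X]] sets_restrict_borel[OF borel_X] by simp

lemma sets_ivol_eq: "sets (ivol m X) = sets (restrict_space borel X)"
 using is_induced_volumeD(1)[OF is_induced_volume_induced_volume[OF X]] .

lemma space_ivol: "space (ivol m X) = X"
 using sets_eq_imp_space_eq[OF sets_ivol_eq] by (simp add: space_restrict_space)

lemma emeasure_ivol_chart: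
 "C1chart m X B H U V Ph Ps ==> A \<in> sets borel ==> A \<subseteq> V Int H ==>
  emeasure (ivol m X) (Ps ` A) = (\<integral>\<^sup>+x\<in>A. ennreal (sqrt (gram_det B Ps x)) \<partial>lborel_span B)"
 using is_induced_volumeD(2)[OF is_induced_volume_induced_volume[OF X]] .

lemma measurable_ivol: "f \<in> borel_measurable borel ==> f \<in> borel_measurable (ivol m X)"
 using measurable_restrict_space1 measurable_cong_sets[OF sets_ivol_eq refl] by blast

text \<open>A bounded density on a compact piece of the model gives finite measure near each point,
  and compactness of \<open>X\<close> leaves finitely many pieces to add.\<close>

lemma finite_ivol: "finite_measure (ivol m X)"
proof -
 let ?mu = "ivol m X"
 have "\<exists>W. open W \<and> p \<in> W \<and> emeasure ?mu (X Int W) < \<infinity>" if p: "p \<in> X" for p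
 proof -
  obtain B H U V Ph Ps where c: "C1chart m X B H U V Ph Ps" and pU: "p \<in> U"
   using X(2) p unfolding charted_def by blast
  note B = chart_B[OF c] and H = chart_H[OF c]
  have "Ph p \<in> V" using chart_inverse(3)[OF c pU] .
  then obtain rh where rh: "rh > 0" "cball (Ph p) rh \<subseteq> V"
   using chart_open(2)[OF c] open_contains_cball by blast
  let ?K = "cball (Ph p) rh Int H"
  have K: "compact ?K" using closed_model[OF B H] by (simp add: compact_Int_closed)
  have Kb: "?K \<in> sets borel" using K by (simp add: borel_closed compact_imp_closed)
  have "continuous_on ?K (\<lambda>x. sqrt (gram_det B Ps x))"
   using continuous_on_gram_det[OF c] rh(2) by (auto intro!: continuous_intros intro: continuous_on_subset)
  then have "bounded ((\<lambda>x. sqrt (gram_det B Ps x)) ` ?K)"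
   using K by (intro compact_imp_bounded compact_continuous_image)
  then obtain M where "\<forall>x\<in>?K. \<bar>sqrt (gram_det B Ps x)\<bar> <= M" by (auto simp: bounded_iff)
  then have M: "!!x. x \<in> ?K ==> \<bar>sqrt (gram_det B Ps x)\<bar> <= M" by blast
  have "(\<integral>\<^sup>+x\<in>?K. ennreal (sqrt (gram_det B Ps x)) \<partial>lborel_span B) <= ennreal M * emeasure (lborel_span B) ?K"
   by (rule nn_integral_mult_le) (use M Kb in \<open>force simp: sets_lborel_span[OF B] intro!: ennreal_leI\<close>)+
  also have "... < \<infinity>"
   using finite_emeasure_lborel_span[OF B Kb compact_imp_bounded[OF K]] by (simp add: ennreal_mult_less_top)
  finally have fin: "emeasure ?mu (Ps ` ?K) < \<infinity>"
   using rh(2) by (subst emeasure_ivol_chart[OF c Kb]) auto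
  let ?W = "U Int Ph -` ball (Ph p) rh"
  have "open ?W"
   using continuous_on_open_vimage[OF chart_open(1)[OF c], of Ph] chart_continuous(1)[OF c]
   by (auto simp: Int_commute)
  moreover have "p \<in> ?W" using pU rh(1) by simp
  moreover have sub: "X Int ?W \<subseteq> Ps ` ?K"
  proof
   fix x assume x: "x \<in> X Int ?W"
   then have "Ps (Ph x) = x" "Ph x \<in> ?K" using chart_inverse(1)[OF c] chart_H_iff(1)[OF c] by auto
   then show "x \<in> Ps ` ?K" by (metis image_eqI)
  qed
  moreover have "Ps ` ?K \<in> sets ?mu"
   using chart_borel_image[OF c borel_X Kb] rh(2) by (auto simp: sets_ivol)
  ultimately have "open ?W \<and> p \<in> ?W \<and> emeasure ?mu (X Int ?W) < \<infinity>"
   using emeasure_mono[OF sub] fin by (meson le_less_trans)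
  then show ?thesis by blast
 qed
 then obtain W where W: "!!p. p \<in> X ==> open (W p) \<and> p \<in> W p \<and> emeasure ?mu (X Int W p) < \<infinity>" by metis
 then obtain F where F: "F \<subseteq> X" "finite F" "X \<subseteq> (\<Union>p\<in>F. W p)"
 proof -
  have "open (W p)" if "p \<in> X" for p using W[OF that] by blast
  moreover have "X \<subseteq> (\<Union>p\<in>X. W p)" using W by blast
  ultimately show thesis using compactE_image[OF X(1), of X W] that by blast
 qed
 have mem: "X Int W p \<in> sets ?mu" if "p \<in> F" for p
  using W F(1) that borel_X by (auto simp: sets_ivol subset_iff)
 have "emeasure ?mu X <= emeasure ?mu (\<Union>p\<in>F. X Int W p)"
 proof (rule emeasure_mono)
  show "X \<subseteq> (\<Union>p\<in>F. X Int W p)" using F(3) by auto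
  show "(\<Union>p\<in>F. X Int W p) \<in> sets ?mu" by (rule sets.finite_UN[OF F(2) mem])
 qed
 also have "... <= (\<Sum>p\<in>F. emeasure ?mu (X Int W p))"
  by (rule emeasure_subadditive_finite) (use F mem in auto)
 also have "... < \<infinity>" using W F by (auto simp: subset_iff)
 finally show ?thesis by (intro finite_measureI) (simp add: space_ivol)
qed

lemma measurable_dist_ivol:
 "(\<lambda>(x, y). dist x y) \<in> borel_measurable (ivol m X \<Otimes>\<^sub>M ivol m X)"
proof -
 have [measurable]: "(\<lambda>x. x) \<in> measurable (ivol m X) borel"
  by (rule measurable_ivol) simp
 show ?thesis by measurable
qed

text \<open>This is the cumulative distribution function of the law of the distance, a measure on
  the real line; in this form sets in spaces of different dimension become comparable.\<close>

lemma distance_distribution_eq: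
 "distance_distribution m X t =
  emeasure (distr (ivol m X \<Otimes>\<^sub>M ivol m X) borel (\<lambda>(x, y). dist x y)) {..t}"
 unfolding distance_distribution_def
 by (subst emeasure_distr[OF measurable_dist_ivol])
   (auto simp: space_pair_measure space_ivol intro!: arg_cong2[where f = emeasure])

end

definition double_integral :: "nat => (real^'d) set => (real => ennreal) => ennreal" where
 "double_integral m X k = (\<integral>\<^sup>+x. \<integral>\<^sup>+y. k (dist x y) \<partial>ivol m X \<partial>ivol m X)"

lemma double_integral_eq_distr:
 fixes X :: "(real^'d) set"
 assumes X: "compact X" "charted m X" and k: "k \<in> borel_measurable borel"
 shows "double_integral m X k =
  integral\<^sup>N (distr (ivol m X \<Otimes>\<^sub>M ivol m X) borel (\<lambda>(x, y). dist x y)) k"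
proof -
 interpret finite_measure "ivol m X" by (rule finite_ivol[OF X])
 have "(\<lambda>(x, y). k (dist x y)) \<in> borel_measurable (ivol m X \<Otimes>\<^sub>M ivol m X)"
  using measurable_compose[OF measurable_dist_ivol[OF X] k] by (simp add: case_prod_beta')
 from nn_integral_fst[OF this] show ?thesis
  unfolding double_integral_def
  by (subst nn_integral_distr[OF measurable_dist_ivol[OF X]]) (use k in \<open>auto simp: case_prod_beta'\<close>)
qed

text \<open>Half-lines form an intersection-stable generator of the Borel sets on which the law is
  finite. Those to the left of 0 carry no mass, so agreement for nonnegative \<open>t\<close>
  determines the whole law.\<close>

theorem double_integral_eqI:
 fixes X :: "(real^'d) set" and Y :: "(real^'e) set"
 assumes X: "compact X" "charted m X" and Y: "compact Y" "charted n Y"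
  and eq: "!!t. 0 <= t ==> distance_distribution m X t = distance_distribution n Y t"
  and k: "k \<in> borel_measurable borel"
 shows "double_integral m X k = double_integral n Y k"
proof -
 let ?M = "distr (ivol m X \<Otimes>\<^sub>M ivol m X) borel (\<lambda>(x, y). dist x y)"
 let ?N = "distr (ivol n Y \<Otimes>\<^sub>M ivol n Y) borel (\<lambda>(x, y). dist x y)"
 interpret X: finite_measure "ivol m X" by (rule finite_ivol[OF X])
 interpret XX: pair_sigma_finite "ivol m X" "ivol m X" ..
 have "?M = ?N"
 proof (rule measure_eqI_generator_eq[where E = "range (\<lambda>a :: real. {..a})" and \<Omega> = UNIV and A = "\<lambda>n. {..real n}"])
  show "Int_stable (range (\<lambda>a :: real. {..a}))"
   by (auto simp: Int_stable_def)
  show "range (\<lambda>a :: real. {..a}) \<subseteq> Pow UNIV" by auto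
  show "sets ?M = sigma_sets UNIV (range (\<lambda>a. {..a}))" "sets ?N = sigma_sets UNIV (range (\<lambda>a. {..a}))"
   by (simp_all add: borel_eq_atMost)
  show "range (\<lambda>n. {..real n}) \<subseteq> range (\<lambda>a :: real. {..a})" by auto
  show "(\<Union>n. {..real n}) = UNIV" using real_arch_simple by auto
  show "emeasure ?M {..real n} \<noteq> \<infinity>" for n
  proof -
   have "emeasure ?M {..real n} <= emeasure ?M (space ?M)" by (rule emeasure_mono) auto
   also have "... = emeasure (ivol m X) X * emeasure (ivol m X) X"
    by (subst emeasure_distr[OF measurable_dist_ivol[OF X]])
      (auto simp: space_pair_measure space_ivol[OF X] X.emeasure_pair_measure_Times sets_ivol[OF X] borel_X[OF X])
   also have "... < \<infinity>" using X.emeasure_finite[of X] by (simp add: ennreal_mult_eq_top_iff less_top[symmetric])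
   finally show ?thesis by simp
  qed
  fix S assume "S \<in> range (\<lambda>a :: real. {..a})"
  then obtain t where S: "S = {..t}" by auto
  show "emeasure ?M S = emeasure ?N S"
  proof (cases "0 <= t")
   case True
   then show ?thesis using eq[OF True] by (simp add: S distance_distribution_eq[OF X] distance_distribution_eq[OF Y])
  next
   case False
   have "\<not> dist x y <= t" for x y :: "real^'d" using False zero_le_dist[of x y] by linarith
   then have "(\<lambda>(x, y). dist x y) -` {..t} Int A = {}" for A :: "((real^'d) \<times> (real^'d)) set"
    by auto
   moreover have "\<not> dist x y <= t" for x y :: "real^'e" using False zero_le_dist[of x y] by linarith
   then have "(\<lambda>(x, y). dist x y) -` {..t} Int A = {}" for A :: "((real^'e) \<times> (real^'e)) set"
    by auto
   ultimately show ?thesis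
    by (simp add: S emeasure_distr[OF measurable_dist_ivol[OF X]] emeasure_distr[OF measurable_dist_ivol[OF Y]])
  qed
 qed
 then show ?thesis by (simp add: double_integral_eq_distr[OF X k] double_integral_eq_distr[OF Y k])
qed

lemma double_integral_const:
 fixes X :: "(real^'d) set"
 assumes X: "compact X" "charted m X"
 shows "double_integral m X (\<lambda>_. 1) = ennreal ((measure (ivol m X) X)\<^sup>2)"
proof -
 interpret finite_measure "ivol m X" by (rule finite_ivol[OF X])
 show ?thesis
  unfolding double_integral_def
  by (simp add: space_ivol[OF X] emeasure_eq_measure power2_eq_square ennreal_mult)
qed

section \<open>Centroid and moment of inertia\<close>

definition centroid :: "'a::euclidean_space measure => 'a" where
 "centroid mu = (\<integral>x. x \<partial>mu) /\<^sub>R measure mu (space mu)"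

definition inertia :: "'a::euclidean_space measure => real" where
 "inertia mu = (\<integral>x. (dist x (centroid mu))\<^sup>2 \<partial>mu)"

lemma integrable_bounded_continuous:
 fixes mu :: "'a::euclidean_space measure" and f :: "'a => 'b::euclidean_space"
 assumes "finite_measure mu" "bounded (space mu)" and m: "(\<lambda>x. x) \<in> measurable mu borel"
  and f: "continuous_on UNIV f"
 shows "integrable mu f"
proof -
 interpret finite_measure mu by fact
 have "compact (closure (space mu))" using assms(2) by (simp add: compact_closure)
 then have "bounded (f ` closure (space mu))"
  by (intro compact_imp_bounded compact_continuous_image continuous_on_subset[OF f]) auto
 then obtain M where "!!x. x \<in> closure (space mu) ==> norm (f x) <= M" by (auto simp: bounded_iff)
 then have "AE x in mu. norm (f x) <= M" using closure_subset by (intro AE_I2) blast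
 moreover have "f \<in> borel_measurable mu"
  using measurable_compose[OF m borel_measurable_continuous_onI[OF f]] .
 ultimately show ?thesis by (rule integrable_const_bound)
qed

text \<open>When the squared distance is expanded about the centroid, the mixed term integrates to
  0.\<close>

lemma second_moment:
 fixes mu :: "'a::euclidean_space measure"
 assumes fin: "finite_measure mu" and bd: "bounded (space mu)" and m: "(\<lambda>x. x) \<in> measurable mu borel"
  and pos: "measure mu (space mu) > 0"
 shows "(\<integral>\<^sup>+x. \<integral>\<^sup>+y. ennreal ((dist x y)\<^sup>2) \<partial>mu \<partial>mu) = ennreal (2 * measure mu (space mu) * inertia mu)"
proof -
 interpret finite_measure mu by fact
 let ?V = "measure mu (space mu)" and ?c = "centroid mu"
 note int = integrable_bounded_continuous[OF fin bd m]
 have ii: "integrable mu (\<lambda>x. x)" "integrable mu (\<lambda>y. y - ?c)" "integrable mu (\<lambda>x. (dist x ?c)\<^sup>2)"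
  by (rule int; intro continuous_intros)+
 have "(\<integral>y. y - ?c \<partial>mu) = (\<integral>y. y \<partial>mu) - ?V *\<^sub>R ?c" by (simp add: ii)
 also have "... = 0" using pos by (simp add: centroid_def)
 finally have zero: "(\<integral>y. y - ?c \<partial>mu) = 0" .
 have inner: "(\<integral>y. (dist x y)\<^sup>2 \<partial>mu) = ?V * (dist x ?c)\<^sup>2 + inertia mu" for x
 proof -
  have i4: "integrable mu (\<lambda>y. (x - ?c) \<bullet> (y - ?c))" by (rule int) (intro continuous_intros)
  have "(\<integral>y. (dist x y)\<^sup>2 \<partial>mu) = (\<integral>y. (dist x ?c)\<^sup>2 + (dist y ?c)\<^sup>2 - 2 * ((x - ?c) \<bullet> (y - ?c)) \<partial>mu)"
   by (intro Bochner_Integration.integral_cong refl)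
     (simp add: dist_norm power2_norm_eq_inner inner_diff_left inner_diff_right inner_commute)
  also have "... = ?V * (dist x ?c)\<^sup>2 + inertia mu - 2 * (\<integral>y. (x - ?c) \<bullet> (y - ?c) \<partial>mu)"
   using ii(3) i4 by (simp add: inertia_def)
  also have "(\<integral>y. (x - ?c) \<bullet> (y - ?c) \<partial>mu) = (x - ?c) \<bullet> (\<integral>y. y - ?c \<partial>mu)"
   by (rule integral_inner_right) (use ii in simp)
  finally show ?thesis by (simp add: zero)
 qed
 have "(\<integral>\<^sup>+y. ennreal ((dist x y)\<^sup>2) \<partial>mu) = ennreal (?V * (dist x ?c)\<^sup>2 + inertia mu)" for x
  unfolding inner[symmetric] by (rule nn_integral_eq_integral) (auto intro!: int continuous_intros)
 then have "(\<integral>\<^sup>+x. \<integral>\<^sup>+y. ennreal ((dist x y)\<^sup>2) \<partial>mu \<partial>mu) = (\<integral>\<^sup>+x. ennreal (?V * (dist x ?c)\<^sup>2 + inertia mu) \<partial>mu)"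
  by simp
 also have "... = ennreal (\<integral>x. ?V * (dist x ?c)\<^sup>2 + inertia mu \<partial>mu)"
  by (rule nn_integral_eq_integral)
    (auto intro!: int continuous_intros simp: inertia_def integral_nonneg)
 also have "(\<integral>x. ?V * (dist x ?c)\<^sup>2 + inertia mu \<partial>mu) = 2 * ?V * inertia mu"
  using ii(3) by (simp add: inertia_def[symmetric] algebra_simps)
 finally show ?thesis .
qed

lemma inertia_nonneg: "inertia mu \<ge> 0"
 by (simp add: inertia_def)

lemma second_moment_ivol:
 fixes X :: "(real^'d) set"
 assumes X: "compact X" "charted m X" and pos: "measure (ivol m X) X > 0"
 shows "double_integral m X (\<lambda>t. ennreal (t\<^sup>2)) =
  ennreal (2 * measure (ivol m X) X * inertia (ivol m X))"
 unfolding double_integral_def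
 using second_moment[OF finite_ivol[OF X], unfolded space_ivol[OF X], OF compact_imp_bounded[OF X(1)]
   measurable_ivol[OF X] pos] by simp

text \<open>The constant kernel 1 yields the square of the volume, the kernel
  \<open>t\<^sup>2\<close> twice the product of volume and inertia.\<close>

lemma volume_inertia_eq:
 fixes X :: "(real^'d) set" and Y :: "(real^'e) set"
 assumes X: "compact X" "charted m X" and Y: "compact Y" "charted n Y"
  and eq: "!!k. k \<in> borel_measurable borel ==> double_integral m X k = double_integral n Y k"
 shows "measure (ivol m X) X = measure (ivol n Y) Y"
  and "measure (ivol n Y) Y > 0 ==> inertia (ivol m X) = inertia (ivol n Y)"
proof -
 have "ennreal ((measure (ivol m X) X)\<^sup>2) = ennreal ((measure (ivol n Y) Y)\<^sup>2)"
  using eq[of "\<lambda>_. 1"] by (simp add: double_integral_const[OF X] double_integral_const[OF Y])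
 then show V: "measure (ivol m X) X = measure (ivol n Y) Y"
  by (simp add: power2_eq_iff_nonneg)
 assume pos: "measure (ivol n Y) Y > 0"
 have "ennreal (2 * measure (ivol m X) X * inertia (ivol m X)) =
   ennreal (2 * measure (ivol n Y) Y * inertia (ivol n Y))"
  using eq[of "\<lambda>t. ennreal (t\<^sup>2)"] pos V
  by (simp add: second_moment_ivol[OF X] second_moment_ivol[OF Y])
 then show "inertia (ivol m X) = inertia (ivol n Y)"
  using pos V by (simp add: inertia_nonneg)
qed

text \<open>Parallel axis identity: the second moment about \<open>a\<close> exceeds the inertia by
  the total mass times the squared distance from \<open>a\<close> to the centroid.\<close>

lemma inertia_le:
 fixes mu :: "'a::euclidean_space measure"
 assumes fin: "finite_measure mu" and bd: "bounded (space mu)" and m: "(\<lambda>x. x) \<in> measurable mu borel"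
  and pos: "measure mu (space mu) > 0"
 shows "inertia mu <= (\<integral>x. (dist x a)\<^sup>2 \<partial>mu)"
proof -
 interpret finite_measure mu by fact
 let ?V = "measure mu (space mu)" and ?c = "centroid mu"
 note int = integrable_bounded_continuous[OF fin bd m]
 have ii: "integrable mu (\<lambda>x. x)" "integrable mu (\<lambda>x. x - ?c)" "integrable mu (\<lambda>x. (dist x ?c)\<^sup>2)"
  "integrable mu (\<lambda>x. (x - ?c) \<bullet> (?c - a))"
  by (rule int; intro continuous_intros)+
 have "(\<integral>x. x - ?c \<partial>mu) = (\<integral>x. x \<partial>mu) - ?V *\<^sub>R ?c" by (simp add: ii)
 also have "... = 0" using pos by (simp add: centroid_def)
 finally have zero: "(\<integral>x. (x - ?c) \<bullet> (?c - a) \<partial>mu) = 0"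
  using integral_inner_left[of "?c - a" mu "\<lambda>x. x - ?c"] ii(2) by simp
 have "(\<integral>x. (dist x a)\<^sup>2 \<partial>mu) = (\<integral>x. (dist x ?c)\<^sup>2 + 2 * ((x - ?c) \<bullet> (?c - a)) + (dist ?c a)\<^sup>2 \<partial>mu)"
  by (intro Bochner_Integration.integral_cong refl)
    (simp add: dist_norm power2_norm_eq_inner inner_diff_left inner_diff_right inner_commute)
 also have "... = inertia mu + ?V * (dist ?c a)\<^sup>2"
  using ii(3,4) by (simp add: inertia_def zero)
 finally show ?thesis by simp
qed

subsection \<open>Bodies\<close>

lemma set_integrable_bounded_continuous:
 fixes f :: "'a::euclidean_space => real"
 assumes "A \<in> sets borel" "bounded A" "continuous_on UNIV f"
 shows "set_integrable lborel A f"
proof -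
 have "compact (closure A)" using assms(2) by (simp add: compact_closure)
 then have "set_integrable lborel (closure A) f"
  unfolding set_integrable_def
  by (rule borel_integrable_compact) (rule continuous_on_subset[OF assms(3)], simp)
 then show ?thesis
  by (rule set_integrable_subset) (use assms(1) closure_subset in auto)
qed

text \<open>The function \<open>(dist x c)\<^sup>2 - r\<^sup>2\<close> is nonpositive on the ball
  and positive outside. As the volumes agree, comparing second moments amounts to comparing
  integrals of this function, to which the part of \<open>X\<close> outside the ball contributes
  nonnegatively and the missing part of the ball nonpositively.\<close>

lemma bathtub:
 fixes c :: "'a::euclidean_space"
 assumes X: "X \<in> sets borel" "bounded X" and V: "measure lborel X = measure lborel (cball c r)" and r: "r \<ge> 0"
  and le: "(LINT x:X|lborel. (dist x c)\<^sup>2) <= (LINT x:cball c r|lborel. (dist x c)\<^sup>2)"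
 shows "emeasure lborel (X - cball c r) = 0" "emeasure lborel (cball c r - X) = 0"
proof -
 let ?B = "cball c r" and ?h = "\<lambda>x. (dist x c)\<^sup>2 - r\<^sup>2"
 have B: "?B \<in> sets borel" "bounded ?B" by auto
 have int: "set_integrable lborel A f" if "A \<in> sets borel" "A \<subseteq> X \<or> A \<subseteq> ?B" "continuous_on UNIV f"
  for A and f :: "'a => real"
  by (rule set_integrable_bounded_continuous) (use that X B bounded_subset in auto)
 have ch: "continuous_on UNIV ?h" by (intro continuous_intros)
 have cd: "continuous_on UNIV (\<lambda>x. (dist x c)\<^sup>2)" by (intro continuous_intros)
 have hA: "(LINT x:A|lborel. ?h x) = (LINT x:A|lborel. (dist x c)\<^sup>2) - r\<^sup>2 * measure lborel A"
  if A: "A \<in> sets borel" "A \<subseteq> X \<or> A \<subseteq> ?B" for A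
 proof -
  have "(LINT x:A|lborel. ?h x) = (LINT x:A|lborel. (dist x c)\<^sup>2) - (LINT x:A|lborel. r\<^sup>2)"
   by (rule set_integral_diff) (use int[OF A] cd in auto)
  also have "emeasure lborel A < \<infinity>"
   using emeasure_bounded_finite A X B bounded_subset by blast
  then have "(LINT x:A|lborel. r\<^sup>2) = r\<^sup>2 * measure lborel A"
   using A by (simp add: set_integral_const)
  finally show ?thesis .
 qed
 have split: "(LINT x:A|lborel. ?h x) = (LINT x:A Int C|lborel. ?h x) + (LINT x:A - C|lborel. ?h x)"
  if "A \<in> sets borel" "C \<in> sets borel" "A \<subseteq> X \<or> A \<subseteq> ?B" for A C
 proof -
  have "(LINT x:(A Int C) \<union> (A - C)|lborel. ?h x) = (LINT x:A Int C|lborel. ?h x) + (LINT x:A - C|lborel. ?h x)"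
   by (rule set_integral_Un) (use that ch in \<open>auto intro!: int\<close>)
  then show ?thesis by (simp add: Int_Diff_Un)
 qed
 have "(LINT x:X|lborel. ?h x) <= (LINT x:?B|lborel. ?h x)"
  using le V hA[OF X(1)] hA[OF B(1)] by simp
 then have le': "(LINT x:X - ?B|lborel. ?h x) <= (LINT x:?B - X|lborel. ?h x)"
  using split[OF X(1) B(1)] split[OF B(1) X(1)] by (simp add: Int_commute)
 have "(LINT x:?B - X|lborel. ?h x) <= (LINT x:?B - X|lborel. 0)"
  by (rule set_integral_mono) (use X ch in \<open>auto intro!: int simp: dist_commute power_mono\<close>)
 then have "(LINT x:X - ?B|lborel. ?h x) <= 0" using le' by (simp add: set_lebesgue_integral_def)
 moreover have nn: "indicator (X - ?B) x *\<^sub>R ?h x \<ge> 0" for x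
  using r by (auto simp: indicator_def dist_commute intro!: power_mono)
 moreover have "0 <= (\<integral>x. indicator (X - ?B) x *\<^sub>R ?h x \<partial>lborel)"
  by (rule Bochner_Integration.integral_nonneg) (rule nn)
 ultimately have z: "(\<integral>x. indicator (X - ?B) x *\<^sub>R ?h x \<partial>lborel) = 0"
  by (simp only: set_lebesgue_integral_def antisym)
 have "integrable lborel (\<lambda>x. indicator (X - ?B) x *\<^sub>R ?h x)"
  using int[of "X - ?B" ?h] X ch unfolding set_integrable_def by auto
 then have "AE x in lborel. indicator (X - ?B) x *\<^sub>R ?h x = 0"
  using integral_nonneg_eq_0_iff_AE[of lborel "\<lambda>x. indicator (X - ?B) x *\<^sub>R ?h x"] z nn by auto
 moreover have "indicator (X - ?B) x *\<^sub>R ?h x = 0 ==> x \<notin> X - ?B" for x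
  using r by (auto simp: indicator_def dist_commute power2_eq_iff_nonneg split: if_splits)
 ultimately have "AE x in lborel. x \<notin> X - ?B" by (rule eventually_mono)
 then show 1: "emeasure lborel (X - ?B) = 0"
  using X B by (subst (asm) AE_iff_null_sets[symmetric]) auto
 have fin: "emeasure lborel X \<noteq> \<infinity>" "emeasure lborel ?B \<noteq> \<infinity>"
  using emeasure_bounded_finite X(2) B(2) by (metis less_irrefl)+
 have emsplit: "emeasure lborel A = emeasure lborel (A Int C) + emeasure lborel (A - C)"
  if "A \<in> sets borel" "C \<in> sets borel" for A C :: "'a set"
 proof -
  have "(A Int C) Int (A - C) = {}" "(A Int C) \<union> (A - C) = A" by auto
  then show ?thesis using plus_emeasure[of "A Int C" lborel "A - C"] that by simp
 qed
 \<comment> \<open>With \<open>X - cball c r\<close> null, equality of the volumes forces the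
   missing part of the ball to be null as well.\<close>
 have s1: "emeasure lborel X = emeasure lborel (X Int ?B)"
  using emsplit[OF X(1) B(1)] 1 by simp
 have "emeasure lborel X = emeasure lborel ?B"
  using V fin by (simp add: emeasure_eq_ennreal_measure)
 then have "emeasure lborel (X Int ?B) + emeasure lborel (?B - X) = emeasure lborel (X Int ?B) + 0"
  using s1 emsplit[OF B(1) X(1)] by (simp add: Int_commute)
 moreover have "emeasure lborel (X Int ?B) \<noteq> top" using s1 fin(1) by simp
 ultimately show "emeasure lborel (?B - X) = 0"
  by (simp only: ennreal_add_left_cancel) simp
qed

lemma open_null_empty: "open S ==> emeasure lborel S = 0 ==> S = {}" for S :: "'a::euclidean_space set"
proof (rule ccontr)
 assume "open S" "emeasure lborel S = 0" "S \<noteq> {}"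
 then have "S \<in> null_sets lborel" by (auto simp: null_sets_def)
 then show False
  using open_not_negligible[OF \<open>open S\<close> \<open>S \<noteq> {}\<close>] null_sets_completionI[of S lborel]
  by (simp add: negligible_iff_null_sets)
qed

text \<open>Open null sets are empty. This applies to \<open>W - cball c r\<close> and to
  \<open>ball c r - X\<close>, both open and contained in the given null sets; taking closures gives
  the two inclusions.\<close>

lemma closure_open_eq_cball:
 fixes c :: "'a::euclidean_space"
 assumes W: "open W" "X = closure W" and r: "r > 0"
  and null: "emeasure lborel (X - cball c r) = 0" "emeasure lborel (cball c r - X) = 0"
 shows "X = cball c r"
proof
 have "emeasure lborel (W - cball c r) <= emeasure lborel (X - cball c r)"
  by (rule emeasure_mono) (use W closure_subset in auto)
 then have "W - cball c r = {}"
  using null W by (intro open_null_empty open_Diff) auto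
 then show "X \<subseteq> cball c r" unfolding W(2) by (intro closure_minimal) auto
 have "emeasure lborel (ball c r - X) <= emeasure lborel (cball c r - X)"
  by (rule emeasure_mono) (use W in auto)
 then have "ball c r - X = {}"
  using null W by (intro open_null_empty open_Diff) auto
 then have "closure (ball c r) \<subseteq> X" unfolding W(2) by (intro closure_minimal) auto
 then show "cball c r \<subseteq> X" using r by simp
qed

lemma measure_restrict_lborel: "X \<in> sets borel ==> measure (restrict_space lborel X) X = measure lborel X"
 by (simp add: measure_restrict_space)

lemma inertia_restrict_lborel:
 "X \<in> sets borel ==> inertia (restrict_space lborel X) =
  (LINT x:X|lborel. (dist x (centroid (restrict_space lborel X)))\<^sup>2)"
 by (simp add: inertia_def integral_restrict_space set_lebesgue_integral_def)

lemma LINT_translate_cball: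
 fixes c :: "'a::euclidean_space"
 shows "(LINT x:cball c r|lborel. (dist x c)\<^sup>2) = (LINT x:cball (0 :: 'a) r|lborel. (dist x 0)\<^sup>2)"
proof -
 have "(LINT x:cball c r|lborel. (dist x c)\<^sup>2) =
   (\<integral>x. indicator (cball c r) x *\<^sub>R (dist x c)\<^sup>2 \<partial>distr lborel borel ((+) c))"
  by (simp add: set_lebesgue_integral_def lborel_distr_plus)
 also have "... = (LINT x:cball (0 :: 'a) r|lborel. (dist x 0)\<^sup>2)"
  unfolding set_lebesgue_integral_def
  by (subst integral_distr) (auto intro!: Bochner_Integration.integral_cong simp: indicator_def dist_norm)
 finally show ?thesis .
qed

lemma measure_cball_translate:
 fixes c :: "'a::euclidean_space"
 shows "measure lborel (cball c r) = measure lborel (cball (0 :: 'a) r)"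
proof -
 have "emeasure lborel (cball c r) = emeasure (distr lborel borel ((+) c)) (cball c r)"
  by (simp add: lborel_distr_plus)
 also have "... = emeasure lborel (cball (0 :: 'a) r)"
 proof -
  have "(+) c -` cball c r = cball (0 :: 'a) r" by (auto simp: dist_norm)
  then show ?thesis by (subst emeasure_distr) auto
 qed
 finally show ?thesis by (simp add: measure_def)
qed

lemma measure_cball_pos: "r > 0 ==> measure lborel (cball (c::'a::euclidean_space) r) > 0"
 by (simp add: content_cball_pos)

text \<open>The inertia of the model ball is bounded by its second moment about the centre, so its
  centroid need not be computed; the bathtub principle is applied about the centroid of
  \<open>X\<close>.\<close>

theorem body_eq_ball:
 fixes X :: "(real^'d) set"
 assumes X: "compact X" "charted CARD('d) X" and W: "open W" "X = closure W" and r: "r > 0"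
  and eq: "!!k. k \<in> borel_measurable borel ==>
   double_integral CARD('d) X k = double_integral CARD('d) (cball (0 :: real^'d) r) k"
 obtains c where "X = cball c r"
proof -
 let ?B = "cball (0 :: real^'d) r"
 have Y: "compact ?B" "charted CARD('d) ?B" using charted_cball[OF r] by auto
 note XB = borel_X[OF X]
 note full = induced_volume_full[OF X] induced_volume_full[OF Y]
 have VB: "measure (ivol CARD('d) ?B) ?B = measure lborel ?B"
  unfolding full by (rule measure_restrict_lborel) simp
 have "measure lborel ?B > 0" by (rule measure_cball_pos[OF r])
 then have V: "measure lborel X = measure lborel ?B"
  and I: "inertia (restrict_space lborel X) = inertia (restrict_space lborel ?B)"
  using volume_inertia_eq[OF X Y eq] VB unfolding full by (simp_all add: measure_restrict_lborel[OF XB])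
 let ?c = "centroid (restrict_space lborel X)"
 have fin: "finite_measure (restrict_space lborel ?B)" using finite_ivol[OF Y] unfolding full .
 have m: "(\<lambda>x. x) \<in> measurable (restrict_space lborel ?B) borel"
  by (rule measurable_restrict_space1) simp
 have "inertia (restrict_space lborel ?B) <= (\<integral>x. (dist x 0)\<^sup>2 \<partial>restrict_space lborel ?B)"
  by (rule inertia_le[OF fin _ m]) (use VB measure_cball_pos[OF r] in \<open>auto simp: full space_restrict_space\<close>)
 also have "... = (LINT x:?B|lborel. (dist x 0)\<^sup>2)"
  by (subst integral_restrict_space) (auto simp: set_lebesgue_integral_def)
 finally have "(LINT x:X|lborel. (dist x ?c)\<^sup>2) <= (LINT x:cball ?c r|lborel. (dist x ?c)\<^sup>2)"
  using I by (simp add: inertia_restrict_lborel[OF XB] LINT_translate_cball[of ?c])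
 moreover have "measure lborel X = measure lborel (cball ?c r)"
  using V by (simp add: measure_cball_translate[of ?c])
 ultimately have "X = cball ?c r"
  using bathtub[OF XB compact_imp_bounded[OF X(1)], of ?c r] r by (intro closure_open_eq_cball[OF W r]) auto
 then show thesis by (rule that)
qed

text \<open>Markov's inequality: whatever volume \<open>X\<close> has beyond that of a ball of
  radius \<open>a\<close> lies farther than \<open>a\<close> from the centroid. This excludes bodies
  on the line in the comparison with a circle.\<close>

lemma inertia_body_ge:
 fixes X :: "(real^'d) set"
 assumes X: "compact X" "charted CARD('d) X" and a: "a \<ge> 0"
 shows "(measure (ivol CARD('d) X) X - measure lborel (cball (0 :: real^'d) a)) * a\<^sup>2
  <= inertia (ivol CARD('d) X)"
proof -
 let ?c = "centroid (restrict_space lborel X)"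
 note XB = borel_X[OF X]
 have fin: "emeasure lborel A < \<infinity>" if "A \<subseteq> X \<or> A \<subseteq> cball ?c a" for A
  using that X(1) by (intro emeasure_bounded_finite) (auto intro: bounded_subset compact_imp_bounded)
 have "measure lborel X <= measure lborel ((X - cball ?c a) \<union> cball ?c a)"
 proof (rule measure_mono_fmeasurable)
  have "bounded (X - cball ?c a \<union> cball ?c a)"
   using compact_imp_bounded[OF X(1)] by (auto intro: bounded_subset)
  from emeasure_bounded_finite[OF this] show "X - cball ?c a \<union> cball ?c a \<in> fmeasurable lborel"
   using XB by (intro fmeasurableI) auto
 qed (use XB in auto)
 also have "... <= measure lborel (X - cball ?c a) + measure lborel (cball ?c a)"
  using XB by (intro measure_Un_le) auto
 finally have "(measure lborel X - measure lborel (cball (0 :: real^'d) a)) * a\<^sup>2 <= measure lborel (X - cball ?c a) * a\<^sup>2"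
  by (simp add: measure_cball_translate[of ?c] mult_right_mono)
 also have "... = (LINT x:X - cball ?c a|lborel. a\<^sup>2)"
 proof -
  have "emeasure lborel (X - cball ?c a) < \<infinity>" using fin by blast
  then show ?thesis using XB by (simp add: set_integral_const)
 qed
 also have "... <= (LINT x:X - cball ?c a|lborel. (dist x ?c)\<^sup>2)"
  by (rule set_integral_mono)
    (use XB a compact_imp_bounded[OF X(1)] bounded_subset in
     \<open>auto intro!: set_integrable_bounded_continuous continuous_intros power_mono simp: dist_commute\<close>)
 also have "... <= (LINT x:X|lborel. (dist x ?c)\<^sup>2)"
 proof -
  have "set_integrable lborel A (\<lambda>x. (dist x ?c)\<^sup>2)" if "A \<in> sets borel" "A \<subseteq> X" for A
   using that compact_imp_bounded[OF X(1)] bounded_subset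
   by (intro set_integrable_bounded_continuous) (auto intro!: continuous_intros)
  then show ?thesis
   unfolding set_lebesgue_integral_def set_integrable_def
   using XB by (intro integral_mono) (auto split: split_indicator)
 qed
 finally show ?thesis
  by (simp add: induced_volume_full[OF X] measure_restrict_lborel[OF XB] inertia_restrict_lborel[OF XB])
qed

definition basis_map :: "('a::euclidean_space => 'b::euclidean_space) => 'a => 'b" where
 "basis_map be x = (\<Sum>b\<in>Basis. (x \<bullet> b) *\<^sub>R be b)"

lemma linear_basis_map: "linear (basis_map be)"
 unfolding basis_map_def
 by (auto intro!: linearI simp: inner_add_left scaleR_add_left sum.distrib scaleR_sum_right)

lemma inner_basis_map:
 assumes "!!b c. b \<in> Basis ==> c \<in> Basis ==> be b \<bullet> be c = (if b = c then 1 else 0)"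
 shows "basis_map be x \<bullet> basis_map be y = x \<bullet> y"
proof -
 have "basis_map be x \<bullet> basis_map be y = (\<Sum>b\<in>Basis. \<Sum>c\<in>Basis. (x \<bullet> b) * (y \<bullet> c) * (if b = c then 1 else 0))"
  unfolding basis_map_def inner_sum_left inner_sum_right using assms by (intro sum.cong refl) simp
 also have "... = (\<Sum>b\<in>Basis. (x \<bullet> b) * (y \<bullet> b))"
  by (intro sum.cong refl) (simp add: if_distrib cong: if_cong)
 finally show ?thesis by (simp add: euclidean_inner[of x y])
qed

text \<open>The index types \<open>'n\<close> and \<open>'d\<close> may differ while having the same
  cardinality; a bijection of the standard bases induces an isometry that preserves Lebesgue
  measure.\<close>

lemma double_integral_cball_reindex:
 assumes card: "CARD('n) = CARD('d)" and r: "r > 0" and k: "k \<in> borel_measurable borel"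
 shows "double_integral CARD('n) (cball (0 :: real^'n) r) k = double_integral CARD('d) (cball (0 :: real^'d) r) k"
proof -
 have "card (Basis :: (real^'n) set) = card (Basis :: (real^'d) set)" using card by simp
 then obtain be where be: "bij_betw be (Basis :: (real^'n) set) (Basis :: (real^'d) set)"
  using finite_same_card_bij[OF finite_Basis finite_Basis] by blast
 let ?J = "basis_map be"
 have "be b \<bullet> be c = (if b = c then 1 else 0)" if "b \<in> Basis" "c \<in> Basis" for b c
 proof -
  have "be b \<in> Basis" "be c \<in> Basis" "be b = be c \<longleftrightarrow> b = c"
   using be that by (auto simp: bij_betw_def inj_on_eq_iff)
  then show ?thesis by (simp add: inner_Basis)
 qed
 note iJ = inner_basis_map[OF this]
 have dJ: "dist (?J x) (?J y) = dist x y" for x y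
  using iJ[of "x - y" "x - y"] by (simp add: dist_norm linear_diff[OF linear_basis_map] norm_eq_sqrt_inner)
 have nJ: "norm (?J x) = norm x" for x using iJ by (simp add: norm_eq_sqrt_inner)
 have [measurable]: "?J \<in> borel_measurable borel"
  using linear_basis_map by (intro borel_measurable_continuous_onI linear_continuous_on)
   (simp add: linear_conv_bounded_linear)
 have distr: "distr lborel borel ?J = lborel"
  using lborel_distr_Basis_bij[OF be] by (simp add: basis_map_def[abs_def])
 note k[measurable]
 have di: "double_integral CARD('m) (cball (0 :: real^'m) r) k =
   (\<integral>\<^sup>+x\<in>cball (0 :: real^'m) r. (\<integral>\<^sup>+y\<in>cball 0 r. k (dist x y) \<partial>lborel) \<partial>lborel)" for a :: "'m::finite itself"
  unfolding double_integral_def induced_volume_full[OF compact_cball charted_cball[OF r]]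
  by (simp add: nn_integral_restrict_space)
 have "(\<integral>\<^sup>+x\<in>cball (0 :: real^'d) r. (\<integral>\<^sup>+y\<in>cball 0 r. k (dist x y) \<partial>lborel) \<partial>lborel) =
  (\<integral>\<^sup>+x. (\<integral>\<^sup>+y. k (dist x y) * indicator (cball 0 r) y \<partial>distr lborel borel ?J) * indicator (cball 0 r) x \<partial>distr lborel borel ?J)"
  by (simp add: distr)
 also have "... = (\<integral>\<^sup>+x\<in>cball (0 :: real^'n) r. (\<integral>\<^sup>+y\<in>cball 0 r. k (dist x y) \<partial>lborel) \<partial>lborel)"
 proof -
  have "(\<integral>\<^sup>+y. k (dist (?J x) y) * indicator (cball 0 r) y \<partial>distr lborel borel ?J) =
    (\<integral>\<^sup>+y\<in>cball (0 :: real^'n) r. k (dist x y) \<partial>lborel)" for x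
   by (subst nn_integral_distr) (auto simp: dJ nJ indicator_def intro!: nn_integral_cong)
  then show ?thesis
   by (subst nn_integral_distr) (auto simp: distr nJ indicator_def intro!: nn_integral_cong)
 qed
 finally show ?thesis by (simp add: di)
qed

subsection \<open>Small balls in closed submanifolds\<close>

lemma emeasure_lborel_span_cball:
 fixes B :: "'a::euclidean_space set"
 assumes B: "B \<subseteq> Basis" and s: "s > 0"
 shows "emeasure (lborel_span B) (cball 0 s) = ennreal (unit_ball_vol (card B) * s ^ card B)"
proof -
 have norm: "norm (\<Sum>b\<in>B. f b *\<^sub>R b) = sqrt (\<Sum>b\<in>B. (f b)\<^sup>2)" for f
 proof -
  have "(\<Sum>b\<in>B. f b *\<^sub>R b) \<bullet> (\<Sum>b\<in>B. f b *\<^sub>R b) = (\<Sum>b\<in>B. \<Sum>c\<in>B. f b * f c * (if b = c then 1 else 0))"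
   unfolding inner_sum_left inner_sum_right using B
   by (intro sum.cong refl) (auto simp: inner_Basis subset_iff)
  also have "... = (\<Sum>b\<in>B. (f b)\<^sup>2)"
   using finite_subset_Basis[OF B] by (intro sum.cong refl) (simp add: if_distrib power2_eq_square cong: if_cong)
  finally show ?thesis by (simp add: norm_eq_sqrt_inner)
 qed
 have "emeasure (lborel_span B) (cball 0 s) =
   emeasure (\<Pi>\<^sub>M b\<in>B. lborel) ((\<lambda>f. \<Sum>b\<in>B. f b *\<^sub>R b) -` cball 0 s Int space (\<Pi>\<^sub>M b\<in>B. lborel))"
  unfolding lborel_span_def by (rule emeasure_distr) auto
 also have "(\<lambda>f. \<Sum>b\<in>B. f b *\<^sub>R b) -` cball 0 s Int space (\<Pi>\<^sub>M b\<in>B. lborel) =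
   {f. sqrt (\<Sum>b\<in>B. (f b)\<^sup>2) <= s} Int space (\<Pi>\<^sub>M b\<in>B. lborel)"
  by (auto simp: norm)
 also have "emeasure (\<Pi>\<^sub>M b\<in>B. lborel) ... = ennreal (unit_ball_vol (card B) * s ^ card B)"
  by (rule emeasure_cball_aux[OF finite_subset_Basis[OF B] s])
 finally show ?thesis .
qed

lemma emeasure_lborel_span_translate:
 fixes B :: "'a::euclidean_space set"
 assumes B: "B \<subseteq> Basis" and a: "a \<in> span B" and A: "A \<in> sets borel"
 shows "emeasure (lborel_span B) ((+) a ` A) = emeasure (lborel_span B) A"
proof -
 have A': "(+) a ` A \<in> sets borel"
 proof -
  have "(+) a ` A = (+) (- a) -` A" by (auto simp: image_iff) (metis add.commute add_diff_cancel diff_add_cancel uminus_add_conv_diff)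
  then show ?thesis using measurable_sets_borel[OF _ A, of "(+) (- a)"] by simp
 qed
 have eq: "(+) a -` (slab B Int proj B -` ((+) a ` A)) = slab B Int proj B -` A"
 proof -
  have "a + z \<in> slab B \<longleftrightarrow> z \<in> slab B" for z
   using a span_iff[OF B] by (auto simp: slab_def inner_add_left)
  moreover have "proj B (a + z) = a + proj B z" for z
   using linear_add[OF linear_proj] proj_id[OF B a] by metis
  ultimately show ?thesis by auto
 qed
 have m: "slab B Int proj B -` ((+) a ` A) \<in> sets borel"
  using sets_slab[OF B] measurable_sets_borel[OF measurable_proj A', of B] by auto
 have "emeasure (lborel_span B) ((+) a ` A) = emeasure (distr lborel borel ((+) a)) (slab B Int proj B -` ((+) a ` A))"
  by (simp add: emeasure_lborel_span[OF B A'] lborel_distr_plus)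
 also have "... = emeasure lborel ((+) a -` (slab B Int proj B -` ((+) a ` A)) Int space lborel)"
  by (rule emeasure_distr) (use m in auto)
 finally show ?thesis unfolding eq by (simp add: emeasure_lborel_span[OF B A])
qed

section \<open>Uniform control of charts and of the volume of small balls\<close>

lemma norm_linear_le_Basis:
 fixes f :: "'a::euclidean_space => 'b::real_normed_vector"
 assumes "linear f" "!!b. b \<in> Basis ==> norm (f b) <= M b"
 shows "norm (f v) <= (\<Sum>b\<in>Basis. M b) * norm v"
proof -
 have "f v = (\<Sum>b\<in>Basis. (v \<bullet> b) *\<^sub>R f b)"
  by (subst euclidean_representation[of v, symmetric])
    (simp only: linear_sum[OF assms(1)] linear_scale[OF assms(1)])
 also have "norm ... <= (\<Sum>b\<in>Basis. norm v * M b)"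
  using assms(2) by (intro sum_norm_le) (auto intro!: mult_mono Basis_le_norm)
 also have "... = (\<Sum>b\<in>Basis. M b) * norm v" by (simp add: sum_distrib_left[symmetric])
 finally show ?thesis .
qed

lemma Ck_on_1_Lipschitz:
 fixes f :: "'a::euclidean_space => 'b::real_normed_vector"
 assumes f: "Ck_on 1 S f" and S: "cball p de \<subseteq> S"
 obtains K where "K \<ge> 0" "!!x v. x \<in> cball p de ==> norm (D f x v) <= K * norm v"
  "!!x y. x \<in> cball p de ==> y \<in> cball p de ==> norm (f x - f y) <= K * norm (x - y)"
proof -
 have "\<exists>M. \<forall>x\<in>cball p de. norm (D f x b) <= M" for b
 proof -
  have "compact ((\<lambda>x. D f x b) ` cball p de)"
   using Ck_on_1D(2)[OF f] S by (intro compact_continuous_image) (auto intro: continuous_on_subset)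
  then show ?thesis using compact_imp_bounded by (fastforce simp: bounded_iff)
 qed
 then obtain M where M: "!!x b. x \<in> cball p de ==> norm (D f x b) <= M b" by metis
 let ?K = "max 0 (\<Sum>b\<in>Basis. M b)"
 have der: "(f has_derivative D f x) (at x)" if "x \<in> cball p de" for x
  using Ck_on_1D(1)[OF f] S that by blast
 have bd: "norm (D f x v) <= ?K * norm v" if x: "x \<in> cball p de" for x v
 proof -
  have "norm (D f x v) <= (\<Sum>b\<in>Basis. M b) * norm v"
   by (rule norm_linear_le_Basis) (use has_derivative_linear[OF der[OF x]] M[OF x] in auto)
  also have "... <= ?K * norm v" by (intro mult_right_mono) auto
  finally show ?thesis .
 qed
 have "norm (f x - f y) <= ?K * norm (x - y)" if "x \<in> cball p de" "y \<in> cball p de" for x y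
  by (rule differentiable_bound[of "cball p de" f "D f"])
    (use that bd der in \<open>auto intro!: onorm_le intro: has_derivative_at_withinI\<close>)
 with bd show thesis by (intro that[of ?K]) auto
qed

text \<open>One natural number serves both as the constant of an estimate and, through
  \<open>1 / real (Suc N)\<close>, as the bound of its range. A local estimate that is monotone in
  this number becomes uniform by adding the numbers of a finite subcover.\<close>

lemma compact_uniform_nat:
 assumes X: "compact (X :: 'a::metric_space set)"
  and loc: "!!p. p \<in> X ==> \<exists>de>0. \<exists>N::nat. \<forall>x\<in>X Int ball p de. Q N x"
  and mono: "!!N M x. N <= M ==> Q N x ==> Q M x"
 obtains N where "!!x. x \<in> X ==> Q N x"
proof -
 from loc obtain de N where d: "!!p. p \<in> X ==> de p > 0 \<and> (\<forall>x\<in>X Int ball p (de p). Q (N p) x)" by metis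
 have "X \<subseteq> (\<Union>p\<in>X. ball p (de p))" using d by force
 then obtain F where F: "F \<subseteq> X" "finite F" "X \<subseteq> (\<Union>p\<in>F. ball p (de p))"
  using compactE_image[OF X, of X "\<lambda>p. ball p (de p)"] by blast
 have "Q (\<Sum>p\<in>F. N p) x" if x: "x \<in> X" for x
 proof -
  obtain p where p: "p \<in> F" "x \<in> ball p (de p)" using F x by blast
  then have "Q (N p) x" using d F(1) x by blast
  moreover have "N p <= (\<Sum>p\<in>F. N p)" using F(2) p(1) by (intro member_le_sum) auto
  ultimately show ?thesis using mono by blast
 qed
 then show thesis by (rule that)
qed

text \<open>A chart at \<open>p\<close> together with a neighbourhood on which everything is controlled by one constant \<open>K\<close>.\<close>

definition good_chart ::
 "nat => (real^'d) set => real^'d => (real^'d) set => (real^'d) set => (real^'d) set =>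
  (real^'d => real^'d) => (real^'d => real^'d) => real => real => real => bool" where
 "good_chart m X p B U V Ph Ps rh de K \<longleftrightarrow> C1chart m X B (span B) U V Ph Ps \<and> p \<in> X \<and> 0 < rh \<and> 0 < de \<and> 1 <= K \<and>
  cball (Ph p) (2 * rh) \<subseteq> V \<and> ball p (2 * de) \<subseteq> U Int Ph -` ball (Ph p) rh \<and>
  (\<forall>a\<in>cball (Ph p) (2 * rh). \<forall>a'\<in>cball (Ph p) (2 * rh). norm (a - a') <= K * norm (Ps a - Ps a') \<and>
   norm (Ps a' - Ps a - D Ps a (a' - a)) <= K * (norm (a' - a))\<^sup>2) \<and>
  (\<forall>a\<in>cball (Ph p) (2 * rh). \<forall>v. norm (D Ps a v) <= K * norm v \<and> norm v <= K * norm (D Ps a v)) \<and>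
  (\<forall>a\<in>cball (Ph p) (2 * rh). sqrt (gram_det B Ps a) <= K)"

text \<open>The constant \<open>K\<close> collects bounds on compact neighbourhoods: for the
  derivative of \<open>Ps\<close>, for the Lipschitz constant of \<open>Ph\<close>, for the
  Lipschitz constant of the derivative of \<open>Ps\<close>, which uses the second order of
  differentiability, and for the density.\<close>

lemma good_chart_exists:
 fixes X :: "(real^'d) set"
 assumes X: "submanifold 2 m X" and p: "p \<in> X"
 obtains B U V Ph Ps rh de K where "good_chart m X p B U V Ph Ps rh de K"
proof -
 obtain B U V Ph Ps where B: "B \<subseteq> Basis" "card B = m" and pU: "p \<in> U" and ch: "adapted_chart 2 X (span B) U V Ph Ps"
  using X p unfolding submanifold_def by blast
 have C2: "Ck_on 2 U Ph" "Ck_on 2 V Ps" and op: "open U" "open V"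
  using ch by (simp_all add: adapted_chart_def Ck_diffeo_def)
 have c: "C1chart m X B (span B) U V Ph Ps"
  using B adapted_chart_mono[OF ch, of 1] by (simp add: C1chart_def)
 note i = chart_inverse[OF c] and C1 = chart_C1[OF c]
 have DC1: "Ck_on 1 V (\<lambda>x. D Ps x v)" for v using C2(2) by (simp add: numeral_2_eq_2)
 obtain de0 where de0: "de0 > 0" "cball p de0 \<subseteq> U" using op(1) pU open_contains_cball by blast
 let ?a = "Ph p"
 have aV: "?a \<in> V" using i(3)[OF pU] .
 have "open (V Int Ps -` ball p de0)"
  using continuous_on_open_vimage[OF op(2), of Ps] chart_continuous(2)[OF c] by (auto simp: Int_commute)
 moreover have "?a \<in> V Int Ps -` ball p de0" using aV i(1)[OF pU] de0 by simp
 ultimately obtain e where e: "e > 0" "cball ?a e \<subseteq> V Int Ps -` ball p de0" using open_contains_cball by blast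
 \<comment> \<open>Halving the radius lets balls of radius \<open>rh\<close> about points within
   \<open>rh\<close> of \<open>Ph p\<close> stay where all estimates hold.\<close>
 define rh where "rh = e / 2"
 have rh: "rh > 0" "cball ?a (2 * rh) \<subseteq> V" "!!x. x \<in> cball ?a (2 * rh) ==> Ps x \<in> cball p de0"
  using e by (auto simp: rh_def less_imp_le subset_iff)
 have "open (U Int Ph -` ball ?a rh)"
  using continuous_on_open_vimage[OF op(1), of Ph] chart_continuous(1)[OF c] by (auto simp: Int_commute)
 moreover have "p \<in> U Int Ph -` ball ?a rh" using pU rh by simp
 ultimately obtain e' where e': "e' > 0" "ball p e' \<subseteq> U Int Ph -` ball ?a rh" using open_contains_ball by blast
 define de where "de = e' / 2"
 obtain K1 where K1: "K1 \<ge> 0" "!!x v. x \<in> cball ?a (2 * rh) ==> norm (D Ps x v) <= K1 * norm v"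
  using Ck_on_1_Lipschitz[OF C1(2) rh(2)] by metis
 obtain K2 where K2: "K2 \<ge> 0" "!!x v. x \<in> cball p de0 ==> norm (D Ph x v) <= K2 * norm v"
  "!!x y. x \<in> cball p de0 ==> y \<in> cball p de0 ==> norm (Ph x - Ph y) <= K2 * norm (x - y)"
  using Ck_on_1_Lipschitz[OF C1(1) de0(2)] by metis
 have "\<exists>K. \<forall>x\<in>cball ?a (2 * rh). \<forall>y\<in>cball ?a (2 * rh). norm (D Ps x b - D Ps y b) <= K * norm (x - y)" for b
  using Ck_on_1_Lipschitz[OF DC1 rh(2), of b] by metis
 then obtain L where L: "!!b x y. x \<in> cball ?a (2 * rh) ==> y \<in> cball ?a (2 * rh) ==>
   norm (D Ps x b - D Ps y b) <= L b * norm (x - y)" by metis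
 define K3 where "K3 = (\<Sum>b\<in>Basis. \<bar>L b\<bar>)"
 have lin: "linear (D Ps x)" if "x \<in> cball ?a (2 * rh)" for x using chart_linear(2)[OF c] that rh(2) by blast
 have DL: "norm (D Ps x v - D Ps y v) <= K3 * norm (x - y) * norm v"
  if "x \<in> cball ?a (2 * rh)" "y \<in> cball ?a (2 * rh)" for x y v
 proof -
  have "linear (\<lambda>v. D Ps x v - D Ps y v)" using lin that by (intro linear_compose_sub)
  moreover have "norm (D Ps x b - D Ps y b) <= \<bar>L b\<bar> * norm (x - y)" for b
   using L[OF that, of b] by (meson abs_ge_self mult_right_mono norm_ge_zero order_trans)
  ultimately have "norm (D Ps x v - D Ps y v) <= (\<Sum>b\<in>Basis. \<bar>L b\<bar> * norm (x - y)) * norm v"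
   by (intro norm_linear_le_Basis) auto
  then show ?thesis by (simp add: K3_def sum_distrib_right)
 qed
 have "compact ((\<lambda>x. sqrt (gram_det B Ps x)) ` cball ?a (2 * rh))"
  using continuous_on_gram_det[OF c] rh(2)
  by (intro compact_continuous_image continuous_intros) (auto intro: continuous_on_subset)
 then obtain K4 where K4: "!!x. x \<in> cball ?a (2 * rh) ==> \<bar>sqrt (gram_det B Ps x)\<bar> <= K4"
  using compact_imp_bounded by (fastforce simp: bounded_iff)
 define K where "K = 1 + K1 + K2 + K3 + \<bar>K4\<bar>"
 have K3: "K3 \<ge> 0" by (simp add: K3_def sum_nonneg)
 have K: "1 <= K" "K1 <= K" "K2 <= K" "K3 <= K" "K4 <= K" using K1 K2 K3 by (auto simp: K_def)
 have "good_chart m X p B U V Ph Ps rh de K"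
  unfolding good_chart_def
 proof (intro conjI ballI allI)
  show "C1chart m X B (span B) U V Ph Ps" "p \<in> X" "0 < rh" "0 < de" "1 <= K" "cball ?a (2 * rh) \<subseteq> V"
   using c p rh e' K by (auto simp: de_def)
  show "ball p (2 * de) \<subseteq> U Int Ph -` ball ?a rh" using e' by (simp add: de_def)
  fix a assume a: "a \<in> cball ?a (2 * rh)"
  have aV: "a \<in> V" using a rh(2) by blast
  show "sqrt (gram_det B Ps a) <= K" using K4[OF a] K(5) by linarith
  fix v
  show "norm (D Ps a v) <= K * norm v"
   using K1(2)[OF a, of v] K(2) by (meson mult_right_mono norm_ge_zero order_trans)
  have "norm (D Ph (Ps a) (D Ps a v)) <= K2 * norm (D Ps a v)" by (rule K2(2)[OF rh(3)[OF a]])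
  then have "norm v <= K2 * norm (D Ps a v)" by (simp only: chart_D_inverse(1)[OF c aV])
  also have "... <= K * norm (D Ps a v)" by (rule mult_right_mono[OF K(3) norm_ge_zero])
  finally show "norm v <= K * norm (D Ps a v)" .
 next
  fix a a' assume a: "a \<in> cball ?a (2 * rh)" "a' \<in> cball ?a (2 * rh)"
  have aV: "a \<in> V" "a' \<in> V" using a rh(2) by blast+
  have "norm (a - a') = norm (Ph (Ps a) - Ph (Ps a'))" using i(2) aV by simp
  also have "... <= K2 * norm (Ps a - Ps a')" by (rule K2(3)[OF rh(3)[OF a(1)] rh(3)[OF a(2)]])
  also have "... <= K * norm (Ps a - Ps a')" using K(3) by (intro mult_right_mono) auto
  finally show "norm (a - a') <= K * norm (Ps a - Ps a')" .
  \<comment> \<open>Intersecting with the ball of radius \<open>norm (a' - a)\<close> about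
    \<open>a\<close> bounds the variation of the derivative by \<open>K3 * norm (a' - a)\<close>
    along the segment, which makes the remainder quadratic.\<close>
  let ?S = "cball ?a (2 * rh) Int cball a (norm (a' - a))"
  have conv: "convex ?S" by (intro convex_Int convex_cball)
  have aS: "a \<in> ?S" "a' \<in> ?S" using a by (auto simp: dist_norm norm_minus_commute)
  have "norm (Ps a' - Ps a - D Ps a (a' - a)) <= norm (a' - a) * (K3 * norm (a' - a))"
  proof (rule differentiable_bound_linearization[where S = ?S and f' = "D Ps" and ?x0.0 = a])
   fix t :: real assume "t \<in> {0..1}"
   then show "a + t *\<^sub>R (a' - a) \<in> ?S"
    using convexD_alt[OF conv aS, of t] by (simp add: algebra_simps)
  next
   fix x assume x: "x \<in> ?S"
   then show "(Ps has_derivative D Ps x) (at x within ?S)"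
    using has_derivative_at_withinI[OF chart_derivative(2)[OF c, of x]] rh(2) by blast
   have "norm (D Ps x v - D Ps a v) <= K3 * norm (a' - a) * norm v" for v
   proof -
    have "norm (D Ps x v - D Ps a v) <= K3 * norm (x - a) * norm v" using DL x a by auto
    also have "... <= K3 * norm (a' - a) * norm v"
     using x K3 by (intro mult_right_mono mult_left_mono) (auto simp: dist_norm norm_minus_commute)
    finally show ?thesis .
   qed
   then show "onorm (D Ps x - D Ps a) <= K3 * norm (a' - a)" by (intro onorm_le) (simp add: fun_diff_def)
  qed (rule aS)
  also have "... = K3 * (norm (a' - a))\<^sup>2" by (simp add: power2_eq_square)
  also have "... <= K * (norm (a' - a))\<^sup>2" using K(4) by (rule mult_right_mono) simp
  finally show "norm (Ps a' - Ps a - D Ps a (a' - a)) <= K * (norm (a' - a))\<^sup>2" .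
 qed
 then show thesis by (rule that)
qed

text \<open>In a good chart the preimage of a ball of radius \<open>t\<close> lies in a ball of
  radius \<open>K * t\<close> of the model, and the density is at most \<open>K\<close>.\<close>

lemma emeasure_ivol_ball_le:
 fixes X :: "(real^'d) set"
 assumes X: "compact X" "submanifold 2 m X"
 obtains C t0 where "C > 0" "t0 > 0"
  "!!x t. x \<in> X ==> 0 < t ==> t <= t0 ==> emeasure (ivol m X) (X Int cball x t) <= ennreal (C * t ^ m)"
proof -
 have chX: "charted m X" by (rule charted_submanifold[OF X(2)]) simp
 define Q where "Q N x \<longleftrightarrow> (\<forall>t. 0 < t \<and> t <= 1 / real (Suc N) -->
   emeasure (ivol m X) (X Int cball x t) <= ennreal (real N * t ^ m))" for N x
 have loc: "\<exists>de>0. \<exists>N::nat. \<forall>x\<in>X Int ball p de. Q N x" if p: "p \<in> X" for p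
 proof -
  obtain B U V Ph Ps rh de K where g: "good_chart m X p B U V Ph Ps rh de K"
   using good_chart_exists[OF X(2) p] by blast
  have c: "C1chart m X B (span B) U V Ph Ps" and pos: "0 < rh" "0 < de" "1 <= K"
   and V: "cball (Ph p) (2 * rh) \<subseteq> V" and U: "ball p (2 * de) \<subseteq> U Int Ph -` ball (Ph p) rh"
   and bi: "!!a a'. a \<in> cball (Ph p) (2 * rh) ==> a' \<in> cball (Ph p) (2 * rh) ==> norm (a - a') <= K * norm (Ps a - Ps a')"
   and gr: "!!a. a \<in> cball (Ph p) (2 * rh) ==> sqrt (gram_det B Ps a) <= K"
   using g by (auto simp: good_chart_def)
  note B = chart_B[OF c] and i = chart_inverse[OF c]
  have cardB: "card B = m" by (rule chart_card[OF c])
  have main: "emeasure (ivol m X) (X Int cball x t) <= ennreal (K * (unit_ball_vol m * K ^ m) * t ^ m)"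
   if x: "x \<in> X Int ball p de" and t: "0 < t" "t < de" for x t
  proof -
   have sub: "cball x t \<subseteq> ball p (2 * de)"
   proof
    fix y assume "y \<in> cball x t"
    then have "dist p y < de + de" using x t dist_triangle[of p y x] by auto
    then show "y \<in> ball p (2 * de)" by simp
   qed
   let ?E = "X Int cball x t" and ?A = "V Int Ps -` (X Int cball x t)"
   have E: "?E \<in> sets borel" "?E \<subseteq> U Int X" using borel_X[OF X(1) chX] sub U by auto
   note pre = chart_preimage[OF c borel_X[OF X(1) chX] E]
   have xU: "x \<in> U" "Ph x \<in> cball (Ph p) (2 * rh)" "Ph x \<in> span B"
   proof -
    have "x \<in> ball p (2 * de)" using x pos by auto
    then have 1: "x \<in> U" "Ph x \<in> ball (Ph p) rh" using U by blast+
    then show "x \<in> U" "Ph x \<in> cball (Ph p) (2 * rh)" using pos by auto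
    show "Ph x \<in> span B" using chart_H_iff(1)[OF c 1(1)] x by simp
   qed
   have A: "a \<in> cball (Ph p) (2 * rh) \<and> a \<in> cball (Ph x) (K * t)" if a: "a \<in> ?A" for a
   proof -
    have "Ps a \<in> ball p (2 * de)" using a sub by auto
    then have "Ph (Ps a) \<in> ball (Ph p) rh" using U by blast
    then have 1: "a \<in> cball (Ph p) (2 * rh)" using i(2)[of a] a pos by simp
    have "norm (Ph x - a) <= K * norm (Ps (Ph x) - Ps a)" by (rule bi[OF xU(2) 1])
    also have "... <= K * t" using i(1)[OF xU(1)] a pos by (auto simp: dist_norm intro!: mult_left_mono)
    finally show ?thesis using 1 by (simp add: dist_norm)
   qed
   have "emeasure (lborel_span B) ?A <= emeasure (lborel_span B) ((+) (Ph x) ` cball 0 (K * t))"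
   proof (rule emeasure_mono)
    show "?A \<subseteq> (+) (Ph x) ` cball 0 (K * t)" using A by (auto simp: cball_translation[symmetric])
   qed (simp add: sets_lborel_span[OF B] flip: cball_translation)
   also have "... = emeasure (lborel_span B) (cball 0 (K * t))"
    by (rule emeasure_lborel_span_translate[OF B xU(3)]) simp
   also have "... = ennreal (unit_ball_vol m * (K * t) ^ m)"
    using emeasure_lborel_span_cball[OF B, of "K * t"] t pos by (simp add: cardB)
   finally have le: "emeasure (lborel_span B) ?A <= ennreal (unit_ball_vol m * (K * t) ^ m)" .
   have "emeasure (ivol m X) ?E = (\<integral>\<^sup>+a\<in>?A. ennreal (sqrt (gram_det B Ps a)) \<partial>lborel_span B)"
    using emeasure_ivol_chart[OF X(1) chX c pre(1,2)] pre(3) by simp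
   also have "... <= ennreal K * emeasure (lborel_span B) ?A"
    by (rule nn_integral_mult_le) (use gr A pre(1) in \<open>auto intro!: ennreal_leI simp: sets_lborel_span[OF B]\<close>)
   also have "... <= ennreal K * ennreal (unit_ball_vol m * (K * t) ^ m)"
    by (rule mult_left_mono[OF le]) simp
   also have "... = ennreal (K * (unit_ball_vol m * K ^ m) * t ^ m)"
    using pos t by (simp add: ennreal_mult[symmetric] power_mult_distrib mult_ac)
   finally show ?thesis .
  qed
  obtain N1 :: nat where N1: "K * (unit_ball_vol m * K ^ m) <= N1" using real_arch_simple by blast
  obtain N2 :: nat where N2: "1 / real (Suc N2) < de" using pos(2) by (metis nat_approx_posE)
  have "Q (N1 + N2) x" if x: "x \<in> X Int ball p de" for x
   unfolding Q_def
  proof (intro allI impI)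
   fix t :: real assume t: "0 < t \<and> t <= 1 / real (Suc (N1 + N2))"
   have "1 / real (Suc (N1 + N2)) <= 1 / real (Suc N2)" by (intro divide_left_mono) auto
   then have "emeasure (ivol m X) (X Int cball x t) <= ennreal (K * (unit_ball_vol m * K ^ m) * t ^ m)"
    using t N2 x by (intro main) auto
   also have "... <= ennreal (real (N1 + N2) * t ^ m)"
    using N1 t by (intro ennreal_leI mult_right_mono) auto
   finally show "emeasure (ivol m X) (X Int cball x t) <= ennreal (real (N1 + N2) * t ^ m)" .
  qed
  then show ?thesis using pos(2) by blast
 qed
 have mono: "Q M x" if "N <= M" "Q N x" for N M x
  unfolding Q_def
 proof (intro allI impI)
  fix t :: real assume t: "0 < t \<and> t <= 1 / real (Suc M)"
  have "1 / real (Suc M) <= 1 / real (Suc N)" using that(1) by (intro divide_left_mono) auto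
  then have "emeasure (ivol m X) (X Int cball x t) <= ennreal (real N * t ^ m)"
   using that(2) t unfolding Q_def by auto
  also have "... <= ennreal (real M * t ^ m)"
   using that(1) t by (intro ennreal_leI mult_right_mono) auto
  finally show "emeasure (ivol m X) (X Int cball x t) <= ennreal (real M * t ^ m)" .
 qed
 obtain N where N: "!!x. x \<in> X ==> Q N x"
 proof (rule compact_uniform_nat[where X = X and Q = Q])
  show "compact X" by (rule X(1))
  show "\<exists>de>0. \<exists>N. \<forall>x\<in>X Int ball p de. Q N x" if "p \<in> X" for p by (rule loc[OF that])
  show "Q M x" if "N <= M" "Q N x" for N M x by (rule mono[OF that])
 qed (rule that)
 show thesis
 proof (rule that[of "real (Suc N)" "1 / real (Suc N)"])
  fix x t assume "x \<in> X" "0 < t" "t <= 1 / real (Suc N)"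
  then have "emeasure (ivol m X) (X Int cball x t) <= ennreal (real N * t ^ m)" using N[unfolded Q_def] by auto
  also have "... <= ennreal (real (Suc N) * t ^ m)"
   using \<open>0 < t\<close> by (intro ennreal_leI mult_right_mono) auto
  finally show "emeasure (ivol m X) (X Int cball x t) <= ennreal (real (Suc N) * t ^ m)" .
 qed auto
qed

text \<open>\<open>F\<close> composed with the inverse of \<open>K\<close> maps the unit ball into
  itself, so its determinant is at most 1 in absolute value.\<close>

lemma abs_det_le_of_norm_le:
 fixes F K :: "real^'d => real^'d"
 assumes F: "linear F" and K: "linear K" "inj K" and le: "!!v. norm (F v) <= norm (K v)"
 shows "\<bar>det (matrix F)\<bar> <= \<bar>det (matrix K)\<bar>"
proof -
 obtain M where M: "linear M" "M \<circ> K = id" "K \<circ> M = id"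
  using linear_injective_isomorphism[OF K] by (auto simp: fun_eq_iff)
 have FM: "linear (F \<circ> M)" using F M(1) by (intro linear_compose)
 have sub: "(F \<circ> M) ` cball 0 1 \<subseteq> cball 0 1"
 proof (rule image_subsetI)
  fix v :: "real^'d" assume v: "v \<in> cball 0 1"
  have "K (M v) = v" using M(3) by (simp add: fun_eq_iff)
  then have "norm (F (M v)) <= norm v" using le[of "M v"] by simp
  then show "(F \<circ> M) v \<in> cball 0 1" using v by simp
 qed
 have im: "(F \<circ> M) ` cball 0 1 \<in> sets borel"
  using FM by (intro borel_compact compact_continuous_image linear_continuous_on) (auto simp: linear_conv_bounded_linear)
 have "\<bar>det (matrix (F \<circ> M))\<bar> <= 1"
 proof (cases "inj (F \<circ> M)")
  case True
  have "emeasure lborel ((F \<circ> M) ` cball 0 1) = (\<integral>\<^sup>+x\<in>cball 0 1. ennreal \<bar>det (matrix (F \<circ> M))\<bar> \<partial>(lborel::(real^'d) measure))"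
   by (rule emeasure_image_eq_integral_det)
    (use im FM True in \<open>auto intro!: linear_imp_has_derivative intro: inj_on_subset simp del: image_comp\<close>)
  also have "... = ennreal \<bar>det (matrix (F \<circ> M))\<bar> * emeasure lborel (cball 0 1 :: (real^'d) set)"
   by (simp add: nn_integral_cmult_indicator)
  finally have "ennreal \<bar>det (matrix (F \<circ> M))\<bar> * emeasure lborel (cball 0 1 :: (real^'d) set) <= emeasure lborel (cball 0 1 :: (real^'d) set)"
   using emeasure_mono[OF sub, of lborel] by simp
  then have "ennreal (\<bar>det (matrix (F \<circ> M))\<bar> * unit_ball_vol CARD('d)) <= ennreal (unit_ball_vol CARD('d))"
   by (simp add: emeasure_cball ennreal_mult)
  then show ?thesis by (simp add: ennreal_le_iff mult_le_cancel_right1)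
 next
  case False
  then show ?thesis using det_nz_iff_inj[OF FM] by simp
 qed
 moreover have "matrix F = matrix (F \<circ> M) ** matrix K"
  using matrix_compose[OF K(1) FM] M(2) by (simp add: comp_assoc)
 ultimately show ?thesis by (simp add: det_mul abs_mult mult_left_le_one_le)
qed

text \<open>Used to rotate \<open>span B\<close> onto a tangent space. An isometry between the two
  subspaces is completed by unit normals, and the completion takes the basis to an orthonormal
  family.\<close>

lemma orthogonal_onto_subspace:
 fixes L :: "'a::euclidean_space => 'a"
 assumes B: "B \<subseteq> Basis" and L: "linear L" and inj: "inj_on L (span B)"
 obtains J where "orthogonal_transformation J" "J ` span B = L ` span B"
proof -
 have sub: "subspace (L ` span B)" using L by (simp add: linear_subspace_image)
 have "dim (L ` span B) = dim (span B)" using dim_image_eq[OF L, of "span B"] inj by (simp only: span_span dim_span)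
 then obtain f where f: "linear f" "f ` span B = L ` span B" "!!x. x \<in> span B ==> norm (f x) = norm x"
  using isometry_subspaces[OF subspace_span sub, of B] by metis
 have "inj_on f (span B)"
 proof (rule inj_onI)
  fix x y assume "x \<in> span B" "y \<in> span B" "f x = f y"
  then show "x = y" using f(3)[OF span_diff, of x y] by (simp add: linear_diff[OF f(1)])
 qed
 then obtain J where J: "normal_extension B f J" using normal_extension_exists[OF B f(1)] by blast
 have linJ: "linear J" using J by (simp add: normal_extension_def)
 have inner: "J b \<bullet> J c = (if b = c then 1 else 0)" if "b \<in> Basis" "c \<in> Basis" for b c
 proof (cases "b \<in> B \<and> c \<in> B")
  case True
  then have "J b \<bullet> J c = b \<bullet> c"
   using J isometry_inner[OF f(1) subspace_span f(3), where x = b and y = c] by (auto simp: normal_extension_def span_base)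
  then show ?thesis using that by (simp add: inner_Basis)
 next
  case False
  then show ?thesis using J that unfolding normal_extension_def
   by (metis DiffI inner_commute)
 qed
 have "basis_map J = J"
  unfolding basis_map_def
  by (rule ext) (subst (2) euclidean_representation[symmetric], simp only: linear_sum[OF linJ] linear_scale[OF linJ])
 then have "J x \<bullet> J y = x \<bullet> y" for x y
  using inner_basis_map[of J x y] inner by simp
 then have "orthogonal_transformation J" using linJ by (simp add: orthogonal_transformation_def)
 moreover have "J v = f v" if "v \<in> span B" for v
  using linear_eq_on_span_Basis[OF linJ f(1) _ that] J by (auto simp: normal_extension_def)
 then have "J ` span B = L ` span B" using f(2) by auto
 ultimately show thesis by (rule that)
qed

lemma norm_proj_Pythagoras:
 assumes B: "B \<subseteq> Basis"
 shows "(norm v)\<^sup>2 = (norm (proj B v))\<^sup>2 + (norm (v - proj B v))\<^sup>2"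
proof -
 have "proj B v \<bullet> (v - proj B v) = 0"
 proof -
  have "b \<bullet> (v - proj B v) = 0" if "b \<in> B" for b
   using inner_proj[OF B, of b v] that B by (auto simp: inner_diff_right inner_commute)
  moreover have "proj B v \<bullet> w = (\<Sum>b\<in>B. (v \<bullet> b) * (b \<bullet> w))" for w by (simp add: proj_def inner_sum_left)
  ultimately show ?thesis by simp
 qed
 then show ?thesis
  using norm_add_Pythagorean[of "proj B v" "v - proj B v"] by (simp add: orthogonal_def)
qed

text \<open>Project the piece of \<open>X\<close> near \<open>x = Ps a\<close> to its tangent space there. The projection does not
 increase volume, and by Brouwer's theorem its image contains a ball of radius almost \<open>t\<close>.\<close>

lemma emeasure_ivol_ball_ge_aux:
 fixes X :: "(real^'d) set"
 assumes X: "compact X" "charted m X" and g: "good_chart m X p B U V Ph Ps rh de K" and x: "x \<in> X Int ball p de"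
  and t: "0 < t" "4 * K ^ 3 * t <= 1" "2 * K * t <= rh" "16 * K ^ 6 * t\<^sup>2 < 1"
 shows "emeasure (ivol m X) (X Int cball x t) \<ge> ennreal (unit_ball_vol m * (t - 16 * K ^ 6 * t ^ 3) ^ m)"
proof -
 have c: "C1chart m X B (span B) U V Ph Ps" and pos: "0 < rh" "0 < de" "1 <= K"
  and V: "cball (Ph p) (2 * rh) \<subseteq> V" and U: "ball p (2 * de) \<subseteq> U Int Ph -` ball (Ph p) rh"
  and bi: "!!a a'. a \<in> cball (Ph p) (2 * rh) ==> a' \<in> cball (Ph p) (2 * rh) ==> norm (a - a') <= K * norm (Ps a - Ps a')"
  and lin: "!!a a'. a \<in> cball (Ph p) (2 * rh) ==> a' \<in> cball (Ph p) (2 * rh) ==>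
   norm (Ps a' - Ps a - D Ps a (a' - a)) <= K * (norm (a' - a))\<^sup>2"
  and DK: "!!a v. a \<in> cball (Ph p) (2 * rh) ==> norm v <= K * norm (D Ps a v)"
  using g by (auto simp: good_chart_def)
 note B = chart_B[OF c] and i = chart_inverse[OF c]
 define a where "a = Ph x"
 have "x \<in> ball p (2 * de)" using x pos by auto
 then have xU: "x \<in> U" "a \<in> ball (Ph p) rh" using U by (auto simp: a_def)
 have aS: "a \<in> span B" and Psa: "Ps a = x" using chart_H_iff(1)[OF c xU(1)] x i(1)[OF xU(1)] by (auto simp: a_def)
 have aC: "a \<in> cball (Ph p) (2 * rh)" using xU(2) pos by auto
 then have aV: "a \<in> V" using V by blast
 have C: "a + h \<in> cball (Ph p) (2 * rh)" if "norm h <= rh" for h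
 proof -
  have "dist (Ph p) (a + h) <= dist (Ph p) a + dist a (a + h)" by (rule dist_triangle)
  also have "... <= rh + rh" using xU(2) that by (intro add_mono) (auto simp: dist_norm)
  finally show ?thesis by simp
 qed
 have linD: "linear (D Ps a)" by (rule chart_linear(2)[OF c aV])
 have injD: "inj_on (D Ps a) (span B)" by (rule inj_on_subset[OF chart_D_inj(1)[OF c aV]]) simp
 obtain J where J: "orthogonal_transformation J" "J ` span B = D Ps a ` span B"
  using orthogonal_onto_subspace[OF B linD injD] by blast
 obtain J' where J': "linear J'" "J' \<circ> J = id" "J \<circ> J' = id"
  using linear_injective_isomorphism[OF orthogonal_transformation_linear[OF J(1)] orthogonal_transformation_inj[OF J(1)]]
  by (auto simp: fun_eq_iff)
 have JJ: "J' (J v) = v" "J (J' v) = v" for v using J'(2,3) by (auto simp: fun_eq_iff)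
 have nJ: "norm (J v) = norm v" "norm (J' v) = norm v" for v
  using orthogonal_transformation_norm[OF J(1)] JJ by metis+
 have J'L: "J' (D Ps a h) \<in> span B" if "h \<in> span B" for h
 proof -
  have "D Ps a h \<in> J ` span B" using that J(2) by blast
  then show ?thesis using JJ by auto
 qed
 have linJ': "linear J'" by (rule J')
 \<comment> \<open>The origin of the constant: for \<open>norm h <= 2 * K * s\<close> the second
   order remainder is at most \<open>4 * K ^ 3 * s\<^sup>2\<close>, and \<open>s\<close> is chosen
   so that this error and an orthogonal tangential part of length \<open>s\<close> fit into radius
   \<open>t\<close>, which is \<open>st2\<close>.\<close>
 define s where "s = t - 16 * K ^ 6 * t ^ 3"
 have K0: "K > 0" using pos by simp
 have st: "0 < s" "s <= t"
 proof -
  have "t * (16 * K ^ 6 * t\<^sup>2) < t * 1" using t by (intro mult_strict_left_mono) auto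
  then show "0 < s" by (simp add: s_def power2_eq_square power3_eq_cube mult_ac)
  show "s <= t" using t K0 by (simp add: s_def)
 qed
 have st2: "s\<^sup>2 + (4 * K ^ 3 * s\<^sup>2)\<^sup>2 <= t\<^sup>2"
 proof -
  define C where "C = 16 * K ^ 6"
  have C0: "C * t\<^sup>2 <= 1" "0 <= C" using t K0 by (auto simp: C_def)
  have "s\<^sup>2 <= t\<^sup>2" using st by (intro power_mono) auto
  then have "(s\<^sup>2)\<^sup>2 <= (t\<^sup>2)\<^sup>2" by (rule power_mono) auto
  then have "(4 * K ^ 3 * s\<^sup>2)\<^sup>2 <= C * t ^ 4" using K0 by (simp add: C_def power_mult_distrib)
  moreover have "s\<^sup>2 = t\<^sup>2 - 2 * C * t ^ 4 + C * t ^ 4 * (C * t\<^sup>2)"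
   by (simp add: s_def C_def power2_eq_square power3_eq_cube power4_eq_xxxx algebra_simps)
  moreover have "C * t ^ 4 * (C * t\<^sup>2) <= C * t ^ 4 * 1" using C0 by (intro mult_left_mono) auto
  ultimately show ?thesis by linarith
 qed
 define A where "A = {a' \<in> span B. a' \<in> cball a (2 * K * t) \<and> Ps a' \<in> cball x t}"
 have AC: "a' \<in> cball (Ph p) (2 * rh)" if "a' \<in> cball a (2 * K * t)" for a'
  using C[of "a' - a"] that t(3) by (auto simp: dist_norm norm_minus_commute)
 have AV: "A \<subseteq> V Int span B" using AC V by (auto simp: A_def)
 have compA: "compact A"
 proof -
  have "cball a (2 * K * t) \<subseteq> V" using AC V by blast
  then have "closed (cball a (2 * K * t) Int Ps -` cball x t)"
   by (intro continuous_closed_preimage continuous_on_subset[OF chart_continuous(2)[OF c]]) auto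
  then have "compact (span B Int cball a (2 * K * t) Int (cball a (2 * K * t) Int Ps -` cball x t))"
   using closed_span_Basis[OF B] by (intro compact_Int_closed closed_Int_compact) auto
  moreover have "span B Int cball a (2 * K * t) Int (cball a (2 * K * t) Int Ps -` cball x t) = A" by (auto simp: A_def)
  ultimately show ?thesis by simp
 qed
 then have Ab: "A \<in> sets borel" by (rule borel_compact)
 define S where "S = slab B Int proj B -` A"
 \<comment> \<open>The tangential projection in full dimension: \<open>J'\<close> turns the tangent
   space at \<open>x\<close> into \<open>span B\<close>, the projection acts there, and the slab
   coordinates are kept.\<close>
 define G where "G z = proj B (J' (Ps (proj B z) - x)) + (z - proj B z)" for z
 define G' where "G' z w = proj B (J' (D Ps (proj B z) (proj B w))) + (w - proj B w)" for z w
 have compS: "compact S"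
 proof -
  have "bounded S"
  proof -
   obtain M where M: "!!z. z \<in> A ==> norm z <= M" using compact_imp_bounded[OF compA] by (auto simp: bounded_iff)
   have "norm z <= (\<Sum>b\<in>(Basis :: (real^'d) set). max M 1)" if z: "z \<in> S" for z
   proof (rule order_trans[OF norm_le_l1], rule sum_mono)
    fix b :: "real^'d" assume b: "b \<in> Basis"
    show "\<bar>z \<bullet> b\<bar> <= max M 1"
    proof (cases "b \<in> B")
     case True
     then have "\<bar>z \<bullet> b\<bar> = \<bar>proj B z \<bullet> b\<bar>" using inner_proj[OF B b, of z] by simp
     also have "... <= M" using Basis_le_norm[OF b, of "proj B z"] M[of "proj B z"] z by (auto simp: S_def)
     finally show ?thesis by simp
    next
     case False
     then have "0 <= z \<bullet> b" "z \<bullet> b <= 1" using z b by (auto simp: S_def slab_def)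
     then show ?thesis by simp
    qed
   qed
   then show ?thesis by (auto simp: bounded_iff)
  qed
  moreover have "closed S"
  proof -
   have "closed (slab B)"
   proof -
    have "slab B = (\<Inter>b\<in>Basis - B. {z. 0 <= z \<bullet> b} Int {z. z \<bullet> b <= 1})" by (auto simp: slab_def)
    also have "closed ..."
     by (intro closed_INT closed_Int ballI) (auto intro!: closed_Collect_le continuous_intros)
    finally show ?thesis .
   qed
   moreover have "closed (proj B -` A)"
    using compact_imp_closed[OF compA] continuous_on_proj[OF continuous_on_id, of UNIV B] by (simp add: continuous_on_closed_vimage)
   ultimately show ?thesis by (simp add: S_def closed_Int)
  qed
  ultimately show ?thesis by (simp add: compact_eq_bounded_closed)
 qed
 have contG: "continuous_on S G"
 proof -
  have "continuous_on (proj B ` S) Ps"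
   using AV by (intro continuous_on_subset[OF chart_continuous(2)[OF c]]) (auto simp: S_def)
  then have "continuous_on S (\<lambda>z. Ps (proj B z))"
   by (intro continuous_on_compose2[of "proj B ` S" Ps S "proj B"] continuous_on_proj) auto
  then show ?thesis
   unfolding G_def
   by (intro continuous_on_add continuous_on_diff continuous_on_proj continuous_on_id continuous_on_const
     linear_continuous_on_compose[OF _ linJ'])
 qed
 have derG: "(G has_derivative G' z) (at z within S)" if z: "z \<in> S" for z
 proof -
  have "proj B z \<in> V" using z AV by (auto simp: S_def)
  from has_derivative_compose[OF has_derivative_proj chart_derivative(2)[OF c this]]
  have "((\<lambda>z. Ps (proj B z)) has_derivative (\<lambda>w. D Ps (proj B z) (proj B w))) (at z within S)" .
  then have "((\<lambda>z. Ps (proj B z) - x) has_derivative (\<lambda>w. D Ps (proj B z) (proj B w))) (at z within S)"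
   by (auto intro!: derivative_eq_intros)
  from has_derivative_compose[OF has_derivative_compose[OF this linear_imp_has_derivative[OF linJ']] has_derivative_proj]
  show ?thesis unfolding G_def G'_def
   by (intro has_derivative_add has_derivative_diff has_derivative_ident has_derivative_proj)
 qed
 \<comment> \<open>Projections do not increase length, so \<open>G' z\<close> shortens every vector
   compared with the completion \<open>N\<close> of the derivative of \<open>Ps\<close>, and the
   determinant of \<open>N\<close> is the density up to sign.\<close>
 have detG: "\<bar>det (matrix (G' z))\<bar> <= sqrt (gram_det B Ps (proj B z))" if z: "z \<in> S" for z
 proof -
  let ?b = "proj B z"
  have bV: "?b \<in> V" using z AV by (auto simp: S_def)
  note L = chart_linear(2)[OF c bV] and Li = inj_on_subset[OF chart_D_inj(1)[OF c bV] subset_UNIV, of "span B"]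
  obtain N where N: "normal_extension B (D Ps ?b) N" using normal_extension_exists[OF B L Li] by blast
  have linN: "linear N" using N by (simp add: normal_extension_def)
  have N1: "N v = D Ps ?b v" if "v \<in> span B" for v
   using linear_eq_on_span_Basis[OF linN L _ that] N by (auto simp: normal_extension_def)
  have N2: "N v \<bullet> N w = v \<bullet> w" if w: "w \<in> span (Basis - B)" for v w
  proof -
   have "subspace {w. N v \<bullet> N w = v \<bullet> w}"
    using linN by (auto simp: subspace_def linear_0 linear_add linear_scale inner_add_right)
   moreover have "N v \<bullet> N w = v \<bullet> w" if w: "w \<in> Basis - B" for w
   proof -
    have "N v = (\<Sum>b\<in>Basis. (v \<bullet> b) *\<^sub>R N b)"
     by (subst (1) euclidean_representation[of v, symmetric]) (simp only: linear_sum[OF linN] linear_scale[OF linN])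
    then have "N v \<bullet> N w = (\<Sum>b\<in>Basis. (v \<bullet> b) * (N b \<bullet> N w))" by (simp add: inner_sum_left)
    also have "... = (\<Sum>b\<in>Basis. (v \<bullet> b) * (if b = w then 1 else 0))"
     using N w by (intro sum.cong refl) (auto simp: normal_extension_def)
    also have "... = v \<bullet> w" using w by (simp add: if_distrib cong: if_cong)
    finally show ?thesis .
   qed
   ultimately show ?thesis using span_induct[OF w, of "\<lambda>w. N v \<bullet> N w = v \<bullet> w"] by blast
  qed
  have comp: "v - proj B v \<in> span (Basis - B)" for v
   using B by (subst span_iff) (auto simp: inner_diff_left inner_proj subset_iff)
  have linG': "linear (G' z)"
   unfolding G'_def using linear_proj[of B] linJ' L
   by (auto intro!: linearI simp: linear_add linear_scale algebra_simps)
  have le: "norm (G' z v) <= norm (N v)" for v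
  proof -
   let ?y = "D Ps ?b (proj B v)"
   have p: "proj B (G' z v) = proj B (J' ?y)"
    using linear_proj[of B] B by (simp add: G'_def linear_add linear_diff proj_proj)
   have q: "G' z v - proj B (J' ?y) = v - proj B v" by (simp add: G'_def)
   have "(norm (G' z v))\<^sup>2 = (norm (proj B (J' ?y)))\<^sup>2 + (norm (v - proj B v))\<^sup>2"
    using norm_proj_Pythagoras[OF B, of "G' z v"] by (simp only: p q)
   also have "... <= (norm ?y)\<^sup>2 + (norm (v - proj B v))\<^sup>2"
    using norm_proj_Pythagoras[OF B, of "J' ?y"] by (simp add: nJ)
   also have "... = (norm (N v))\<^sup>2"
   proof -
    have "N v = N (proj B v) + N (v - proj B v)" by (simp add: linear_add[OF linN, symmetric])
    moreover have "N (proj B v) \<bullet> N (v - proj B v) = proj B v \<bullet> (v - proj B v)" by (rule N2[OF comp])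
    moreover have "proj B v \<bullet> (v - proj B v) = 0"
     using norm_proj_Pythagoras[OF B, of v] by (simp add: power2_norm_eq_inner inner_diff_left inner_diff_right inner_commute)
    moreover have "(norm (N (v - proj B v)))\<^sup>2 = (norm (v - proj B v))\<^sup>2"
     using N2[OF comp[of v], of "v - proj B v"] by (simp add: power2_norm_eq_inner)
    ultimately show ?thesis
     using norm_add_Pythagorean[of "N (proj B v)" "N (v - proj B v)"] N1[OF proj_span[OF B], of v] by (simp add: orthogonal_def)
   qed
   finally show ?thesis by (simp add: power2_le_iff_abs_le)
  qed
  have "\<bar>det (matrix (G' z))\<bar> <= \<bar>det (matrix N)\<bar>"
   by (rule abs_det_le_of_norm_le[OF linG' linN normal_extension_inj[OF B L Li N] le])
  also have "... = sqrt (gram_det B Ps ?b)"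
   unfolding gram_det_eq gram_normal_extension[OF B N] by simp
  finally show ?thesis .
 qed
 \<comment> \<open>For a tangential target \<open>u\<close>, a parameter \<open>h\<close> for which
   the tangential component of \<open>Ps (a + h) - x\<close> is \<open>u\<close> is a fixed point of
   the map \<open>T\<close>, provided by Brouwer's theorem on the ball of radius \<open>e\<close> in
   \<open>span B\<close>.\<close>
 have cover: "slab B Int proj B -` cball 0 s \<subseteq> G ` S"
 proof
  fix w assume w: "w \<in> slab B Int proj B -` cball 0 s"
  define u where "u = proj B w"
  have u: "norm u <= s" "u \<in> span B" using w proj_span[OF B] by (auto simp: u_def)
  define R where "R h = Ps (a + h) - x - D Ps a h" for h
  define e where "e = 2 * K * s"
  have e: "0 < e" "e <= 2 * K * t" "e <= rh" using st K0 t by (auto simp: e_def intro: order_trans[rotated])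
  have R: "norm (R h) <= K * (norm h)\<^sup>2" if "norm h <= e" for h
   using lin[OF aC C[of h]] that e by (simp add: R_def Psa)
  define T where "T h = D Ph x (J (u - proj B (J' (R h))))" for h
  have Tspan: "T h \<in> span B" and LT: "D Ps a (T h) = J (u - proj B (J' (R h)))" for h
  proof -
   have "u - proj B (J' (R h)) \<in> span B" using u(2) by (intro span_diff proj_span[OF B])
   then obtain k where k: "k \<in> span B" "J (u - proj B (J' (R h))) = D Ps a k" using J(2) by blast
   then have "T h = k" using chart_D_inverse(1)[OF c aV, of k] by (simp add: T_def Psa)
   then show "T h \<in> span B" "D Ps a (T h) = J (u - proj B (J' (R h)))" using k by auto
  qed
  have nT: "norm (T h) <= e" if h: "norm h <= e" for h
  proof -
   have "norm (proj B (J' (R h))) <= norm (R h)"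
    using norm_proj_Pythagoras[OF B, of "J' (R h)"] nJ(2)[of "R h"]
    by (metis abs_le_square_iff abs_norm_cancel le_add_same_cancel1 zero_le_power2)
   also have "... <= K * e\<^sup>2" using R[OF h] h K0 by (meson mult_left_mono order_trans power_mono norm_ge_zero less_imp_le)
   finally have 1: "norm (u - proj B (J' (R h))) <= s + K * e\<^sup>2" using norm_triangle_ineq4[of u "proj B (J' (R h))"] u by linarith
   have "norm (T h) <= K * norm (D Ps a (T h))" by (rule DK[OF aC])
   also have "... <= K * (s + K * e\<^sup>2)" unfolding LT nJ by (rule mult_left_mono[OF 1]) (use K0 in simp)
   \<comment> \<open>Since \<open>e = 2 * K * s\<close>, the condition
     \<open>4 * K ^ 3 * t <= 1\<close> is what keeps \<open>T\<close> inside the ball of radius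
     \<open>e\<close>.\<close>
   also have "... = K * s + K * s * (4 * K ^ 3 * s)" by (simp add: e_def power2_eq_square power3_eq_cube algebra_simps)
   also have "... <= K * s + K * s * 1"
   proof -
    have "4 * K ^ 3 * s <= 4 * K ^ 3 * t" using st K0 by simp
    then have "4 * K ^ 3 * s <= 1" using t(2) by linarith
    then show ?thesis using st K0 by (intro add_left_mono mult_left_mono) auto
   qed
   finally show ?thesis by (simp add: e_def)
  qed
  have contT: "continuous_on (span B Int cball 0 e) T"
  proof -
   have "(\<lambda>h. a + h) ` (span B Int cball 0 e) \<subseteq> V" using C e V by fastforce
   then have "continuous_on (span B Int cball 0 e) (\<lambda>h. Ps (a + h))"
    by (intro continuous_on_compose2[OF chart_continuous(2)[OF c]] continuous_intros)
   then have "continuous_on (span B Int cball 0 e) R"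
    unfolding R_def by (intro continuous_intros linear_continuous_on_compose[OF continuous_on_id linD, simplified])
   then show ?thesis
    unfolding T_def
    by (intro linear_continuous_on_compose[OF _ chart_linear(1)[OF c xU(1)]]
     linear_continuous_on_compose[OF _ orthogonal_transformation_linear[OF J(1)]] continuous_intros continuous_on_proj
     linear_continuous_on_compose[OF _ linJ'])
  qed
  obtain h where h: "h \<in> span B Int cball 0 e" "T h = h"
  proof (rule brouwer[of "span B Int cball 0 e" T])
   show "compact (span B Int cball 0 e)" using closed_span_Basis[OF B] by (intro closed_Int_compact) auto
   show "convex (span B Int cball 0 e)" by (intro convex_Int subspace_imp_convex subspace_span convex_cball)
   show "span B Int cball 0 e \<noteq> {}" using span_zero e by force
   show "T \<in> span B Int cball 0 e \<rightarrow> span B Int cball 0 e" using Tspan nT by auto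
  qed (use contT in auto)
  have nh: "norm h <= e" using h by simp
  have "D Ps a h = J (u - proj B (J' (R h)))" using LT[of h] h by simp
  then have J'h: "J' (D Ps a h) = u - proj B (J' (R h))" by (simp add: JJ)
  have y: "J' (Ps (a + h) - x) = u + (J' (R h) - proj B (J' (R h)))"
  proof -
   have "Ps (a + h) - x = D Ps a h + R h" by (simp add: R_def)
   then show ?thesis by (simp add: linear_add[OF linJ'] J'h)
  qed
  have proj_y: "proj B (J' (Ps (a + h) - x)) = u"
   unfolding y using linear_proj[of B] B by (simp add: linear_add linear_diff proj_proj proj_id[OF B u(2)])
  have "norm (Ps (a + h) - x) <= t"
  proof -
   have "norm (J' (R h) - proj B (J' (R h))) <= norm (R h)"
    using norm_proj_Pythagoras[OF B, of "J' (R h)"] nJ(2)[of "R h"]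
    by (metis abs_le_square_iff abs_norm_cancel le_add_same_cancel2 zero_le_power2)
   also have "... <= K * e\<^sup>2" using R[OF nh] nh K0 by (meson mult_left_mono order_trans power_mono norm_ge_zero less_imp_le)
   also have "... = 4 * K ^ 3 * s\<^sup>2" by (simp add: e_def power2_eq_square power3_eq_cube)
   finally have "(norm (J' (R h) - proj B (J' (R h))))\<^sup>2 <= (4 * K ^ 3 * s\<^sup>2)\<^sup>2" by (intro power_mono) auto
   moreover have "(norm u)\<^sup>2 <= s\<^sup>2" using u by (intro power_mono) auto
   moreover have "(norm (Ps (a + h) - x))\<^sup>2 = (norm u)\<^sup>2 + (norm (J' (R h) - proj B (J' (R h))))\<^sup>2"
    using norm_proj_Pythagoras[OF B, of "J' (Ps (a + h) - x)"] unfolding proj_y nJ unfolding y by simp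
   ultimately have "(norm (Ps (a + h) - x))\<^sup>2 <= t\<^sup>2" using st2 by linarith
   then show ?thesis using t(1) by (simp add: power2_le_iff_abs_le)
  qed
  then have hA: "a + h \<in> A"
   using h aS e(2) nh by (auto simp: A_def span_add dist_norm norm_minus_commute)
  \<comment> \<open>The preimage of \<open>w\<close> under \<open>G\<close> has the slab coordinates
    of \<open>w\<close> and the subspace part \<open>a + h\<close>.\<close>
  define z where "z = a + h + (w - u)"
  have pz: "proj B z = a + h"
   using linear_proj[of B] B aS h(1)
   by (simp add: z_def linear_add linear_diff u_def proj_proj proj_id span_add)
  have "z \<in> slab B"
  proof -
   have "(a + h) \<bullet> b = 0" "u \<bullet> b = 0" if "b \<in> Basis - B" for b
    using that span_iff[OF B] aS h(1) u(2) by (auto simp: inner_add_left)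
   then show ?thesis using w by (auto simp: slab_def z_def inner_add_left inner_diff_left)
  qed
  then have "z \<in> S" using pz hA by (simp add: S_def)
  moreover have "G z = w" unfolding G_def pz proj_y by (simp add: z_def)
  ultimately show "w \<in> G ` S" by blast
 qed
 have "ennreal (unit_ball_vol m * s ^ m) = emeasure (lborel_span B) (cball 0 s)"
  using emeasure_lborel_span_cball[OF B st(1)] chart_card[OF c] by simp
 also have "... = emeasure lborel (slab B Int proj B -` cball 0 s)" by (rule emeasure_lborel_span[OF B]) simp
 also have GS: "compact (G ` S)" by (rule compact_continuous_image[OF contG compS])
 have "emeasure lborel (slab B Int proj B -` cball 0 s) <= emeasure lborel (G ` S)"
  by (rule emeasure_mono[OF cover]) (use borel_compact[OF GS] in simp)
 also have "... <= (\<integral>\<^sup>+z\<in>S. ennreal \<bar>det (matrix (G' z))\<bar> \<partial>lborel)"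
  by (rule emeasure_image_le_integral_det[OF borel_compact[OF compS] derG borel_compact[OF GS]])
 also have "... <= (\<integral>\<^sup>+z\<in>S. ennreal (sqrt (gram_det B Ps (proj B z))) \<partial>lborel)"
  by (rule nn_integral_mono) (use detG in \<open>auto split: split_indicator intro!: ennreal_leI\<close>)
 also have "... = (\<integral>\<^sup>+a\<in>A. ennreal (sqrt (gram_det B Ps a)) \<partial>lborel_span B)"
  unfolding S_def by (rule set_nn_integral_lborel_span[OF B Ab, symmetric])
   (use measurable_gram_det[OF c Ab] AV in auto)
 also have "... = emeasure (ivol m X) (Ps ` A)"
  by (rule emeasure_ivol_chart[OF X c Ab AV, symmetric])
 also have "... <= emeasure (ivol m X) (X Int cball x t)"
 proof (rule emeasure_mono)
  show "Ps ` A \<subseteq> X Int cball x t" using chart_borel_image(2)[OF c borel_X[OF X] Ab AV] by (auto simp: A_def)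
  show "X Int cball x t \<in> sets (ivol m X)" using sets_ivol[OF X] borel_X[OF X] by auto
 qed
 finally show ?thesis by (simp add: s_def)
qed

text \<open>The uniform constants come from compactness through \<open>compact_uniform_nat\<close>.
  The condition \<open>C * t0\<^sup>2 <= 1\<close> keeps \<open>t - C * t ^ 3\<close> nonnegative,
  so that its powers behave monotonically.\<close>

lemma emeasure_ivol_ball_ge:
 fixes X :: "(real^'d) set"
 assumes X: "compact X" "submanifold 2 m X"
 obtains C t0 where "C > 0" "t0 > 0" "C * t0\<^sup>2 <= 1"
  "!!x t. x \<in> X ==> 0 < t ==> t <= t0 ==>
   emeasure (ivol m X) (X Int cball x t) \<ge> ennreal (unit_ball_vol m * (t - C * t ^ 3) ^ m)"
proof -
 have chX: "charted m X" by (rule charted_submanifold[OF X(2)]) simp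
 define Q where "Q N x \<longleftrightarrow> (\<forall>t. 0 < t \<and> t <= 1 / real (Suc N) -->
   emeasure (ivol m X) (X Int cball x t) \<ge> ennreal (unit_ball_vol m * (t - real N * t ^ 3) ^ m))" for N x
 have nn: "0 <= t - real N * t ^ 3" if t: "0 < t" "t <= 1 / real (Suc N)" for N :: nat and t :: real
 proof -
  have 1: "real (Suc N) * t <= 1" using t by (simp add: field_simps)
  have 2: "t <= 1" using order_trans[OF t(2)] by simp
  have "real N * t * t <= 1 * 1"
   by (rule mult_mono) (use 1 2 t in \<open>auto simp: algebra_simps\<close>)
  then have "t * (real N * t * t) <= t * 1" using t by (intro mult_left_mono) auto
  then show ?thesis by (simp add: power3_eq_cube mult_ac)
 qed
 have loc: "\<exists>de>0. \<exists>N::nat. \<forall>x\<in>X Int ball p de. Q N x" if p: "p \<in> X" for p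
 proof -
  obtain B U V Ph Ps rh de K where g: "good_chart m X p B U V Ph Ps rh de K"
   using good_chart_exists[OF X(2) p] by blast
  then have pos: "0 < rh" "0 < de" "1 <= K" by (auto simp: good_chart_def)
  \<comment> \<open>One natural number bounds the constants of all smallness conditions of
    \<open>emeasure_ivol_ball_ge_aux\<close>.\<close>
  obtain N :: nat where N: "16 * K ^ 6 + 4 * K ^ 3 + 2 * K / rh <= N" using real_arch_simple by blast
  have nn': "0 <= 16 * K ^ 6" "0 <= 4 * K ^ 3" "0 <= 2 * K / rh" using pos by auto
  have sum3: "a + b + c <= n ==> 0 <= a ==> 0 <= b ==> 0 <= c ==> a <= n \<and> b <= n \<and> c <= n" for a b c n :: real
   by linarith
  note N' = sum3[OF N nn']
  have "Q N x" if x: "x \<in> X Int ball p de" for x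
   unfolding Q_def
  proof (intro allI impI)
   fix t :: real assume t: "0 < t \<and> t <= 1 / real (Suc N)"
   have *: "c * t < 1" if "c <= real N" for c
   proof -
    have "c * t <= real N * t" using that t by (intro mult_right_mono) auto
    also have "... < real (Suc N) * t" using t by simp
    also have "... <= 1" using t by (simp add: field_simps)
    finally show ?thesis .
   qed
   have a1: "16 * K ^ 6 * t < 1" by (rule *) (use N' in blast)
   have a2: "4 * K ^ 3 * t < 1" by (rule *) (use N' in blast)
   have a3: "2 * K / rh * t < 1" by (rule *) (use N' in blast)
   have "t <= 1" using order_trans[of t "1 / real (Suc N)" 1] t by simp
   then have "16 * K ^ 6 * t * t <= 16 * K ^ 6 * t * 1" using nn' t by (intro mult_left_mono) auto
   then have a4: "16 * K ^ 6 * t\<^sup>2 < 1" using a1 by (simp add: power2_eq_square mult.assoc)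
   have "ennreal (unit_ball_vol m * (t - real N * t ^ 3) ^ m) <= ennreal (unit_ball_vol m * (t - 16 * K ^ 6 * t ^ 3) ^ m)"
   proof (intro ennreal_leI mult_left_mono power_mono)
    have "16 * K ^ 6 * t ^ 3 <= real N * t ^ 3" using N' t by (intro mult_right_mono) auto
    then show "t - real N * t ^ 3 <= t - 16 * K ^ 6 * t ^ 3" by simp
   qed (use nn[of t N] t in auto)
   also have "... <= emeasure (ivol m X) (X Int cball x t)"
   proof (rule emeasure_ivol_ball_ge_aux[OF X(1) chX g x])
    show "2 * K * t <= rh" using a3 pos by (simp add: field_simps)
   qed (use a2 a4 t in auto)
   finally show "ennreal (unit_ball_vol m * (t - real N * t ^ 3) ^ m) <= emeasure (ivol m X) (X Int cball x t)" .
  qed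
  then show ?thesis using pos(2) by blast
 qed
 have mono: "Q M x" if "N <= M" "Q N x" for N M x
  unfolding Q_def
 proof (intro allI impI)
  fix t :: real assume t: "0 < t \<and> t <= 1 / real (Suc M)"
  have le: "1 / real (Suc M) <= 1 / real (Suc N)" using that(1) by (intro divide_left_mono) auto
  have "ennreal (unit_ball_vol m * (t - real M * t ^ 3) ^ m) <= ennreal (unit_ball_vol m * (t - real N * t ^ 3) ^ m)"
   using nn[of t M] t that(1) by (intro ennreal_leI mult_left_mono power_mono) (auto intro!: mult_right_mono)
  also have "... <= emeasure (ivol m X) (X Int cball x t)"
   using that(2) t le unfolding Q_def by auto
  finally show "ennreal (unit_ball_vol m * (t - real M * t ^ 3) ^ m) <= emeasure (ivol m X) (X Int cball x t)" .
 qed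
 obtain N where N: "!!x. x \<in> X ==> Q N x"
 proof (rule compact_uniform_nat[where X = X and Q = Q])
  show "compact X" by (rule X(1))
  show "\<exists>de>0. \<exists>N. \<forall>x\<in>X Int ball p de. Q N x" if "p \<in> X" for p by (rule loc[OF that])
  show "Q M x" if "N <= M" "Q N x" for N M x by (rule mono[OF that])
 qed (rule that)
 \<comment> \<open>Passing to the successor makes the constant positive.\<close>
 have N': "Q (Suc N) x" if "x \<in> X" for x by (rule mono[OF _ N[OF that]]) simp
 show thesis
 proof (rule that[of "real (Suc N)" "1 / real (Suc (Suc N))"])
  show "real (Suc N) * (1 / real (Suc (Suc N)))\<^sup>2 <= 1"
   by (simp add: power2_eq_square divide_simps) (simp add: algebra_simps)
  show "ennreal (unit_ball_vol m * (t - real (Suc N) * t ^ 3) ^ m) <= emeasure (ivol m X) (X Int cball x t)"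
   if "x \<in> X" "0 < t" "t <= 1 / real (Suc (Suc N))" for x t
   using N'[OF that(1)] that unfolding Q_def by blast
 qed auto
qed

section \<open>Order of the distance distribution at 0 and the dimension\<close>

lemma distance_distribution_eq_nn_integral:
 fixes X :: "(real^'d) set"
 assumes X: "compact X" "charted m X"
 shows "distance_distribution m X t = (\<integral>\<^sup>+x. emeasure (ivol m X) (X Int cball x t) \<partial>ivol m X)"
proof -
 have "distance_distribution m X t = double_integral m X (indicator {..t})"
  unfolding double_integral_eq_distr[OF X borel_measurable_indicator[OF atMost_borel]]
  by (simp add: distance_distribution_eq[OF X])
 also have "... = (\<integral>\<^sup>+x. emeasure (ivol m X) (X Int cball x t) \<partial>ivol m X)"
  unfolding double_integral_def
 proof (rule nn_integral_cong)
  fix x assume "x \<in> space (ivol m X)"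
  have "(\<integral>\<^sup>+y. indicator {..t} (dist x y) \<partial>ivol m X) = (\<integral>\<^sup>+y. indicator (X Int cball x t) y \<partial>ivol m X)"
   by (rule nn_integral_cong) (auto simp: space_ivol[OF X] split: split_indicator)
  also have "... = emeasure (ivol m X) (X Int cball x t)"
   by (rule nn_integral_indicator) (use sets_ivol[OF X] borel_X[OF X] in auto)
  finally show "(\<integral>\<^sup>+y. indicator {..t} (dist x y) \<partial>ivol m X) = emeasure (ivol m X) (X Int cball x t)" .
 qed
 finally show ?thesis .
qed

text \<open>Growth of order exactly \<open>m\<close> at 0; the exponent is the invariant that
  recovers the dimension, for bodies and submanifolds alike.\<close>

definition power_order :: "nat => (real => ennreal) => bool" where
 "power_order m f \<longleftrightarrow> (\<exists>c C t0. 0 < c \<and> 0 < t0 \<and>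
   (\<forall>t. 0 < t \<and> t <= t0 --> ennreal (c * t ^ m) <= f t \<and> f t <= ennreal (C * t ^ m)))"

lemma power_orderI:
 assumes "0 < c" "0 < t0" "!!t. 0 < t ==> t <= t0 ==> ennreal (c * t ^ m) <= f t"
  "!!t. 0 < t ==> t <= t0 ==> f t <= ennreal (C * t ^ m)"
 shows "power_order m f"
 unfolding power_order_def using assms by blast

lemma power_order_le:
 assumes f: "power_order m f" and g: "power_order n g" and eq: "!!t. 0 < t ==> f t = g t"
 shows "n <= m"
proof (rule ccontr)
 assume "\<not> n <= m"
 then have mn: "m < n" by simp
 obtain c t1 where c: "0 < c" "0 < t1" "!!t. 0 < t ==> t <= t1 ==> ennreal (c * t ^ m) <= f t"
  using f by (auto simp: power_order_def)
 obtain C t2 where C: "0 < t2" "!!t. 0 < t ==> t <= t2 ==> g t <= ennreal (C * t ^ n)"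
  using g by (auto simp: power_order_def)
 define C' where "C' = \<bar>C\<bar> + 1"
 \<comment> \<open>At this \<open>t\<close> the two bounds give \<open>c <= C' * t\<close>, while
   the choice makes \<open>C' * t\<close> at most \<open>c / 2\<close>.\<close>
 define t where "t = min (min t1 t2) (min 1 (c / (2 * C')))"
 have C': "C' > 0" "C <= C'" by (auto simp: C'_def)
 have t: "0 < t" "t <= t1" "t <= t2" "t <= 1" "t <= c / (2 * C')" using c C C' by (auto simp: t_def)
 have "ennreal (c * t ^ m) <= ennreal (C * t ^ n)"
  using order_trans[OF c(3)[of t]] C(2)[of t] t eq[of t] by auto
 also have "... <= ennreal (C' * t ^ n)" using C' t by (intro ennreal_leI mult_right_mono) auto
 finally have "c * t ^ m <= C' * t ^ n" using C' t by (simp add: ennreal_le_iff)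
 also have "t ^ n <= t ^ Suc m" using mn t by (intro power_decreasing) auto
 then have "C' * t ^ n <= C' * t ^ Suc m" using C' by simp
 finally have "c <= C' * t" using t(1) by simp
 also have "... <= c / 2" using t(5) C' by (simp add: field_simps)
 finally show False using c(1) by simp
qed

lemma power_order_unique:
 "power_order m f ==> power_order n g ==> (!!t. 0 < t ==> f t = g t) ==> m = n"
 by (rule order_antisym) (simp_all add: power_order_le)

lemma emeasure_ivol_eq_measure:
 fixes X :: "(real^'d) set"
 assumes X: "compact X" "charted m X"
 shows "emeasure (ivol m X) E = ennreal (measure (ivol m X) E)"
 using finite_measure.emeasure_eq_measure[OF finite_ivol[OF X]] .

lemma power_order_submanifold:
 fixes X :: "(real^'d) set"
 assumes X: "compact X" "submanifold 2 m X" and V: "measure (ivol m X) X > 0"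
 shows "power_order m (distance_distribution m X)"
proof -
 have X': "compact X" "charted m X" using X charted_submanifold[OF X(2)] by auto
 let ?V = "measure (ivol m X) X"
 have const: "(\<integral>\<^sup>+x. ennreal c \<partial>ivol m X) = ennreal (c * ?V)" if "c \<ge> 0" for c
  using that by (simp add: emeasure_ivol_eq_measure[OF X'] space_ivol[OF X'] ennreal_mult)
 obtain C1 t1 where 1: "C1 > 0" "t1 > 0" "!!x t. x \<in> X ==> 0 < t ==> t <= t1 ==>
   emeasure (ivol m X) (X Int cball x t) <= ennreal (C1 * t ^ m)"
  using emeasure_ivol_ball_le[OF X] by metis
 obtain C2 t2 where 2: "C2 > 0" "t2 > 0" "!!x t. x \<in> X ==> 0 < t ==> t <= t2 ==>
   emeasure (ivol m X) (X Int cball x t) \<ge> ennreal (unit_ball_vol m * (t - C2 * t ^ 3) ^ m)"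
  using emeasure_ivol_ball_ge[OF X] by metis
 \<comment> \<open>The bounds by 1 and by \<open>1 / (2 * C2)\<close> keep the cubic loss below
   \<open>t / 2\<close>, so that \<open>(t / 2) ^ m\<close> is available as a lower bound.\<close>
 define t0 where "t0 = min (min t1 t2) (min 1 (1 / (2 * C2)))"
 have t0: "0 < t0" using 1 2 by (simp add: t0_def)
 show ?thesis
 proof (rule power_orderI[of "unit_ball_vol m * (1/2) ^ m * ?V" t0])
  fix t assume t: "0 < t" "t <= t0"
  then have t': "t <= t1" "t <= t2" "t <= 1" "t <= 1 / (2 * C2)" by (auto simp: t0_def)
  have "C2 * t <= 1 / 2" using t'(4) 2(1) by (simp add: field_simps)
  then have "C2 * t * t <= 1 / 2 * 1" using t t' 2(1) by (intro mult_mono) auto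
  then have "t * (C2 * t * t) <= t * (1 / 2)" using t by (intro mult_left_mono) auto
  then have half: "t / 2 <= t - C2 * t ^ 3" by (simp add: power3_eq_cube mult_ac)
  have "ennreal (unit_ball_vol m * (1/2) ^ m * ?V * t ^ m) = (\<integral>\<^sup>+x. ennreal (unit_ball_vol m * (t / 2) ^ m) \<partial>ivol m X)"
   using t by (subst const) (auto simp: power_divide mult_ac)
  also have "... <= distance_distribution m X t"
   unfolding distance_distribution_eq_nn_integral[OF X']
  proof (rule nn_integral_mono)
   fix x assume "x \<in> space (ivol m X)"
   then have x: "x \<in> X" by (simp add: space_ivol[OF X'])
   have "ennreal (unit_ball_vol m * (t / 2) ^ m) <= ennreal (unit_ball_vol m * (t - C2 * t ^ 3) ^ m)"
    using half t by (intro ennreal_leI mult_left_mono power_mono) auto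
   also have "... <= emeasure (ivol m X) (X Int cball x t)" by (rule 2(3)[OF x t(1) t'(2)])
   finally show "ennreal (unit_ball_vol m * (t / 2) ^ m) <= emeasure (ivol m X) (X Int cball x t)" .
  qed
  finally show "ennreal (unit_ball_vol m * (1/2) ^ m * ?V * t ^ m) <= distance_distribution m X t" .
  have "distance_distribution m X t <= (\<integral>\<^sup>+x. ennreal (C1 * t ^ m) \<partial>ivol m X)"
   unfolding distance_distribution_eq_nn_integral[OF X']
   using 1(3) t(1) t'(1) by (intro nn_integral_mono) (simp add: space_ivol[OF X'])
  also have "... = ennreal (C1 * ?V * t ^ m)" using t 1(1) by (subst const) (auto simp: mult_ac)
  finally show "distance_distribution m X t <= ennreal (C1 * ?V * t ^ m)" .
 qed (use t0 V in auto)
qed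

lemma distance_distribution_full:
 fixes X :: "(real^'d) set"
 assumes X: "compact X" "charted CARD('d) X"
 shows "distance_distribution CARD('d) X t = (\<integral>\<^sup>+x\<in>X. emeasure lborel (X Int cball x t) \<partial>lborel)"
proof -
 note Xb = borel_X[OF X]
 have "emeasure (restrict_space lborel X) (X Int cball x t) = emeasure lborel (X Int cball x t)" for x
  using Xb by (intro emeasure_restrict_space) auto
 then show ?thesis
  unfolding distance_distribution_eq_nn_integral[OF X] induced_volume_full[OF X]
  by (simp add: nn_integral_restrict_space Xb)
qed

text \<open>Points within \<open>e / 4\<close> of the centre of a ball of radius \<open>e\<close>
  inside \<open>W\<close> see a full ball of radius \<open>t\<close> for \<open>t <= e / 4\<close>;
  this set of positive volume gives the lower bound.\<close>

lemma power_order_body: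
 fixes X :: "(real^'d) set"
 assumes X: "compact X" "charted CARD('d) X" and W: "open W" "X = closure W" "X \<noteq> {}"
 shows "power_order CARD('d) (distance_distribution CARD('d) X)"
proof -
 note Xb = borel_X[OF X]
 let ?om = "unit_ball_vol CARD('d)"
 have ball: "emeasure lborel (cball x t) = ennreal (?om * t ^ CARD('d))" if "t \<ge> 0" for t and x :: "real^'d"
  using emeasure_cball[OF that, of x] by simp
 obtain p where "p \<in> W" using W by auto
 then obtain e where e: "e > 0" "ball p e \<subseteq> W" using W(1) open_contains_ball by blast
 have eX: "ball p e \<subseteq> X" using e(2) W(2) closure_subset by blast
 have VX: "emeasure lborel X < \<infinity>" using compact_imp_bounded[OF X(1)] by (rule emeasure_bounded_finite)
 show ?thesis
 proof (rule power_orderI[of "?om * (e / 4) ^ CARD('d) * ?om" "e / 4"])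
  fix t assume t: "0 < t" "t <= e / 4"
  have "ennreal (?om * (e / 4) ^ CARD('d) * ?om * t ^ CARD('d)) =
    (\<integral>\<^sup>+x. ennreal (?om * t ^ CARD('d)) * indicator (cball p (e / 4)) x \<partial>lborel)"
   using t e(1) ball[of "e / 4" p] by (simp add: nn_integral_cmult_indicator ennreal_mult[symmetric] mult_ac)
  also have "... <= (\<integral>\<^sup>+x\<in>X. emeasure lborel (X Int cball x t) \<partial>lborel)"
  proof (rule nn_integral_mono)
   fix x :: "real^'d"
   show "ennreal (?om * t ^ CARD('d)) * indicator (cball p (e / 4)) x <= emeasure lborel (X Int cball x t) * indicator X x"
   proof (cases "x \<in> cball p (e / 4)")
    case True
    have sub: "cball x t \<subseteq> ball p e"
    proof
     fix y assume "y \<in> cball x t"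
     then have "dist p y <= e / 4 + e / 4" using True t dist_triangle[of p y x] by auto
     then show "y \<in> ball p e" using e(1) by simp
    qed
    then have "X Int cball x t = cball x t" using eX by blast
    moreover have "x \<in> X" using sub t eX by fastforce
    ultimately show ?thesis using ball[of t x] t True by simp
   qed simp
  qed
  finally show "ennreal (?om * (e / 4) ^ CARD('d) * ?om * t ^ CARD('d)) <= distance_distribution CARD('d) X t"
   by (simp add: distance_distribution_full[OF X])
  have "distance_distribution CARD('d) X t <= (\<integral>\<^sup>+x. ennreal (?om * t ^ CARD('d)) * indicator X x \<partial>lborel)"
   unfolding distance_distribution_full[OF X]
  proof (intro nn_integral_mono mult_right_mono)
   fix x :: "real^'d"
   have "emeasure lborel (X Int cball x t) <= emeasure lborel (cball x t)" by (rule emeasure_mono) auto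
   then show "emeasure lborel (X Int cball x t) <= ennreal (?om * t ^ CARD('d))" using ball t by simp
  qed simp
  also have "... = ennreal (?om * t ^ CARD('d)) * emeasure lborel X" using Xb by (simp add: nn_integral_cmult_indicator)
  also have "... = ennreal (?om * measure lborel X * t ^ CARD('d))"
   using VX t by (simp add: emeasure_eq_ennreal_measure ennreal_mult[symmetric] mult_ac)
  finally show "distance_distribution CARD('d) X t <= ennreal (?om * measure lborel X * t ^ CARD('d))" .
 qed (use e in auto)
qed

text \<open>A point within \<open>t / 4\<close> of the boundary loses at least a ball of radius \<open>t / 4\<close>.\<close>

lemma distance_distribution_cball_le:
 fixes r t :: real
 assumes r: "r > 0" and t: "0 < t" "t <= r"
 defines "om \<equiv> unit_ball_vol CARD('n::finite)"
 shows "distance_distribution CARD('n) (cball (0 :: real^'n) r) t <=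
  ennreal (om * t ^ CARD('n) * (measure lborel (cball (0 :: real^'n) r) - om * r ^ (CARD('n) - 1) * t / 4 ^ (CARD('n) + 1)))"
proof -
 let ?B = "cball (0 :: real^'n) r" and ?n = "CARD('n)"
 have Y: "compact ?B" "charted CARD('n) ?B" using charted_cball[OF r] by auto
 have ball: "emeasure lborel (cball x s) = ennreal (om * s ^ ?n)" if "s \<ge> 0" for s and x :: "real^'n"
  using emeasure_cball[OF that, of x] by (simp add: om_def)
 have bal: "emeasure lborel (ball x s) = ennreal (om * s ^ ?n)" if "s \<ge> 0" for s and x :: "real^'n"
  using emeasure_ball[OF that, of x] by (simp add: om_def)
 have om: "om \<ge> 0" by (simp add: om_def)
 define A where "A = ?B - ball 0 (r - t / 4)"
 define a where "a = om * t ^ ?n"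
 define b where "b = om * (t / 4) ^ ?n"
 have ab: "0 <= b" "0 <= a" using t om by (auto simp: a_def b_def)
 have loss: "emeasure lborel (?B Int cball x t) + ennreal b * indicator A x <= ennreal a" if x: "x \<in> ?B" for x
 proof (cases "x \<in> A")
  case False
  have "emeasure lborel (?B Int cball x t) <= emeasure lborel (cball x t)" by (rule emeasure_mono) auto
  then show ?thesis using False t ball by (simp add: a_def)
 next
  case True
  then have x': "r - t / 4 <= norm x" "norm x <= r" by (auto simp: A_def)
  then have nx: "norm x > 0" using t r by linarith
  \<comment> \<open>Pushing \<open>x\<close> outward by \<open>t / 2\<close> makes room for a ball
    of radius \<open>t / 4\<close> that is outside the large ball but within distance
    \<open>t\<close> of \<open>x\<close>.\<close>
  define u where "u = t / 2 / norm x"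
  define y where "y = x + u *\<^sub>R x"
  have u: "u > 0" "u * norm x = t / 2" using nx t by (auto simp: u_def)
  have "y = (1 + u) *\<^sub>R x" by (simp add: y_def scaleR_add_left)
  then have "norm y = (1 + u) * norm x" using u(1) by simp
  then have ny: "norm y = norm x + t / 2" using u(2) by (simp add: distrib_right)
  have dy: "dist x y = t / 2" using u by (simp add: y_def dist_norm)
  have "z \<notin> ?B \<and> z \<in> cball x t" if z: "z \<in> ball y (t / 4)" for z
  proof -
   have "norm y <= norm z + dist y z" using norm_triangle_ineq[of z "y - z"] by (simp add: dist_norm)
   then have "norm z > r" using z ny x' by simp
   moreover have "dist x z <= t / 2 + t / 4" using dist_triangle[of x z y] dy z by simp
   ultimately show ?thesis using t by simp
  qed
  then have dis: "(?B Int cball x t) Int ball y (t / 4) = {}" and sub: "(?B Int cball x t) \<union> ball y (t / 4) \<subseteq> cball x t" by blast+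
  have "emeasure lborel (?B Int cball x t) + emeasure lborel (ball y (t / 4)) = emeasure lborel ((?B Int cball x t) \<union> ball y (t / 4))"
   by (rule plus_emeasure) (use dis in auto)
  also have "... <= emeasure lborel (cball x t)" by (rule emeasure_mono[OF sub]) simp
  finally show ?thesis using True t bal[of "t / 4" y] ball[of t x] by (simp add: a_def b_def)
 qed
 \<comment> \<open>A lower bound for the volume of the shell of width \<open>t / 4\<close>: in
   dimension \<open>n\<close>, the difference \<open>r ^ n - (r - t / 4) ^ n\<close> is at least
   \<open>r ^ (n - 1) * t / 4\<close>. Together with \<open>4 ^ n\<close> from the lost ball this
   makes the denominator \<open>4 ^ (n + 1)\<close>.\<close>
 define q where "q = om * r ^ (?n - 1) * t / 4"
 have q0: "q \<ge> 0" using om r t by (simp add: q_def)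
 have Am: "emeasure lborel A \<ge> ennreal q"
 proof -
  have "emeasure lborel A = emeasure lborel ?B - emeasure lborel (ball 0 (r - t / 4) :: (real^'n) set)"
   unfolding A_def using t r by (intro emeasure_Diff) (use bal[of "r - t / 4" 0] in \<open>auto simp: subset_iff\<close>)
  also have "... = ennreal (om * r ^ ?n - om * (r - t / 4) ^ ?n)"
   using ball[of r 0] bal[of "r - t / 4" 0] r t om by (simp add: ennreal_minus)
  also have "ennreal q <= ..."
  proof (rule ennreal_leI)
   have "(r - t / 4) ^ ?n = (r - t / 4) * (r - t / 4) ^ (?n - 1)" by (simp add: power_eq_if)
   also have "... <= (r - t / 4) * r ^ (?n - 1)" using t r by (intro mult_left_mono power_mono) auto
   also have "... = r ^ ?n - r ^ (?n - 1) * t / 4" by (simp add: power_eq_if algebra_simps)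
   finally have "om * (r - t / 4) ^ ?n <= om * (r ^ ?n - r ^ (?n - 1) * t / 4)" using om by (intro mult_left_mono) auto
   then show "q <= om * r ^ ?n - om * (r - t / 4) ^ ?n" by (simp add: q_def algebra_simps)
  qed
  finally show ?thesis .
 qed
 let ?D = "distance_distribution ?n ?B t"
 let ?V = "measure lborel ?B"
 have VB: "emeasure lborel ?B = ennreal ?V" by (intro emeasure_eq_ennreal_measure) (use ball[of r 0] r in simp)
 have "?D + ennreal (b * q) <= ?D + ennreal b * emeasure lborel A"
  using Am ab q0 by (intro add_left_mono) (simp add: ennreal_mult mult_left_mono)
 also have "... = (\<integral>\<^sup>+x. emeasure lborel (?B Int cball x t) * indicator ?B x + ennreal b * indicator A x \<partial>lborel)"
 proof -
  have "(\<lambda>x. emeasure lborel (?B Int cball x t) * indicator ?B x) \<in> borel_measurable (lborel :: (real^'n) measure)"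
  proof -
   define Q where "Q = {(x, y). y \<in> ?B \<and> dist x y <= t}"
   have "Q = {p. norm (snd p) <= r} Int {p. dist (fst p) (snd p) <= t}" by (auto simp: Q_def)
   also have "closed ..." by (intro closed_Int closed_Collect_le continuous_intros)
   finally have Q: "Q \<in> sets (lborel \<Otimes>\<^sub>M (lborel :: (real^'n) measure))"
    unfolding sets_pair_measure_cong[OF sets_lborel sets_lborel] borel_prod by (rule borel_closed)
   have "Pair x -` Q = ?B Int cball x t" for x by (auto simp: Q_def)
   moreover note lborel.measurable_emeasure_Pair[OF Q]
   ultimately show ?thesis by (intro borel_measurable_times_ennreal borel_measurable_indicator) auto
  qed
  moreover have "A \<in> sets borel" by (simp add: A_def)
  ultimately show ?thesis
   unfolding distance_distribution_full[OF Y] by (subst nn_integral_add) (auto simp: nn_integral_cmult_indicator)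
 qed
 also have "... <= (\<integral>\<^sup>+x. ennreal a * indicator ?B x \<partial>lborel)"
 proof (rule nn_integral_mono)
  fix x :: "real^'n"
  show "emeasure lborel (?B Int cball x t) * indicator ?B x + ennreal b * indicator A x <= ennreal a * indicator ?B x"
  proof (cases "x \<in> ?B")
   case True then show ?thesis using loss by simp
  next
   case False
   then have "x \<notin> A" by (auto simp: A_def)
   then show ?thesis using False by simp
  qed
 qed
 also have "... = ennreal (a * ?V)" using ab VB by (simp add: nn_integral_cmult_indicator ennreal_mult)
 finally have le: "?D + ennreal (b * q) <= ennreal (a * ?V)" .
 have "?D <= ?D + ennreal (b * q)" by simp
 also note le
 also have "ennreal (a * ?V) < \<infinity>" by simp
 finally have "?D < \<infinity>" .
 then obtain d where d: "d \<ge> 0" "?D = ennreal d" by (cases ?D) auto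
 have "d + b * q <= a * ?V" using le d ab q0 by (simp add: ennreal_plus[symmetric] del: ennreal_plus)
 then have "d <= a * ?V - b * q" by simp
 also have "... = a * (?V - om * r ^ (?n - 1) * t / 4 ^ (?n + 1))"
  by (simp add: a_def b_def q_def algebra_simps power_divide)
 finally show ?thesis unfolding d(2) a_def by (rule ennreal_leI)
qed

text \<open>Relative to the leading term the submanifold loses at most order
  \<open>t\<^sup>2\<close>, the ball at least order \<open>t\<close>; for small \<open>t\<close>
  this is incompatible with equal distributions.\<close>

lemma submanifold_not_ball:
 fixes X :: "(real^'d) set"
 assumes X: "compact X" "submanifold 2 CARD('n::finite) X" and r: "r > 0"
  and eq: "!!t. 0 <= t ==> distance_distribution CARD('n) X t = distance_distribution CARD('n) (cball (0 :: real^'n) r) t"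
 shows False
proof -
 let ?n = "CARD('n)"
 let ?om = "unit_ball_vol ?n" and ?B = "cball (0 :: real^'n) r"
 have X': "compact X" "charted ?n X" using X charted_submanifold[OF X(2)] by auto
 have Y: "compact ?B" "charted ?n ?B" using charted_cball[OF r] by auto
 let ?V = "measure lborel ?B"
 have "measure (ivol ?n ?B) ?B = ?V"
  unfolding induced_volume_full[OF Y] by (rule measure_restrict_lborel) simp
 moreover have eqk: "double_integral ?n X k = double_integral ?n ?B k" if "k \<in> borel_measurable borel" for k
  by (rule double_integral_eqI[OF X' Y eq that])
 ultimately have V: "measure (ivol ?n X) X = ?V"
  using volume_inertia_eq(1)[OF X' Y eqk] by (simp only:)
 have V0: "?V > 0" by (rule measure_cball_pos[OF r])
 obtain C t0 where C: "C > 0" "t0 > 0" "C * t0\<^sup>2 <= 1" "!!x t. x \<in> X ==> 0 < t ==> t <= t0 ==>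
   emeasure (ivol ?n X) (X Int cball x t) \<ge> ennreal (?om * (t - C * t ^ 3) ^ ?n)"
  using emeasure_ivol_ball_ge[OF X] by metis
 define k where "k = ?om * r ^ (?n - 1) / 4 ^ (?n + 1)"
 have k: "k > 0" using r by (simp add: k_def)
 \<comment> \<open>The last bound makes the quadratic loss at most half of the linear loss
   \<open>k * t\<close>. The bound \<open>?V / k\<close> makes the lower estimate positive, so that
   the comparison in \<open>ennreal\<close> is one of real numbers.\<close>
 define t where "t = min (min t0 r) (min (?V / k) (k / (2 * ?V * ?n * C)))"
 have t: "0 < t" "t <= t0" "t <= r" "t <= k / (2 * ?V * ?n * C)" "t <= ?V / k" using C r k V0 by (auto simp: t_def)
 have Ct: "C * t\<^sup>2 <= 1"
 proof -
  have "C * t\<^sup>2 <= C * t0\<^sup>2" using t C by (intro mult_left_mono power_mono) auto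
  then show ?thesis using C(3) by linarith
 qed
 have fact: "t - C * t ^ 3 = t * (1 - C * t\<^sup>2)" by (simp add: algebra_simps power2_eq_square power3_eq_cube)
 have "ennreal (?om * t ^ ?n * (?V * (1 - ?n * (C * t\<^sup>2)))) <= ennreal (?om * (t - C * t ^ 3) ^ ?n * ?V)"
 proof (rule ennreal_leI)
  have "1 + real ?n * (- (C * t\<^sup>2)) <= (1 + (- (C * t\<^sup>2))) ^ ?n"
   by (rule Bernoulli_inequality) (use Ct in simp)
  then have "?om * t ^ ?n * ?V * (1 - ?n * (C * t\<^sup>2)) <= ?om * t ^ ?n * ?V * (1 - C * t\<^sup>2) ^ ?n"
   using t V0 by (intro mult_left_mono) auto
  then show "?om * t ^ ?n * (?V * (1 - ?n * (C * t\<^sup>2))) <= ?om * (t - C * t ^ 3) ^ ?n * ?V"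
   unfolding fact by (simp add: power_mult_distrib mult_ac)
 qed
 also have "... = (\<integral>\<^sup>+x. ennreal (?om * (t - C * t ^ 3) ^ ?n) \<partial>ivol ?n X)"
  using t Ct V by (simp add: fact emeasure_ivol_eq_measure[OF X'] space_ivol[OF X'] ennreal_mult)
 also have "... <= distance_distribution ?n X t"
  unfolding distance_distribution_eq_nn_integral[OF X']
  using C(4) t by (intro nn_integral_mono) (simp add: space_ivol[OF X'])
 also have "... = distance_distribution ?n ?B t" using eq t by simp
 also have "... <= ennreal (?om * t ^ ?n * (?V - k * t))"
  using distance_distribution_cball_le[OF r t(1,3), where 'n = 'n] by (simp add: k_def)
 finally have le: "ennreal (?om * t ^ ?n * (?V * (1 - ?n * (C * t\<^sup>2)))) <= ennreal (?om * t ^ ?n * (?V - k * t))" .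
 have kt: "?V * ?n * C * t <= k / 2" using t(4) V0 C k by (simp add: field_simps)
 then have "t * (?V * ?n * C * t) <= t * (k / 2)" using t by (intro mult_left_mono) auto
 then have kt2: "?V * (?n * (C * t\<^sup>2)) <= k * t / 2" by (simp add: algebra_simps power2_eq_square)
 have kt3: "0 < k * t" using k t by simp
 then have lt: "?V - k * t < ?V * (1 - ?n * (C * t\<^sup>2))" using kt2 by (simp add: right_diff_distrib)
 have pos: "?om * t ^ ?n > 0" using t by simp
 have *: "?om * t ^ ?n * (?V - k * t) < ?om * t ^ ?n * (?V * (1 - ?n * (C * t\<^sup>2)))" by (rule mult_strict_left_mono[OF lt pos])
 have "0 < ?V * (1 - ?n * (C * t\<^sup>2))"
 proof -
  have "k * t <= ?V" using t(5) k by (simp add: field_simps)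
  then show ?thesis using kt2 V0 unfolding right_diff_distrib by linarith
 qed
 then have "0 < ?om * t ^ ?n * (?V * (1 - ?n * (C * t\<^sup>2)))" using pos by (rule mult_pos_pos[rotated])
 then show False using le * by (simp add: ennreal_le_iff2)
qed

section \<open>Identification of balls\<close>

lemma submanifold_mono: "submanifold k m X ==> j <= k ==> submanifold j m X"
 unfolding submanifold_def using adapted_chart_mono by meson

lemma charted_body_or_closed_submanifold:
 fixes X :: "(real^'d) set"
 assumes "body_or_closed_submanifold k m X" "1 <= k"
 shows "compact X" "charted m X"
 using assms compact_closure_body charted_submanifold charted_submanifold_with_boundary
 by (auto simp: body_or_closed_submanifold_def closed_submanifold_def compact_body_def)

lemma congruent_copy_cball:
 fixes c :: "'a::euclidean_space"
 shows "congruent_copy (cball c r) (cball (0 :: 'a) r)"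
 unfolding congruent_copy_def by (rule exI[of _ "\<lambda>x. c + x"]) (simp add: dist_norm)

lemma body_eq_ball_congruent:
 fixes X :: "(real^'d) set"
 assumes X: "compact_body k X" "1 <= k" and r: "r > 0" and card: "CARD('n) = CARD('d)"
  and eq: "!!t. 0 <= t ==> distance_distribution CARD('d) X t = distance_distribution CARD('n) (cball (0 :: real^'n) r) t"
 shows "congruent_copy X (cball (0 :: real^'d) r)"
proof -
 have X': "compact X" "charted CARD('d) X"
  using X compact_closure_body charted_submanifold_with_boundary by (auto simp: compact_body_def)
 have Y: "compact (cball (0 :: real^'n) r)" "charted CARD('n) (cball (0 :: real^'n) r)" using charted_cball[OF r] by auto
 obtain W where W: "open W" "X = closure W" using X(1) by (auto simp: compact_body_def)
 have eqk: "double_integral CARD('d) X k = double_integral CARD('d) (cball (0 :: real^'d) r) k"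
  if k: "k \<in> borel_measurable borel" for k
  using double_integral_eqI[OF X' Y eq k] double_integral_cball_reindex[OF card r k] by (rule trans)
 obtain c where "X = cball c r" using body_eq_ball[OF X' W r eqk] by blast
 then show ?thesis by (simp add: congruent_copy_cball)
qed

text \<open>The order at 0 gives \<open>m = CARD('n)\<close>. For a body this is the equality of the
  ambient dimensions; a closed submanifold of the same dimension as the ball is impossible by
  \<open>submanifold_not_ball\<close>.\<close>

lemma body_or_closed_submanifold_eq_ball:
 fixes X :: "(real^'d) set"
 assumes X: "body_or_closed_submanifold k m X" "2 <= k" and r: "r > 0"
  and eq: "!!t. 0 <= t ==> distance_distribution m X t = distance_distribution CARD('n) (cball (0 :: real^'n) r) t"
 shows "CARD('n) = CARD('d) \<and> congruent_copy X (cball (0 :: real^'d) r)"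
proof -
 have k: "1 <= k" using X(2) by simp
 note X' = charted_body_or_closed_submanifold[OF X(1) k]
 let ?B = "cball (0 :: real^'n) r"
 have Y: "compact ?B" "charted CARD('n) ?B" using charted_cball[OF r] by auto
 have eqk: "double_integral m X k = double_integral CARD('n) ?B k" if "k \<in> borel_measurable borel" for k
  by (rule double_integral_eqI[OF X' Y eq that])
 have VB: "measure (ivol CARD('n) ?B) ?B = measure lborel ?B"
  unfolding induced_volume_full[OF Y] by (rule measure_restrict_lborel) simp
 have V: "measure (ivol m X) X > 0"
  using volume_inertia_eq(1)[OF X' Y eqk] measure_cball_pos[OF r, of "0 :: real^'n"] unfolding VB by (simp only:)
 have YO: "power_order CARD('n) (distance_distribution CARD('n) ?B)"
  by (rule power_order_body[OF Y, of "ball 0 r"]) (use r in auto)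
 from X(1) consider "m = CARD('d)" "compact_body k X" | "m < CARD('d)" "compact X" "submanifold k m X"
  by (auto simp: body_or_closed_submanifold_def closed_submanifold_def)
 then show ?thesis
 proof cases
  case 1
  obtain W where W: "open W" "X = closure W" using 1(2) by (auto simp: compact_body_def)
  have ne: "X \<noteq> {}" using V by auto
  have "power_order m (distance_distribution m X)"
   using power_order_body[OF _ _ W ne] X' 1(1) by simp
  then have n: "CARD('n) = CARD('d)"
   using power_order_unique[OF YO, of m "distance_distribution m X"] eq 1(1) by simp
  then show ?thesis using body_eq_ball_congruent[OF 1(2) k r n] eq 1(1) by simp
 next
  case 2
  have X2: "submanifold 2 m X" by (rule submanifold_mono[OF 2(3) X(2)])
  have "m = CARD('n)"
   by (rule power_order_unique[OF power_order_submanifold[OF 2(2) X2 V] YO]) (use eq in auto)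
  then have False using submanifold_not_ball[OF 2(2) _ r, where 'n = 'n] X2 eq by simp
  then show ?thesis ..
 qed
qed

section \<open>The cap kernel and analytic tools for circles\<close>

lemma nn_integral_layer_cake:
 fixes nu :: "real measure"
 assumes nu: "finite_measure nu" "sets nu = sets borel" and t: "t \<ge> 0"
 shows "(\<integral>\<^sup>+s. ennreal (max 0 (t\<^sup>2 - (max 0 s)\<^sup>2)) \<partial>nu) = (\<integral>\<^sup>+ta\<in>{0..t}. ennreal (2 * ta) * emeasure nu {..ta} \<partial>lborel)"
proof -
 interpret finite_measure nu by (rule nu)
 interpret P: pair_sigma_finite nu "lborel :: real measure" ..
 note [measurable_cong] = nu(2)
 \<comment> \<open>For \<open>0 <= s <= t\<close> the value \<open>t\<^sup>2 - s\<^sup>2\<close> is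
   the integral of \<open>2 * ta\<close> from \<open>s\<close> to \<open>t\<close>; the inner
   maximum covers negative \<open>s\<close>, as \<open>nu\<close> lives on the whole line.\<close>
 have 1: "ennreal (max 0 (t\<^sup>2 - (max 0 s)\<^sup>2)) = (\<integral>\<^sup>+ta. ennreal (2 * ta) * indicator {0..t} ta * indicator {p. fst p <= snd p} (s, ta) \<partial>lborel)" for s
 proof (cases "max 0 s <= t")
  case True
  have "(\<integral>\<^sup>+ta. ennreal (2 * ta) * indicator {max 0 s..t} ta \<partial>lborel) = ennreal (t\<^sup>2 - (max 0 s)\<^sup>2)"
   by (rule nn_integral_FTC_Icc[where F = "\<lambda>x. x\<^sup>2"])
    (use True in \<open>auto intro!: derivative_eq_intros\<close>)
  also have "(\<integral>\<^sup>+ta. ennreal (2 * ta) * indicator {max 0 s..t} ta \<partial>lborel) =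
    (\<integral>\<^sup>+ta. ennreal (2 * ta) * indicator {0..t} ta * indicator {p. fst p <= snd p} (s, ta) \<partial>lborel)"
   by (intro nn_integral_cong) (auto split: split_indicator)
  finally show ?thesis using True by (simp add: power_mono)
 next
  case False
  then have "s > t" using t by auto
  then have "(\<lambda>ta. ennreal (2 * ta) * indicator {0..t} ta * indicator {p. fst p <= snd p} (s, ta)) = (\<lambda>_. 0)"
   by (auto split: split_indicator)
  then have "(\<integral>\<^sup>+ta. ennreal (2 * ta) * indicator {0..t} ta * indicator {p. fst p <= snd p} (s, ta) \<partial>lborel) = 0"
   by (simp only: nn_integral_const mult_zero_left)
  moreover have "t\<^sup>2 <= (max 0 s)\<^sup>2" using False t by (intro power_mono) auto
  ultimately show ?thesis by simp
 qed
 have "(\<integral>\<^sup>+s. ennreal (max 0 (t\<^sup>2 - (max 0 s)\<^sup>2)) \<partial>nu) =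
   (\<integral>\<^sup>+ta. \<integral>\<^sup>+s. ennreal (2 * ta) * indicator {0..t} ta * indicator {p. fst p <= snd p} (s, ta) \<partial>nu \<partial>lborel)"
  unfolding 1 by (rule P.Fubini'[symmetric]) measurable
 also have "... = (\<integral>\<^sup>+ta. ennreal (2 * ta) * emeasure nu {..ta} * indicator {0..t} ta \<partial>lborel)"
 proof (rule nn_integral_cong)
  fix ta :: real
  have "(\<integral>\<^sup>+s. ennreal (2 * ta) * indicator {0..t} ta * indicator {p. fst p <= snd p} (s, ta) \<partial>nu) =
    (\<integral>\<^sup>+s. ennreal (2 * ta) * indicator {0..t} ta * indicator {..ta} s \<partial>nu)"
   by (intro nn_integral_cong) (auto split: split_indicator)
  also have "... = ennreal (2 * ta) * indicator {0..t} ta * emeasure nu {..ta}"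
   by (rule nn_integral_cmult_indicator) (simp add: nu(2))
  finally show "(\<integral>\<^sup>+s. ennreal (2 * ta) * indicator {0..t} ta * indicator {p. fst p <= snd p} (s, ta) \<partial>nu) =
    ennreal (2 * ta) * emeasure nu {..ta} * indicator {0..t} ta"
   by (simp only: mult_ac)
 qed
 finally show ?thesis .
qed

text \<open>The kernel vanishes at the edge of its support. Points of a curve beyond arc length
  \<open>t\<close> but still within distance \<open>t\<close> fill a parameter range of order
  \<open>t ^ 3\<close>, on which the kernel is of order \<open>t ^ 4\<close>; discarding them costs
  order \<open>t ^ 7\<close>, below the curvature term of order \<open>t ^ 5\<close>.\<close>

abbreviation cap_kernel :: "real => real => real" where
 "cap_kernel t s \<equiv> max 0 (t\<^sup>2 - s\<^sup>2)"

text \<open>Through this formula a bound on the distribution integrates to a bound for the kernel,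
  which is how the circle is treated.\<close>

lemma double_integral_cap_kernel:
 fixes X :: "(real^'d) set"
 assumes X: "compact X" "charted m X" and t: "t \<ge> 0"
 shows "double_integral m X (\<lambda>s. ennreal (cap_kernel t s)) =
  (\<integral>\<^sup>+ta\<in>{0..t}. ennreal (2 * ta) * distance_distribution m X ta \<partial>lborel)"
proof -
 let ?nu = "distr (ivol m X \<Otimes>\<^sub>M ivol m X) borel (\<lambda>(x, y). dist x y)"
 interpret finite_measure "ivol m X" by (rule finite_ivol[OF X])
 interpret P: pair_sigma_finite "ivol m X" "ivol m X" ..
 have fin: "finite_measure (ivol m X \<Otimes>\<^sub>M ivol m X)"
  by (rule finite_measure_pair_measure) (rule finite_ivol[OF X])+
 have "double_integral m X (\<lambda>s. ennreal (cap_kernel t s)) = double_integral m X (\<lambda>s. ennreal (max 0 (t\<^sup>2 - (max 0 s)\<^sup>2)))"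
  by (simp add: double_integral_def)
 also have "... = (\<integral>\<^sup>+s. ennreal (max 0 (t\<^sup>2 - (max 0 s)\<^sup>2)) \<partial>?nu)" by (rule double_integral_eq_distr[OF X]) simp
 also have "... = (\<integral>\<^sup>+ta\<in>{0..t}. ennreal (2 * ta) * emeasure ?nu {..ta} \<partial>lborel)"
  by (rule nn_integral_layer_cake[OF finite_measure.finite_measure_distr[OF fin measurable_dist_ivol[OF X]] _ t]) simp
 finally show ?thesis by (simp add: distance_distribution_eq[OF X])
qed

text \<open>Equality case of Fatou's lemma.\<close>

lemma AE_zero_of_liminf:
 fixes ph :: "nat => 'a => real" and g :: "'a => real"
 assumes mu: "finite_measure mu" and ph: "!!n. integrable mu (ph n)" and g: "integrable mu g"
  and lower: "!!n x. x \<in> space mu ==> - M <= ph n x" "!!x. x \<in> space mu ==> - M <= g x"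
  and lim: "!!x. x \<in> space mu ==> \<exists>s\<ge>0. \<forall>e>0. \<forall>\<^sub>F n in sequentially. g x + s - e <= ph n x"
  and b: "!!n. (\<integral>x. ph n x \<partial>mu) <= b n" "b \<longlonglongrightarrow> (\<integral>x. g x \<partial>mu)"
 shows "AE x in mu. \<forall>s\<ge>0. (\<forall>e>0. \<forall>\<^sub>F n in sequentially. g x + s - e <= ph n x) --> s = 0"
proof -
 interpret finite_measure mu by (rule mu)
 let ?V = "measure mu (space mu)"
 \<comment> \<open>Shifting by \<open>M\<close> makes all functions nonnegative, so that Fatou's
   lemma for \<open>ennreal\<close> applies.\<close>
 define f where "f x = liminf (\<lambda>n. ennreal (ph n x + M))" for x
 have [measurable]: "ph n \<in> borel_measurable mu" "g \<in> borel_measurable mu" for n using ph g by auto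
 have fm[measurable]: "f \<in> borel_measurable mu" unfolding f_def by measurable
 have int: "(\<integral>\<^sup>+x. ennreal (h x + M) \<partial>mu) = ennreal ((\<integral>x. h x \<partial>mu) + M * ?V)"
  if "integrable mu h" "!!x. x \<in> space mu ==> - M <= h x" for h
 proof -
  have "(\<integral>\<^sup>+x. ennreal (h x + M) \<partial>mu) = ennreal (\<integral>x. h x + M \<partial>mu)"
  proof (rule nn_integral_eq_integral)
   show "AE x in mu. 0 <= h x + M" by (rule AE_I2) (use that(2) in fastforce)
  qed (use that(1) in simp)
  then show ?thesis using that(1) by (simp add: mult.commute)
 qed
 have "(\<integral>\<^sup>+x. f x \<partial>mu) <= liminf (\<lambda>n. \<integral>\<^sup>+x. ennreal (ph n x + M) \<partial>mu)"
  unfolding f_def by (rule nn_integral_liminf) measurable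
 also have "... <= liminf (\<lambda>n. ennreal (b n + M * ?V))"
  using b(1) by (intro Liminf_mono always_eventually allI) (simp add: int[OF ph lower(1)] ennreal_leI)
 also have "... = ennreal ((\<integral>x. g x \<partial>mu) + M * ?V)"
  by (intro lim_imp_Liminf tendsto_ennrealI tendsto_add b(2) tendsto_const) simp
 also have "... = (\<integral>\<^sup>+x. ennreal (g x + M) \<partial>mu)" by (rule int[OF g lower(2), symmetric])
 finally have le: "(\<integral>\<^sup>+x. f x \<partial>mu) <= (\<integral>\<^sup>+x. ennreal (g x + M) \<partial>mu)" .
 have fg: "f x \<ge> ennreal (g x + M + s)" if L: "!!e. e > 0 ==> \<forall>\<^sub>F n in sequentially. g x + s - e <= ph n x" for x s
 proof (rule ennreal_le_epsilon)
  fix e :: real assume e: "e > 0"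
  have "ennreal (g x + s - e + M) <= f x"
   unfolding f_def by (rule Liminf_bounded) (use L[OF e] in \<open>auto elim!: eventually_mono intro!: ennreal_leI\<close>)
  then have "ennreal (g x + s - e + M) + ennreal e <= f x + ennreal e" by (rule add_right_mono)
  moreover have "ennreal (g x + M + s) <= ennreal (g x + s - e + M) + ennreal e"
  proof (cases "g x + s - e + M \<ge> 0")
   case True then show ?thesis using e by (simp add: ennreal_plus[symmetric] del: ennreal_plus)
  next
   case False
   then have "ennreal (g x + M + s) <= ennreal e" by (intro ennreal_leI) simp
   then show ?thesis by (simp add: add_increasing)
  qed
  ultimately show "ennreal (g x + M + s) <= f x + ennreal e" by (rule order_trans[rotated])
 qed
 have gle: "ennreal (g x + M) <= f x" if x: "x \<in> space mu" for x
 proof -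
  obtain s where s: "s \<ge> 0" "!!e. e > 0 ==> \<forall>\<^sub>F n in sequentially. g x + s - e <= ph n x" using lim[OF x] by blast
  have "ennreal (g x + M) <= ennreal (g x + M + s)" using s(1) by (intro ennreal_leI) simp
  also have "... <= f x" by (rule fg[OF s(2)])
  finally show ?thesis .
 qed
 \<comment> \<open>\<open>f\<close> dominates the shifted \<open>g\<close> pointwise and has no
   larger integral, so the two agree almost everywhere; a positive gap \<open>s\<close> is then
   impossible.\<close>
 have "(\<integral>\<^sup>+x. f x - ennreal (g x + M) \<partial>mu) = (\<integral>\<^sup>+x. f x \<partial>mu) - (\<integral>\<^sup>+x. ennreal (g x + M) \<partial>mu)"
  using gle by (intro nn_integral_diff) (auto simp: int[OF g lower(2)] intro!: AE_I2)
 also have "... = 0" using le le_less_trans[OF le, of top] by (simp add: diff_eq_0_iff_ennreal int[OF g lower(2)])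
 finally have "AE x in mu. f x - ennreal (g x + M) = 0" by (simp add: nn_integral_0_iff_AE)
 then show ?thesis
 proof (rule AE_mp, intro AE_I2 impI allI)
  fix x s assume x: "x \<in> space mu" and "f x - ennreal (g x + M) = 0" and s: "0 <= s"
   and L: "\<forall>e>0. \<forall>\<^sub>F n in sequentially. g x + s - e <= ph n x"
  then have "f x <= ennreal (g x + M)" by (simp add: diff_eq_0_iff_ennreal)
  then have "ennreal (g x + M + s) <= ennreal (g x + M)" using fg[of x s] L by (meson order_trans)
  then show "s = 0" using s lower(2)[OF x] by (simp add: ennreal_le_iff)
 qed
qed

text \<open>Bootstrapping from the Maclaurin bound for the sine:
  \<open>y - y ^ 3 / 6 - y ^ 5 / 120 <= z\<close> gives \<open>y <= 2 * z\<close>, hence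
  \<open>y <= z + 2 * z ^ 3\<close>, hence a bound for \<open>y ^ 3\<close> with exact leading term.
  Sharpness matters only up to the cubic coefficient.\<close>

lemma arcsin_le:
 assumes z: "0 <= z" "z <= 1 / 2"
 shows "arcsin z <= z + z ^ 3 / 6 + 2 * z ^ 5"
proof -
 define y where "y = arcsin z"
 have y: "sin y = z" "0 <= y" "y <= 1"
 proof -
  show "sin y = z" unfolding y_def using z by (intro sin_arcsin) auto
  show "0 <= y" unfolding y_def using arcsin_le_arcsin[of 0 z] z by simp
  have "y <= arcsin (1 / 2)" unfolding y_def using z by (intro arcsin_le_arcsin) auto
  also have "... = pi / 6" using arcsin_sin[of "pi / 6"] by (simp add: sin_30)
  also have "... <= 1" using pi_less_4 by simp
  finally show "y <= 1" .
 qed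
 have "\<bar>sin y - (\<Sum>m<5. sin_coeff m * y ^ m)\<bar> <= inverse (fact 5) * \<bar>y\<bar> ^ 5" by (rule Maclaurin_sin_bound)
 also have "(\<Sum>m<5. sin_coeff m * y ^ m) = y - y ^ 3 / 6"
  by (simp add: lessThan_nat_numeral lessThan_Suc sin_coeff_def fact_numeral)
 finally have "\<bar>z - (y - y ^ 3 / 6)\<bar> <= y ^ 5 / 120" using y by (simp add: fact_numeral)
 then have 1: "y - y ^ 3 / 6 - y ^ 5 / 120 <= z" using abs_ge_minus_self[of "z - (y - y ^ 3 / 6)"] by linarith
 have p: "y ^ 3 <= y" "y ^ 5 <= y ^ 3" "0 <= y ^ 3"
  using power_decreasing[of 1 3 y] power_decreasing[of 3 5 y] y by auto
 have y2: "y <= 2 * z" using 1 p by linarith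
 have "y ^ 3 <= (2 * z) ^ 3" "y ^ 5 <= (2 * z) ^ 5" by (rule power_mono[OF y2 y(2)])+
 then have q: "y ^ 3 <= 8 * z ^ 3" "y ^ 5 <= 32 * z ^ 5" by (simp_all add: power_mult_distrib)
 have "y <= z + 2 * z ^ 3" using 1 p q zero_le_power[OF z(1), of 3] by linarith
 then have "y ^ 3 <= (z + 2 * z ^ 3) ^ 3" using y by (intro power_mono) auto
 also have "... = z ^ 3 + 6 * z ^ 5 + (12 + 8 * z\<^sup>2) * z\<^sup>2 * z ^ 5" by (simp add: eval_nat_numeral algebra_simps)
 also have "... <= z ^ 3 + 6 * z ^ 5 + 14 * (1 / 4) * z ^ 5"
 proof -
  have "z\<^sup>2 <= (1/2)\<^sup>2" using z by (intro power_mono) auto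
  then have "(12 + 8 * z\<^sup>2) * z\<^sup>2 <= 14 * (1 / 4)" by (intro mult_mono) (auto simp: power2_eq_square)
  then show ?thesis using z by (intro add_left_mono mult_right_mono) auto
 qed
 finally show ?thesis using 1 q zero_le_power[OF z(1), of 5] unfolding y_def[symmetric] by linarith
qed

subsection \<open>Arc length on curves\<close>

text \<open>Strict monotonicity and the intermediate value theorem provide the inverse; it is
  applied to arc length as a function of a chart parameter.\<close>

lemma increasing_C1_inverse:
 fixes si n :: "real => real"
 assumes et: "et > 0" and der: "!!u. \<bar>u - a\<bar> <= et ==> (si has_real_derivative n u) (at u)"
  and pos: "!!u. \<bar>u - a\<bar> <= et ==> n u > 0" and 0: "si a = 0"
 obtains e ta where "e > 0" "ta 0 = a" "!!s. \<bar>s\<bar> <= e ==> \<bar>ta s - a\<bar> < et \<and> si (ta s) = s"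
  "!!u. \<bar>u - a\<bar> <= et ==> ta (si u) = u" "!!s. \<bar>s\<bar> < e ==> (ta has_real_derivative 1 / n (ta s)) (at s)"
  "!!u v. \<bar>u - a\<bar> <= et ==> \<bar>v - a\<bar> <= et ==> u < v \<longleftrightarrow> si u < si v"
proof -
 let ?I = "{a - et..a + et}"
 have I: "u \<in> ?I \<longleftrightarrow> \<bar>u - a\<bar> <= et" for u by auto
 have lt: "si u < si v" if "u \<in> ?I" "v \<in> ?I" "u < v" for u v
 proof (rule DERIV_pos_imp_increasing[OF that(3)])
  fix x assume "u <= x" "x <= v"
  then have "\<bar>x - a\<bar> <= et" using that by auto
  then show "\<exists>y. (si has_real_derivative y) (at x) \<and> 0 < y" using der pos by blast
 qed
 have iff: "u < v \<longleftrightarrow> si u < si v" if "u \<in> ?I" "v \<in> ?I" for u v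
  using lt[OF that] lt[OF that(2,1)] by (cases u v rule: linorder_cases) (blast dest: less_asym, simp, blast dest: less_asym)
 have inj: "inj_on si ?I"
 proof (rule inj_onI)
  fix u v assume "u \<in> ?I" "v \<in> ?I" "si u = si v"
  then show "u = v" using lt[of u v] lt[of v u] by (cases u v rule: linorder_cases) auto
 qed
 have cont: "continuous_on ?I si"
  by (intro continuous_at_imp_continuous_on ballI DERIV_isCont[OF der]) auto
 define ta where "ta = the_inv_into ?I si"
 have tasi: "ta (si u) = u" if "u \<in> ?I" for u unfolding ta_def by (rule the_inv_into_f_f[OF inj that])
 \<comment> \<open>Half of the smaller one-sided range keeps the inverse strictly inside the
   interval.\<close>
 define e where "e = min (si (a + et)) (- si (a - et)) / 2"
 have "si (a - et) < 0" "0 < si (a + et)" using lt[of "a - et" a] lt[of a "a + et"] et 0 by auto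
 then have e: "e > 0" "e < si (a + et)" "si (a - et) < - e" by (auto simp: e_def)
 have ex: "\<exists>u\<in>?I. si u = s" if "\<bar>s\<bar> <= e" for s
  using IVT'[of si "a - et" s "a + et"] that e et cont by fastforce
 have ta: "\<bar>ta s - a\<bar> < et \<and> si (ta s) = s" if s: "\<bar>s\<bar> <= e" for s
 proof -
  obtain u where u: "u \<in> ?I" "si u = s" using ex[OF s] by blast
  then have "u \<noteq> a + et" "u \<noteq> a - et" using s e by auto
  then show ?thesis using u tasi[OF u(1)] by auto
 qed
 have sub: "{-e..e} \<subseteq> si ` ?I"
 proof
  fix s assume "s \<in> {-e..e}"
  then have "\<bar>s\<bar> <= e" by auto
  then show "s \<in> si ` ?I" using ex by blast
 qed
 have contta: "continuous_on {-e..e} ta"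
  unfolding ta_def using continuous_on_subset[OF continuous_on_inv_into[OF cont _ inj] sub] by simp
 show thesis
 proof (rule that[of e ta])
  show "ta 0 = a" using tasi[of a] 0 et by simp
  show "(ta has_real_derivative 1 / n (ta s)) (at s)" if s: "\<bar>s\<bar> < e" for s
  proof -
   have t: "\<bar>ta s - a\<bar> <= et" using ta[of s] s by simp
   have "isCont ta s" using s contta by (intro continuous_on_interior[OF contta]) auto
   then have "(ta has_real_derivative inverse (n (ta s))) (at s)"
    using der[OF t] pos[OF t] s ta by (intro DERIV_inverse_function[where f = si and a = "-e" and b = e]) auto
   then show ?thesis by (simp add: inverse_eq_divide)
  qed
  show "e > 0" by (rule e(1))
  show "\<bar>ta s - a\<bar> < et \<and> si (ta s) = s" if "\<bar>s\<bar> <= e" for s by (rule ta[OF that])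
  show "ta (si u) = u" if "\<bar>u - a\<bar> <= et" for u by (rule tasi) (simp only: I that)
  show "u < v \<longleftrightarrow> si u < si v" if "\<bar>u - a\<bar> <= et" "\<bar>v - a\<bar> <= et" for u v by (rule iff) (simp_all only: I that)
 qed
qed

lemma nn_integral_lborel_span_singleton:
 fixes b :: "'a::euclidean_space"
 assumes [measurable]: "f \<in> borel_measurable borel"
 shows "(\<integral>\<^sup>+x. f x \<partial>lborel_span {b}) = (\<integral>\<^sup>+u. f (u *\<^sub>R b) \<partial>lborel)"
proof -
 interpret product_sigma_finite "\<lambda>_ :: 'a. lborel :: real measure" by standard
 have "(\<lambda>u. f (u *\<^sub>R b)) \<in> borel_measurable (lborel :: real measure)" by measurable
 from product_nn_integral_singleton[of _ b, OF this] show ?thesis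
  unfolding lborel_span_def by (subst nn_integral_distr) auto
qed

lemma gram_singleton: "gram {b} L = L b \<bullet> L b"
proof -
 have "{\<pi>. \<pi> permutes {b}} = {id}" by (auto simp: permutes_sing)
 then show ?thesis unfolding gram_def by (simp add: sign_id)
qed

text \<open>The clause with \<open>rh\<close> says that even short subarcs about 0 contain all of
  \<open>X\<close> near \<open>ga 0\<close>, so no other strand of \<open>X\<close> passes there.
  The last clause says that the induced volume on the arc is arc length.\<close>

definition unit_arc :: "(real^'d) set => (real => real^'d) => (real => real^'d) => (real => real^'d) => real => bool" where
 "unit_arc X ga ga1 ga2 e \<longleftrightarrow> 0 < e \<and>
  (\<forall>s. \<bar>s\<bar> < e --> (ga has_vector_derivative ga1 s) (at s) \<and> (ga1 has_vector_derivative ga2 s) (at s) \<and>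
   norm (ga1 s) = 1 \<and> ga s \<in> X) \<and>
  continuous_on {-e<..<e} ga2 \<and> (\<forall>de. 0 < de \<and> de <= e --> (\<exists>rh>0. X Int ball (ga 0) rh \<subseteq> ga ` {-de<..<de})) \<and>
  inj_on ga {-e<..<e} \<and> ga ` {-e<..<e} \<in> sets borel \<and>
  (\<forall>E\<in>sets borel. emeasure (ivol 1 X) (E Int ga ` {-e<..<e}) = emeasure lborel {s\<in>{-e<..<e}. ga s \<in> E})"

lemma unit_arcD:
 assumes "unit_arc X ga ga1 ga2 e" "\<bar>s\<bar> < e"
 shows "(ga has_vector_derivative ga1 s) (at s)" "(ga1 has_vector_derivative ga2 s) (at s)" "norm (ga1 s) = 1" "ga s \<in> X"
 using assms by (simp_all add: unit_arc_def)

lemma unit_arc_inj: "unit_arc X ga ga1 ga2 e ==> inj_on ga {-e<..<e}"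
 by (simp add: unit_arc_def)

lemma continuous_on_unit_arc: "unit_arc X ga ga1 ga2 e ==> continuous_on {-e<..<e} ga"
 by (intro continuous_at_imp_continuous_on ballI has_vector_derivative_continuous[OF unit_arcD(1)]) auto

text \<open>A chart restricts to a curve \<open>cc\<close> in one real variable, which is
  reparametrized by arc length. Two derivatives survive because the speed, the norm of a nowhere
  vanishing differentiable vector, is itself continuously differentiable.\<close>

lemma unit_arc_exists:
 fixes X :: "(real^'d) set"
 assumes X: "compact X" "submanifold 2 1 X" and p: "p \<in> X"
 obtains ga ga1 ga2 e where "unit_arc X ga ga1 ga2 e" "ga 0 = p"
proof -
 have chX: "charted 1 X" by (rule charted_submanifold[OF X(2)]) simp
 from X(2)[unfolded submanifold_def, rule_format, OF p]
 obtain B U V Ph Ps where B: "B \<subseteq> Basis" "card B = 1" and pU: "p \<in> U" and ch: "adapted_chart 2 X (span B) U V Ph Ps"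
  by (elim exE conjE) (rule that)
 have C2: "Ck_on 2 V Ps" and op: "open U" "open V" using ch by (simp_all add: adapted_chart_def Ck_diffeo_def)
 have c: "C1chart 1 X B (span B) U V Ph Ps"
  using B adapted_chart_mono[OF ch, of 1] by (simp add: C1chart_def)
 note i = chart_inverse[OF c]
 obtain b where b: "B = {b}" using B(2) by (meson card_1_singletonE)
 have bb: "b \<bullet> b = 1" using B(1) by (simp add: b inner_same_Basis)
 have sp: "y \<in> span B \<longleftrightarrow> y = (y \<bullet> b) *\<^sub>R b" for y
  unfolding b span_singleton using bb by (auto simp: image_iff)
 define a where "a = Ph p \<bullet> b"
 have Php: "Ph p = a *\<^sub>R b" using chart_H_iff(1)[OF c pU] p sp by (simp add: a_def)
 have "open ((\<lambda>u. u *\<^sub>R b) -` V)" by (intro continuous_open_vimage op continuous_intros)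
 moreover have "a \<in> (\<lambda>u. u *\<^sub>R b) -` V" using i(3)[OF pU] Php by simp
 ultimately obtain et where et: "et > 0" "cball a et \<subseteq> (\<lambda>u. u *\<^sub>R b) -` V" using open_contains_cball by blast
 have V: "u *\<^sub>R b \<in> V" if "\<bar>u - a\<bar> <= et" for u
 proof -
  have "u \<in> cball a et" using that by (simp add: dist_real_def abs_minus_commute)
  then show ?thesis using et(2) by blast
 qed
 define cc where "cc u = Ps (u *\<^sub>R b)" for u
 define c1 where "c1 u = D Ps (u *\<^sub>R b) b" for u
 define c2 where "c2 u = D (\<lambda>x. D Ps x b) (u *\<^sub>R b) b" for u
 have C1': "Ck_on 1 V (\<lambda>x. D Ps x b)" using C2 by (simp add: numeral_2_eq_2)
 have line: "((\<lambda>u. u *\<^sub>R b) has_vector_derivative b) (at u)" for u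
  by (auto intro!: derivative_eq_intros)
 have chain: "((\<lambda>u. F (u *\<^sub>R b)) has_vector_derivative D F (u *\<^sub>R b) b) (at u)"
  if F: "(F has_derivative D F (u *\<^sub>R b)) (at (u *\<^sub>R b))" for F :: "real^'d => real^'d" and u
  using has_derivative_compose[OF line[unfolded has_vector_derivative_def] F]
  by (simp add: has_vector_derivative_def linear_scale[OF has_derivative_linear[OF F]])
 have d1: "(cc has_vector_derivative c1 u) (at u)" and d2: "(c1 has_vector_derivative c2 u) (at u)"
  if "\<bar>u - a\<bar> <= et" for u
  unfolding cc_def c1_def c2_def
  by (rule chain chart_derivative(2)[OF c V[OF that]] Ck_on_1D(1)[OF C1' V[OF that]])+
 have contc2: "continuous_on {u. \<bar>u - a\<bar> <= et} c2"
  unfolding c2_def by (rule continuous_on_compose2[OF Ck_on_1D(2)[OF C1']]) (use V in \<open>auto intro!: continuous_intros\<close>)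
 have contc1: "continuous_on {u. \<bar>u - a\<bar> <= et} c1"
  by (intro continuous_at_imp_continuous_on ballI has_vector_derivative_continuous[OF d2]) auto
 have c1n: "c1 u \<noteq> 0" if "\<bar>u - a\<bar> <= et" for u
  using chart_D_inj(1)[OF c V[OF that]] bb linear_0[OF chart_linear(2)[OF c V[OF that]]]
  unfolding c1_def by (metis inj_eq inner_zero_left zero_neq_one)
 define n where "n u = norm (c1 u)" for u
 have n0: "n u > 0" if "\<bar>u - a\<bar> <= et" for u using c1n[OF that] by (simp add: n_def)
 have contn: "continuous_on {u. \<bar>u - a\<bar> <= et} n" unfolding n_def by (intro continuous_intros contc1)
 define et' where "et' = et / 2"
 have et': "et' > 0" "et' < et" using et(1) by (auto simp: et'_def)
 have "{a - et..a + et} = {u. \<bar>u - a\<bar> <= et}" by auto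
 then obtain h where h: "!!x. x \<in> {a - et..a + et} ==> (h has_vector_derivative n x) (at x within {a - et..a + et})"
  using antiderivative_continuous[of "a - et" "a + et" n] contn by metis
 \<comment> \<open>Arc length measured from \<open>p\<close>, as an antiderivative of the
   speed.\<close>
 define si where "si u = h u - h a" for u
 have dsi: "(si has_real_derivative n u) (at u)" if u: "\<bar>u - a\<bar> <= et'" for u
 proof -
  have "u \<in> {a - et<..<a + et}" using u et' by auto
  then have "(h has_vector_derivative n u) (at u)"
   using h[of u] at_within_interior[of u "{a - et..a + et}"] by auto
  then show ?thesis unfolding si_def has_real_derivative_iff_has_vector_derivative
   by (auto intro!: derivative_eq_intros)
 qed
 obtain e ta where e: "e > 0" "ta 0 = a" and ta: "!!s. \<bar>s\<bar> <= e ==> \<bar>ta s - a\<bar> < et' \<and> si (ta s) = s"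
  and tasi: "!!u. \<bar>u - a\<bar> <= et' ==> ta (si u) = u" and dta: "!!s. \<bar>s\<bar> < e ==> (ta has_real_derivative 1 / n (ta s)) (at s)"
  and mono: "!!u v. \<bar>u - a\<bar> <= et' ==> \<bar>v - a\<bar> <= et' ==> u < v \<longleftrightarrow> si u < si v"
  by (rule increasing_C1_inverse[OF et'(1), of a si n]) (use dsi n0 et' in \<open>auto simp: si_def\<close>)
 define ga where "ga s = cc (ta s)" for s
 define ga1 where "ga1 s = (1 / n (ta s)) *\<^sub>R c1 (ta s)" for s
 \<comment> \<open>The derivative of \<open>c1 / n\<close> along \<open>ta\<close>, whose own speed
   is \<open>1 / n\<close>; the second summand stems from the derivative of
   \<open>1 / n\<close>.\<close>
 define ga2 where "ga2 s = (1 / n (ta s)) *\<^sub>R ((1 / n (ta s)) *\<^sub>R c2 (ta s) - ((c1 (ta s) \<bullet> c2 (ta s)) / n (ta s) ^ 3) *\<^sub>R c1 (ta s))" for s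
 have ta': "\<bar>ta s - a\<bar> <= et" if "\<bar>s\<bar> <= e" for s using ta[OF that] et' by simp
 have D1: "(ga has_vector_derivative ga1 s) (at s)" if s: "\<bar>s\<bar> < e" for s
  using vector_diff_chain_at[OF _ d1, of ta "1 / n (ta s)" s] dta[OF s] ta'[of s] s
  by (simp add: ga_def[abs_def] ga1_def o_def has_real_derivative_iff_has_vector_derivative)
 have D2: "(ga1 has_vector_derivative ga2 s) (at s)" if s: "\<bar>s\<bar> < e" for s
 proof -
  let ?u = "ta s"
  have u: "\<bar>?u - a\<bar> <= et" using ta'[of s] s by simp
  have "(norm has_derivative (\<lambda>w. w \<bullet> sgn (c1 ?u))) (at (c1 ?u))" by (rule has_derivative_norm[OF c1n[OF u]])
  from has_derivative_compose[OF d2[OF u, unfolded has_vector_derivative_def] this]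
  have "(n has_real_derivative (c2 ?u \<bullet> c1 ?u) / n ?u) (at ?u)"
   unfolding has_field_derivative_def n_def by (simp add: sgn_div_norm divide_inverse mult_ac mult_commute_abs)
  from DERIV_inverse_fun[OF this]
  have "((\<lambda>u. 1 / n u) has_real_derivative - ((c1 ?u \<bullet> c2 ?u) / n ?u ^ 3)) (at ?u)"
   using n0[OF u] by (simp add: inverse_eq_divide power3_eq_cube inner_commute mult.assoc)
  then have "((\<lambda>u. (1 / n u) *\<^sub>R c1 u) has_vector_derivative (1 / n ?u) *\<^sub>R c2 ?u + (- ((c1 ?u \<bullet> c2 ?u) / n ?u ^ 3)) *\<^sub>R c1 ?u) (at ?u)"
   by (rule has_vector_derivative_scaleR[OF _ d2[OF u]])
  from vector_diff_chain_at[where f = ta, OF _ this, of "1 / n ?u"] dta[OF s] show ?thesis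
   by (simp add: ga1_def[abs_def] ga2_def o_def has_real_derivative_iff_has_vector_derivative)
 qed
 have contta: "continuous_on {-e<..<e} ta"
  by (intro continuous_at_imp_continuous_on ballI DERIV_isCont[OF dta]) auto
 have cont2: "continuous_on {-e<..<e} ga2"
 proof -
  have "continuous_on {-e<..<e} (\<lambda>s. f (ta s))" if "continuous_on {u. \<bar>u - a\<bar> <= et} f" for f :: "real => 'z::topological_space"
   by (rule continuous_on_compose2[OF that contta]) (use ta' in auto)
  note * = this[OF contn] this[OF contc1] this[OF contc2]
  show ?thesis unfolding ga2_def
   by (intro continuous_intros *) (use n0 ta' in \<open>force simp: less_imp_neq[symmetric]\<close>)+
 qed
 have mem: "ga s \<in> X" if "\<bar>s\<bar> < e" for s
  using chart_H_iff(2)[OF c V[OF ta'[of s]]] sp[of "ta s *\<^sub>R b"] that bb by (simp add: ga_def cc_def)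
 have open_image: "\<exists>W. open W \<and> p \<in> W \<and> ga ` {-de<..<de} = X Int W" if de: "0 < de" "de <= e" for de
 proof -
  \<comment> \<open>Monotonicity of arc length turns the bound \<open>de\<close> on the parameter
    into an open condition on the chart coordinate, so every centred subarc is relatively open in
    \<open>X\<close>.\<close>
  let ?W = "U Int (\<lambda>x. Ph x \<bullet> b) -` {ta (-de)<..<ta de}"
  have "open ?W"
  proof -
   have "continuous_on U (\<lambda>x. Ph x \<bullet> b)" by (intro continuous_intros chart_continuous(1)[OF c])
   then show ?thesis using continuous_on_open_vimage[OF op(1)] by (metis Int_commute open_greaterThanLessThan)
  qed
  have ends: "\<bar>ta de - a\<bar> < et'" "\<bar>ta (-de) - a\<bar> < et'" "si (ta de) = de" "si (ta (-de)) = -de"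
   using ta[of de] ta[of "-de"] de by auto
  have *: "u \<in> {ta (-de)<..<ta de} \<longleftrightarrow> \<bar>si u\<bar> < de" if u: "\<bar>u - a\<bar> <= et'" for u
   using mono[OF u, of "ta de"] mono[OF _ u, of "ta (-de)"] ends by auto
  have "p \<in> ?W" using pU *[of a] et' de by (simp add: Php bb si_def)
  moreover have "ga ` {-de<..<de} = X Int ?W"
  proof (intro set_eqI iffI)
   fix x assume "x \<in> ga ` {-de<..<de}"
   then obtain s where "s \<in> {-de<..<de}" "x = ga s" by blast
   then have s: "\<bar>s\<bar> < de" "x = ga s" by auto
   have se: "\<bar>s\<bar> <= e" using s de by simp
   have v: "ta s *\<^sub>R b \<in> V" by (rule V[OF ta'[OF se]])
   have "x \<in> U" "Ph x \<bullet> b = ta s" using i(2)[OF v] i(4)[OF v] bb by (auto simp: s(2) ga_def cc_def)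
   moreover have "ta s \<in> {ta (-de)<..<ta de}" using *[of "ta s"] ta[OF se] s by simp
   ultimately show "x \<in> X Int ?W" using mem[of s] s de by auto
  next
   fix x assume x: "x \<in> X Int ?W"
   then have u: "\<bar>Ph x \<bullet> b - a\<bar> <= et'" using ends by auto
   have "Ph x = (Ph x \<bullet> b) *\<^sub>R b" using chart_H_iff(1)[OF c, of x] x sp by simp
   then have "x = cc (Ph x \<bullet> b)" using i(1)[of x] x unfolding cc_def by simp
   then have "x = ga (si (Ph x \<bullet> b))" by (simp add: ga_def tasi[OF u])
   moreover have "\<bar>si (Ph x \<bullet> b)\<bar> < de" using *[OF u] x by simp
   ultimately show "x \<in> ga ` {-de<..<de}" by (intro image_eqI[of _ _ "si (Ph x \<bullet> b)"]) auto
  qed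
  ultimately show ?thesis using \<open>open ?W\<close> by blast
 qed
 have ga0: "ga 0 = p" using i(1)[OF pU] by (simp add: ga_def cc_def e(2) Php)
 have im: "ga ` {-e<..<e} \<in> sets borel"
  using open_image[OF e(1) order_refl] borel_X[OF X(1) chX] by auto
 have inj: "inj_on ga {-e<..<e}"
 proof (rule inj_onI)
  fix s s' assume "s \<in> {-e<..<e}" "s' \<in> {-e<..<e}" "ga s = ga s'"
  then have s: "\<bar>s\<bar> < e" "\<bar>s'\<bar> < e" "Ps (ta s *\<^sub>R b) = Ps (ta s' *\<^sub>R b)" by (auto simp: ga_def cc_def)
  then have "ta s *\<^sub>R b = ta s' *\<^sub>R b" using i(2)[OF V[OF ta'[of s]]] i(2)[OF V[OF ta'[of s']]] by auto
  then have eq: "ta s = ta s'" using bb by auto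
  have "si (ta s) = s" "si (ta s') = s'" using ta[of s] ta[of s'] s by simp_all
  then show "s = s'" unfolding eq by (rule trans[OF sym])
 qed
 have meas: "emeasure (ivol 1 X) (E Int ga ` {-e<..<e}) = emeasure lborel {s\<in>{-e<..<e}. ga s \<in> E}"
  if E: "E \<in> sets borel" for E
 proof -
  let ?E = "E Int ga ` {-e<..<e}" and ?A = "V Int Ps -` (E Int ga ` {-e<..<e})"
  have gaU: "ga s \<in> U" if "\<bar>s\<bar> < e" for s using i(4)[OF V[OF ta'[of s]]] that by (simp add: ga_def cc_def)
  have E': "?E \<in> sets borel" "?E \<subseteq> U Int X" using E im mem gaU by auto
  note pre = chart_preimage[OF c borel_X[OF X(1) chX] E']
  define T where "T = {s\<in>{-e<..<e}. ga s \<in> E}"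
  have Tb: "T \<in> sets borel"
  proof -
   have "continuous_on {-e<..<e} ga" by (intro continuous_at_imp_continuous_on ballI has_vector_derivative_continuous[OF D1]) auto
   from continuous_on_vimage_borel[OF this _ E] show ?thesis by (simp add: T_def vimage_def Int_def)
  qed
  have AT: "u *\<^sub>R b \<in> ?A \<longleftrightarrow> u \<in> {ta (-e)..ta e} \<and> si u \<in> T" for u
  proof
   assume u: "u *\<^sub>R b \<in> ?A"
   then obtain s where "s \<in> {-e<..<e}" "Ps (u *\<^sub>R b) = ga s" by blast
   then have s: "\<bar>s\<bar> < e" "Ps (u *\<^sub>R b) = Ps (ta s *\<^sub>R b)" by (auto simp: ga_def cc_def)
   then have "u = ta s \<or> b = 0" using i(2)[of "u *\<^sub>R b"] i(2)[OF V[OF ta'[of s]]] u by auto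
   then have us: "u = ta s" using bb by auto
   then have "si u = s" "\<bar>u - a\<bar> <= et'" using ta[of s] s by auto
   moreover have "ga s \<in> E" using u by (simp add: us ga_def cc_def)
   ultimately show "u \<in> {ta (-e)..ta e} \<and> si u \<in> T"
    using mono[of "ta (-e)" u] mono[of u "ta e"] ta[of e] ta[of "-e"] s e by (auto simp: T_def)
  next
   assume u: "u \<in> {ta (-e)..ta e} \<and> si u \<in> T"
   then have u': "\<bar>u - a\<bar> <= et'" using ta[of e] ta[of "-e"] e by auto
   then show "u *\<^sub>R b \<in> ?A" using u V[of u] et' tasi[OF u'] by (auto simp: T_def ga_def cc_def intro!: image_eqI[of _ _ "si u"])
  qed
  have "emeasure (ivol 1 X) ?E = (\<integral>\<^sup>+x\<in>?A. ennreal (sqrt (gram_det B Ps x)) \<partial>lborel_span B)"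
   using emeasure_ivol_chart[OF X(1) chX c pre(1,2)] pre(3) by simp
  also have "... = (\<integral>\<^sup>+u. ennreal (sqrt (gram_det B Ps (u *\<^sub>R b))) * indicator ?A (u *\<^sub>R b) \<partial>lborel)"
   using measurable_gram_det[OF c pre(1)] unfolding b by (intro nn_integral_lborel_span_singleton) auto
  also have "... = (\<integral>\<^sup>+u. ennreal (indicator T (si u) * n u * indicator {ta (-e)..ta e} u) \<partial>lborel)"
  proof (rule nn_integral_cong)
   fix u :: real
   have "(indicator ?A (u *\<^sub>R b) :: ennreal) = indicator T (si u) * indicator {ta (-e)..ta e} u"
    unfolding indicator_def AT by auto
   moreover have "sqrt (gram_det B Ps (u *\<^sub>R b)) = n u"
    by (simp add: b gram_det_eq gram_singleton n_def c1_def norm_eq_sqrt_inner)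
   ultimately show "ennreal (sqrt (gram_det B Ps (u *\<^sub>R b))) * indicator ?A (u *\<^sub>R b) =
     ennreal (indicator T (si u) * n u * indicator {ta (-e)..ta e} u)"
    by (simp add: indicator_def)
  qed
  \<comment> \<open>The Gram density of a curve is its speed, so substituting arc length leaves
    Lebesgue measure.\<close>
  also have "... = (\<integral>\<^sup>+s. ennreal (indicator T s * indicator {si (ta (-e))..si (ta e)} s) \<partial>lborel)"
  proof (rule nn_integral_substitution[symmetric])
   have ends: "\<bar>ta e - a\<bar> < et'" "\<bar>ta (-e) - a\<bar> < et'" "si (ta e) = e" "si (ta (-e)) = -e" using ta[of e] ta[of "-e"] e by auto
   show "ta (-e) <= ta e" using mono[of "ta (-e)" "ta e"] ends e by simp
   show "set_borel_measurable borel {si (ta (-e))..si (ta e)} (indicator T :: real => real)"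
    using Tb by (simp add: set_borel_measurable_def)
   have *: "\<bar>x - a\<bar> <= et'" if "x \<in> {ta (-e)..ta e}" for x using that ends by auto
   then show "continuous_on {ta (-e)..ta e} n" using et' by (intro continuous_on_subset[OF contn]) force
   show "(si has_real_derivative n x) (at x)" "0 <= n x" if "x \<in> {ta (-e)..ta e}" for x
    using dsi[OF *[OF that]] by (auto simp: n_def)
  qed
  also have "... = (\<integral>\<^sup>+s. indicator T s \<partial>lborel)"
   using ta[of e] ta[of "-e"] e by (intro nn_integral_cong) (auto simp: T_def indicator_def)
  also have "... = emeasure lborel T" using Tb by simp
  finally show ?thesis by (simp add: T_def)
 qed
 have "unit_arc X ga ga1 ga2 e"
  unfolding unit_arc_def
 proof (intro conjI allI impI ballI)
  show "norm (ga1 s) = 1" if "\<bar>s\<bar> < e" for s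
   using n0[OF ta'[of s]] that by (simp add: ga1_def n_def)
  fix de assume "0 < de \<and> de <= e"
  then obtain W where W: "open W" "p \<in> W" "ga ` {-de<..<de} = X Int W" using open_image[of de] by blast
  then obtain rh where "rh > 0" "ball p rh \<subseteq> W" using open_contains_ball by blast
  then show "\<exists>rh>0. X Int ball (ga 0) rh \<subseteq> ga ` {-de<..<de}" using W(3) ga0 by auto
 qed (use e D1 D2 cont2 mem im inj meas in auto)
 then show thesis using ga0 by (rule that)
qed

text \<open>Two measures on the ambient space agree on Borel sets by the last clause of
  \<open>unit_arc\<close>, hence so do the integrals against them.\<close>

lemma nn_integral_unit_arc:
 fixes X :: "(real^'d) set"
 assumes X: "compact X" "charted 1 X" and a: "unit_arc X ga ga1 ga2 e" and [measurable]: "g \<in> borel_measurable borel"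
 shows "(\<integral>\<^sup>+x\<in>ga ` {-e<..<e}. g x \<partial>ivol 1 X) = (\<integral>\<^sup>+s\<in>{-e<..<e}. g (ga s) \<partial>lborel)"
proof -
 let ?I = "{-e<..<e}" and ?mu = "ivol 1 X"
 have im: "ga ` ?I \<in> sets borel" "ga ` ?I \<subseteq> X" using a by (auto simp: unit_arc_def)
 have m1: "ga \<in> measurable (restrict_space lborel ?I) borel"
  using borel_measurable_continuous_on_restrict[OF continuous_on_unit_arc[OF a]] by (auto simp: measurable_def space_restrict_space sets_restrict_space)
 have m2: "(\<lambda>x. x) \<in> measurable (restrict_space ?mu (ga ` ?I)) borel"
  by (intro measurable_restrict_space1 measurable_ivol[OF X]) simp
 have imX: "ga ` ?I \<in> sets ?mu" using im sets_ivol[OF X] by simp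
 have "distr (restrict_space ?mu (ga ` ?I)) borel (\<lambda>x. x) = distr (restrict_space lborel ?I) borel ga"
 proof (rule measure_eqI)
  fix E assume "E \<in> sets (distr (restrict_space ?mu (ga ` ?I)) borel (\<lambda>x. x))"
  then have E: "E \<in> sets borel" by simp
  have "E Int ga ` ?I \<in> sets ?mu" using E im sets_ivol[OF X] by auto
  then have "emeasure (restrict_space ?mu (ga ` ?I)) (E Int ga ` ?I) = emeasure ?mu (E Int ga ` ?I)"
   using imX sets.sets_into_space[OF imX] by (subst emeasure_restrict_space) (auto simp: Int_absorb2)
  moreover have "emeasure (restrict_space lborel ?I) (ga -` E Int ?I) = emeasure lborel {s\<in>?I. ga s \<in> E}"
   by (subst emeasure_restrict_space) (auto intro!: arg_cong[where f = "emeasure lborel"])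
  moreover have "space (restrict_space ?mu (ga ` ?I)) = ga ` ?I" using sets.sets_into_space[OF imX] by (auto simp: space_restrict_space)
  then have "emeasure (distr (restrict_space ?mu (ga ` ?I)) borel (\<lambda>x. x)) E = emeasure (restrict_space ?mu (ga ` ?I)) (E Int ga ` ?I)"
   using emeasure_distr[OF m2 E] by simp
  moreover have "emeasure ?mu (E Int ga ` ?I) = emeasure lborel {s\<in>?I. ga s \<in> E}"
   using a E unfolding unit_arc_def by blast
  ultimately show "emeasure (distr (restrict_space ?mu (ga ` ?I)) borel (\<lambda>x. x)) E = emeasure (distr (restrict_space lborel ?I) borel ga) E"
   using emeasure_distr[OF m1 E] by (simp add: space_restrict_space)
 qed simp
 then have "(\<integral>\<^sup>+x. g x \<partial>distr (restrict_space ?mu (ga ` ?I)) borel (\<lambda>x. x)) = (\<integral>\<^sup>+x. g x \<partial>distr (restrict_space lborel ?I) borel ga)" by simp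
 then show ?thesis
  using imX sets.sets_into_space[OF imX]
  by (simp add: nn_integral_distr[OF m1] nn_integral_distr[OF m2] nn_integral_restrict_space Int_absorb2 del: One_nat_def)
qed

section \<open>Chord length and curvature along an arc\<close>

lemma vector_mvt_bound:
 fixes f :: "real => 'a::real_normed_vector"
 assumes "!!s. \<bar>s\<bar> <= \<bar>r\<bar> ==> (f has_vector_derivative f' s) (at s)" "!!s. \<bar>s\<bar> <= \<bar>r\<bar> ==> norm (f' s) <= B"
 shows "norm (f r - f 0) <= B * \<bar>r\<bar>"
proof -
 have "norm (f r - f 0) <= B * norm (r - 0)"
 proof (rule differentiable_bound[of "{-\<bar>r\<bar>..\<bar>r\<bar>}" f "\<lambda>s h. h *\<^sub>R f' s"])
  fix s assume "s \<in> {-\<bar>r\<bar>..\<bar>r\<bar>}"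
  then have s: "\<bar>s\<bar> <= \<bar>r\<bar>" by auto
  show "(f has_derivative (\<lambda>h. h *\<^sub>R f' s)) (at s within {-\<bar>r\<bar>..\<bar>r\<bar>})"
   using assms(1)[OF s] unfolding has_vector_derivative_def by (rule has_derivative_at_withinI)
  show "onorm (\<lambda>h. h *\<^sub>R f' s) <= B"
   using assms(2)[OF s] by (intro onorm_le) (simp add: mult.commute[of B] mult_left_mono)
 qed auto
 then show ?thesis by simp
qed

text \<open>Convexity: the slope is nondecreasing and vanishes at 0, where the function vanishes
  too.\<close>

lemma nonneg_of_second_derivative:
 fixes h :: "real => real"
 assumes h: "!!s. \<bar>s\<bar> <= de ==> (h has_real_derivative h1 s) (at s)" "!!s. \<bar>s\<bar> <= de ==> (h1 has_real_derivative h2 s) (at s)"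
  and 0: "h 0 = 0" "h1 0 = 0" and pos: "!!s. \<bar>s\<bar> <= de ==> h2 s \<ge> 0" and s: "\<bar>s\<bar> <= de"
 shows "h s \<ge> 0"
proof -
 have mono: "h1 a <= h1 b" if "a <= b" "-de <= a" "b <= de" for a b
 proof (rule DERIV_nonneg_imp_nondecreasing[OF that(1)])
  fix x assume "a <= x" "x <= b"
  then have "\<bar>x\<bar> <= de" using that by auto
  then show "\<exists>y. (h1 has_real_derivative y) (at x) \<and> 0 <= y" using h pos by blast
 qed
 show ?thesis
 proof (cases "0 <= s")
  case True
  have "h 0 <= h s"
  proof (rule DERIV_nonneg_imp_nondecreasing[OF True])
   fix x assume x: "0 <= x" "x <= s"
   then have "\<bar>x\<bar> <= de" using s by auto
   from h(1)[OF this] show "\<exists>y. (h has_real_derivative y) (at x) \<and> 0 <= y"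
    using mono[of 0 x] x s 0 by (intro exI[of _ "h1 x"]) auto
  qed
  then show ?thesis using 0 by simp
 next
  case False
  then have "h 0 <= h s"
  proof (intro DERIV_nonpos_imp_nonincreasing[of s 0 h])
   fix x assume x: "s <= x" "x <= 0"
   then have "\<bar>x\<bar> <= de" using s by auto
   from h(1)[OF this] show "\<exists>y. (h has_real_derivative y) (at x) \<and> y <= 0"
    using mono[of x 0] x s 0 by (intro exI[of _ "h1 x"]) auto
  qed auto
  then show ?thesis using 0 by simp
 qed
qed

text \<open>The lower bound \<open>P\<close> may be negative inside the interval, so it is compared
  through its positive part, which the nonnegative \<open>F\<close> still dominates.\<close>

lemma integral_le_nn_integral:
 fixes P F :: "real => real"
 assumes P: "!!s. (Q has_real_derivative P s) (at s)" "continuous_on UNIV P" and ab: "a <= b"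
  and F: "!!s. a <= s ==> s <= b ==> 0 <= F s \<and> P s <= F s"
 shows "ennreal (Q b - Q a) <= (\<integral>\<^sup>+s\<in>{a..b}. ennreal (F s) \<partial>lborel)"
proof -
 have c: "continuous_on {a..b} P" "continuous_on {a..b} (\<lambda>s. max 0 (P s))"
  by (intro continuous_intros continuous_on_subset[OF P(2)]; simp)+
 have int: "(\<lambda>s. max 0 (P s)) integrable_on {a..b}" "P integrable_on {a..b}"
  using c by (auto intro: integrable_continuous_real)
 have "(P has_integral (Q b - Q a)) {a..b}"
  by (rule fundamental_theorem_of_calculus[OF ab])
   (use P(1) in \<open>auto simp: has_real_derivative_iff_has_vector_derivative[symmetric] intro: has_field_derivative_at_within\<close>)
 then have "Q b - Q a = integral {a..b} P" by (simp add: integral_unique)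
 also have "... <= integral {a..b} (\<lambda>s. max 0 (P s))" using int by (intro integral_le) auto
 also have "ennreal ... = (\<integral>\<^sup>+s. ennreal (max 0 (P s) * indicator {a..b} s) \<partial>lborel)"
 proof -
  have "((\<lambda>s. max 0 (P s) * indicator {a..b} s) has_integral integral {a..b} (\<lambda>s. max 0 (P s))) UNIV"
  proof -
   have "(\<lambda>s. max 0 (P s) * indicator {a..b} s) = (\<lambda>s. if s \<in> {a..b} then max 0 (P s) else 0)"
    by (auto simp: indicator_def)
   then show ?thesis using integrable_integral[OF int(1)] by (simp only: has_integral_restrict_UNIV)
  qed
  moreover have "(\<lambda>s. max 0 (P s) * indicator {a..b} s) \<in> borel_measurable borel"
   using borel_measurable_continuous_onI[OF P(2)] by measurable
  ultimately show ?thesis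
   by (intro nn_integral_has_integral_lborel[symmetric]) auto
 qed
 also have "... <= (\<integral>\<^sup>+s\<in>{a..b}. ennreal (F s) \<partial>lborel)"
  using F by (intro nn_integral_mono) (auto split: split_indicator intro!: ennreal_leI)
 finally show ?thesis by (simp add: ennreal_leI)
qed

text \<open>The term added to 1 is antisymmetric in \<open>x\<close> and \<open>y\<close>, so it
  disappears from the double integral of a symmetric kernel. In the inner integral it remains and
  shifts the coefficient of \<open>t ^ 5\<close> by a multiple of 1 plus the inner product of the
  curvature vector with \<open>x - c\<close>.\<close>

abbreviation moment_weight :: "'a::real_inner => real => 'a => 'a => real" where
 "moment_weight c l x y \<equiv> 1 + l * ((dist y c)\<^sup>2 - (dist x c)\<^sup>2)"

definition weighted_cap :: "'a::euclidean_space measure => 'a => real => real => 'a => ennreal" where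
 "weighted_cap mu c l t x = (\<integral>\<^sup>+y. ennreal (cap_kernel t (dist x y) * moment_weight c l x y) \<partial>mu)"

text \<open>Within distance \<open>t\<close> the linear term contributes at least
  \<open>- (2 * l * R * t)\<close> and the quadratic term is nonnegative. Nonnegative weights are
  needed because the integrals take values in \<open>ennreal\<close>.\<close>

lemma moment_weight_ge:
 fixes x y c :: "'a::real_inner"
 assumes "0 <= l" "dist x c <= R" "dist x y <= t" "2 * l * R * t <= 1"
 shows "0 <= moment_weight c l x y"
  and "moment_weight c l x y = 1 + l * (2 * ((x - c) \<bullet> (y - x)) + (dist x y)\<^sup>2)"
proof -
 have "(dist y c)\<^sup>2 = (norm ((x - c) + (y - x)))\<^sup>2" by (simp add: dist_norm)
 also have "... = (dist x c)\<^sup>2 + 2 * ((x - c) \<bullet> (y - x)) + (dist x y)\<^sup>2"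
  unfolding power2_norm_eq_inner dist_norm norm_minus_commute[of x y]
  by (simp add: inner_add_left inner_add_right inner_commute algebra_simps)
 finally have e: "(dist y c)\<^sup>2 - (dist x c)\<^sup>2 = 2 * ((x - c) \<bullet> (y - x)) + (dist x y)\<^sup>2" by simp
 then show "moment_weight c l x y = 1 + l * (2 * ((x - c) \<bullet> (y - x)) + (dist x y)\<^sup>2)" by simp
 have "\<bar>(x - c) \<bullet> (y - x)\<bar> <= norm (x - c) * norm (y - x)" by (rule Cauchy_Schwarz_ineq2)
 also have "... <= R * t"
  using assms by (intro mult_mono) (auto simp: dist_norm norm_minus_commute intro: order_trans[OF norm_ge_zero])
 finally have "- (2 * (R * t)) <= 2 * ((x - c) \<bullet> (y - x)) + (dist x y)\<^sup>2" using zero_le_power2[of "dist x y"] by linarith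
 then have "l * (- (2 * (R * t))) <= l * ((dist y c)\<^sup>2 - (dist x c)\<^sup>2)" unfolding e using assms(1) by (rule mult_left_mono)
 then show "0 <= moment_weight c l x y" using assms(4) by (simp add: algebra_simps)
qed

text \<open>On the parameter interval of radius \<open>t\<close> about \<open>s0\<close> the
  integrand is bounded below by the polynomial \<open>P\<close>: the kernel through the upper bound
  on the chord, the weight through the expansion with curvature vector \<open>ka\<close>. The
  integrals of \<open>t\<^sup>2 - s\<^sup>2\<close> against 1 and \<open>s\<^sup>2\<close>, and of
  \<open>al * s ^ 4\<close>, produce the coefficients \<open>4 / 3\<close>, \<open>4 / 15\<close>
  and \<open>2 / 5\<close>.\<close>

lemma weighted_cap_ge:
 fixes X :: "(real^'d) set"
 assumes X: "compact X" "charted 1 X" and a: "unit_arc X ga ga1 ga2 e" and t: "0 < t" "\<bar>s0\<bar> + t < e"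
  and l: "0 <= l" "dist (ga s0) c <= R" "2 * l * R * t <= 1" and ep: "0 <= ep" and al: "0 <= al"
  and T: "!!s. \<bar>s\<bar> <= t ==> norm (ga (s0 + s) - ga s0 - s *\<^sub>R ga1 s0 - (s\<^sup>2 / 2) *\<^sub>R ka) <= ep * s\<^sup>2"
  and D: "!!s. \<bar>s\<bar> <= t ==> (dist (ga s0) (ga (s0 + s)))\<^sup>2 <= s\<^sup>2 - al * s ^ 4"
 defines "mu' \<equiv> l * (1 - (norm ka + 2 * ep) * t + ka \<bullet> (ga s0 - c) - 2 * ep * R)"
 shows "ennreal (4 / 3 * t ^ 3 + (4 / 15 * mu' + 2 / 5 * al) * t ^ 5 + 2 / 7 * al * mu' * t ^ 7)
  <= weighted_cap (ivol 1 X) c l t (ga s0)"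
proof -
 let ?x = "ga s0" and ?mu = "ivol 1 X"
 define A where "A = (?x - c) \<bullet> ga1 s0"
 define B where "B = ka \<bullet> (?x - c)"
 \<comment> \<open>The linear coefficient of the weight; all its contributions to \<open>P\<close>
   are odd in \<open>s\<close> and drop out of \<open>Q t - Q (- t)\<close>.\<close>
 define be where "be = 2 * l * A"
 have mu': "mu' = l * (1 - (norm ka + 2 * ep) * t + B - 2 * ep * R)" by (simp add: mu'_def B_def)
 define P where "P s = (t\<^sup>2 - s\<^sup>2 + al * s ^ 4) * (1 + be * s + mu' * s\<^sup>2)" for s
 define Q where "Q s = t\<^sup>2 * s + t\<^sup>2 * be * s\<^sup>2 / 2 + (t\<^sup>2 * mu' - 1) * s ^ 3 / 3 - be * s ^ 4 / 4 + (al - mu') * s ^ 5 / 5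
   + al * be * s ^ 6 / 6 + al * mu' * s ^ 7 / 7" for s
 have dQ: "(Q has_real_derivative P s) (at s)" for s
  unfolding Q_def P_def by (rule derivative_eq_intros refl | simp)+ (simp add: eval_nat_numeral algebra_simps)
 have contP: "continuous_on UNIV P" unfolding P_def by (intro continuous_intros)
 define F where "F s = cap_kernel t (dist ?x (ga (s0 + s))) * moment_weight c l ?x (ga (s0 + s))" for s
 have F: "0 <= F s \<and> P s <= F s" if s: "- t <= s" "s <= t" for s
 proof -
  have s': "\<bar>s\<bar> <= t" using s by auto
  let ?y = "ga (s0 + s)"
  have D0: "(dist ?x ?y)\<^sup>2 <= s\<^sup>2 - al * s ^ 4" by (rule D[OF s'])
  have s4: "0 <= al * s ^ 4" using al by simp
  have s2: "s\<^sup>2 <= t\<^sup>2" using s' by (simp add: power2_le_iff_abs_le t less_imp_le)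
  have "(dist ?x ?y)\<^sup>2 <= t\<^sup>2" using D0 s4 s2 by linarith
  then have dt: "dist ?x ?y <= t" using t by (simp add: power2_le_iff_abs_le)
  note w = moment_weight_ge[OF l(1,2) dt l(3)]
  define E where "E = ?y - ?x - s *\<^sub>R ga1 s0 - (s\<^sup>2 / 2) *\<^sub>R ka"
  have E: "norm E <= ep * s\<^sup>2" unfolding E_def by (rule T[OF s'])
  have y: "?y - ?x = s *\<^sub>R ga1 s0 + ((s\<^sup>2 / 2) *\<^sub>R ka + E)" by (simp add: E_def)
  have n1: "norm (ga1 s0) = 1" by (rule unit_arcD(3)[OF a]) (use t in linarith)
  have p: "norm ((s\<^sup>2 / 2) *\<^sub>R ka + E) <= s\<^sup>2 * (norm ka / 2 + ep)"
   using norm_triangle_ineq[of "(s\<^sup>2 / 2) *\<^sub>R ka" E] E by (simp add: algebra_simps)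
  have "\<bar>s\<bar> <= dist ?x ?y + s\<^sup>2 * (norm ka / 2 + ep)"
  proof -
   have "norm (s *\<^sub>R ga1 s0) <= norm (?y - ?x) + norm ((s\<^sup>2 / 2) *\<^sub>R ka + E)"
    using norm_triangle_ineq4[of "?y - ?x" "(s\<^sup>2 / 2) *\<^sub>R ka + E"] by (simp add: y)
   then show ?thesis using p n1 by (simp add: dist_norm norm_minus_commute)
  qed
  then have lo: "\<bar>s\<bar> - s\<^sup>2 * (norm ka / 2 + ep) <= dist ?x ?y" by simp
  \<comment> \<open>The weight contains the squared chord with a positive sign, so a lower bound on
    the chord is needed as well.\<close>
  have dlow: "s\<^sup>2 * (1 - (norm ka + 2 * ep) * t) <= (dist ?x ?y)\<^sup>2"
  proof -
   define q where "q = s\<^sup>2 * (norm ka / 2 + ep)"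
   have q0: "0 <= q" using ep by (simp add: q_def)
   have 1: "s\<^sup>2 - 2 * \<bar>s\<bar> * q <= (dist ?x ?y)\<^sup>2"
   proof (cases "q <= \<bar>s\<bar>")
    case True
    then have "(\<bar>s\<bar> - q)\<^sup>2 <= (dist ?x ?y)\<^sup>2" using lo by (intro power_mono) (auto simp: q_def)
    moreover have "(\<bar>s\<bar> - q)\<^sup>2 = s\<^sup>2 - 2 * \<bar>s\<bar> * q + q\<^sup>2" by (simp add: power2_eq_square algebra_simps)
    ultimately show ?thesis using zero_le_power2[of q] by linarith
   next
    case False
    then have "\<bar>s\<bar> * \<bar>s\<bar> <= \<bar>s\<bar> * q" by (intro mult_left_mono) auto
    then have "s\<^sup>2 <= \<bar>s\<bar> * q" by (simp add: power2_eq_square)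
    moreover have "0 <= \<bar>s\<bar> * q" using q0 by simp
    ultimately show ?thesis using zero_le_power2[of "dist ?x ?y"] by linarith
   qed
   have "2 * \<bar>s\<bar> * q <= 2 * t * q" using s' q0 by (intro mult_right_mono) auto
   then show ?thesis using 1 by (simp add: q_def algebra_simps)
  qed
  have "(?x - c) \<bullet> E \<ge> - (R * (ep * s\<^sup>2))"
  proof -
   have "\<bar>(?x - c) \<bullet> E\<bar> <= norm (?x - c) * norm E" by (rule Cauchy_Schwarz_ineq2)
   also have "... <= R * (ep * s\<^sup>2)" using l E ep by (intro mult_mono) (auto simp: dist_norm intro: order_trans[OF norm_ge_zero])
   finally show ?thesis by linarith
  qed
  then have "2 * (s * A + s\<^sup>2 / 2 * B - R * (ep * s\<^sup>2)) + s\<^sup>2 * (1 - (norm ka + 2 * ep) * t)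
    <= 2 * ((?x - c) \<bullet> (?y - ?x)) + (dist ?x ?y)\<^sup>2"
   unfolding y A_def B_def using dlow by (simp add: inner_add_right inner_commute)
  note ml = mult_left_mono[OF this l(1)]
  have wl: "1 + be * s + mu' * s\<^sup>2 <= moment_weight c l ?x ?y"
  proof -
   have "1 + be * s + mu' * s\<^sup>2 = 1 + l * (2 * (s * A + s\<^sup>2 / 2 * B - R * (ep * s\<^sup>2)) + s\<^sup>2 * (1 - (norm ka + 2 * ep) * t))"
    unfolding be_def mu' by (simp add: field_simps)
   with w(2) ml show ?thesis by linarith
  qed
  have al0: "0 <= t\<^sup>2 - s\<^sup>2 + al * s ^ 4" using s2 s4 by simp
  have k: "t\<^sup>2 - s\<^sup>2 + al * s ^ 4 <= cap_kernel t (dist ?x ?y)" using D0 by simp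
  have "P s <= (t\<^sup>2 - s\<^sup>2 + al * s ^ 4) * moment_weight c l ?x ?y"
   unfolding P_def by (rule mult_left_mono[OF wl al0])
  also have "... <= F s" unfolding F_def by (rule mult_right_mono[OF k w(1)])
  finally show ?thesis using w(1) by (simp add: F_def)
 qed
 have "4 / 3 * t ^ 3 + (4 / 15 * mu' + 2 / 5 * al) * t ^ 5 + 2 / 7 * al * mu' * t ^ 7 = Q t - Q (- t)"
  by (simp add: Q_def eval_nat_numeral field_simps)
 also have "ennreal ... <= (\<integral>\<^sup>+s\<in>{-t..t}. ennreal (F s) \<partial>lborel)"
  by (rule integral_le_nn_integral[OF dQ contP _ F]) (use t in auto)
 also have "... = (\<integral>\<^sup>+s\<in>{s0 - t..s0 + t}. ennreal (cap_kernel t (dist ?x (ga s)) * moment_weight c l ?x (ga s)) \<partial>lborel)"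
 proof -
  let ?G = "\<lambda>s. ennreal (cap_kernel t (dist ?x (ga s)) * moment_weight c l ?x (ga s)) * indicator {s0 - t..s0 + t} s"
  have "continuous_on {s0 - t..s0 + t} ga"
   by (rule continuous_on_subset[OF continuous_on_unit_arc[OF a]]) (use t in auto)
  then have "continuous_on {s0 - t..s0 + t} (\<lambda>s. cap_kernel t (dist ?x (ga s)) * moment_weight c l ?x (ga s))"
   by (intro continuous_intros)
  then have "(\<lambda>s. indicator {s0 - t..s0 + t} s *\<^sub>R (cap_kernel t (dist ?x (ga s)) * moment_weight c l ?x (ga s))) \<in> borel_measurable borel"
   by (rule borel_measurable_continuous_on_indicator[rotated]) simp
  then have "(\<lambda>s. ennreal (indicator {s0 - t..s0 + t} s *\<^sub>R (cap_kernel t (dist ?x (ga s)) * moment_weight c l ?x (ga s)))) \<in> borel_measurable borel"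
   by measurable
  then have "?G \<in> borel_measurable borel"
   by (rule measurable_cong[THEN iffD1, rotated]) (auto split: split_indicator)
  from nn_integral_real_affine[OF this, of 1 s0]
  have "(\<integral>\<^sup>+s. ?G s \<partial>lborel) = (\<integral>\<^sup>+s. ?G (s0 + s) \<partial>lborel)" by simp
  also have "... = (\<integral>\<^sup>+s\<in>{-t..t}. ennreal (F s) \<partial>lborel)"
   by (intro nn_integral_cong) (auto simp: F_def split: split_indicator)
  finally show ?thesis by simp
 qed
 also have "... <= (\<integral>\<^sup>+s\<in>{-e<..<e}. ennreal (cap_kernel t (dist ?x (ga s)) * moment_weight c l ?x (ga s)) \<partial>lborel)"
  using t by (intro nn_integral_mono) (auto split: split_indicator)
 also have "... = (\<integral>\<^sup>+y\<in>ga ` {-e<..<e}. ennreal (cap_kernel t (dist ?x y) * moment_weight c l ?x y) \<partial>?mu)"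
  by (rule nn_integral_unit_arc[OF X a, symmetric]) measurable
 also have "... <= weighted_cap ?mu c l t ?x"
  unfolding weighted_cap_def by (intro nn_integral_mono) (auto split: split_indicator)
 finally show ?thesis .
qed

lemma has_real_derivative_inner:
 fixes f g :: "real => 'a::real_inner"
 assumes "(f has_vector_derivative f') (at s)" "(g has_vector_derivative g') (at s)"
 shows "((\<lambda>s. f s \<bullet> g s) has_real_derivative (f s \<bullet> g' + f' \<bullet> g s)) (at s)"
 unfolding has_field_derivative_def
 by (rule has_derivative_eq_rhs[OF has_derivative_inner[OF assms[unfolded has_vector_derivative_def]]])
  (simp add: fun_eq_iff distrib_left mult.commute)

lemma unit_arc_orthogonal:
 assumes a: "unit_arc X ga ga1 ga2 e" and s: "\<bar>s\<bar> < e"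
 shows "ga2 s \<bullet> ga1 s = 0"
proof -
 have "((\<lambda>u. ga1 u \<bullet> ga1 u) has_real_derivative (ga1 s \<bullet> ga2 s + ga2 s \<bullet> ga1 s)) (at s)"
  by (rule has_real_derivative_inner; rule unit_arcD(2)[OF a s])
 moreover have "((\<lambda>u. ga1 u \<bullet> ga1 u) has_real_derivative 0) (at s)"
  by (rule has_field_derivative_transform_within_open[of "\<lambda>_. 1" 0 _ "{-e<..<e}"])
   (use s unit_arcD(3)[OF a] in \<open>auto simp: norm_eq_1\<close>)
 ultimately have "ga1 s \<bullet> ga2 s + ga2 s \<bullet> ga1 s = 0" by (rule DERIV_unique)
 then show ?thesis by (simp add: inner_commute)
qed

text \<open>Expanding the chord to order four would call for higher derivatives of the curve.
  Instead the defect \<open>h\<close> is differentiated twice: as the tangent has constant length 1,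
  \<open>h2\<close> involves only the product of \<open>ga2\<close> with the chord, and closeness of
  \<open>ga2\<close> to \<open>ka\<close> makes it nonnegative.\<close>

lemma unit_arc_second_order:
 fixes X :: "(real^'d) set"
 assumes a: "unit_arc X ga ga1 ga2 e" and et: "0 <= et" and t: "0 < t" "\<bar>s0\<bar> + t < e"
  and near: "!!s. \<bar>s\<bar> <= t ==> norm (ga2 (s0 + s) - ka) <= et" and s: "\<bar>s\<bar> <= t"
 shows "norm (ga (s0 + s) - ga s0 - s *\<^sub>R ga1 s0 - (s\<^sup>2 / 2) *\<^sub>R ka) <= et * s\<^sup>2"
  and "(dist (ga s0) (ga (s0 + s)))\<^sup>2 <= s\<^sup>2"
  and "(dist (ga s0) (ga (s0 + s)))\<^sup>2 <= s\<^sup>2 - ((norm ka)\<^sup>2 - et * (5 * norm ka + 4 * et)) / 12 * s ^ 4"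
proof -
 have in_e: "\<bar>s0 + s\<bar> < e" if "\<bar>s\<bar> <= t" for s using that t by linarith
 have shift: "((\<lambda>s. f (s0 + s)) has_vector_derivative f' (s0 + s)) (at s)"
  if "(f has_vector_derivative f' (s0 + s)) (at (s0 + s))" for f f' :: "real => real^'d" and s
 proof -
  have "((\<lambda>s. s0 + s) has_vector_derivative 0 + 1) (at s)"
   by (intro has_vector_derivative_add has_vector_derivative_const has_vector_derivative_id)
  from vector_diff_chain_at[OF this that] show ?thesis by (simp add: o_def)
 qed
 have d0: "((\<lambda>s. ga (s0 + s)) has_vector_derivative ga1 (s0 + s)) (at s)"
  and d1: "((\<lambda>s. ga1 (s0 + s)) has_vector_derivative ga2 (s0 + s)) (at s)" if "\<bar>s\<bar> <= t" for s
  by (rule shift unit_arcD(1,2)[OF a in_e[OF that]])+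
 let ?T = "ga1 s0" and ?x = "ga s0"
 define ph where "ph s = ga1 (s0 + s) - ?T - s *\<^sub>R ka" for s
 define ps where "ps s = ga (s0 + s) - ?x - s *\<^sub>R ?T - (s\<^sup>2 / 2) *\<^sub>R ka" for s
 have dph: "(ph has_vector_derivative (ga2 (s0 + s) - ka)) (at s)" if "\<bar>s\<bar> <= t" for s
  unfolding ph_def by (auto intro!: derivative_eq_intros d1[OF that])
 have dps: "(ps has_vector_derivative ph s) (at s)" if "\<bar>s\<bar> <= t" for s
 proof -
  have "((\<lambda>s. s\<^sup>2 / 2) has_real_derivative s) (at s)" by (auto intro!: derivative_eq_intros)
  from has_vector_derivative_scaleR[OF this has_vector_derivative_const[of ka]]
  have "((\<lambda>s. (s\<^sup>2 / 2) *\<^sub>R ka) has_vector_derivative s *\<^sub>R ka) (at s)" by simp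
  then show ?thesis unfolding ps_def ph_def by (auto intro!: derivative_eq_intros d0[OF that])
 qed
 have bph: "norm (ph s) <= et * \<bar>s\<bar>" if "\<bar>s\<bar> <= t" for s
  using vector_mvt_bound[of s ph "\<lambda>s. ga2 (s0 + s) - ka" et] dph near that by (simp add: ph_def)
 have bps: "norm (ps s) <= et * s\<^sup>2" if s: "\<bar>s\<bar> <= t" for s
 proof -
  have "norm (ps s - ps 0) <= (et * \<bar>s\<bar>) * \<bar>s\<bar>"
  proof (rule vector_mvt_bound[of s ps ph])
   fix s' assume s': "\<bar>s'\<bar> <= \<bar>s\<bar>"
   show "(ps has_vector_derivative ph s') (at s')" using s s' by (intro dps) linarith
   have "norm (ph s') <= et * \<bar>s'\<bar>" using s s' by (intro bph) linarith
   also have "... <= et * \<bar>s\<bar>" using s' et by (rule mult_left_mono)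
   finally show "norm (ph s') <= et * \<bar>s\<bar>" .
  qed
  then show ?thesis by (simp add: ps_def power2_eq_square mult.assoc)
 qed
 show "norm (ga (s0 + s) - ga s0 - s *\<^sub>R ga1 s0 - (s\<^sup>2 / 2) *\<^sub>R ka) <= et * s\<^sup>2" using bps[OF s] by (simp add: ps_def)
 have "norm (ga (s0 + s) - ga (s0 + 0)) <= 1 * \<bar>s\<bar>"
 proof (rule vector_mvt_bound[of s "\<lambda>s. ga (s0 + s)" "\<lambda>s. ga1 (s0 + s)"])
  fix s' assume "\<bar>s'\<bar> <= \<bar>s\<bar>"
  then have s': "\<bar>s'\<bar> <= t" using s by linarith
  show "((\<lambda>s. ga (s0 + s)) has_vector_derivative ga1 (s0 + s')) (at s')" by (rule d0[OF s'])
  show "norm (ga1 (s0 + s')) <= 1" using unit_arcD(3)[OF a in_e[OF s']] by simp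
 qed
 then have "dist ?x (ga (s0 + s)) <= \<bar>s\<bar>" by (simp add: dist_norm norm_minus_commute)
 from power_mono[OF this, of 2] show "(dist (ga s0) (ga (s0 + s)))\<^sup>2 <= s\<^sup>2" by simp
 define k where "k = norm ka"
 \<comment> \<open>For a circle of curvature \<open>k\<close> the coefficient is
   \<open>k\<^sup>2 / 12\<close>. Before division by 12 the error is \<open>et * k\<close>, from
   replacing \<open>ga2\<close> by \<open>ka\<close>, plus \<open>4 * et * (k + et)\<close>, from
   the remainder \<open>E\<close>.\<close>
 define al where "al = (k\<^sup>2 - et * (5 * k + 4 * et)) / 12"
 define z where "z s = ga (s0 + s) - ?x" for s
 define h where "h s = s\<^sup>2 - z s \<bullet> z s - al * s ^ 4" for s
 define h1 where "h1 s = 2 * s - 2 * (ga1 (s0 + s) \<bullet> z s) - 4 * al * s ^ 3" for s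
 define h2 where "h2 s = - 2 * (ga2 (s0 + s) \<bullet> z s) - 12 * al * s\<^sup>2" for s
 have dz: "(z has_vector_derivative ga1 (s0 + s)) (at s)" if "\<bar>s\<bar> <= t" for s
  unfolding z_def by (auto intro!: derivative_eq_intros d0[OF that])
 have unit: "ga1 (s0 + s) \<bullet> ga1 (s0 + s) = 1" if "\<bar>s\<bar> <= t" for s
  using unit_arcD(3)[OF a in_e[OF that]] by (simp add: norm_eq_1)
 have orth: "ga2 (s0 + s) \<bullet> ga1 (s0 + s) = 0" if "\<bar>s\<bar> <= t" for s
  by (rule unit_arc_orthogonal[OF a in_e[OF that]])
 have "h s \<ge> 0"
 proof (rule nonneg_of_second_derivative[of t h h1 h2, OF _ _ _ _ _ s])
  fix s assume s: "\<bar>s\<bar> <= t"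
  show "(h has_real_derivative h1 s) (at s)"
   unfolding h_def h1_def
   by (rule derivative_eq_intros has_real_derivative_inner[OF dz[OF s] dz[OF s]] refl | simp add: inner_commute)+
  show "(h1 has_real_derivative h2 s) (at s)"
   unfolding h1_def h2_def
   by (rule derivative_eq_intros has_real_derivative_inner[OF d1[OF s] dz[OF s]] refl | simp add: unit[OF s])+
  \<comment> \<open>The chord is expanded along the tangent at its far end, since it is paired with
    \<open>ga2\<close> at that end, where the tangential part drops out.\<close>
  define E where "E = z s - s *\<^sub>R ga1 (s0 + s) + (s\<^sup>2 / 2) *\<^sub>R ka"
  have "E = ps s - s *\<^sub>R ph s"
   by (simp add: E_def z_def ps_def ph_def algebra_simps power2_eq_square flip: scaleR_add_left)
  then have "norm E <= norm (ps s) + \<bar>s\<bar> * norm (ph s)" using norm_triangle_ineq4[of "ps s" "s *\<^sub>R ph s"] by simp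
  also have "... <= et * s\<^sup>2 + \<bar>s\<bar> * (et * \<bar>s\<bar>)" using bps[OF s] bph[OF s] by (intro add_mono mult_left_mono) auto
  also have "... = 2 * et * s\<^sup>2" by (simp add: power2_eq_square)
  finally have E: "norm E <= 2 * et * s\<^sup>2" .
  have g2: "norm (ga2 (s0 + s)) <= k + et"
   using norm_triangle_ineq[of ka "ga2 (s0 + s) - ka"] near[OF s] by (simp add: k_def)
  have "\<bar>ga2 (s0 + s) \<bullet> E\<bar> <= norm (ga2 (s0 + s)) * norm E" by (rule Cauchy_Schwarz_ineq2)
  also have "... <= (k + et) * (2 * et * s\<^sup>2)" using g2 E et by (intro mult_mono) (auto simp: k_def)
  finally have gE: "\<bar>ga2 (s0 + s) \<bullet> E\<bar> <= (k + et) * (2 * et * s\<^sup>2)" .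
  have "ga2 (s0 + s) \<bullet> ka = k\<^sup>2 + (ga2 (s0 + s) - ka) \<bullet> ka" by (simp add: inner_diff_left k_def power2_norm_eq_inner)
  moreover have "\<bar>(ga2 (s0 + s) - ka) \<bullet> ka\<bar> <= et * k"
   unfolding k_def using near[OF s] by (intro order_trans[OF Cauchy_Schwarz_ineq2] mult_right_mono) auto
  ultimately have gk: "k\<^sup>2 - et * k <= ga2 (s0 + s) \<bullet> ka" by linarith
  have "z s = s *\<^sub>R ga1 (s0 + s) - (s\<^sup>2 / 2) *\<^sub>R ka + E" by (simp add: E_def)
  then have "ga2 (s0 + s) \<bullet> z s = - (s\<^sup>2 / 2) * (ga2 (s0 + s) \<bullet> ka) + ga2 (s0 + s) \<bullet> E"
   by (simp add: inner_add_right inner_diff_right orth[OF s])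
  then have "h2 s = s\<^sup>2 * (ga2 (s0 + s) \<bullet> ka) - 2 * (ga2 (s0 + s) \<bullet> E) - 12 * al * s\<^sup>2" by (simp add: h2_def)
  moreover have "s\<^sup>2 * (k\<^sup>2 - et * k) <= s\<^sup>2 * (ga2 (s0 + s) \<bullet> ka)" by (rule mult_left_mono[OF gk]) simp
  moreover have "s\<^sup>2 * (k\<^sup>2 - et * k) - 2 * ((k + et) * (2 * et * s\<^sup>2)) = 12 * al * s\<^sup>2"
   by (simp add: al_def algebra_simps power2_eq_square)
  ultimately show "0 <= h2 s" using gE by linarith
 qed (auto simp: h_def h1_def z_def)
 then show "(dist (ga s0) (ga (s0 + s)))\<^sup>2 <= s\<^sup>2 - ((norm ka)\<^sup>2 - et * (5 * norm ka + 4 * et)) / 12 * s ^ 4"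
  by (simp add: h_def z_def al_def k_def dist_norm norm_minus_commute[of "ga s0"] power2_norm_eq_inner)
qed

declare One_nat_def [simp del]

text \<open>The weights of \<open>(x, y)\<close> and \<open>(y, x)\<close> add up to 2, so the
  symmetrized weighted double integral is twice the unweighted one.\<close>

lemma weighted_cap_le:
 fixes X :: "(real^'d) set"
 assumes X: "compact X" "charted 1 X" and R: "!!x. x \<in> X ==> dist x c <= R"
  and t: "0 < t" "0 <= l" "2 * l * R * t <= 1"
 shows "(\<integral>\<^sup>+x. weighted_cap (ivol 1 X) c l t x \<partial>ivol 1 X) = double_integral 1 X (\<lambda>s. ennreal (cap_kernel t s))"
  and "x \<in> X ==> weighted_cap (ivol 1 X) c l t x <= ennreal (2 * t\<^sup>2 * measure (ivol 1 X) X)"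
  and "weighted_cap (ivol 1 X) c l t \<in> borel_measurable (ivol 1 X)"
proof -
 let ?mu = "ivol 1 X"
 interpret finite_measure ?mu by (rule finite_ivol[OF X])
 interpret P: pair_sigma_finite ?mu ?mu ..
 have [measurable]: "(\<lambda>x. x) \<in> borel_measurable ?mu" by (rule measurable_ivol[OF X]) simp
 define k where "k x y = ennreal (cap_kernel t (dist x y) * moment_weight c l x y)" for x y
 have km: "(\<lambda>(x, y). k x y) \<in> borel_measurable (?mu \<Otimes>\<^sub>M ?mu)"
  "(\<lambda>(x, y). k y x) \<in> borel_measurable (?mu \<Otimes>\<^sub>M ?mu)"
 proof -
  have id2: "(\<lambda>p. (fst p, snd p)) \<in> measurable (?mu \<Otimes>\<^sub>M ?mu) borel"
   unfolding borel_prod[symmetric] by measurable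
  have *: "(\<lambda>p. ennreal (f p)) \<in> borel_measurable (?mu \<Otimes>\<^sub>M ?mu)" if "continuous_on UNIV f" for f :: "(real^'d) \<times> (real^'d) => real"
   using measurable_compose[OF id2 borel_measurable_continuous_onI[OF that]] by simp
  show "(\<lambda>(x, y). k x y) \<in> borel_measurable (?mu \<Otimes>\<^sub>M ?mu)" "(\<lambda>(x, y). k y x) \<in> borel_measurable (?mu \<Otimes>\<^sub>M ?mu)"
   unfolding k_def case_prod_beta by (intro * continuous_intros)+
 qed
 have kk: "k x y <= ennreal (2 * t\<^sup>2)" "k x y + k y x = 2 * ennreal (cap_kernel t (dist x y))"
  if x: "x \<in> X" and y: "y \<in> X" for x y
 proof -
  have sum: "moment_weight c l x y + moment_weight c l y x = 2" by (simp add: algebra_simps)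
  show "k x y + k y x = 2 * ennreal (cap_kernel t (dist x y))"
  proof (cases "dist x y <= t")
   case True
   then have w: "0 <= moment_weight c l x y" "0 <= moment_weight c l y x"
    using moment_weight_ge(1)[OF t(2) R[OF x] _ t(3), of y] moment_weight_ge(1)[OF t(2) R[OF y] _ t(3), of x]
    by (auto simp: dist_commute)
   have gen: "ennreal (K * a) + ennreal (K * b) = 2 * ennreal K" if "0 <= a" "0 <= b" "a + b = 2" "0 <= K" for K a b :: real
   proof -
    have "ennreal (K * a) + ennreal (K * b) = ennreal (K * (a + b))" unfolding distrib_left using that by (intro ennreal_plus[symmetric]) auto
    also have "... = 2 * ennreal K" unfolding that(3) using that(4) by (simp add: ennreal_mult mult.commute)
    finally show ?thesis .
   qed
   show ?thesis unfolding k_def dist_commute[of y x] by (rule gen[OF w sum]) simp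
  next
   case False
   then have "t\<^sup>2 <= (dist x y)\<^sup>2" using t by (intro power_mono) auto
   then show ?thesis by (simp add: k_def dist_commute)
  qed
  \<comment> \<open>Since the swapped term is nonnegative, the symmetrization identity also bounds
    each single term.\<close>
  moreover have "k x y <= k x y + k y x" by simp
  ultimately have "k x y <= 2 * ennreal (cap_kernel t (dist x y))" by (simp only:)
  also have "... = ennreal (2 * cap_kernel t (dist x y))" by (simp add: ennreal_mult)
  also have "... <= ennreal (2 * t\<^sup>2)" by (intro ennreal_leI) simp
  finally show "k x y <= ennreal (2 * t\<^sup>2)" .
 qed
 have W: "weighted_cap ?mu c l t x = (\<integral>\<^sup>+y. k x y \<partial>?mu)" for x by (simp add: weighted_cap_def k_def)
 show "weighted_cap ?mu c l t \<in> borel_measurable ?mu"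
  unfolding W[abs_def] using borel_measurable_nn_integral_fst[OF km(1)] by simp
 show "weighted_cap ?mu c l t x <= ennreal (2 * t\<^sup>2 * measure ?mu X)" if x: "x \<in> X"
 proof -
  have "(\<integral>\<^sup>+y. k x y \<partial>?mu) <= (\<integral>\<^sup>+y. ennreal (2 * t\<^sup>2) \<partial>?mu)"
   using kk(1)[OF x] by (intro nn_integral_mono) (simp add: space_ivol[OF X])
  then show ?thesis by (simp add: W space_ivol[OF X] emeasure_ivol_eq_measure[OF X] ennreal_mult)
 qed
 have "(\<integral>\<^sup>+x. \<integral>\<^sup>+y. k y x \<partial>?mu \<partial>?mu) = (\<integral>\<^sup>+x. \<integral>\<^sup>+y. k x y \<partial>?mu \<partial>?mu)"
  using P.Fubini'[of "\<lambda>x y. k x y"] km(1) by simp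
 then have "2 * (\<integral>\<^sup>+x. \<integral>\<^sup>+y. k x y \<partial>?mu \<partial>?mu) = (\<integral>\<^sup>+x. \<integral>\<^sup>+y. k x y \<partial>?mu \<partial>?mu) + (\<integral>\<^sup>+x. \<integral>\<^sup>+y. k y x \<partial>?mu \<partial>?mu)"
  by (simp add: mult_2)
 also have "... = (\<integral>\<^sup>+x. (\<integral>\<^sup>+y. k x y \<partial>?mu) + (\<integral>\<^sup>+y. k y x \<partial>?mu) \<partial>?mu)"
  using borel_measurable_nn_integral_fst[OF km(1)] borel_measurable_nn_integral_fst[OF km(2)]
  by (intro nn_integral_add[symmetric]) simp_all
 also have "... = (\<integral>\<^sup>+x. 2 * (\<integral>\<^sup>+y. ennreal (cap_kernel t (dist x y)) \<partial>?mu) \<partial>?mu)"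
 proof (rule nn_integral_cong)
  fix x assume "x \<in> space ?mu"
  then have x: "x \<in> X" by (simp add: space_ivol[OF X])
  have m1: "k x \<in> borel_measurable ?mu" "(\<lambda>y. k y x) \<in> borel_measurable ?mu"
   using measurable_compose[OF measurable_Pair1' km(1), of x] measurable_compose[OF measurable_Pair1' km(2), of x]
    \<open>x \<in> space ?mu\<close> by simp_all
  have "(\<integral>\<^sup>+y. k x y \<partial>?mu) + (\<integral>\<^sup>+y. k y x \<partial>?mu) = (\<integral>\<^sup>+y. k x y + k y x \<partial>?mu)"
   by (rule nn_integral_add[symmetric, OF m1])
  also have "... = (\<integral>\<^sup>+y. 2 * ennreal (cap_kernel t (dist x y)) \<partial>?mu)"
   using kk(2)[OF x] by (intro nn_integral_cong) (simp add: space_ivol[OF X])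
  also have "... = 2 * (\<integral>\<^sup>+y. ennreal (cap_kernel t (dist x y)) \<partial>?mu)" by (rule nn_integral_cmult) measurable
  finally show "(\<integral>\<^sup>+y. k x y \<partial>?mu) + (\<integral>\<^sup>+y. k y x \<partial>?mu) = 2 * (\<integral>\<^sup>+y. ennreal (cap_kernel t (dist x y)) \<partial>?mu)" .
 qed
 also have "... = 2 * double_integral 1 X (\<lambda>s. ennreal (cap_kernel t s))"
 proof -
  have "(\<lambda>(x, y). ennreal (cap_kernel t (dist x y))) \<in> borel_measurable (?mu \<Otimes>\<^sub>M ?mu)" by measurable
  from borel_measurable_nn_integral_fst[OF this] show ?thesis
   unfolding double_integral_def by (intro nn_integral_cmult) simp
 qed
 finally show "(\<integral>\<^sup>+x. weighted_cap ?mu c l t x \<partial>?mu) = double_integral 1 X (\<lambda>s. ennreal (cap_kernel t s))"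
  unfolding W by (simp add: ennreal_mult_cancel_left)
qed

section \<open>Small-scale asymptotics and the curvature equation\<close>

lemma unit_arc_curvature_near:
 assumes a: "unit_arc X ga ga1 ga2 e" and s: "\<bar>s0\<bar> < e" and et: "et > 0"
 obtains de where "de > 0" "\<bar>s0\<bar> + de < e" "!!s. \<bar>s\<bar> <= de ==> norm (ga2 (s0 + s) - ga2 s0) <= et"
proof -
 have "continuous_on {-e<..<e} ga2" using a by (simp add: unit_arc_def)
 then obtain d where d: "d > 0" "!!u. u \<in> {-e<..<e} ==> dist u s0 < d ==> dist (ga2 u) (ga2 s0) < et"
  using s et unfolding continuous_on_iff by (metis abs_less_iff greaterThanLessThan_iff minus_less_iff)
 define de where "de = min (d / 2) ((e - \<bar>s0\<bar>) / 2)"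
 have de: "de > 0" "de < d" "\<bar>s0\<bar> + de < e" using d s by (auto simp: de_def min_def field_simps)
 have "norm (ga2 (s0 + s) - ga2 s0) <= et" if "\<bar>s\<bar> <= de" for s
 proof -
  have "- e < s0 + s" "s0 + s < e" "\<bar>s\<bar> < d" using that de by linarith+
  then show ?thesis using d(2)[of "s0 + s"] by (simp add: dist_norm less_imp_le)
 qed
 with de show thesis by (intro that)
qed

lemma unit_arc_nhds:
 "unit_arc X ga ga1 ga2 e ==> 0 < de ==> de <= e ==> \<exists>rh>0. X Int ball (ga 0) rh \<subseteq> ga ` {-de<..<de}"
 by (simp add: unit_arc_def)

text \<open>Fatou's lemma requires a lower bound uniform in \<open>x\<close>. It comes from
  \<open>weighted_cap_ge\<close> with the crude choice of curvature vector 0 and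
  \<open>al = 0\<close>, the actual curvature entering only through its local bound
  \<open>K\<close>.\<close>

lemma weighted_cap_uniform:
 fixes X :: "(real^'d) set"
 assumes X: "compact X" "submanifold 2 1 X" and R: "!!x. x \<in> X ==> dist x c <= R" "0 < R" and l: "0 < l"
 obtains N :: nat where "!!x t. x \<in> X ==> 0 < t ==> t <= 1 / real (Suc N) ==>
  ennreal (4 / 3 * t ^ 3 - real N * t ^ 5) <= weighted_cap (ivol 1 X) c l t x"
proof -
 have chX: "charted 1 X" by (rule charted_submanifold[OF X(2)]) simp
 define Q where "Q N x \<longleftrightarrow> (\<forall>t. 0 < t \<and> t <= 1 / real (Suc N) -->
  ennreal (4 / 3 * t ^ 3 - real N * t ^ 5) <= weighted_cap (ivol 1 X) c l t x)" for N x
 have loc: "\<exists>de>0. \<exists>N::nat. \<forall>x\<in>X Int ball p de. Q N x" if p: "p \<in> X" for p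
 proof -
  obtain ga ga1 ga2 e where a: "unit_arc X ga ga1 ga2 e" "ga 0 = p" by (rule unit_arc_exists[OF X p])
  have e: "e > 0" using a(1) by (simp add: unit_arc_def)
  \<comment> \<open>Base points stay within \<open>e / 2\<close> and \<open>t\<close> within
    \<open>e / 4\<close>, so all parameters lie within \<open>3 / 4 * e\<close>.\<close>
  have "continuous_on {- (3 / 4 * e)..3 / 4 * e} ga2"
   using a(1) e by (auto simp: unit_arc_def intro: continuous_on_subset)
  then have "bounded (ga2 ` {- (3 / 4 * e)..3 / 4 * e})" by (intro compact_imp_bounded compact_continuous_image) auto
  then obtain K where K0: "K > 0" "\<forall>y\<in>ga2 ` {- (3 / 4 * e)..3 / 4 * e}. norm y <= K" using bounded_pos by blast
  have "norm (ga2 s) <= K" if "\<bar>s\<bar> <= 3 / 4 * e" for s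
  proof -
   have "s \<in> {- (3 / 4 * e)..3 / 4 * e}" using that by auto
   then show ?thesis using K0(2) by blast
  qed
  note K = K0(1) this
  obtain rh where rh: "rh > 0" "X Int ball p rh \<subseteq> ga ` {- (e / 2)<..<e / 2}"
   using unit_arc_nhds[OF a(1), of "e / 2"] e a(2) by auto
  \<comment> \<open>The summands enforce \<open>t <= e / 4\<close>, the smallness condition of the
    weight, and the lower bound for the coefficient of \<open>t ^ 5\<close>.\<close>
  obtain N :: nat where N: "4 / e + 2 * l * R + 2 * l * K * (1 + R) <= N" using real_arch_simple by blast
  have nn: "0 <= 4 / e" "0 <= 2 * l * R" "0 <= 2 * l * K * (1 + R)" using e l R(2) K(1) by simp_all
  have "Q N x" if x: "x \<in> X Int ball p rh" for x
   unfolding Q_def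
  proof (intro allI impI)
   fix t :: real assume t: "0 < t \<and> t <= 1 / real (Suc N)"
   have Nt: "real N * t < 1"
   proof -
    have "real N * t < real (Suc N) * t" using t by simp
    also have "... <= 1" using t by (simp add: field_simps)
    finally show ?thesis .
   qed
   have *: "b * t <= 1" if "b <= real N" for b
    using mult_right_mono[OF that, of t] Nt t by linarith
   have "4 / e * t <= 1" "2 * l * R * t <= 1" by (rule *; use N nn in linarith)+
   then have te: "t <= e / 4" and lt: "2 * l * R * t <= 1" using e by (auto simp: field_simps)
   have "1 / real (Suc N) <= 1" by simp
   then have t1: "t <= 1" using t by linarith
   have "x \<in> ga ` {- (e / 2)<..<e / 2}" using rh(2) x by blast
   then obtain s0 where "x = ga s0" "s0 \<in> {- (e / 2)<..<e / 2}" by blast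
   then have s0: "x = ga s0" "\<bar>s0\<bar> < e / 2" by auto
   have s0t: "\<bar>s0\<bar> + t < e" using s0 te e by linarith
   have near: "norm (ga2 (s0 + s) - 0) <= K" if "\<bar>s\<bar> <= t" for s
   proof -
    have "\<bar>s0 + s\<bar> <= 3 / 4 * e" using that s0 te by linarith
    then show ?thesis using K(2) by simp
   qed
   note so = unit_arc_second_order[OF a(1) less_imp_le[OF K(1)] conjunct1[OF t] s0t near]
   let ?mu' = "l * (1 - (norm (0 :: real^'d) + 2 * K) * t + 0 \<bullet> (ga s0 - c) - 2 * K * R)"
   have "ennreal (4 / 3 * t ^ 3 - real N * t ^ 5) <= ennreal (4 / 3 * t ^ 3 + (4 / 15 * ?mu' + 2 / 5 * 0) * t ^ 5 + 2 / 7 * 0 * ?mu' * t ^ 7)"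
   proof (rule ennreal_leI)
    have "- (2 * l * K * (1 + R)) <= ?mu'"
    proof -
     have "l * (2 * K * t) <= l * (2 * K * 1)" using t1 l K(1) by (intro mult_left_mono) auto
     then show ?thesis using l by (simp add: algebra_simps)
    qed
    moreover have "2 * l * K * (1 + R) <= real N" using N nn by linarith
    ultimately have "- real N <= 4 / 15 * ?mu'" by linarith
    then have "- real N * t ^ 5 <= 4 / 15 * ?mu' * t ^ 5" using t by (intro mult_right_mono) auto
    then show "4 / 3 * t ^ 3 - real N * t ^ 5 <= 4 / 3 * t ^ 3 + (4 / 15 * ?mu' + 2 / 5 * 0) * t ^ 5 + 2 / 7 * 0 * ?mu' * t ^ 7" by simp
   qed
   also have "... <= weighted_cap (ivol 1 X) c l t (ga s0)"
   proof (rule weighted_cap_ge[OF X(1) chX a(1) conjunct1[OF t] s0t less_imp_le[OF l] R(1) lt less_imp_le[OF K(1)] order_refl])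
    show "ga s0 \<in> X" using x s0 by simp
    fix s assume s: "\<bar>s\<bar> <= t"
    show "norm (ga (s0 + s) - ga s0 - s *\<^sub>R ga1 s0 - (s\<^sup>2 / 2) *\<^sub>R 0) <= K * s\<^sup>2" by (rule so(1)[OF _ s])
    show "(dist (ga s0) (ga (s0 + s)))\<^sup>2 <= s\<^sup>2 - 0 * s ^ 4" using so(2)[OF _ s] by simp
   qed
   finally show "ennreal (4 / 3 * t ^ 3 - real N * t ^ 5) <= weighted_cap (ivol 1 X) c l t x" by (simp add: s0)
  qed
  then show ?thesis using rh(1) by blast
 qed
 have mono: "Q M x" if "N <= M" "Q N x" for N M x
  unfolding Q_def
 proof (intro allI impI)
  fix t :: real assume t: "0 < t \<and> t <= 1 / real (Suc M)"
  have "1 / real (Suc M) <= 1 / real (Suc N)" using that(1) by (intro divide_left_mono) auto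
  moreover have "ennreal (4 / 3 * t ^ 3 - real M * t ^ 5) <= ennreal (4 / 3 * t ^ 3 - real N * t ^ 5)"
   using t that(1) by (intro ennreal_leI diff_left_mono mult_right_mono) auto
  ultimately show "ennreal (4 / 3 * t ^ 3 - real M * t ^ 5) <= weighted_cap (ivol 1 X) c l t x"
   using that(2) t unfolding Q_def by (meson order_trans)
 qed
 obtain N where "!!x. x \<in> X ==> Q N x"
 proof (rule compact_uniform_nat[where X = X and Q = Q])
  show "compact X" by (rule X(1))
  show "\<exists>de>0. \<exists>N. \<forall>x\<in>X Int ball p de. Q N x" if "p \<in> X" for p by (rule loc[OF that])
  show "Q M x" if "N <= M" "Q N x" for N M x by (rule mono[OF that])
 qed (rule that)
 then show thesis unfolding Q_def by (intro that) blast
qed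

text \<open>Pointwise the true curvature vector \<open>ga2 s0\<close> is inserted; the factor
  \<open>4 / 15 * l\<close> from the weight and the factor \<open>2 / 5\<close> times
  \<open>1 / 12\<close> from the chord combine over the denominator 30.\<close>

lemma weighted_cap_liminf:
 fixes X :: "(real^'d) set"
 assumes X: "compact X" "charted 1 X" and a: "unit_arc X ga ga1 ga2 e" and s0: "\<bar>s0\<bar> < e"
  and R: "dist (ga s0) c <= R" "0 < R" and l: "0 < l" and t: "!!n. t n > 0" "t \<longlonglongrightarrow> 0" and e': "e' > 0"
 shows "\<forall>\<^sub>F n in sequentially.
  ennreal (4 / 3 * t n ^ 3 + ((8 * l * (1 + ga2 s0 \<bullet> (ga s0 - c)) + (norm (ga2 s0))\<^sup>2) / 30 - e') * t n ^ 5)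
   <= weighted_cap (ivol 1 X) c l (t n) (ga s0)"
proof -
 define k where "k = norm (ga2 s0)"
 define B where "B = ga2 s0 \<bullet> (ga s0 - c)"
 \<comment> \<open>\<open>et * Z\<close> bounds the total loss from treating the curvature vector as
   constant up to an error \<open>et <= 1\<close>; half of \<open>e'\<close> is reserved for
   it.\<close>
 define Z where "Z = 8 / 15 * l * R + (5 * k + 4) / 30"
 have Z: "Z > 0" using l R by (simp add: Z_def k_def add_pos_nonneg add_nonneg_pos)
 define et where "et = min 1 (e' / (2 * Z))"
 have et: "0 < et" "et <= 1" "et * Z <= e' / 2"
  using e' Z by (auto simp: et_def min_def field_simps)
 obtain de where de: "de > 0" "\<bar>s0\<bar> + de < e" "!!s. \<bar>s\<bar> <= de ==> norm (ga2 (s0 + s) - ga2 s0) <= et"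
  by (rule unit_arc_curvature_near[OF a s0 et(1)]) (rule that)
 \<comment> \<open>Clipped at 0 because \<open>weighted_cap_ge\<close> asks for a nonnegative
   \<open>al\<close>; in the clipped case the trivial bound of the chord by arc length
   serves.\<close>
 define al where "al = max 0 ((k\<^sup>2 - et * (5 * k + 4 * et)) / 12)"
 define mu' where "mu' t = l * (1 - (k + 2 * et) * t + B - 2 * et * R)" for t
 let ?h = "(8 * l * (1 + B) + k\<^sup>2) / 30"
 have "(\<lambda>n. 4 / 15 * mu' (t n) + 2 / 5 * al + 2 / 7 * al * mu' (t n) * (t n)\<^sup>2) \<longlonglongrightarrow>
   4 / 15 * (l * (1 - (k + 2 * et) * 0 + B - 2 * et * R)) + 2 / 5 * al + 2 / 7 * al * (l * (1 - (k + 2 * et) * 0 + B - 2 * et * R)) * 0\<^sup>2"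
  unfolding mu'_def by (intro tendsto_intros t(2))
 moreover have "?h - e' < 4 / 15 * (l * (1 - (k + 2 * et) * 0 + B - 2 * et * R)) + 2 / 5 * al + 2 / 7 * al * (l * (1 - (k + 2 * et) * 0 + B - 2 * et * R)) * 0\<^sup>2"
 proof -
  have gen: "(u + K2) / 30 - e < u / 30 - 8 / 15 * w + 2 / 5 * al"
   if "(K2 - p) / 12 <= al" "p <= q" "8 / 15 * w + q / 30 <= e / 2" "0 < e" for K2 p q w u e al :: real
   using that by (simp add: field_simps)
  have eq: "4 / 15 * (l * (1 - (k + 2 * et) * 0 + B - 2 * et * R)) = 8 * l * (1 + B) / 30 - 8 / 15 * (l * et * R)" by (simp add: algebra_simps)
  have "?h - e' < 8 * l * (1 + B) / 30 - 8 / 15 * (l * et * R) + 2 / 5 * al"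
  proof (rule gen)
   show "(k\<^sup>2 - et * (5 * k + 4 * et)) / 12 <= al" by (simp add: al_def)
   show "et * (5 * k + 4 * et) <= et * (5 * k + 4)" using et by (intro mult_left_mono) auto
   have "et * Z = 8 / 15 * (l * et * R) + et * (5 * k + 4) / 30" by (simp add: Z_def algebra_simps)
   then show "8 / 15 * (l * et * R) + et * (5 * k + 4) / 30 <= e' / 2" using et(3) by simp
  qed (rule e')
  then show ?thesis unfolding eq by simp
 qed
 ultimately have ev1: "\<forall>\<^sub>F n in sequentially. ?h - e' < 4 / 15 * mu' (t n) + 2 / 5 * al + 2 / 7 * al * mu' (t n) * (t n)\<^sup>2"
  by (rule order_tendstoD(1))
 have ev2: "\<forall>\<^sub>F n in sequentially. t n < min de (1 / (2 * l * R))"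
  using de(1) l R by (intro order_tendstoD(2)[OF t(2)]) auto
 show ?thesis using ev1 ev2
 proof eventually_elim
  case (elim n)
  have tn: "0 < t n" "t n <= de" "2 * l * R * t n <= 1" using t(1)[of n] elim(2) l R by (auto simp: field_simps)
  have st: "\<bar>s0\<bar> + t n < e" using de(2) tn by linarith
  have near: "norm (ga2 (s0 + s) - ga2 s0) <= et" if "\<bar>s\<bar> <= t n" for s using de(3) that tn by simp
  note so = unit_arc_second_order[OF a less_imp_le[OF et(1)] tn(1) st near]
  have "(?h - e') * t n ^ 5 <= (4 / 15 * mu' (t n) + 2 / 5 * al + 2 / 7 * al * mu' (t n) * (t n)\<^sup>2) * t n ^ 5"
   using elim(1) tn by (intro mult_right_mono) auto
  also have "... = (4 / 15 * mu' (t n) + 2 / 5 * al) * t n ^ 5 + 2 / 7 * al * mu' (t n) * t n ^ 7"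
   by (simp add: eval_nat_numeral One_nat_def algebra_simps)
  finally have "ennreal (4 / 3 * t n ^ 3 + (?h - e') * t n ^ 5) <=
    ennreal (4 / 3 * t n ^ 3 + (4 / 15 * mu' (t n) + 2 / 5 * al) * t n ^ 5 + 2 / 7 * al * mu' (t n) * t n ^ 7)"
   by (intro ennreal_leI) simp
  also have "... <= weighted_cap (ivol 1 X) c l (t n) (ga s0)"
   unfolding mu'_def k_def B_def
  proof (rule weighted_cap_ge[OF X a tn(1) st less_imp_le[OF l] R(1) tn(3) less_imp_le[OF et(1)]])
   show "0 <= al" by (simp add: al_def)
   fix s assume s: "\<bar>s\<bar> <= t n"
   show "norm (ga (s0 + s) - ga s0 - s *\<^sub>R ga1 s0 - (s\<^sup>2 / 2) *\<^sub>R ga2 s0) <= et * s\<^sup>2" by (rule so(1)[OF _ s])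
   show "(dist (ga s0) (ga (s0 + s)))\<^sup>2 <= s\<^sup>2 - al * s ^ 4"
   proof -
    have "(dist (ga s0) (ga (s0 + s)))\<^sup>2 <= s\<^sup>2" by (rule so(2)[OF _ s])
    moreover have "(dist (ga s0) (ga (s0 + s)))\<^sup>2 <= s\<^sup>2 - (k\<^sup>2 - et * (5 * k + 4 * et)) / 12 * s ^ 4"
     unfolding k_def by (rule so(3)[OF _ s])
    moreover have "al = 0 \<or> al = (k\<^sup>2 - et * (5 * k + 4 * et)) / 12" unfolding al_def max_def by presburger
    ultimately show ?thesis by (elim disjE) (simp_all only: mult_zero_left diff_0_right)
   qed
  qed
  finally show ?case by (simp add: k_def B_def)
 qed
qed

text \<open>Since \<open>c\<close> is arbitrary with small moment of inertia, the first variation of length enters only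
 through the weight, whose double integral vanishes by antisymmetry.\<close>

lemma curvature_eq:
 fixes X :: "(real^'d) set"
 assumes X: "compact X" "submanifold 2 1 X" and r: "r > 0" and t0: "t0 > 0"
  and I: "(\<integral>x. (dist x c)\<^sup>2 \<partial>ivol 1 X) <= r\<^sup>2 * measure (ivol 1 X) X"
  and K: "!!t. 0 < t ==> t <= t0 ==> double_integral 1 X (\<lambda>s. ennreal (cap_kernel t s)) <=
   ennreal (measure (ivol 1 X) X * (4 / 3 * t ^ 3 + t ^ 5 / (30 * r\<^sup>2) + C * t ^ 7))"
  and a: "unit_arc X ga ga1 ga2 e" and s: "\<bar>s\<bar> < e"
 shows "ga2 s = - (1 / r\<^sup>2) *\<^sub>R (ga s - c)"
proof -
 have chX: "charted 1 X" by (rule charted_submanifold[OF X(2)]) simp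
 note X' = X(1) chX
 let ?mu = "ivol 1 X" and ?L = "measure (ivol 1 X) X"
 interpret finite_measure ?mu by (rule finite_ivol[OF X'])
 obtain R0 where R0: "!!x. x \<in> X ==> norm (x - c) <= R0"
  using compact_imp_bounded[OF compact_translation_subtract[OF X(1), of c]] by (auto simp: bounded_iff)
 define R where "R = \<bar>R0\<bar> + 1"
 have R: "dist x c <= R" if "x \<in> X" for x using R0[OF that] by (simp add: R_def dist_norm)
 have R': "R > 0" by (simp add: R_def)
 \<comment> \<open>This makes \<open>8 * l = 2 / r\<^sup>2\<close>, the coefficient of the mixed
   term in the squared norm of \<open>ga2 s + (1 / r\<^sup>2) *\<^sub>R (ga s - c)\<close>.\<close>
 define l where "l = 1 / (4 * r\<^sup>2)"
 have l: "l > 0" using r by (simp add: l_def)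
 obtain N :: nat where N: "!!x t. x \<in> X ==> 0 < t ==> t <= 1 / real (Suc N) ==>
   ennreal (4 / 3 * t ^ 3 - real N * t ^ 5) <= weighted_cap ?mu c l t x"
  by (rule weighted_cap_uniform[where c = c and R = R, OF X _ R' l]) (erule R, rule that)
 define ta where "ta = min (min t0 (1 / real (Suc N))) (1 / (2 * l * R))"
 have ta: "ta > 0" using t0 l R' by (simp add: ta_def)
 define t where "t n = ta / real (Suc n)" for n
 have t: "t n > 0" "t n <= t0" "t n <= 1 / real (Suc N)" "2 * l * R * t n <= 1" for n
 proof -
  have "t n <= ta" using ta by (simp add: t_def field_simps)
  then have 1: "t n <= t0" "t n <= 1 / real (Suc N)" "t n <= 1 / (2 * l * R)" by (auto simp: ta_def)
  then show "t n <= t0" "t n <= 1 / real (Suc N)" "2 * l * R * t n <= 1" using l R' by (auto simp: field_simps)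
  show "t n > 0" using ta by (simp add: t_def)
 qed
 have t_lim: "t \<longlonglongrightarrow> 0" unfolding t_def using lim_const_over_n[of ta] by (rule LIMSEQ_Suc)
 define W where "W n x = enn2real (weighted_cap ?mu c l (t n) x)" for n x
 have We: "weighted_cap ?mu c l (t n) x = ennreal (W n x)" if "x \<in> X" for n x
 proof -
  have "weighted_cap ?mu c l (t n) x < top"
   using weighted_cap_le(2)[OF X' R t(1) less_imp_le[OF l] t(4) that, of n] by (rule le_less_trans) simp_all
  then show ?thesis by (simp add: W_def)
 qed
 have W0: "0 <= W n x" for n x by (simp add: W_def)
 have Wm[measurable]: "W n \<in> borel_measurable ?mu" for n
  unfolding W_def[abs_def] by (rule borel_measurable_enn2real[OF weighted_cap_le(3)[OF X' R t(1) less_imp_le[OF l] t(4)]])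
 have Wle: "W n x <= 2 * (t n)\<^sup>2 * ?L" if "x \<in> X" for n x
  using weighted_cap_le(2)[OF X' R t(1) less_imp_le[OF l] t(4) that, of n] by (simp add: We[OF that] ennreal_le_iff)
 have Wint: "integrable ?mu (W n)" for n
  by (rule integrable_const_bound[where B = "2 * (t n)\<^sup>2 * ?L"])
   (use Wle W0 in \<open>auto intro!: AE_I2 simp: space_ivol[OF X']\<close>)
 have WI: "(\<integral>x. W n x \<partial>?mu) <= ?L * (4 / 3 * t n ^ 3 + t n ^ 5 / (30 * r\<^sup>2) + \<bar>C\<bar> * t n ^ 7)" for n
 proof -
  have "ennreal (\<integral>x. W n x \<partial>?mu) = (\<integral>\<^sup>+x. ennreal (W n x) \<partial>?mu)" using Wint W0 by (intro nn_integral_eq_integral[symmetric]) auto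
  also have "... = (\<integral>\<^sup>+x. weighted_cap ?mu c l (t n) x \<partial>?mu)"
   by (intro nn_integral_cong) (simp add: We space_ivol[OF X'])
  also have "... = double_integral 1 X (\<lambda>s. ennreal (cap_kernel (t n) s))"
   by (rule weighted_cap_le(1)[OF X' R t(1) less_imp_le[OF l] t(4)])
  also have "... <= ennreal (?L * (4 / 3 * t n ^ 3 + t n ^ 5 / (30 * r\<^sup>2) + C * t n ^ 7))" by (rule K[OF t(1,2)])
  also have "... <= ennreal (?L * (4 / 3 * t n ^ 3 + t n ^ 5 / (30 * r\<^sup>2) + \<bar>C\<bar> * t n ^ 7))"
   using t(1)[of n] by (intro ennreal_leI mult_left_mono add_left_mono mult_right_mono) auto
  finally show ?thesis using t(1)[of n] by (subst (asm) ennreal_le_iff) (auto intro!: mult_nonneg_nonneg add_nonneg_nonneg)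
 qed
 \<comment> \<open>The leading term is the same at every point; subtracting it and dividing by
   \<open>t n ^ 5\<close> exposes the curvature coefficient.\<close>
 define ph where "ph n x = W n x / t n ^ 5 - 4 / (3 * (t n)\<^sup>2)" for n x
 \<comment> \<open>What remains of the coefficient after one thirtieth of the squared norm of
   \<open>ga2 s + (1 / r\<^sup>2) *\<^sub>R (ga s - c)\<close> is split off.\<close>
 define g where "g x = (2 / r\<^sup>2 - (dist x c)\<^sup>2 / r ^ 4) / 30" for x :: "real^'d"
 define M where "M = real N + R\<^sup>2 / r ^ 4"
 have eqt: "4 / (3 * u\<^sup>2) = (4 / 3 * u ^ 3) / u ^ 5" if "u > 0" for u :: real
  using that by (simp add: field_simps eval_nat_numeral One_nat_def)
 have ph_ge: "b <= ph n x" if x: "x \<in> X" and b: "ennreal (4 / 3 * t n ^ 3 + b * t n ^ 5) <= weighted_cap ?mu c l (t n) x" for b n x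
 proof -
  have "4 / 3 * t n ^ 3 + b * t n ^ 5 <= W n x" using b W0[of n x] unfolding We[OF x] by (auto simp: ennreal_le_iff2)
  then have "b * t n ^ 5 <= W n x - 4 / 3 * t n ^ 3" by simp
  then have "b <= (W n x - 4 / 3 * t n ^ 3) / t n ^ 5" using t(1)[of n] by (simp add: pos_le_divide_eq)
  then show ?thesis unfolding ph_def eqt[OF t(1)] by (simp add: diff_divide_distrib)
 qed
 have bdd: "bounded (space ?mu)" using compact_imp_bounded[OF X(1)] by (simp add: space_ivol[OF X'])
 have idm: "(\<lambda>x. x) \<in> borel_measurable ?mu" by (rule measurable_ivol[OF X']) simp
 have dint: "integrable ?mu (\<lambda>x. (dist x c)\<^sup>2)"
  by (rule integrable_bounded_continuous[OF finite_ivol[OF X'] bdd idm]) (intro continuous_intros)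
 have gint: "integrable ?mu g" unfolding g_def using dint by simp
 \<comment> \<open>By the bound on the second moment about \<open>c\<close>, the integral of
   \<open>g\<close> is at least the coefficient of \<open>t ^ 5\<close> allowed by the assumed upper
   bound, so nothing is left for the square.\<close>
 have gI: "?L / (30 * r\<^sup>2) <= (\<integral>x. g x \<partial>?mu)"
 proof -
  have "(\<integral>x. g x \<partial>?mu) = (2 / r\<^sup>2 * ?L - (\<integral>x. (dist x c)\<^sup>2 \<partial>?mu) / r ^ 4) / 30"
   unfolding g_def using dint by (simp add: space_ivol[OF X'])
  moreover have "(\<integral>x. (dist x c)\<^sup>2 \<partial>?mu) / r ^ 4 <= r\<^sup>2 * ?L / r ^ 4" using I r by (intro divide_right_mono) auto
  moreover have "r\<^sup>2 * ?L / r ^ 4 = ?L / r\<^sup>2" using r by (simp add: eval_nat_numeral One_nat_def)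
  ultimately show ?thesis by (simp add: field_simps)
 qed
 have lim: "\<forall>e>0. \<forall>\<^sub>F n in sequentially. g x + s - e <= ph n x"
  if ar: "unit_arc X ga ga1 ga2 e" and s0: "\<bar>s0\<bar> < e" and x: "x = ga s0"
   and sd: "s = (norm (ga2 s0 + (1 / r\<^sup>2) *\<^sub>R (ga s0 - c)))\<^sup>2 / 30" for ga ga1 ga2 e s0 x s
 proof (intro allI impI)
  fix e' :: real assume e': "e' > 0"
  have xX: "x \<in> X" using unit_arcD(4)[OF ar s0] x by simp
  let ?k = "ga2 s0" and ?v = "ga s0 - c"
  have "(norm (?k + (1 / r\<^sup>2) *\<^sub>R ?v))\<^sup>2 = (norm ?k)\<^sup>2 + 2 / r\<^sup>2 * (?k \<bullet> ?v) + (norm ?v)\<^sup>2 / r ^ 4"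
   unfolding power2_norm_eq_inner by (simp add: inner_add_left inner_add_right inner_commute eval_nat_numeral One_nat_def)
  moreover have "8 * l = 2 / r\<^sup>2" by (simp add: l_def)
  ultimately have eq: "(8 * l * (1 + ?k \<bullet> ?v) + (norm ?k)\<^sup>2) / 30 = g x + s"
   unfolding g_def sd x dist_norm by (simp add: algebra_simps add_divide_distrib diff_divide_distrib)
  show "\<forall>\<^sub>F n in sequentially. g x + s - e' <= ph n x"
   using weighted_cap_liminf[OF X' ar s0 R R' l t(1) t_lim e']
   unfolding eq unfolding x[symmetric] using xX by (auto elim!: eventually_mono intro!: ph_ge)
 qed
 have AE: "AE x in ?mu. \<forall>s\<ge>0. (\<forall>e>0. \<forall>\<^sub>F n in sequentially. g x + s - e <= ph n x) --> s = 0"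
 proof (rule AE_zero_of_liminf[OF finite_ivol[OF X'] _ gint, where M = M and b = "\<lambda>n. (\<integral>x. g x \<partial>?mu) + ?L * \<bar>C\<bar> * (t n)\<^sup>2"])
  show "integrable ?mu (ph n)" for n unfolding ph_def using Wint by simp
  fix x assume "x \<in> space ?mu"
  then have x: "x \<in> X" by (simp add: space_ivol[OF X'])
  have "- real N <= ph n x" for n by (rule ph_ge[OF x]) (use N[OF x t(1) t(3), of n] in simp)
  moreover have "0 <= R\<^sup>2 / r ^ 4" by simp
  ultimately show "- M <= ph n x" for n unfolding M_def by (meson add_increasing2 diff_left_mono le_minus_iff minus_le_iff order_trans)
  have a1: "(dist x c)\<^sup>2 / r ^ 4 <= R\<^sup>2 / r ^ 4" using R[OF x] by (intro divide_right_mono power_mono) auto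
  have a2: "0 <= 2 / r\<^sup>2" "0 <= R\<^sup>2 / r ^ 4" by simp_all
  have gen: "- (n + b) <= (p - a) / 30" if "a <= b" "0 <= p" "0 <= b" "0 <= n" for a b p n :: real
   using that by simp
  show "- M <= g x" unfolding M_def g_def by (rule gen[OF a1 a2]) simp
  obtain ga ga1 ga2 e where a: "unit_arc X ga ga1 ga2 e" "ga 0 = x" by (rule unit_arc_exists[OF X x])
  then have "\<bar>0\<bar> < e" by (simp add: unit_arc_def)
  from lim[OF a(1) this a(2)[symmetric] refl]
  show "\<exists>s\<ge>0. \<forall>e>0. \<forall>\<^sub>F n in sequentially. g x + s - e <= ph n x" by (intro exI conjI) auto
 next
  show "(\<integral>x. ph n x \<partial>?mu) <= (\<integral>x. g x \<partial>?mu) + ?L * \<bar>C\<bar> * (t n)\<^sup>2" for n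
  proof -
   have "(\<integral>x. ph n x \<partial>?mu) = (\<integral>x. W n x \<partial>?mu) / t n ^ 5 - 4 / (3 * (t n)\<^sup>2) * ?L"
    unfolding ph_def using Wint by (simp add: space_ivol[OF X'])
   also have "... <= ?L * (4 / 3 * t n ^ 3 + t n ^ 5 / (30 * r\<^sup>2) + \<bar>C\<bar> * t n ^ 7) / t n ^ 5 - 4 / (3 * (t n)\<^sup>2) * ?L"
    using WI[of n] t(1)[of n] by (intro diff_right_mono divide_right_mono) auto
   also have "... = ?L / (30 * r\<^sup>2) + ?L * \<bar>C\<bar> * (t n)\<^sup>2"
    using t(1)[of n] r by (simp add: field_simps eval_nat_numeral One_nat_def)
   finally show ?thesis using gI by linarith
  qed
  have "(\<lambda>n. (\<integral>x. g x \<partial>?mu) + ?L * \<bar>C\<bar> * (t n)\<^sup>2) \<longlonglongrightarrow> (\<integral>x. g x \<partial>?mu) + ?L * \<bar>C\<bar> * 0\<^sup>2"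
   by (intro tendsto_intros t_lim)
  then show "(\<lambda>n. (\<integral>x. g x \<partial>?mu) + ?L * \<bar>C\<bar> * (t n)\<^sup>2) \<longlonglongrightarrow> (\<integral>x. g x \<partial>?mu)" by simp
 qed
 then obtain N where N: "N \<in> null_sets ?mu"
  "{x \<in> space ?mu. \<not> (\<forall>s\<ge>0. (\<forall>e>0. \<forall>\<^sub>F n in sequentially. g x + s - e <= ph n x) --> s = 0)} \<subseteq> N"
  by (auto simp: eventually_ae_filter)
 \<comment> \<open>Failure of the curvature equation is an open condition on the parameter, and the
   parameters where it fails form a null set because the arc carries arc length; hence there are
   none.\<close>
 define Z where "Z = {s \<in> {-e<..<e}. ga2 s + (1 / r\<^sup>2) *\<^sub>R (ga s - c) \<in> - {0}}"
 have "open Z"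
 proof -
  have "continuous_on {-e<..<e} (\<lambda>s. ga2 s + (1 / r\<^sup>2) *\<^sub>R (ga s - c))"
   using a continuous_on_unit_arc[OF a] by (auto simp: unit_arc_def intro!: continuous_intros)
  then have "open ((\<lambda>s. ga2 s + (1 / r\<^sup>2) *\<^sub>R (ga s - c)) -` (- {0}) Int {-e<..<e})"
   by (rule continuous_on_open_vimage[OF open_greaterThanLessThan, THEN iffD1, rule_format]) (rule open_Compl[OF closed_singleton])
  moreover have "(\<lambda>s. ga2 s + (1 / r\<^sup>2) *\<^sub>R (ga s - c)) -` (- {0}) Int {-e<..<e} = Z" by (auto simp: Z_def)
  ultimately show ?thesis by simp
 qed
 moreover have "emeasure lborel Z = 0"
 proof -
  have Nb: "N \<in> sets borel" "emeasure ?mu N = 0" using N(1) sets_ivol[OF X', of N] by auto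
  have sub: "Z \<subseteq> {s\<in>{-e<..<e}. ga s \<in> N}"
  proof
   fix s assume s: "s \<in> Z"
   then have se: "\<bar>s\<bar> < e" and ne: "ga2 s + (1 / r\<^sup>2) *\<^sub>R (ga s - c) \<noteq> 0" by (auto simp: Z_def)
   have "ga s \<in> space ?mu" using unit_arcD(4)[OF a se] by (simp add: space_ivol[OF X'])
   moreover have "\<not> (\<forall>s'\<ge>0. (\<forall>e>0. \<forall>\<^sub>F n in sequentially. g (ga s) + s' - e <= ph n (ga s)) --> s' = 0)"
    using lim[OF a se refl refl] ne by (intro notI) (drule spec[of _ "(norm (ga2 s + (1 / r\<^sup>2) *\<^sub>R (ga s - c)))\<^sup>2 / 30"], simp)
   ultimately show "s \<in> {s\<in>{-e<..<e}. ga s \<in> N}" using N(2) s by (auto simp: Z_def)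
  qed
  have "emeasure lborel {s\<in>{-e<..<e}. ga s \<in> N} = emeasure ?mu (N Int ga ` {-e<..<e})"
   using a Nb(1) unfolding unit_arc_def by simp
  also have "... <= emeasure ?mu N" using N(1) by (intro emeasure_mono) auto
  finally have 0: "emeasure lborel {s\<in>{-e<..<e}. ga s \<in> N} = 0" using Nb(2) by simp
  have "{s\<in>{-e<..<e}. ga s \<in> N} \<in> sets lborel"
   using continuous_on_vimage_borel[OF continuous_on_unit_arc[OF a] _ Nb(1)] by (simp add: vimage_def Int_def)
  then have "emeasure lborel Z <= emeasure lborel {s\<in>{-e<..<e}. ga s \<in> N}" by (intro emeasure_mono[OF sub])
  then show ?thesis using 0 by simp
 qed
 ultimately have "Z = {}" by (rule open_null_empty)
 then have "s \<notin> Z" by simp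
 then have "ga2 s + (1 / r\<^sup>2) *\<^sub>R (ga s - c) = 0" using s by (auto simp: Z_def)
 then show ?thesis by (simp add: eq_neg_iff_add_eq_0)
qed

section \<open>Arcs that satisfy the curvature equation of a circle\<close>

definition circle_point :: "'a::real_inner => 'a => 'a => real => 'a" where
 "circle_point c u v th = c + (cos th *\<^sub>R u + sin th *\<^sub>R v)"

lemma continuous_on_circle_point[continuous_intros]: "continuous_on S (circle_point c u v)"
 unfolding circle_point_def[abs_def] by (intro continuous_intros)

text \<open>Moves the base point of the parametrization to the angle \<open>th\<close>.\<close>

lemma circle_point_add:
 "circle_point c u v (th + ph) = circle_point c (circle_point c u v th - c) (cos th *\<^sub>R v - sin th *\<^sub>R u) ph"
 by (simp add: circle_point_def cos_add sin_add algebra_simps)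

lemma circle_point_eq_iff:
 assumes u: "u \<bullet> u = r\<^sup>2" "v \<bullet> v = r\<^sup>2" "u \<bullet> v = 0" and r: "r > 0"
 shows "circle_point c u v th = circle_point c u v ph \<longleftrightarrow> cos th = cos ph \<and> sin th = sin ph"
proof
 assume eq: "circle_point c u v th = circle_point c u v ph"
 have "(circle_point c u v th - c) \<bullet> u = cos th * r\<^sup>2" "(circle_point c u v th - c) \<bullet> v = sin th * r\<^sup>2" for th
  using u by (simp_all add: circle_point_def inner_add_left inner_commute[of v u])
 then have "cos th * r\<^sup>2 = cos ph * r\<^sup>2" "sin th * r\<^sup>2 = sin ph * r\<^sup>2" using eq by metis+
 then show "cos th = cos ph \<and> sin th = sin ph" using r by simp
qed (simp add: circle_point_def)

text \<open>The position vector is orthogonal to the tangent because the curvature vector is;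
  differentiating this relation at 0 gives the radius. The arc agrees with the circle of the same
  initial data, since the energy \<open>E\<close> of the difference \<open>w\<close> is constant and
  starts at 0.\<close>

lemma unit_arc_circle:
 assumes a: "unit_arc X ga ga1 ga2 e" and r: "r > 0"
  and ode: "!!s. \<bar>s\<bar> < e ==> ga2 s = - (1 / r\<^sup>2) *\<^sub>R (ga s - c)"
 defines "u \<equiv> ga 0 - c" and "v \<equiv> r *\<^sub>R ga1 0"
 shows "u \<bullet> u = r\<^sup>2" "v \<bullet> v = r\<^sup>2" "u \<bullet> v = 0"
  and "!!s. \<bar>s\<bar> < e ==> ga s = circle_point c u v (s / r)"
proof -
 have e: "\<bar>0\<bar> < e" using a by (simp add: unit_arc_def)
 have d: "((\<lambda>s. ga s - c) has_vector_derivative ga1 s) (at s)" if "\<bar>s\<bar> < e" for s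
  using unit_arcD(1)[OF a that] by (auto intro!: derivative_eq_intros)
 have orth: "(ga s - c) \<bullet> ga1 s = 0" if "\<bar>s\<bar> < e" for s
  using unit_arc_orthogonal[OF a that] ode[OF that] r by simp
 have n1: "ga1 s \<bullet> ga1 s = 1" if "\<bar>s\<bar> < e" for s using unit_arcD(3)[OF a that] by (simp add: norm_eq_1)
 have "((\<lambda>s. (ga s - c) \<bullet> ga1 s) has_real_derivative ((ga 0 - c) \<bullet> ga2 0 + ga1 0 \<bullet> ga1 0)) (at 0)"
  by (rule has_real_derivative_inner[OF d[OF e] unit_arcD(2)[OF a e]])
 moreover have "((\<lambda>s. (ga s - c) \<bullet> ga1 s) has_real_derivative 0) (at 0)"
  by (rule has_field_derivative_transform_within_open[of "\<lambda>_. 0" 0 _ "{-e<..<e}"]) (use e orth in \<open>auto simp: abs_less_iff minus_less_iff\<close>)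
 ultimately have "(ga 0 - c) \<bullet> ga2 0 + ga1 0 \<bullet> ga1 0 = 0" by (rule DERIV_unique)
 moreover have "(ga 0 - c) \<bullet> ga2 0 = - (u \<bullet> u / r\<^sup>2)" unfolding ode[OF e] u_def by simp
 ultimately have "u \<bullet> u / r\<^sup>2 = 1" using n1[OF e] by linarith
 then show uu: "u \<bullet> u = r\<^sup>2" using r by (simp add: field_simps)
 show vv: "v \<bullet> v = r\<^sup>2" using n1[OF e] by (simp add: v_def power2_eq_square)
 show uv: "u \<bullet> v = 0" using orth[OF e] by (simp add: u_def v_def)
 define w where "w s = ga s - circle_point c u v (s / r)" for s
 define w1 where "w1 s = ga1 s - (cos (s / r) / r) *\<^sub>R v + (sin (s / r) / r) *\<^sub>R u" for s
 have dc: "((\<lambda>s. cos (s / r)) has_real_derivative - (sin (s / r) / r)) (at s)"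
  "((\<lambda>s. sin (s / r)) has_real_derivative cos (s / r) / r) (at s)" for s
  using r by (auto intro!: derivative_eq_intros)
 have dw: "(w has_vector_derivative w1 s) (at s)" if s: "\<bar>s\<bar> < e" for s
 proof -
  note 1 = has_vector_derivative_scaleR[OF dc(1)[of s] has_vector_derivative_const[of u]]
   has_vector_derivative_scaleR[OF dc(2)[of s] has_vector_derivative_const[of v]]
  have "((\<lambda>s. ga s - (c + (cos (s / r) *\<^sub>R u + sin (s / r) *\<^sub>R v))) has_vector_derivative
    ga1 s - (0 + ((cos (s / r) *\<^sub>R 0 + (- (sin (s / r) / r)) *\<^sub>R u) + (sin (s / r) *\<^sub>R 0 + (cos (s / r) / r) *\<^sub>R v)))) (at s)"
   by (intro has_vector_derivative_diff has_vector_derivative_add has_vector_derivative_const 1 unit_arcD(1)[OF a s])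
  then show ?thesis by (simp add: w_def[abs_def] circle_point_def w1_def algebra_simps)
 qed
 have dw1: "(w1 has_vector_derivative - (1 / r\<^sup>2) *\<^sub>R w s) (at s)" if s: "\<bar>s\<bar> < e" for s
 proof -
  have dc': "((\<lambda>s. cos (s / r) / r) has_real_derivative - (sin (s / r) / r\<^sup>2)) (at s)"
   "((\<lambda>s. sin (s / r) / r) has_real_derivative cos (s / r) / r\<^sup>2) (at s)"
   using DERIV_cdivide[OF dc(1)[of s], of r] DERIV_cdivide[OF dc(2)[of s], of r] by (simp_all add: power2_eq_square)
  note 1 = has_vector_derivative_scaleR[OF dc'(2) has_vector_derivative_const[of u]]
   has_vector_derivative_scaleR[OF dc'(1) has_vector_derivative_const[of v]]
  have "(w1 has_vector_derivative ga2 s - ((cos (s / r) / r) *\<^sub>R 0 + (- (sin (s / r) / r\<^sup>2)) *\<^sub>R v)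
    + ((sin (s / r) / r) *\<^sub>R 0 + (cos (s / r) / r\<^sup>2) *\<^sub>R u)) (at s)"
   unfolding w1_def[abs_def]
   by (intro has_vector_derivative_diff has_vector_derivative_add 1 unit_arcD(2)[OF a s])
  moreover have "ga2 s - ((cos (s / r) / r) *\<^sub>R 0 + (- (sin (s / r) / r\<^sup>2)) *\<^sub>R v)
    + ((sin (s / r) / r) *\<^sub>R 0 + (cos (s / r) / r\<^sup>2) *\<^sub>R u) = - (1 / r\<^sup>2) *\<^sub>R w s"
   by (simp add: ode[OF s] w_def circle_point_def algebra_simps)
  ultimately show ?thesis by simp
 qed
 define E where "E s = w1 s \<bullet> w1 s + (1 / r\<^sup>2) * (w s \<bullet> w s)" for s
 have dE: "(E has_real_derivative 0) (at s)" if s: "\<bar>s\<bar> < e" for s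
 proof -
  have "(E has_real_derivative (w1 s \<bullet> (- (1 / r\<^sup>2) *\<^sub>R w s) + (- (1 / r\<^sup>2) *\<^sub>R w s) \<bullet> w1 s) + (1 / r\<^sup>2) * (w s \<bullet> w1 s + w1 s \<bullet> w s)) (at s)"
   unfolding E_def[abs_def]
   by (intro DERIV_add DERIV_cmult has_real_derivative_inner dw[OF s] dw1[OF s])
  then show ?thesis by (simp add: inner_commute)
 qed
 fix s assume s: "\<bar>s\<bar> < e"
 have "E s = E 0"
  by (rule DERIV_isconst3[of "-e" e]) (use s e dE in \<open>auto simp: abs_less_iff minus_less_iff\<close>)
 also have "E 0 = 0" using r by (simp add: E_def w_def w1_def circle_point_def u_def v_def)
 finally have E0: "w1 s \<bullet> w1 s + (1 / r\<^sup>2) * (w s \<bullet> w s) = 0" by (simp add: E_def)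
 have "0 <= (1 / r\<^sup>2) * (w s \<bullet> w s)" by simp
 then have "(1 / r\<^sup>2) * (w s \<bullet> w s) = 0" using E0 inner_ge_zero[of "w1 s"] by linarith
 then have "w s = 0" using r by simp
 then show "ga s = circle_point c u v (s / r)" by (simp add: w_def)
qed

lemma congruent_copy_circle:
 fixes u v c :: "'a::euclidean_space"
 assumes uv: "u \<bullet> u = r\<^sup>2" "v \<bullet> v = r\<^sup>2" "u \<bullet> v = 0" and r: "r > 0"
 shows "congruent_copy (range (circle_point c u v)) (sphere (0 :: real^2) r)"
 unfolding congruent_copy_def
proof (intro exI[of _ "\<lambda>z. c + ((z $ 1 / r) *\<^sub>R u + (z $ 2 / r) *\<^sub>R v)"] conjI allI)
 let ?g = "\<lambda>z :: real^2. c + ((z $ 1 / r) *\<^sub>R u + (z $ 2 / r) *\<^sub>R v)"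
 fix x y :: "real^2"
 have "(dist (?g x) (?g y))\<^sup>2 = (dist x y)\<^sup>2"
 proof -
  define z where "z = x - y"
  have "?g x - ?g y = (z $ 1 / r) *\<^sub>R u + (z $ 2 / r) *\<^sub>R v" by (simp add: z_def algebra_simps diff_divide_distrib)
  then have "(dist (?g x) (?g y))\<^sup>2 = (z $ 1)\<^sup>2 + (z $ 2)\<^sup>2"
   using uv r unfolding dist_norm power2_norm_eq_inner
   by (simp add: inner_add_left inner_add_right inner_commute[of v u] power2_eq_square)
  also have "... = (dist x y)\<^sup>2" unfolding dist_norm power2_norm_eq_inner z_def[symmetric] by (simp add: inner_vec_def sum_2 power2_eq_square)
  finally show ?thesis .
 qed
 then show "dist (?g x) (?g y) = dist x y" by (simp add: power2_eq_iff_nonneg)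
next
 let ?g = "\<lambda>z :: real^2. c + ((z $ 1 / r) *\<^sub>R u + (z $ 2 / r) *\<^sub>R v)"
 have sph: "z \<in> sphere 0 r \<longleftrightarrow> (z $ 1 / r)\<^sup>2 + (z $ 2 / r)\<^sup>2 = 1" for z :: "real^2"
 proof -
  have "z \<in> sphere 0 r \<longleftrightarrow> (norm z)\<^sup>2 = r\<^sup>2" using r by (simp add: power2_eq_iff_nonneg)
  also have "(norm z)\<^sup>2 = (z $ 1)\<^sup>2 + (z $ 2)\<^sup>2" unfolding power2_norm_eq_inner by (simp add: inner_vec_def sum_2 power2_eq_square)
  also have "(z $ 1)\<^sup>2 + (z $ 2)\<^sup>2 = r\<^sup>2 \<longleftrightarrow> ((z $ 1)\<^sup>2 + (z $ 2)\<^sup>2) / r\<^sup>2 = 1" using r by (simp add: divide_eq_eq)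
  finally show ?thesis by (simp add: power_divide add_divide_distrib)
 qed
 show "range (circle_point c u v) = ?g ` sphere 0 r"
 proof (intro set_eqI iffI)
  fix x assume "x \<in> range (circle_point c u v)"
  then obtain th where x: "x = circle_point c u v th" by blast
  define z :: "real^2" where "z = vector [r * cos th, r * sin th]"
  have "z \<in> sphere 0 r" "x = ?g z" using r unfolding sph by (simp_all add: z_def x circle_point_def)
  then show "x \<in> ?g ` sphere 0 r" by blast
 next
  fix x assume "x \<in> ?g ` sphere 0 r"
  then obtain z where z: "z \<in> sphere 0 r" "x = ?g z" by blast
  then obtain t where "z $ 1 / r = cos t" "z $ 2 / r = sin t" using sincos_total_2pi[of "z $ 1 / r" "z $ 2 / r"] sph by metis
  then have "x = circle_point c u v t" by (simp add: z circle_point_def)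
  then show "x \<in> range (circle_point c u v)" by blast
 qed
qed

subsection \<open>Round spheres and circles\<close>

lemma Ck_on_2I:
 assumes "!!x. x \<in> S ==> (f has_derivative f' x) (at x)" "!!v. Ck_on 1 S (\<lambda>x. D f x v)"
 shows "Ck_on 2 S f"
proof -
 have "Ck_on (Suc 1) S f" unfolding Ck_on.simps using assms differentiableI by blast
 then show ?thesis by (simp add: numeral_2_eq_2 One_nat_def)
qed

text \<open>The derivative of the inverse is found by solving the linear equation given by the
  derivative of \<open>Ph\<close>. The solution \<open>R\<close> is a quotient whose denominator
  does not vanish on \<open>U\<close>, so it can be differentiated once more along the
  inverse.\<close>

lemma sphere_chart_inverse_C2:
 fixes c :: "real^'d" and r s :: real
 assumes b: "b \<in> Basis" and s: "s = 1 \<or> s = -1"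
 defines "U \<equiv> {z. 0 < s * ((z - c) \<bullet> b)}" and "Ph \<equiv> \<lambda>z. z + (r\<^sup>2 - (z - c) \<bullet> (z - c) - z \<bullet> b) *\<^sub>R b"
 shows "Ck_diffeo 2 U (Ph ` U) Ph (inv_into U Ph)"
proof -
 let ?L = "\<lambda>z h. h + (- (2 * ((z - c) \<bullet> h)) - h \<bullet> b) *\<^sub>R b"
 let ?Ps = "inv_into U Ph"
 have bb: "b \<bullet> b = 1" using b by (simp add: inner_same_Basis)
 have ch: "Ck_diffeo 1 U (Ph ` U) Ph ?Ps" unfolding U_def Ph_def by (rule sphere_ball_chart(1)[OF b s])
 then have op: "open (Ph ` U)" and hom: "homeomorphism U (Ph ` U) Ph ?Ps" and C1: "Ck_on 1 (Ph ` U) ?Ps"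
  by (simp_all add: Ck_diffeo_def)
 have der: "(Ph has_derivative ?L z) (at z)" for z
  unfolding Ph_def by (auto intro!: derivative_eq_intros simp: inner_commute algebra_simps)
 have "Ck_on 1 U (\<lambda>z. D Ph z v)" for v
 proof (rule Ck_on_1I[where f' = "\<lambda>z h. (- (2 * (h \<bullet> v))) *\<^sub>R b"])
  show "((\<lambda>z. D Ph z v) has_derivative (\<lambda>h. (- (2 * (h \<bullet> v))) *\<^sub>R b)) (at x)" for x
   unfolding D_eqI[OF der] by (auto intro!: derivative_eq_intros simp: algebra_simps)
 qed (intro continuous_intros)
 then have C2: "Ck_on 2 U Ph" by (rule Ck_on_2I[OF der])
 define R where "R z v = v - ((2 * ((z - c) \<bullet> v) + v \<bullet> b) / (2 * ((z - c) \<bullet> b))) *\<^sub>R b" for z v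
 define R' where "R' z v h = (- ((2 * (h \<bullet> v) * (2 * ((z - c) \<bullet> b)) - (2 * ((z - c) \<bullet> v) + v \<bullet> b) * (2 * (h \<bullet> b))) / (2 * ((z - c) \<bullet> b) * (2 * ((z - c) \<bullet> b))))) *\<^sub>R b" for z v h
 have nz: "(z - c) \<bullet> b \<noteq> 0" if "z \<in> U" for z using that by (auto simp: U_def)
 have dR: "((\<lambda>z. R z v) has_derivative R' z v) (at z)" if z: "z \<in> U" for z v
  unfolding R_def R'_def using nz[OF z] by (auto intro!: derivative_eq_intros)
 have PsU: "?Ps w \<in> U" if "w \<in> Ph ` U" for w using that by (rule inv_into_into)
 have dPs: "(?Ps has_derivative D ?Ps w) (at w)" if "w \<in> Ph ` U" for w using Ck_on_1D(1)[OF C1 that] .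
 have DPs: "D ?Ps w v = R (?Ps w) v" if w: "w \<in> Ph ` U" for w v
 proof -
  let ?z = "?Ps w"
  have "(Ph \<circ> ?Ps has_derivative ?L ?z \<circ> D ?Ps w) (at w)" using diff_chain_at[OF dPs[OF w] der] .
  moreover have "(Ph \<circ> ?Ps has_derivative (\<lambda>h. h)) (at w)"
   by (rule has_derivative_transform_within_open[OF has_derivative_ident op w]) (simp add: f_inv_into_f)
  ultimately have "?L ?z \<circ> D ?Ps w = (\<lambda>h. h)" by (rule has_derivative_unique)
  then have e: "?L ?z (D ?Ps w v) = v" by (simp add: fun_eq_iff)
  define y where "y = D ?Ps w v"
  \<comment> \<open>The solution differs from \<open>v\<close> by a multiple of \<open>b\<close>;
    pairing with the position vector and with \<open>b\<close> determines this coefficient.\<close>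
  define k where "k = 2 * ((?z - c) \<bullet> y) + y \<bullet> b"
  have y: "y = v + k *\<^sub>R b" using e unfolding y_def[symmetric] k_def by (simp add: algebra_simps)
  have "2 * ((?z - c) \<bullet> v) + v \<bullet> b = - k * (2 * ((?z - c) \<bullet> b))"
  proof -
   have "2 * ((?z - c) \<bullet> y) = 2 * ((?z - c) \<bullet> v) + k * (2 * ((?z - c) \<bullet> b))" "y \<bullet> b = v \<bullet> b + k"
    unfolding y by (simp_all add: inner_add_right inner_add_left bb)
   then show ?thesis unfolding k_def by linarith
  qed
  then have "R ?z v = y" using nz[OF PsU[OF w]] unfolding R_def y by simp
  then show ?thesis by (simp add: y_def)
 qed
 have "Ck_on 1 (Ph ` U) (\<lambda>w. D ?Ps w v)" for v
 proof (rule Ck_on_1I[where f' = "\<lambda>w h. R' (?Ps w) v (D ?Ps w h)"])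
  fix w assume w: "w \<in> Ph ` U"
  show "((\<lambda>w. D ?Ps w v) has_derivative (\<lambda>h. R' (?Ps w) v (D ?Ps w h))) (at w)"
   by (rule has_derivative_transform_within_open[OF has_derivative_compose[OF dPs[OF w] dR[OF PsU[OF w]]] op w]) (simp add: DPs)
 next
  have cPs: "continuous_on (Ph ` U) ?Ps" using hom by (simp add: homeomorphism_def)
  show "continuous_on (Ph ` U) (\<lambda>w. R' (?Ps w) v (D ?Ps w u))" for u
   unfolding R'_def by (intro continuous_intros cPs Ck_on_1D(2)[OF C1]) (use nz PsU in auto)
 qed
 then have "Ck_on 2 (Ph ` U) ?Ps" using Ck_on_2I[of "Ph ` U", OF dPs] by blast
 then show ?thesis using C2 ch by (simp add: Ck_diffeo_def)
qed

lemma submanifold_sphere: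
 fixes c :: "real^'d"
 assumes "r > 0"
 shows "submanifold 2 (CARD('d) - 1) (sphere c r)"
 unfolding submanifold_def
proof
 fix p assume p: "p \<in> sphere c r"
 then have "p \<noteq> c" using assms by auto
 then obtain b s where b: "b \<in> Basis" "s = 1 \<or> s = -1" "0 < s * ((p - c) \<bullet> b)" by (rule sphere_cover)
 let ?U = "{z. 0 < s * ((z - c) \<bullet> b)}" and ?Ph = "\<lambda>z. z + (r\<^sup>2 - (z - c) \<bullet> (z - c) - z \<bullet> b) *\<^sub>R b"
 have mem: "?Ph z \<in> span (Basis - {b}) \<longleftrightarrow> z \<in> sphere c r" for z
 proof -
  have "?Ph z \<in> span (Basis - {b}) \<longleftrightarrow> ?Ph z \<bullet> b = 0" using b(1) by (subst span_iff) auto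
  also have "... \<longleftrightarrow> r\<^sup>2 = (norm (z - c))\<^sup>2"
   unfolding sphere_ball_chart(2)[OF b(1,2), where c = c and r = r] by (simp add: power2_norm_eq_inner)
  also have "... \<longleftrightarrow> z \<in> sphere c r"
   using assms by (auto simp: dist_norm norm_minus_commute power2_eq_iff_nonneg)
  finally show ?thesis .
 qed
 have ch: "adapted_chart 2 (sphere c r) (span (Basis - {b})) ?U (?Ph ` ?U) ?Ph (inv_into ?U ?Ph)"
  unfolding adapted_chart_def using sphere_chart_inverse_C2[OF b(1,2), where c = c and r = r] mem by blast
 show "\<exists>B U V Ph Ps. B \<subseteq> Basis \<and> card B = CARD('d) - 1 \<and> p \<in> U \<and> adapted_chart 2 (sphere c r) (span B) U V Ph Ps"
 proof (intro exI conjI)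
  show "card (Basis - {b}) = CARD('d) - 1" using b(1) by (simp add: card_Diff_singleton)
  show "p \<in> ?U" using b(3) by simp
 qed (blast, rule ch)
qed

text \<open>Pulling a chart back by \<open>J\<close> gives a chart with the same Gram density, as
  \<open>J'\<close> preserves inner products. The push-forward thus has the defining property of the
  induced volume and equals it by uniqueness.\<close>

lemma distr_induced_volume_orthogonal:
 fixes X :: "(real^'d) set"
 assumes X: "compact X" "charted m X" and J: "orthogonal_transformation J" and JX: "J ` X = X"
 defines "mu \<equiv> ivol m X"
 shows "J \<in> measurable mu mu" "distr mu mu J = mu"
proof -
 note sp = space_ivol[OF X, folded mu_def] and se = sets_ivol[OF X, folded mu_def]
 have lin: "linear J" by (rule orthogonal_transformation_linear[OF J])
 obtain J' where J': "linear J'" "J' \<circ> J = id" "J \<circ> J' = id"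
  using linear_injective_isomorphism[OF lin orthogonal_transformation_inj[OF J]] by (auto simp: fun_eq_iff)
 have JJ: "J' (J v) = v" "J (J' v) = v" for v using J'(2,3) by (auto simp: fun_eq_iff)
 have inn: "J' v \<bullet> J' w = v \<bullet> w" for v w
  using J[unfolded orthogonal_transformation_def, THEN conjunct2, rule_format, of "J' v" "J' w"] by (simp add: JJ)
 have cont: "continuous_on S J" "continuous_on S J'" for S
  using lin J'(1) by (auto intro: linear_continuous_on simp: linear_conv_bounded_linear)
 have J'X: "J' x \<in> X" if "x \<in> X" for x using that JX JJ by (metis imageE)
 have "J \<in> borel_measurable mu" unfolding mu_def
  by (rule measurable_ivol[OF X]) (intro borel_measurable_continuous_onI cont)
 then show m: "J \<in> measurable mu mu" using JX by (auto simp: measurable_def sp se)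
 have "is_induced_volume m X (distr mu mu J)"
  unfolding is_induced_volume_def
 proof (intro conjI allI impI)
  show "sets (distr mu mu J) = sets (restrict_space borel X)"
   using is_induced_volumeD(1)[OF is_induced_volume_induced_volume[OF X]] by (simp add: mu_def)
  fix B H U V and Ph Ps :: "real^'d => real^'d" and A
  assume c: "C1chart m X B H U V Ph Ps" and A: "A \<in> sets borel" "A \<subseteq> V Int H"
  note im = chart_borel_image[OF c borel_X[OF X] A]
  have hom: "homeomorphism (J -` U) V (Ph \<circ> J) (J' \<circ> Ps)"
  proof (rule homeomorphism_compose[OF _ chart_hom[OF c]])
   show "homeomorphism (J -` U) U J J'" by (rule homeomorphismI) (auto simp: JJ cont)
  qed
  have dPs: "(J' \<circ> Ps has_derivative (\<lambda>v. J' (D Ps y v))) (at y)" if "y \<in> V" for y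
   using diff_chain_at[OF chart_derivative(2)[OF c that] linear_imp_has_derivative[OF J'(1)]] by (simp add: o_def)
  have "open (J -` U)" by (rule open_vimage[OF chart_open(1)[OF c] cont(1)])
  moreover have "Ck_on 1 (J -` U) (Ph \<circ> J)"
  proof (rule Ck_on_1I[where f' = "\<lambda>x v. D Ph (J x) (J v)"])
   show "(Ph \<circ> J has_derivative (\<lambda>v. D Ph (J x) (J v))) (at x)" if "x \<in> J -` U" for x
    using diff_chain_at[OF linear_imp_has_derivative[OF lin] chart_derivative(1)[OF c]] that by (simp add: o_def)
   show "continuous_on (J -` U) (\<lambda>x. D Ph (J x) (J v))" for v
    by (rule continuous_on_compose2[OF Ck_on_1D(2)[OF chart_C1(1)[OF c]] cont(1)]) auto
  qed
  moreover have "Ck_on 1 V (J' \<circ> Ps)"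
  proof (rule Ck_on_1I[OF dPs])
   show "continuous_on V (\<lambda>y. J' (D Ps y v))" for v
    by (rule continuous_on_compose2[OF cont(2) Ck_on_1D(2)[OF chart_C1(2)[OF c]]]) auto
  qed
  moreover have "(Ph \<circ> J) ` (J -` U Int X) = V Int H"
  proof -
   have "J ` (J -` U Int X) = U Int J ` X" by auto
   then show ?thesis unfolding image_comp[symmetric] JX by (simp only: chart_image[OF c])
  qed
  ultimately have c': "C1chart m X B H (J -` U) V (Ph \<circ> J) (J' \<circ> Ps)"
   using c hom by (simp add: C1chart_def adapted_chart_def Ck_diffeo_def del: Ck_on.simps)
  have "J -` (Ps ` A) Int X = (J' \<circ> Ps) ` A"
  proof (intro set_eqI iffI)
   fix y assume "y \<in> J -` (Ps ` A) Int X"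
   then obtain a where "a \<in> A" "J y = Ps a" by blast
   then have "y = J' (Ps a)" using JJ(1)[of y] by simp
   then show "y \<in> (J' \<circ> Ps) ` A" using \<open>a \<in> A\<close> by auto
  qed (use im(2) J'X JJ in auto)
  then have "emeasure (distr mu mu J) (Ps ` A) = emeasure mu ((J' \<circ> Ps) ` A)"
   using emeasure_distr[OF m, of "Ps ` A"] im by (simp add: se sp)
  also have "... = (\<integral>\<^sup>+x\<in>A. ennreal (sqrt (gram_det B (J' \<circ> Ps) x)) \<partial>lborel_span B)"
   unfolding mu_def by (rule emeasure_ivol_chart[OF X c' A])
  also have "... = (\<integral>\<^sup>+x\<in>A. ennreal (sqrt (gram_det B Ps x)) \<partial>lborel_span B)"
   using A(2) by (intro nn_integral_cong) (auto simp: gram_det_def D_eqI[OF dPs] inn indicator_def)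
  finally show "emeasure (distr mu mu J) (Ps ` A) = ..." .
 qed
 then show "distr mu mu J = mu"
  by (rule is_induced_volume_unique[OF X _ is_induced_volume_induced_volume[OF X, folded mu_def]])
qed

lemma image_orthogonal_transformation_sphere:
 fixes f :: "real^'d => real^'d"
 assumes f: "orthogonal_transformation f"
 shows "f ` sphere 0 r = sphere 0 r"
proof -
 have "x \<in> f ` sphere 0 r" if x: "x \<in> sphere 0 r" for x
 proof -
  obtain y where y: "x = f y" using orthogonal_transformation_surj[OF f] by (rule surjE)
  then have "y \<in> sphere 0 r" using x orthogonal_transformation_norm[OF f, of y] by simp
  then show ?thesis using y by blast
 qed
 then show ?thesis using orthogonal_transformation_norm[OF f] by auto
qed

lemma integral_sphere_orthogonal:
 fixes f :: "real^'d => 'b::euclidean_space" and J :: "real^'d => real^'d"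
 assumes r: "r > 0" and J: "orthogonal_transformation J" and f: "f \<in> borel_measurable borel"
 defines "mu \<equiv> ivol (CARD('d) - 1) (sphere (0 :: real^'d) r)"
 shows "(\<integral>x. f (J x) \<partial>mu) = (\<integral>x. f x \<partial>mu)"
proof -
 have S: "compact (sphere (0 :: real^'d) r)" "charted (CARD('d) - 1) (sphere (0 :: real^'d) r)" using charted_sphere[OF r] by auto
 note d = distr_induced_volume_orthogonal[OF S J image_orthogonal_transformation_sphere[OF J], folded mu_def]
 have "f \<in> borel_measurable mu" unfolding mu_def by (rule measurable_ivol[OF S f])
 then show ?thesis using integral_distr[OF d(1), of f] d(2) by simp
qed

text \<open>The induced volume has full support, so closed conditions that hold almost everywhere
  hold on all of \<open>X\<close>.\<close>

lemma emeasure_ivol_ball_pos: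
 fixes X :: "(real^'d) set"
 assumes X: "compact X" "submanifold 2 m X" and x: "x \<in> X" and t: "t > 0"
 shows "emeasure (ivol m X) (X Int cball x t) > 0"
proof -
 have X': "compact X" "charted m X" using X charted_submanifold[OF X(2)] by auto
 obtain C t0 where C: "C > 0" "t0 > 0" "C * t0\<^sup>2 <= 1" "!!x t. x \<in> X ==> 0 < t ==> t <= t0 ==>
   emeasure (ivol m X) (X Int cball x t) \<ge> ennreal (unit_ball_vol m * (t - C * t ^ 3) ^ m)"
  by (rule emeasure_ivol_ball_ge[OF X]) (rule that)
 \<comment> \<open>Half of \<open>t0\<close> turns \<open>C * t0\<^sup>2 <= 1\<close> into a strict
   inequality, hence gives a positive radius.\<close>
 define s where "s = min t (t0 / 2)"
 have s: "0 < s" "s <= t" "s <= t0 / 2" using t C(2) by (auto simp: s_def)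
 then have "C * s\<^sup>2 <= C * (t0 / 2)\<^sup>2" using C(1) by (intro mult_left_mono power_mono) auto
 then have "C * s\<^sup>2 < 1" using C(3) by (simp add: power_divide)
 then have "s * (C * s\<^sup>2) < s * 1" using s(1) by (intro mult_strict_left_mono)
 then have "0 < unit_ball_vol m * (s - C * s ^ 3) ^ m" by (simp add: power3_eq_cube power2_eq_square mult_ac)
 then have "0 < ennreal (unit_ball_vol m * (s - C * s ^ 3) ^ m)" by simp
 also have "... <= emeasure (ivol m X) (X Int cball x s)" using C s by (intro C(4)[OF x]) auto
 also have "... <= emeasure (ivol m X) (X Int cball x t)"
  using s sets_ivol[OF X'] borel_X[OF X'] by (intro emeasure_mono) auto
 finally show ?thesis .
qed

text \<open>Invariance under the antipodal map puts the centroid at 0, from which all points have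
  distance \<open>r\<close>.\<close>

lemma sphere_facts:
 fixes r :: real
 assumes r: "r > 0" and d: "2 <= CARD('d)"
 defines "S \<equiv> sphere (0 :: real^'d) r"
 defines "mu \<equiv> ivol (CARD('d) - 1) S"
 shows "compact S" "charted (CARD('d) - 1) S" "0 < measure mu S" "(\<integral>x. x \<partial>mu) = 0"
  "inertia mu = r\<^sup>2 * measure mu S" "power_order (CARD('d) - 1) (distance_distribution (CARD('d) - 1) S)"
proof -
 show S: "compact S" "charted (CARD('d) - 1) S" using charted_sphere[OF r, of "0 :: real^'d"] by (simp_all add: S_def)
 have sub: "submanifold 2 (CARD('d) - 1) S" using submanifold_sphere[OF r] by (simp add: S_def)
 interpret finite_measure mu unfolding mu_def by (rule finite_ivol[OF S])
 obtain b :: "real^'d" where "b \<in> Basis" using nonempty_Basis by blast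
 then have "r *\<^sub>R b \<in> S" using r by (simp add: S_def)
 from emeasure_ivol_ball_pos[OF S(1) sub this zero_less_one] have "0 < emeasure mu (S Int cball (r *\<^sub>R b) 1)" by (simp only: mu_def)
 also have "... <= emeasure mu S" unfolding mu_def using sets_ivol[OF S] borel_X[OF S] by (intro emeasure_mono) auto
 finally show V: "0 < measure mu S" by (simp add: emeasure_eq_measure)
 show "power_order (CARD('d) - 1) (distance_distribution (CARD('d) - 1) S)"
  by (rule power_order_submanifold[OF S(1)]) (use sub V mu_def in auto)
 note sp = space_ivol[OF S, folded mu_def]
 have "(\<integral>x. - x \<partial>mu) = (\<integral>x. x \<partial>mu)"
  using integral_sphere_orthogonal[OF r, of "\<lambda>x :: real^'d. - x" "\<lambda>x. x"]
  by (simp add: mu_def S_def orthogonal_transformation_def linear_uminus)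
 then show zero: "(\<integral>x. x \<partial>mu) = 0" by (simp add: neg_eq_iff_add_eq_0 flip: scaleR_2)
 have "inertia mu = (\<integral>x. r\<^sup>2 \<partial>mu)" unfolding inertia_def
  by (rule Bochner_Integration.integral_cong[OF refl]) (simp add: centroid_def zero sp S_def)
 then show "inertia mu = r\<^sup>2 * measure mu S" by (simp add: sp)
qed

section \<open>Closed curves made of circular arcs, and the model circle\<close>

lemma orthogonal_pair_real2:
 fixes w a b :: "real^2"
 assumes w: "w \<bullet> a = 0" "w \<bullet> b = 0" and ab: "a \<bullet> b = 0" "a \<noteq> 0" "b \<noteq> 0"
 shows "w = 0"
proof -
 \<comment> \<open>The determinant of \<open>a\<close> and \<open>b\<close>, nonzero by Lagrange's
   identity; the coordinates of \<open>w\<close> vanish by Cramer's rule.\<close>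
 define k where "k = a $ 1 * b $ 2 - a $ 2 * b $ 1"
 have "k\<^sup>2 + (a \<bullet> b)\<^sup>2 = (a \<bullet> a) * (b \<bullet> b)" by (simp add: k_def inner_vec_def sum_2 power2_eq_square algebra_simps)
 then have "k \<noteq> 0" using ab by auto
 moreover have "w $ 1 * k = (w \<bullet> a) * b $ 2 - (w \<bullet> b) * a $ 2" "w $ 2 * k = (w \<bullet> b) * a $ 1 - (w \<bullet> a) * b $ 1"
  by (simp_all add: k_def inner_vec_def sum_2 algebra_simps)
 ultimately show ?thesis using w by (simp add: vec_eq_iff forall_2)
qed

text \<open>In the plane the position vector and the unit tangent form an orthogonal basis, and
  \<open>w\<close> is orthogonal to both. The circle thus satisfies the same equation as the unknown
  curve, so the same argument computes its length.\<close>

lemma circle_arc_ode: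
 assumes r: "r > 0" and a: "unit_arc (sphere (0 :: real^2) r) ga ga1 ga2 e" and s: "\<bar>s\<bar> < e"
 shows "ga2 s = - (1 / r\<^sup>2) *\<^sub>R (ga s - 0)"
proof -
 have const: "D = 0" if "(f has_real_derivative D) (at t)" "\<bar>t\<bar> < e" "!!s. \<bar>s\<bar> < e ==> f s = k" for f D t k
 proof -
  have "(f has_real_derivative 0) (at t)"
   by (rule has_field_derivative_transform_within_open[of "\<lambda>_. k" 0 _ "{-e<..<e}"]) (use that in \<open>auto simp: abs_less_iff minus_less_iff\<close>)
  then show ?thesis using that(1) DERIV_unique by blast
 qed
 have n: "ga s \<bullet> ga s = r\<^sup>2" "ga1 s \<bullet> ga1 s = 1" if "\<bar>s\<bar> < e" for s
  using unit_arcD(3,4)[OF a that] by (simp_all add: power2_norm_eq_inner[symmetric])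
 have o: "ga s \<bullet> ga1 s = 0" if s: "\<bar>s\<bar> < e" for s
  using const[OF has_real_derivative_inner[OF unit_arcD(1)[OF a s] unit_arcD(1)[OF a s]] s n(1)] by (simp add: inner_commute)
 define w where "w = ga2 s + (1 / r\<^sup>2) *\<^sub>R ga s"
 have "ga s \<bullet> ga2 s + ga1 s \<bullet> ga1 s = 0"
  by (rule const[OF has_real_derivative_inner[OF unit_arcD(1)[OF a s] unit_arcD(2)[OF a s]] s o])
 then have w: "w \<bullet> ga s = 0" "w \<bullet> ga1 s = 0"
  using n[OF s] o[OF s] unit_arc_orthogonal[OF a s] r by (simp_all add: w_def inner_add_left inner_commute[of "ga2 s" "ga s"])
 have "ga s \<noteq> 0" "ga1 s \<noteq> 0" using n[OF s] r by auto
 then have "w = 0" by (rule orthogonal_pair_real2[OF w o[OF s]])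
 then show ?thesis by (simp add: w_def eq_neg_iff_add_eq_0)
qed

lemma range_circle_point: "range (circle_point c u v) = circle_point c u v ` {0..<2 * pi}"
proof (intro equalityI subsetI)
 fix x assume "x \<in> range (circle_point c u v)"
 then obtain th where th: "x = circle_point c u v th" by blast
 have "(cos th)\<^sup>2 + (sin th)\<^sup>2 = 1" by simp
 then obtain t where "0 <= t" "t < 2 * pi" "cos th = cos t" "sin th = sin t"
  using sincos_total_2pi[of "cos th" "sin th"] by metis
 then show "x \<in> circle_point c u v ` {0..<2 * pi}"
  unfolding th by (intro image_eqI[of _ _ t]) (auto simp: circle_point_def)
qed auto

text \<open>Continuation along a circle: the angles around which the circle runs inside
  \<open>X\<close> form a nonempty open and closed set of reals. Its measure is added up over short
  angular intervals, where the arcs carry arc length.\<close>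

lemma great_circle_of_unit_arcs:
 fixes X :: "(real^'d) set"
 assumes X: "compact X" "submanifold 2 1 X" and r: "r > 0" and ne: "X \<noteq> {}"
  and ode: "!!ga ga1 ga2 e s. unit_arc X ga ga1 ga2 e ==> \<bar>s\<bar> < e ==> ga2 s = - (1 / r\<^sup>2) *\<^sub>R (ga s - c)"
 obtains u v where "u \<bullet> u = r\<^sup>2" "v \<bullet> v = r\<^sup>2" "u \<bullet> v = 0" "range (circle_point c u v) \<subseteq> X"
  "measure (ivol 1 X) (range (circle_point c u v)) = 2 * pi * r"
proof -
 have chX: "charted 1 X" by (rule charted_submanifold[OF X(2)]) simp
 note X' = X(1) chX
 let ?mu = "ivol 1 X"
 interpret finite_measure ?mu by (rule finite_ivol[OF X'])
 obtain p where p: "p \<in> X" using ne by blast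
 obtain ga ga1 ga2 e where a: "unit_arc X ga ga1 ga2 e" "ga 0 = p" by (rule unit_arc_exists[OF X p])
 have e: "e > 0" using a(1) by (simp add: unit_arc_def)
 define u where "u = ga 0 - c"
 define v where "v = r *\<^sub>R ga1 0"
 note uc = unit_arc_circle[OF a(1) r ode[OF a(1)], folded u_def v_def]
 note uv = uc(1-3) and gac = uc(4)
 let ?ze = "circle_point c u v"
 \<comment> \<open>An arc of \<open>X\<close> through the point at angle \<open>th0\<close> is
   itself an arc of a circle of radius \<open>r\<close> about \<open>c\<close>. Sharing a second
   nearby point with the given circle determines its tangent up to sign, so only the orientation
   \<open>si\<close> remains free.\<close>
 have step: "\<exists>ga ga1 ga2 e si. unit_arc X ga ga1 ga2 e \<and> (si = 1 \<or> si = - 1) \<and> (\<forall>s. \<bar>s\<bar> < e --> ga s = ?ze (th0 + si * (s / r)))"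
  if mem: "?ze th0 \<in> X" and lim: "!!de. de > 0 ==> \<exists>th. 0 < \<bar>th - th0\<bar> \<and> \<bar>th - th0\<bar> < de \<and> ?ze th \<in> X" for th0
 proof -
  obtain ga ga1 ga2 e where a: "unit_arc X ga ga1 ga2 e" "ga 0 = ?ze th0" by (rule unit_arc_exists[OF X mem])
  have e: "e > 0" using a(1) by (simp add: unit_arc_def)
  define u' where "u' = ?ze th0 - c"
  define v' where "v' = cos th0 *\<^sub>R v - sin th0 *\<^sub>R u"
  define w where "w = r *\<^sub>R ga1 0"
  have w: "u' \<bullet> u' = r\<^sup>2" "u' \<bullet> w = 0" "!!s. \<bar>s\<bar> < e ==> ga s = circle_point c u' w (s / r)"
   using unit_arc_circle[OF a(1) r ode[OF a(1)]] a(2) by (simp_all add: u'_def w_def)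
  have u'v': "u' \<bullet> v' = 0"
   using uv by (simp add: u'_def v'_def circle_point_def inner_add_left inner_diff_right inner_commute[of v u])
  have add: "?ze (th0 + ph) = circle_point c u' v' ph" for ph unfolding u'_def v'_def by (rule circle_point_add)
  \<comment> \<open>The bound \<open>r\<close> keeps the angle \<open>s / r\<close> within 1 of 0,
    where the cosine determines the absolute value.\<close>
  define de where "de = min e r"
  have de: "0 < de" "de <= e" "de <= r" using e r by (auto simp: de_def)
  obtain rh where rh: "rh > 0" "X Int ball (?ze th0) rh \<subseteq> ga ` {-de<..<de}" using unit_arc_nhds[OF a(1) de(1,2)] a(2) by auto
  have "isCont ?ze th0" using continuous_on_circle_point[of UNIV c u v] by (simp add: continuous_on_eq_continuous_at)
  then obtain d where d: "d > 0" "!!th. dist th th0 < d ==> dist (?ze th) (?ze th0) < rh"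
   using rh(1) unfolding continuous_at by (metis continuous_at continuous_at_eps_delta dist_norm)
  have "min d 1 > 0" using d(1) by simp
  from lim[OF this] obtain th where th: "0 < \<bar>th - th0\<bar>" "\<bar>th - th0\<bar> < d" "\<bar>th - th0\<bar> < 1" "?ze th \<in> X" by auto
  have "?ze th \<in> ball (?ze th0) rh" using d(2)[of th] th(2) by (simp add: dist_commute dist_real_def)
  then have "?ze th \<in> ga ` {-de<..<de}" using rh(2) th(4) by blast
  then obtain s where s: "?ze th = ga s" "s \<in> {-de<..<de}" by blast
  then have s': "\<bar>s\<bar> < e" "\<bar>s / r\<bar> <= 1" using de r by (auto simp: field_simps)
  define ph where "ph = th - th0"
  have ph: "ph \<noteq> 0" "\<bar>ph\<bar> < 1" using th by (auto simp: ph_def)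
  have eq: "cos ph *\<^sub>R u' + sin ph *\<^sub>R v' = cos (s / r) *\<^sub>R u' + sin (s / r) *\<^sub>R w"
   using s(1) w(3)[OF s'(1)] add[of ph] by (simp add: ph_def circle_point_def)
  then have "(cos ph *\<^sub>R u' + sin ph *\<^sub>R v') \<bullet> u' = (cos (s / r) *\<^sub>R u' + sin (s / r) *\<^sub>R w) \<bullet> u'" by simp
  then have cc: "cos ph = cos (s / r)"
   using w(1,2) u'v' r by (simp add: inner_add_left inner_commute[of v'] inner_commute[of w])
  have ce: "cos \<bar>ph\<bar> = cos \<bar>s / r\<bar>" unfolding cos_abs_real by (rule cc)
  have "\<bar>ph\<bar> = \<bar>s / r\<bar>"
   by (rule cos_inj_pi[OF abs_ge_zero _ abs_ge_zero _ ce]) (use ph(2) s'(2) pi_gt3 in linarith)+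
  then have "s / r = ph \<or> s / r = - ph" by linarith
  moreover have "sin ph \<noteq> 0" using sin_gt_zero[of "\<bar>ph\<bar>"] ph pi_gt3 by (auto simp: abs_if split: if_splits)
  moreover have "sin ph *\<^sub>R v' = sin (s / r) *\<^sub>R w" using eq cc by simp
  ultimately have "sin ph *\<^sub>R v' = sin ph *\<^sub>R w \<or> sin ph *\<^sub>R v' = sin ph *\<^sub>R (- w)" by auto
  then have "w = v' \<or> w = - v'" using \<open>sin ph \<noteq> 0\<close> unfolding scaleR_cancel_left by auto
  then obtain si :: real where si: "si = 1 \<or> si = - 1" "w = si *\<^sub>R v'" by (metis scaleR_minus1_left scaleR_one)
  have "ga s = ?ze (th0 + si * (s / r))" if "\<bar>s\<bar> < e" for s
   using si unfolding w(3)[OF that] add by (auto simp: circle_point_def)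
  then show ?thesis using a(1) si(1) by blast
 qed
 define A where "A = interior {th. ?ze th \<in> X}"
 have nbd: "th0 \<in> A" if ar: "unit_arc X ga ga1 ga2 e" and si: "si = 1 \<or> si = (- 1 :: real)"
  and eq: "!!s. \<bar>s\<bar> < e ==> ga s = ?ze (th0 + si * (s / r))" for th0 ga ga1 ga2 e si
 proof -
  have "ball th0 (e / r) \<subseteq> {th. ?ze th \<in> X}"
  proof
   fix th assume "th \<in> ball th0 (e / r)"
   then have "\<bar>th - th0\<bar> < e / r" by (simp add: dist_real_def abs_minus_commute)
   then have "\<bar>th - th0\<bar> * r < e" using r by (simp add: pos_less_divide_eq)
   then have s: "\<bar>si * ((th - th0) * r)\<bar> < e" using si r by (auto simp: abs_mult)
   have "?ze th = ga (si * ((th - th0) * r))" using eq[OF s] si r by auto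
   then show "th \<in> {th. ?ze th \<in> X}" using unit_arcD(4)[OF ar s] by simp
  qed
  moreover have "e / r > 0" using ar r by (simp add: unit_arc_def)
  ultimately show ?thesis unfolding A_def by (meson centre_in_ball interiorI open_ball)
 qed
 have "A \<noteq> {}" using nbd[OF a(1), of 1 0] gac by auto
 moreover have "open A" by (simp add: A_def)
 moreover have "closed A"
 proof (rule closure_subset_eq[THEN iffD1], rule subsetI)
  fix th0 assume th0: "th0 \<in> closure A"
  have near: "\<exists>th\<in>A. \<bar>th - th0\<bar> < de" if "de > 0" for de
   using closure_approachable[of th0 A] th0 that by (auto simp: dist_real_def)
  have "closed {th. ?ze th \<in> X}"
   using continuous_closed_vimage[OF compact_imp_closed[OF X(1)], of ?ze] continuous_on_circle_point[of UNIV c u v]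
   by (simp add: continuous_on_eq_continuous_at vimage_def)
  moreover have AX: "A \<subseteq> {th. ?ze th \<in> X}" unfolding A_def by (rule interior_subset)
  ultimately have mem: "?ze th0 \<in> X" using closure_minimal[of A] th0 by blast
  have lim: "\<exists>th. 0 < \<bar>th - th0\<bar> \<and> \<bar>th - th0\<bar> < de \<and> ?ze th \<in> X" if de: "de > 0" for de
  proof -
   obtain th where th: "th \<in> A" "\<bar>th - th0\<bar> < de" using near[OF de] by blast
   obtain h where h: "h > 0" "ball th h \<subseteq> A" using \<open>open A\<close> th(1) open_contains_ball by blast
   show ?thesis
   proof (cases "th = th0")
    case False
    then show ?thesis using th AX by auto
   next
    case True
    \<comment> \<open>The approximating angle may be \<open>th0\<close> itself; a different one is
      taken from the open set \<open>A\<close>.\<close>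
    define th' where "th' = th + min h de / 2"
    have t': "th' \<noteq> th" "\<bar>th' - th\<bar> < h" "\<bar>th' - th\<bar> < de" using h(1) de by (auto simp: th'_def)
    then have "th' \<in> ball th h" by (simp add: dist_real_def abs_minus_commute)
    then have "?ze th' \<in> X" using h(2) AX by blast
    then show ?thesis using t' True by auto
   qed
  qed
  from step[OF mem lim] show "th0 \<in> A" using nbd by blast
 qed
 ultimately have "A = UNIV" using clopen by blast
 then have all: "?ze th \<in> X" for th using interior_subset[of "{th. ?ze th \<in> X}"] by (auto simp: A_def)
 have all_arc: "\<exists>ga ga1 ga2 e si. unit_arc X ga ga1 ga2 e \<and> (si = 1 \<or> si = - 1) \<and> (\<forall>s. \<bar>s\<bar> < e --> ga s = ?ze (th0 + si * (s / r)))" for th0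
 proof (rule step[OF all])
  fix de :: real assume "de > 0"
  then show "\<exists>th. 0 < \<bar>th - th0\<bar> \<and> \<bar>th - th0\<bar> < de \<and> ?ze th \<in> X"
   using all by (intro exI[of _ "th0 + de / 2"]) auto
 qed
 let ?C = "range ?ze"
 have inj: "th = ph" if "?ze th = ?ze ph" "\<bar>th - ph\<bar> < 2 * pi" for th ph
 proof -
  have "sin th = sin ph \<and> cos th = cos ph" using circle_point_eq_iff[OF uv r] that(1) by blast
  then obtain n :: int where n: "th = ph + 2 * pi * n" using sin_cos_eq_iff by blast
  then have "\<bar>2 * pi * real_of_int n\<bar> < 2 * pi" using that(2) by simp
  then have "\<bar>real_of_int n\<bar> < 1" by (simp add: abs_mult)
  then have "n = 0" by linarith
  then show ?thesis using n by simp
 qed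
 \<comment> \<open>Half-open intervals make the claim additive; length at most \<open>pi\<close>
   keeps \<open>circle_point\<close> injective on them, which makes images of adjacent ones
   disjoint.\<close>
 define P where "P a b \<longleftrightarrow> (a <= b --> b - a <= pi --> measure ?mu (?ze ` {a..<b}) = r * (b - a))" for a b
 have meas: "?ze ` {a..<b} \<in> sets ?mu" if "a <= b" "b - a <= pi" for a b
 proof -
  have "?ze ` {a..<b} = ?ze ` {a..b} - {?ze b}"
  proof -
   have "?ze x \<noteq> ?ze b" if "a <= x" "x < b" for x
    using inj[of x b] that \<open>b - a <= pi\<close> pi_gt_zero by auto
   then show ?thesis using \<open>a <= b\<close> by (auto simp: image_iff less_le)
  qed
  moreover have "?ze ` {a..b} \<in> sets borel"
   by (intro borel_compact compact_continuous_image continuous_on_circle_point) auto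
  ultimately show ?thesis using all sets_ivol[OF X'] by auto
 qed
 have disj: "?ze ` {a..<b} Int ?ze ` {b..<c} = {}" if "a <= b" "b <= c" "c - a <= 2 * pi" for a b c
 proof -
  have False if "a <= x" "x < b" "b <= y" "y < c" "?ze x = ?ze y" for x y
   using inj[OF that(5)] that \<open>c - a <= 2 * pi\<close> by auto
  then show ?thesis by fastforce
 qed
 have P: "P a b" if ab: "a <= b" for a b
  using ab
 proof (induction rule: Bolzano)
  case (trans a b c)
  show ?case
   unfolding P_def
  proof (intro impI)
   assume b: "a <= c" "c - a <= pi"
   have "?ze ` {a..<c} = ?ze ` {a..<b} \<union> ?ze ` {b..<c}" using trans(3,4) by (simp add: ivl_disj_un_two(3) flip: image_Un)
   moreover have "?ze ` {a..<b} Int ?ze ` {b..<c} = {}" by (rule disj) (use trans b pi_gt_zero in auto)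
   ultimately have "measure ?mu (?ze ` {a..<c}) = measure ?mu (?ze ` {a..<b}) + measure ?mu (?ze ` {b..<c})"
    using meas[of a b] meas[of b c] trans(3,4) b by (simp add: finite_measure_Union)
   also have "... = r * (b - a) + r * (c - b)" using trans b unfolding P_def by auto
   finally show "measure ?mu (?ze ` {a..<c}) = r * (c - a)" by (simp add: algebra_simps)
  qed
 next
  case (local th0)
  obtain ga ga1 ga2 e si where ar: "unit_arc X ga ga1 ga2 e" and si: "si = 1 \<or> si = (- 1 :: real)"
   and eq: "!!s. \<bar>s\<bar> < e ==> ga s = ?ze (th0 + si * (s / r))" using all_arc[of th0] by blast
  have e: "e > 0" using ar by (simp add: unit_arc_def)
  have "P a b" if ab: "a <= th0 \<and> th0 <= b \<and> b - a < e / r" for a b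
   unfolding P_def
  proof (intro impI)
   assume b: "a <= b" "b - a <= pi"
   let ?E = "?ze ` {a..<b}"
   have Eb: "?E \<in> sets borel" using meas[OF b] sets_ivol[OF X'] by blast
   \<comment> \<open>The arc parameters of the angular interval; the orientation decides which end
     is open.\<close>
   define T0 where "T0 = (if si = 1 then {r * (a - th0)..<r * (b - th0)} else {r * (th0 - b)<..r * (th0 - a)})"
   have "r * (b - a) < e" using ab r by (simp add: field_simps)
   moreover have "0 <= r * (b - th0)" "0 <= r * (th0 - a)" using ab r by auto
   ultimately have T0e: "\<bar>s\<bar> < e" if "s \<in> T0" for s
    using that by (auto simp: T0_def algebra_simps split: if_splits)
   then have T0s: "T0 \<subseteq> {-e<..<e}" by (auto simp: abs_less_iff minus_less_iff)
   have E: "?E = ga ` T0"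
   proof (intro equalityI subsetI)
    fix x assume "x \<in> ga ` T0"
    then obtain s where s: "s \<in> T0" "x = ga s" by blast
    have "th0 + si * (s / r) \<in> {a..<b}" using s(1) si r by (auto simp: T0_def field_simps split: if_splits)
    then show "x \<in> ?E" using s(2) eq[OF T0e[OF s(1)]] by blast
   next
    fix x assume "x \<in> ?E"
    then obtain th where th: "th \<in> {a..<b}" "x = ?ze th" by blast
    have s: "si * ((th - th0) * r) \<in> T0" using th(1) si r by (auto simp: T0_def field_simps)
    have "ga (si * ((th - th0) * r)) = ?ze th" unfolding eq[OF T0e[OF s]] using si r by auto
    then show "x \<in> ga ` T0" using s th(2) by (metis imageI)
   qed
   have T0: "{s\<in>{-e<..<e}. ga s \<in> ?E} = T0"
    using inj_on_image_mem_iff[OF unit_arc_inj[OF ar] _ T0s] T0s unfolding E by blast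
   have "?E \<subseteq> ga ` {-e<..<e}" unfolding E by (rule image_mono[OF T0s])
   then have "emeasure ?mu ?E = emeasure ?mu (?E Int ga ` {-e<..<e})" by (simp add: Int_absorb2)
   also have "... = emeasure lborel {s\<in>{-e<..<e}. ga s \<in> ?E}" using ar Eb unfolding unit_arc_def by blast
   also have "... = emeasure lborel T0" unfolding T0 ..
   also have "... = ennreal (r * (b - a))" using si b(1) r by (auto simp: T0_def algebra_simps)
   finally show "measure ?mu ?E = r * (b - a)" using b(1) r by (simp add: measure_def)
  qed
  then show ?case using e r by (intro exI[of _ "e / r"]) auto
 qed
 have "?C = ?ze ` {0..<2 * pi}" by (rule range_circle_point)
 also have "{0..<2 * pi} = {0..<pi} \<union> {pi..<2 * pi}" using pi_gt_zero by (subst ivl_disj_un_two(3)) auto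
 finally have "measure ?mu ?C = measure ?mu (?ze ` {0..<pi} \<union> ?ze ` {pi..<2 * pi})" by (simp only: image_Un)
 also have "... = measure ?mu (?ze ` {0..<pi}) + measure ?mu (?ze ` {pi..<2 * pi})"
  by (intro finite_measure_Union meas disj) (use pi_gt_zero in auto)
 also have "... = 2 * pi * r" using P[of 0 pi] P[of pi "2 * pi"] pi_gt_zero unfolding P_def by simp
 finally have "measure ?mu ?C = 2 * pi * r" .
 then show thesis using all uv by (intro that[of u v]) auto
qed

text \<open>One full circle already exhausts the length. A further point of \<open>X\<close> would
  have a small ball of positive measure disjoint from that circle.\<close>

lemma circle_of_unit_arcs:
 fixes X :: "(real^'d) set"
 assumes X: "compact X" "submanifold 2 1 X" and r: "r > 0" and ne: "X \<noteq> {}"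
  and L: "measure (ivol 1 X) X <= 2 * pi * r"
  and ode: "!!ga ga1 ga2 e s. unit_arc X ga ga1 ga2 e ==> \<bar>s\<bar> < e ==> ga2 s = - (1 / r\<^sup>2) *\<^sub>R (ga s - c)"
 obtains u v where "u \<bullet> u = r\<^sup>2" "v \<bullet> v = r\<^sup>2" "u \<bullet> v = 0" "X = range (circle_point c u v)"
proof -
 have X': "compact X" "charted 1 X" using X charted_submanifold[OF X(2)] by auto
 let ?mu = "ivol 1 X"
 interpret finite_measure ?mu by (rule finite_ivol[OF X'])
 obtain u v where uv: "u \<bullet> u = r\<^sup>2" "v \<bullet> v = r\<^sup>2" "u \<bullet> v = 0" and CX: "range (circle_point c u v) \<subseteq> X"
  and len: "measure ?mu (range (circle_point c u v)) = 2 * pi * r"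
  by (rule great_circle_of_unit_arcs[OF X r ne, where c = c]) (erule (1) ode, rule that)
 let ?C = "range (circle_point c u v)"
 have "x \<in> ?C" if x: "x \<in> X" for x
 proof (rule ccontr)
  assume "x \<notin> ?C"
  moreover have C: "compact ?C"
  proof -
   have "circle_point c u v ` {0..<2 * pi} \<subseteq> circle_point c u v ` {0..2 * pi}" by (intro image_mono) auto
   then have "?C = circle_point c u v ` {0..2 * pi}" using range_circle_point[of c u v] by blast
   then show ?thesis by (simp add: compact_continuous_image continuous_on_circle_point)
  qed
  ultimately obtain t where t: "t > 0" "cball x t \<subseteq> - ?C"
   using open_Compl[OF compact_imp_closed[OF C]] unfolding open_contains_cball by blast
  have s: "?C \<in> sets ?mu" "X Int cball x t \<in> sets ?mu"
   using C CX sets_ivol[OF X'] borel_X[OF X'] by (auto simp: borel_compact)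
  then have "measure ?mu ?C + measure ?mu (X Int cball x t) = measure ?mu (?C \<union> X Int cball x t)"
   using t(2) by (intro finite_measure_Union[symmetric]) auto
  also have "... <= measure ?mu X" using bounded_measure[of "?C \<union> X Int cball x t"] by (simp add: space_ivol[OF X'])
  finally have "measure ?mu (X Int cball x t) <= 0" using len L by simp
  then show False using emeasure_ivol_ball_pos[OF X x t(1)] by (simp add: emeasure_eq_measure)
 qed
 then show thesis using CX uv by (intro that[of u v]) auto
qed

text \<open>The continuation argument applied to the circle itself yields a full circle inside it,
  and expanding a point in the orthogonal basis \<open>u\<close>, \<open>v\<close> shows that
  nothing is left over.\<close>

lemma measure_circle:
 assumes r: "r > 0"
 shows "measure (ivol 1 (sphere (0 :: real^2) r)) (sphere 0 r) = 2 * pi * r"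
proof -
 let ?S = "sphere (0 :: real^2) r"
 have sub: "submanifold 2 1 ?S" using submanifold_sphere[OF r, of "0 :: real^2"] by (simp add: One_nat_def)
 have ne: "?S \<noteq> {}" using r by simp
 obtain u v :: "real^2" where uv: "u \<bullet> u = r\<^sup>2" "v \<bullet> v = r\<^sup>2" "u \<bullet> v = 0" and C: "range (circle_point 0 u v) \<subseteq> ?S"
  and len: "measure (ivol 1 ?S) (range (circle_point 0 u v)) = 2 * pi * r"
  by (rule great_circle_of_unit_arcs[OF compact_sphere sub r ne, where c = 0]) (erule (1) circle_arc_ode[OF r], rule that)
 have "x \<in> range (circle_point 0 u v)" if x: "x \<in> ?S" for x
 proof -
  define a where "a = (x \<bullet> u) / r\<^sup>2"
  define b where "b = (x \<bullet> v) / r\<^sup>2"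
  have "u \<noteq> 0" "v \<noteq> 0" using uv r by auto
  moreover have "(x - (a *\<^sub>R u + b *\<^sub>R v)) \<bullet> u = 0" "(x - (a *\<^sub>R u + b *\<^sub>R v)) \<bullet> v = 0"
   using uv r by (simp_all add: inner_diff_left inner_add_left inner_commute[of v u] a_def b_def)
  ultimately have "x - (a *\<^sub>R u + b *\<^sub>R v) = 0" by (intro orthogonal_pair_real2[of _ u v] uv(3))
  then have xab: "x = a *\<^sub>R u + b *\<^sub>R v" by simp
  have "r\<^sup>2 = x \<bullet> x" using x by (simp add: power2_norm_eq_inner[symmetric])
  also have "... = (a\<^sup>2 + b\<^sup>2) * r\<^sup>2"
   unfolding xab using uv by (simp add: inner_add_left inner_add_right inner_commute[of v u] power2_eq_square distrib_right)
  finally have "a\<^sup>2 + b\<^sup>2 = 1" using r by simp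
  then obtain th where "a = cos th" "b = sin th" using sincos_total_2pi by metis
  then show ?thesis using xab by (simp add: circle_point_def)
 qed
 then have "range (circle_point 0 u v) = ?S" using C by blast
 then show ?thesis using len by simp
qed

text \<open>An orthogonal transformation reduces every centre to \<open>p\<close>, near which the
  circle is a single arc whose chord at arc length \<open>s\<close> is
  \<open>2 * r * sin (\<bar>s\<bar> / (2 * r))\<close>.\<close>

lemma emeasure_circle_cball:
 assumes r: "r > 0"
 obtains t0 where "0 < t0" "t0 <= r" "!!x t. x \<in> sphere (0 :: real^2) r ==> 0 < t ==> t <= t0 ==>
  emeasure (ivol 1 (sphere 0 r)) (sphere 0 r Int cball x t) <= ennreal (4 * r * arcsin (t / (2 * r)))"
proof -
 let ?S = "sphere (0 :: real^2) r" and ?mu = "ivol 1 (sphere (0 :: real^2) r)"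
 have S: "compact ?S" "charted 1 ?S" and sub: "submanifold 2 1 ?S"
  using charted_sphere[OF r, of "0 :: real^2"] submanifold_sphere[OF r, of "0 :: real^2"] by (simp_all add: One_nat_def)
 interpret finite_measure ?mu by (rule finite_ivol[OF S])
 define p :: "real^2" where "p = r *\<^sub>R axis 1 1"
 have p: "p \<in> ?S" using r by (simp add: p_def)
 obtain ga ga1 ga2 e where a: "unit_arc ?S ga ga1 ga2 e" "ga 0 = p" by (rule unit_arc_exists[OF S(1) sub p])
 let ?v = "r *\<^sub>R ga1 0"
 have uc: "p \<bullet> p = r\<^sup>2" "?v \<bullet> ?v = r\<^sup>2" "p \<bullet> ?v = 0" "!!s. \<bar>s\<bar> < e ==> ga s = circle_point 0 p ?v (s / r)"
  using unit_arc_circle[OF a(1) r circle_arc_ode[OF r a(1)]] by (simp_all only: a(2) diff_zero)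
 have e: "e > 0" using a(1) by (simp add: unit_arc_def)
 have len: "emeasure ?mu (E Int ga ` {-e<..<e}) = emeasure lborel {s\<in>{-e<..<e}. ga s \<in> E}" if "E \<in> sets borel" for E
  using a(1) that by (simp add: unit_arc_def)
 \<comment> \<open>Beyond \<open>pi * r\<close> the arc would meet itself at the antipode. Hence the
   half angle below stays at most \<open>pi / 2\<close>, where the sine can be inverted.\<close>
 have ep: "e <= pi * r"
 proof (rule ccontr)
  assume "\<not> e <= pi * r"
  then have p: "\<bar>pi * r\<bar> < e" "\<bar>- (pi * r)\<bar> < e" using r by (auto simp: abs_mult)
  have "ga (pi * r) = ga (- (pi * r))" unfolding uc(4)[OF p(1)] uc(4)[OF p(2)] using r by (simp add: circle_point_def)
  then have "pi * r = - (pi * r)" using p by (intro inj_onD[OF unit_arc_inj[OF a(1)]]) (auto simp: abs_less_iff)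
  then show False using r by simp
 qed
 obtain rh where rh: "rh > 0" "?S Int ball p rh \<subseteq> ga ` {-e<..<e}" using unit_arc_nhds[OF a(1) e] a(2) by auto
 show thesis
 proof (rule that[of "min r (rh / 2)"])
  fix x :: "real^2" and t assume x: "x \<in> ?S" and t: "0 < t" "t <= min r (rh / 2)"
  obtain J where J: "orthogonal_transformation J" "J p = x"
   using orthogonal_transformation_exists[of p x] x p by (auto simp: dist_norm)
  note d = distr_induced_volume_orthogonal[OF S J(1) image_orthogonal_transformation_sphere[OF J(1)]]
  have dJ: "dist (J y) (J z) = dist y z" and nJ: "norm (J y) = norm y" for y z
   using J(1) orthogonal_transformation_isometry orthogonal_transformation_norm by blast+
  have b: "A \<in> sets ?mu" if "A \<in> sets borel" "A \<subseteq> ?S" for A using that sets_ivol[OF S] by auto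
  have "emeasure ?mu (?S Int cball x t) = emeasure (distr ?mu ?mu J) (?S Int cball x t)" by (simp only: d(2))
  also have "... = emeasure ?mu (J -` (?S Int cball x t) Int ?S)" using emeasure_distr[OF d(1) b] by (simp add: space_ivol[OF S])
  also have "J -` (?S Int cball x t) Int ?S = ?S Int cball p t" unfolding J(2)[symmetric] by (auto simp: dJ nJ)
  also have "... = (?S Int cball p t) Int ga ` {-e<..<e}" using rh t by auto
  also have "emeasure ?mu ... = emeasure lborel {s\<in>{-e<..<e}. ga s \<in> ?S Int cball p t}" by (rule len) auto
  also have "... <= emeasure lborel {- (2 * r * arcsin (t / (2 * r)))..2 * r * arcsin (t / (2 * r))}"
  proof (rule emeasure_mono)
   show "{s\<in>{-e<..<e}. ga s \<in> ?S Int cball p t} \<subseteq> {- (2 * r * arcsin (t / (2 * r)))..2 * r * arcsin (t / (2 * r))}"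
   proof
    fix s assume s: "s \<in> {s\<in>{-e<..<e}. ga s \<in> ?S Int cball p t}"
    then have se: "\<bar>s\<bar> < e" and dt: "dist p (ga s) <= t" by auto
    define k where "k = \<bar>s\<bar> / (2 * r)"
    have k: "0 <= k" "k <= pi / 2" using se ep r by (auto simp: k_def field_simps)
    have "(dist p (ga s))\<^sup>2 = (1 - cos (s / r))\<^sup>2 * r\<^sup>2 + (sin (s / r))\<^sup>2 * r\<^sup>2"
    proof -
     have "p - ga s = (1 - cos (s / r)) *\<^sub>R p - sin (s / r) *\<^sub>R ?v"
      using uc(4)[OF se] by (simp add: circle_point_def algebra_simps)
     moreover have "(a *\<^sub>R p - b *\<^sub>R q) \<bullet> (a *\<^sub>R p - b *\<^sub>R q) = a\<^sup>2 * (p \<bullet> p) + b\<^sup>2 * (q \<bullet> q) - 2 * a * b * (p \<bullet> q)" for a b q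
      by (simp add: inner_diff_left inner_diff_right inner_commute[of q p] power2_eq_square right_diff_distrib mult_ac)
     ultimately show ?thesis unfolding dist_norm power2_norm_eq_inner by (simp only: uc)
    qed
    also have "... = r\<^sup>2 * (2 - 2 * cos (s / r))"
    proof -
     have "(1 - c)\<^sup>2 * r\<^sup>2 + k\<^sup>2 * r\<^sup>2 = r\<^sup>2 * (k\<^sup>2 + c\<^sup>2 + 1 - 2 * c)" for c k by (simp add: power2_eq_square algebra_simps)
     then show ?thesis by simp
    qed
    also have "cos (s / r) = cos (2 * k)" using r cos_abs_real[of "s / r"] by (simp add: k_def)
    also have "r\<^sup>2 * (2 - 2 * cos (2 * k)) = (2 * r * sin k)\<^sup>2" by (simp add: cos_double_sin power_mult_distrib)
    finally have "2 * r * sin k <= t"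
     using dt r k sin_ge_zero[of k] by (simp add: power2_eq_iff_nonneg)
    then have "sin k <= t / (2 * r)" using r by (simp add: field_simps)
    then have "arcsin (sin k) <= arcsin (t / (2 * r))"
     using sin_ge_zero[of k] k t r by (intro arcsin_le_arcsin) (auto simp: field_simps)
    moreover have "arcsin (sin k) = k" using k by (intro arcsin_sin) auto
    ultimately have "2 * r * k <= 2 * r * arcsin (t / (2 * r))" using r by (intro mult_left_mono) auto
    then have "\<bar>s\<bar> <= 2 * r * arcsin (t / (2 * r))" using r by (simp add: k_def)
    then show "s \<in> {- (2 * r * arcsin (t / (2 * r)))..2 * r * arcsin (t / (2 * r))}" by auto
   qed
  qed simp
  also have "... = ennreal (4 * r * arcsin (t / (2 * r)))"
   using arcsin_le_arcsin[of 0 "t / (2 * r)"] t r by (subst emeasure_lborel_Icc) (auto simp: field_simps)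
  finally show "emeasure ?mu (?S Int cball x t) <= ennreal (4 * r * arcsin (t / (2 * r)))" .
 qed (use r rh in auto)
qed

text \<open>The terms of \<open>q\<close> come from \<open>arcsin_le\<close> at
  \<open>ta / (2 * r)\<close>; multiplying by \<open>2 * ta\<close> and integrating produces the
  factors \<open>4 / 3\<close>, \<open>1 / 30\<close> and \<open>1 / 14\<close>.\<close>

lemma double_integral_circle_cap_kernel:
 assumes r: "r > 0"
 obtains t0 where "t0 > 0" "!!t. 0 < t ==> t <= t0 ==> double_integral 1 (sphere (0 :: real^2) r) (\<lambda>s. ennreal (cap_kernel t s)) <=
   ennreal (2 * pi * r * (4 / 3 * t ^ 3 + t ^ 5 / (30 * r\<^sup>2) + 1 / (14 * r ^ 4) * t ^ 7))"
proof -
 define Y where "Y = sphere (0 :: real^2) r"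
 note sf = sphere_facts[OF r, where 'd = 2, folded Y_def, simplified, folded One_nat_def]
 note c = sf(1,2)
 let ?mu = "ivol 1 Y" and ?L = "2 * pi * r"
 interpret finite_measure ?mu by (rule finite_ivol[OF c])
 have L: "measure ?mu Y = ?L"
  unfolding Y_def by (rule measure_circle[OF r])
 obtain t0 where t0: "0 < t0" "t0 <= r" "!!x t. x \<in> Y ==> 0 < t ==> t <= t0 ==>
  emeasure ?mu (Y Int cball x t) <= ennreal (4 * r * arcsin (t / (2 * r)))"
  by (rule emeasure_circle_cball[OF r, folded Y_def]) (rule that)
 define q where "q ta = 2 * ta + ta ^ 3 / (12 * r\<^sup>2) + ta ^ 5 / (4 * r ^ 4)" for ta
 have dd: "distance_distribution 1 Y ta <= ennreal (?L * q ta)" if ta: "0 < ta" "ta <= t0" for ta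
 proof -
  have "arcsin (ta / (2 * r)) <= ta / (2 * r) + (ta / (2 * r)) ^ 3 / 6 + 2 * (ta / (2 * r)) ^ 5"
   by (rule arcsin_le) (use ta t0(2) r in \<open>auto simp: field_simps\<close>)
  then have "4 * r * arcsin (ta / (2 * r)) <= 4 * r * (ta / (2 * r) + (ta / (2 * r)) ^ 3 / 6 + 2 * (ta / (2 * r)) ^ 5)"
   using r by (intro mult_left_mono) auto
  also have "... = q ta"
   using r by (simp add: q_def power_divide power_mult_distrib field_simps eval_nat_numeral One_nat_def)
  finally have "ennreal (4 * r * arcsin (ta / (2 * r))) <= ennreal (q ta)" by (rule ennreal_leI)
  then have "distance_distribution 1 Y ta <= (\<integral>\<^sup>+x. ennreal (q ta) \<partial>?mu)"
   unfolding distance_distribution_eq_nn_integral[OF c]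
   using t0(3)[OF _ ta] by (intro nn_integral_mono) (auto simp: space_ivol[OF c] intro: order_trans)
  also have "... = ennreal (?L * q ta)"
  proof -
   have "0 <= q ta" using ta by (simp add: q_def)
   then show ?thesis using r by (simp add: space_ivol[OF c] emeasure_eq_measure L ennreal_mult[symmetric] mult_ac)
  qed
  finally show ?thesis .
 qed
 show thesis
 proof (rule that[OF t0(1), folded Y_def])
  fix t assume t: "0 < t" "t <= t0"
  define Q where "Q ta = ?L * (4 / 3 * ta ^ 3 + ta ^ 5 / (30 * r\<^sup>2) + 1 / (14 * r ^ 4) * ta ^ 7)" for ta
  have "double_integral 1 Y (\<lambda>s. ennreal (cap_kernel t s)) = (\<integral>\<^sup>+ta\<in>{0..t}. ennreal (2 * ta) * distance_distribution 1 Y ta \<partial>lborel)"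
   by (rule double_integral_cap_kernel[OF c]) (use t in simp)
  also have "... <= (\<integral>\<^sup>+ta\<in>{0..t}. ennreal (2 * ta * (?L * q ta)) \<partial>lborel)"
  proof (intro nn_integral_mono)
   fix ta :: real
   show "ennreal (2 * ta) * distance_distribution 1 Y ta * indicator {0..t} ta <= ennreal (2 * ta * (?L * q ta)) * indicator {0..t} ta"
   proof (cases "0 < ta \<and> ta <= t")
    case True
    then have "ennreal (2 * ta) * distance_distribution 1 Y ta <= ennreal (2 * ta) * ennreal (?L * q ta)"
     using t by (intro mult_left_mono dd) auto
    also have "... = ennreal (2 * ta * (?L * q ta))" using True r by (intro ennreal_mult[symmetric]) (auto simp: q_def)
    finally show ?thesis using True by simp
   next
    case False
    then have "ta <= 0 \<or> t < ta" by auto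
    then show ?thesis by (auto simp: ennreal_neg split: split_indicator)
   qed
  qed
  also have "... = ennreal (Q t - Q 0)"
  proof (rule nn_integral_FTC_Icc)
   fix x :: real assume x: "x \<in> {0..t}"
   show "(Q has_real_derivative 2 * x * (?L * q x)) (at x)"
    unfolding Q_def q_def using r by (auto intro!: derivative_eq_intros simp: field_simps eval_nat_numeral One_nat_def)
   show "0 <= 2 * x * (?L * q x)" using r x by (simp add: q_def)
  qed (use t in \<open>auto simp: q_def[abs_def]\<close>)
  finally show "double_integral 1 Y (\<lambda>s. ennreal (cap_kernel t s)) <= ennreal (?L * (4 / 3 * t ^ 3 + t ^ 5 / (30 * r\<^sup>2) + 1 / (14 * r ^ 4) * t ^ 7))"
   by (simp add: Q_def)
 qed
qed

text \<open>A body would have to be one-dimensional, and its inertia would be too small for its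
  volume. A closed submanifold is a curve, and the explicit bound for the circle is the one that
  \<open>curvature_eq\<close> asks for, with the centroid as \<open>c\<close>.\<close>

theorem body_or_closed_submanifold_eq_circle:
 fixes X :: "(real^'d) set"
 assumes X: "body_or_closed_submanifold k m X" "2 <= k" and r: "r > 0"
  and eq: "!!t. 0 <= t ==> distance_distribution m X t = distance_distribution 1 (sphere (0 :: real^2) r) t"
 shows "congruent_copy X (sphere (0 :: real^2) r)"
proof -
 have k: "1 <= k" using X(2) by simp
 note X' = charted_body_or_closed_submanifold[OF X(1) k]
 let ?Y = "sphere (0 :: real^2) r"
 have card2: "2 <= CARD(2)" "CARD(2) - 1 = 1" by (simp_all add: One_nat_def)
 note cf = sphere_facts[where 'd = 2, OF r card2(1), unfolded card2(2)]
 have eqk: "double_integral m X k = double_integral 1 ?Y k" if "k \<in> borel_measurable borel" for k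
  by (rule double_integral_eqI[OF X' cf(1,2) eq that])
 note vi = volume_inertia_eq[OF X' cf(1,2) eqk]
 have L: "measure (ivol m X) X = 2 * pi * r"
  using vi(1) measure_circle[OF r] by simp
 have I: "inertia (ivol m X) <= r\<^sup>2 * (2 * pi * r)" using vi L cf(3,5) r by simp
 have V: "measure (ivol m X) X > 0" using L r by simp
 have ne: "X \<noteq> {}" using V by auto
 from X(1) consider "m = CARD('d)" "compact_body k X" | "m < CARD('d)" "compact X" "submanifold k m X"
  by (auto simp: body_or_closed_submanifold_def closed_submanifold_def)
 then show ?thesis
 proof cases
  case 1
  obtain W where W: "open W" "X = closure W" using 1(2) by (auto simp: compact_body_def)
  have "power_order CARD('d) (distance_distribution CARD('d) X)"
   using power_order_body[OF _ _ W ne] X' 1(1) by simp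
  then have d1: "CARD('d) = 1"
   by (rule power_order_unique[OF _ cf(6)]) (use eq 1(1) in simp)
  \<comment> \<open>With radius \<open>2 * r\<close> the inertia bound becomes
    \<open>8 * pi - 16 <= 2 * pi\<close>, which contradicts \<open>pi > 3\<close>.\<close>
  have "(measure (ivol CARD('d) X) X - measure lborel (cball (0 :: real^'d) (2 * r))) * (2 * r)\<^sup>2 <= inertia (ivol CARD('d) X)"
   by (rule inertia_body_ge) (use X' 1(1) r in auto)
  moreover have "measure lborel (cball (0 :: real^'d) (2 * r)) = 4 * r"
   using content_cball[of "2 * r" "0 :: real^'d"] r by (simp add: d1 unit_ball_vol_1)
  ultimately have "(2 * pi * r - 4 * r) * (2 * r)\<^sup>2 <= inertia (ivol m X)" using L unfolding 1(1) by simp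
  also note I
  finally have "(2 * pi * r - 4 * r) * (2 * r)\<^sup>2 <= r\<^sup>2 * (2 * pi * r)" .
  then have "r ^ 3 * (8 * pi - 16) <= r ^ 3 * (2 * pi)" by (simp add: algebra_simps eval_nat_numeral One_nat_def)
  then have "8 * pi - 16 <= 2 * pi" using r by simp
  then show ?thesis using pi_gt3 by linarith
 next
  case 2
  have X2: "submanifold 2 m X" by (rule submanifold_mono[OF 2(3) X(2)])
  have m: "m = 1"
   by (rule power_order_unique[OF power_order_submanifold[OF 2(2) X2 V] cf(6)]) (use eq in auto)
  let ?mu = "ivol 1 X"
  let ?c = "centroid ?mu"
  obtain t0 where t0: "t0 > 0" "!!t. 0 < t ==> t <= t0 ==> double_integral 1 ?Y (\<lambda>s. ennreal (cap_kernel t s)) <=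
   ennreal (2 * pi * r * (4 / 3 * t ^ 3 + t ^ 5 / (30 * r\<^sup>2) + 1 / (14 * r ^ 4) * t ^ 7))"
   by (rule double_integral_circle_cap_kernel[OF r]) (rule that)
  have ode: "ga2 s = - (1 / r\<^sup>2) *\<^sub>R (ga s - ?c)" if "unit_arc X ga ga1 ga2 e" "\<bar>s\<bar> < e" for ga ga1 ga2 e s
  proof (rule curvature_eq[OF 2(2) _ r t0(1) _ _ that])
   show "submanifold 2 1 X" using X2 m by simp
   show "(\<integral>x. (dist x ?c)\<^sup>2 \<partial>?mu) <= r\<^sup>2 * measure ?mu X" using I L m by (simp add: inertia_def)
   fix t assume t: "0 < t" "t <= t0"
   have "double_integral 1 X (\<lambda>s. ennreal (cap_kernel t s)) = double_integral 1 ?Y (\<lambda>s. ennreal (cap_kernel t s))"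
    using eqk[of "\<lambda>s. ennreal (cap_kernel t s)"] m by simp
   also have "... <= ennreal (measure ?mu X * (4 / 3 * t ^ 3 + t ^ 5 / (30 * r\<^sup>2) + 1 / (14 * r ^ 4) * t ^ 7))"
    using t0(2)[OF t] L m by simp
   finally show "double_integral 1 X (\<lambda>s. ennreal (cap_kernel t s)) <= ennreal (measure ?mu X * (4 / 3 * t ^ 3 + t ^ 5 / (30 * r\<^sup>2) + 1 / (14 * r ^ 4) * t ^ 7))" .
  qed
  obtain u v where uv: "u \<bullet> u = r\<^sup>2" "v \<bullet> v = r\<^sup>2" "u \<bullet> v = 0" "X = range (circle_point ?c u v)"
  proof (rule circle_of_unit_arcs[where c = ?c, OF 2(2) _ r ne])
   show "submanifold 2 1 X" using X2 m by simp
   show "measure ?mu X <= 2 * pi * r" using L m by simp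
  qed (erule (1) ode, rule that)
  show ?thesis by (subst uv(4)) (rule congruent_copy_circle[OF uv(1-3) r])
 qed
qed

subsection \<open>Moments on the 2-sphere\<close>

text \<open>With \<open>u = x - c\<close> and \<open>w = y - c\<close> the fourth power is the
  square of \<open>(norm u)\<^sup>2 + (norm w)\<^sup>2 - 2 * (u \<bullet> w)\<close>. Terms linear
  in \<open>u\<close> or in \<open>w\<close> vanish since \<open>c\<close> is the centroid, and the
  squared inner product integrates to the sum of the squared entries of the matrix of second
  moments.\<close>

lemma fourth_moment:
 fixes mu :: "'a::euclidean_space measure"
 assumes fin: "finite_measure mu" and bd: "bounded (space mu)" and m: "(\<lambda>x. x) \<in> measurable mu borel"
  and pos: "measure mu (space mu) > 0"
 defines "c \<equiv> centroid mu"
 shows "(\<integral>\<^sup>+x. \<integral>\<^sup>+y. ennreal (dist x y ^ 4) \<partial>mu \<partial>mu) =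
  ennreal (2 * measure mu (space mu) * (\<integral>x. dist x c ^ 4 \<partial>mu) + 2 * (inertia mu)\<^sup>2
   + 4 * (\<Sum>i\<in>Basis. \<Sum>j\<in>Basis. (\<integral>x. ((x - c) \<bullet> i) * ((x - c) \<bullet> j) \<partial>mu)\<^sup>2))"
proof -
 interpret finite_measure mu by fact
 let ?V = "measure mu (space mu)"
 note int = integrable_bounded_continuous[OF fin bd m]
 define I4 where "I4 = (\<integral>x. dist x c ^ 4 \<partial>mu)"
 define M where "M i j = (\<integral>x. ((x - c) \<bullet> i) * ((x - c) \<bullet> j) \<partial>mu)" for i j
 \<comment> \<open>The cubic moment occurs only paired with \<open>x - c\<close>, so the outer
   integral removes it.\<close>
 define w3 where "w3 = (\<integral>y. (norm (y - c))\<^sup>2 *\<^sub>R (y - c) \<partial>mu)"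
 have ii: "integrable mu (\<lambda>x. x)" by (rule int) (intro continuous_intros)
 have "(\<integral>y. y - c \<partial>mu) = (\<integral>y. y \<partial>mu) - ?V *\<^sub>R c" by (simp add: ii)
 also have "... = 0" using pos by (simp add: centroid_def c_def)
 finally have zero: "(\<integral>y. y - c \<partial>mu) = 0" .
 have I2: "inertia mu = (\<integral>y. (norm (y - c))\<^sup>2 \<partial>mu)" by (simp add: inertia_def c_def dist_norm)
 define G where "G u = ?V * norm u ^ 4 + I4 + 2 * (norm u)\<^sup>2 * inertia mu + 4 * (\<Sum>i\<in>Basis. \<Sum>j\<in>Basis. (u \<bullet> i) * (u \<bullet> j) * M i j) - 4 * (u \<bullet> w3)" for u
 have inner: "(\<integral>y. dist x y ^ 4 \<partial>mu) = G (x - c)" for x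
 proof -
  let ?u = "x - c"
  have quad: "(a \<bullet> b)\<^sup>2 = (\<Sum>i\<in>Basis. \<Sum>j\<in>Basis. (a \<bullet> i) * (a \<bullet> j) * ((b \<bullet> i) * (b \<bullet> j)))" for a b :: 'a
   by (subst euclidean_inner) (simp add: power2_eq_square sum_product mult_ac)
  have "dist x y ^ 4 = norm ?u ^ 4 + dist y c ^ 4 + 2 * (norm ?u)\<^sup>2 * (norm (y - c))\<^sup>2
    + 4 * (\<Sum>i\<in>Basis. \<Sum>j\<in>Basis. (?u \<bullet> i) * (?u \<bullet> j) * (((y - c) \<bullet> i) * ((y - c) \<bullet> j)))
    - 4 * (norm ?u)\<^sup>2 * (?u \<bullet> (y - c)) - 4 * (?u \<bullet> ((norm (y - c))\<^sup>2 *\<^sub>R (y - c)))" for y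
  proof -
   let ?w = "y - c"
   have "(dist x y)\<^sup>2 = (norm (?u - ?w))\<^sup>2" by (simp add: dist_norm)
   also have "... = (norm ?u)\<^sup>2 + (norm ?w)\<^sup>2 - 2 * (?u \<bullet> ?w)"
    unfolding power2_norm_eq_inner by (simp only: inner_diff_left[of ?u ?w] inner_diff_right[of _ ?u ?w] inner_commute[of ?w ?u])
   finally have e: "(dist x y)\<^sup>2 = (norm ?u)\<^sup>2 + (norm ?w)\<^sup>2 - 2 * (?u \<bullet> ?w)" .
   have f: "dist x y ^ 4 = ((dist x y)\<^sup>2)\<^sup>2" "norm ?u ^ 4 = ((norm ?u)\<^sup>2)\<^sup>2" "dist y c ^ 4 = ((norm ?w)\<^sup>2)\<^sup>2"
    by (simp_all add: dist_norm flip: power_mult)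
   have g: "(p + q - 2 * k)\<^sup>2 = p\<^sup>2 + q\<^sup>2 + 2 * p * q + 4 * k\<^sup>2 - 4 * p * k - 4 * (q * k)" for p q k :: real
    by (simp add: power2_eq_square algebra_simps)
   show ?thesis unfolding f e g by (simp only: quad inner_scaleR_right)
  qed
  then have "(\<integral>y. dist x y ^ 4 \<partial>mu) = (\<integral>y. norm ?u ^ 4 + dist y c ^ 4 + 2 * (norm ?u)\<^sup>2 * (norm (y - c))\<^sup>2
    + 4 * (\<Sum>i\<in>Basis. \<Sum>j\<in>Basis. (?u \<bullet> i) * (?u \<bullet> j) * (((y - c) \<bullet> i) * ((y - c) \<bullet> j)))
    - 4 * (norm ?u)\<^sup>2 * (?u \<bullet> (y - c)) - 4 * (?u \<bullet> ((norm (y - c))\<^sup>2 *\<^sub>R (y - c))) \<partial>mu)" by (simp only:)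
  moreover have i1: "integrable mu (\<lambda>y. dist y c ^ 4)" "integrable mu (\<lambda>y. (norm (y - c))\<^sup>2)"
   "integrable mu (\<lambda>y. ((y - c) \<bullet> i) * ((y - c) \<bullet> j))" "integrable mu (\<lambda>y. y - c)"
   "integrable mu (\<lambda>y. (norm (y - c))\<^sup>2 *\<^sub>R (y - c))" "integrable mu (\<lambda>y. ?u \<bullet> (y - c))"
   "integrable mu (\<lambda>y. ?u \<bullet> ((norm (y - c))\<^sup>2 *\<^sub>R (y - c)))" for i j
   by (rule int; intro continuous_intros)+
  moreover have "(\<integral>y. ?u \<bullet> (y - c) \<partial>mu) = ?u \<bullet> (\<integral>y. y - c \<partial>mu)" by (rule integral_inner_right) (rule i1)
  moreover have "(\<integral>y. ?u \<bullet> ((norm (y - c))\<^sup>2 *\<^sub>R (y - c)) \<partial>mu) = ?u \<bullet> w3" unfolding w3_def by (rule integral_inner_right) (rule i1)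
  ultimately show ?thesis
   by (simp add: G_def I4_def I2 M_def zero mult.commute del: inner_diff_left inner_diff_right)
 qed
 have contG: "continuous_on UNIV (\<lambda>x. G (x - c))" unfolding G_def by (intro continuous_intros)
 have Gint: "integrable mu (\<lambda>x. G (x - c))" by (rule int[OF contG])
 have G0: "0 <= G (x - c)" for x unfolding inner[symmetric] by (rule Bochner_Integration.integral_nonneg) simp
 have "(\<integral>\<^sup>+y. ennreal (dist x y ^ 4) \<partial>mu) = ennreal (G (x - c))" for x
  unfolding inner[symmetric] by (rule nn_integral_eq_integral) (auto intro!: int continuous_intros)
 then have "(\<integral>\<^sup>+x. \<integral>\<^sup>+y. ennreal (dist x y ^ 4) \<partial>mu \<partial>mu) = ennreal (\<integral>x. G (x - c) \<partial>mu)"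
  using nn_integral_eq_integral[OF Gint] G0 by simp
 also have "(\<integral>x. G (x - c) \<partial>mu) = ?V * I4 + ?V * I4 + 2 * inertia mu * inertia mu + 4 * (\<Sum>i\<in>Basis. \<Sum>j\<in>Basis. M i j * M i j)"
 proof -
  have i1: "integrable mu (\<lambda>y. norm (y - c) ^ 4)" "integrable mu (\<lambda>y. (norm (y - c))\<^sup>2)"
   "integrable mu (\<lambda>y. ((y - c) \<bullet> i) * ((y - c) \<bullet> j))" "integrable mu (\<lambda>y. y - c)" "integrable mu (\<lambda>y. (y - c) \<bullet> w3)" for i j
   by (rule int; intro continuous_intros)+
  moreover have "(\<integral>y. (y - c) \<bullet> w3 \<partial>mu) = (\<integral>y. y - c \<partial>mu) \<bullet> w3" by (rule integral_inner_left) (rule i1)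
  moreover have "(\<integral>y. norm (y - c) ^ 4 \<partial>mu) = I4" by (simp add: I4_def dist_norm)
  ultimately show ?thesis unfolding G_def
   by (simp add: I2[symmetric] M_def[symmetric] zero mult_ac del: inner_diff_left inner_diff_right)
 qed
 finally show ?thesis by (simp add: I4_def M_def power2_eq_square mult.assoc)
qed

text \<open>Dropping the off-diagonal entries leaves the Cauchy--Schwarz inequality for the
  trace.\<close>

lemma sum_squares_ge_trace:
 fixes M :: "'i => 'i => real"
 assumes "finite B" "0 < card B"
 shows "(\<Sum>i\<in>B. M i i)\<^sup>2 / card B <= (\<Sum>i\<in>B. \<Sum>j\<in>B. (M i j)\<^sup>2)"
proof -
 have "(\<Sum>i\<in>B. M i i)\<^sup>2 <= card B * (\<Sum>i\<in>B. (M i i)\<^sup>2)"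
  using Cauchy_Schwarz_ineq_sum[of "\<lambda>_. 1" "\<lambda>i. M i i" B] by simp
 also have "... <= card B * (\<Sum>i\<in>B. \<Sum>j\<in>B. (M i j)\<^sup>2)"
  using assms by (intro mult_left_mono sum_mono) (auto intro: member_le_sum)
 finally show ?thesis using assms by (simp add: pos_divide_le_eq mult.commute)
qed

text \<open>On the sphere \<open>dist x y ^ 4\<close> is the square of
  \<open>2 * r\<^sup>2 - 2 * (x \<bullet> y)\<close>. Its linear part integrates to 0, and its
  quadratic part adds one third of the constant \<open>4 * r ^ 4\<close>, which makes
  \<open>16 / 3\<close>.\<close>

lemma sphere_moments:
 fixes r :: real
 assumes r: "r > 0"
 defines "S \<equiv> sphere (0 :: real^3) r"
 defines "V \<equiv> measure (ivol 2 S) S"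
 shows "compact S" "charted 2 S" "0 < V" "inertia (ivol 2 S) = r\<^sup>2 * V"
  "power_order 2 (distance_distribution 2 S)"
  "double_integral 2 S (\<lambda>s. ennreal (s ^ 4)) <= ennreal (16 / 3 * r ^ 4 * V\<^sup>2)"
proof -
 note sf = sphere_facts[OF r, where 'd = 3, folded S_def, simplified]
 show S: "compact S" "charted 2 S" and V: "0 < V" and "inertia (ivol 2 S) = r\<^sup>2 * V"
  and "power_order 2 (distance_distribution 2 S)" using sf by (simp_all add: V_def)
 let ?mu = "ivol 2 S"
 interpret finite_measure ?mu by (rule finite_ivol[OF S])
 note sp = space_ivol[OF S]
 have bd: "bounded (space ?mu)" using compact_imp_bounded[OF S(1)] by (simp add: sp)
 have idm: "(\<lambda>x. x) \<in> borel_measurable ?mu" by (rule measurable_ivol[OF S]) simp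
 note int = integrable_bounded_continuous[OF finite_ivol[OF S] bd idm]
 have inv: "(\<integral>x. f (J x) \<partial>?mu) = (\<integral>x. f x \<partial>?mu)"
  if "orthogonal_transformation J" "f \<in> borel_measurable borel" for f :: "real^3 => 'b::euclidean_space" and J
  using integral_sphere_orthogonal[OF r that] by (simp add: S_def)
 have nS: "norm x = r" if "x \<in> space ?mu" for x using that unfolding sp by (simp add: S_def)
 have cong: "(\<integral>x. f x \<partial>?mu) = (\<integral>x. g x \<partial>?mu)" if "!!x. norm x = r ==> f x = g x" for f g :: "real^3 => real"
  by (rule Bochner_Integration.integral_cong) (use that nS in auto)
 \<comment> \<open>By rotation invariance the integral depends only on \<open>norm a\<close>;
   summing over an orthonormal basis gives one third of the trace.\<close>
 have quad: "(\<integral>x. (x \<bullet> a)\<^sup>2 \<partial>?mu) = (norm a)\<^sup>2 * (r\<^sup>2 * V / 3)" for a :: "real^3"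
 proof -
  have same: "(\<integral>x. (x \<bullet> a)\<^sup>2 \<partial>?mu) = (\<integral>x. (x \<bullet> a')\<^sup>2 \<partial>?mu)" if n: "norm a = norm a'" for a a' :: "real^3"
  proof -
   obtain J where J: "orthogonal_transformation J" "J a = a'" using orthogonal_transformation_exists[OF n] by metis
   have "(\<lambda>x. (x \<bullet> a')\<^sup>2) \<in> borel_measurable borel" by measurable
   from inv[OF J(1) this] show ?thesis unfolding J(2)[symmetric] using J(1) by (simp add: orthogonal_transformation_def)
  qed
  have "(\<integral>x. (x \<bullet> (norm a *\<^sub>R i))\<^sup>2 \<partial>?mu) = (\<integral>x. (x \<bullet> a)\<^sup>2 \<partial>?mu)" if "i \<in> Basis" for i :: "real^3"
   by (rule same) (use that in simp)
  then have "(\<Sum>i\<in>(Basis :: (real^3) set). \<integral>x. (x \<bullet> (norm a *\<^sub>R i))\<^sup>2 \<partial>?mu) = 3 * (\<integral>x. (x \<bullet> a)\<^sup>2 \<partial>?mu)" by simp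
  moreover have "(\<Sum>i\<in>(Basis :: (real^3) set). \<integral>x. (x \<bullet> (norm a *\<^sub>R i))\<^sup>2 \<partial>?mu) = (\<integral>x. (\<Sum>i\<in>Basis. (x \<bullet> (norm a *\<^sub>R i))\<^sup>2) \<partial>?mu)"
   by (rule Bochner_Integration.integral_sum[symmetric]) (rule int, intro continuous_intros)
  moreover have "(\<integral>x. (\<Sum>i\<in>Basis. (x \<bullet> (norm a *\<^sub>R i))\<^sup>2) \<partial>?mu) = (\<integral>x. (norm a)\<^sup>2 * r\<^sup>2 \<partial>?mu)"
  proof (rule cong)
   fix x :: "real^3" assume x: "norm x = r"
   have "(\<Sum>i\<in>Basis. (x \<bullet> (norm a *\<^sub>R i))\<^sup>2) = (norm a)\<^sup>2 * (x \<bullet> x)"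
    by (subst (2) euclidean_inner) (simp add: sum_distrib_left power2_eq_square mult_ac)
   then show "(\<Sum>i\<in>Basis. (x \<bullet> (norm a *\<^sub>R i))\<^sup>2) = (norm a)\<^sup>2 * r\<^sup>2" using x by (simp add: power2_norm_eq_inner[symmetric])
  qed
  ultimately show ?thesis by (simp add: sp V_def mult_ac)
 qed
 have "(\<integral>\<^sup>+y. ennreal (dist x y ^ 4) \<partial>?mu) = ennreal (16 / 3 * r ^ 4 * V)" if x: "norm x = r" for x
 proof -
  have "(\<integral>\<^sup>+y. ennreal (dist x y ^ 4) \<partial>?mu) = ennreal (\<integral>y. dist x y ^ 4 \<partial>?mu)"
   by (rule nn_integral_eq_integral) (auto intro!: int continuous_intros)
  also have "(\<integral>y. dist x y ^ 4 \<partial>?mu) = (\<integral>y. 4 * r ^ 4 - 8 * r\<^sup>2 * (x \<bullet> y) + 4 * (y \<bullet> x)\<^sup>2 \<partial>?mu)"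
  proof (rule cong)
   fix y :: "real^3" assume y: "norm y = r"
   have "(dist x y)\<^sup>2 = 2 * r\<^sup>2 - 2 * (x \<bullet> y)"
   proof -
    have "x \<bullet> x = r\<^sup>2" "y \<bullet> y = r\<^sup>2" using x y by (simp_all add: power2_norm_eq_inner[symmetric])
    then show ?thesis unfolding dist_norm power2_norm_eq_inner
     by (simp add: inner_diff_left inner_diff_right inner_commute)
   qed
   then have "((dist x y)\<^sup>2)\<^sup>2 = (2 * r\<^sup>2 - 2 * (x \<bullet> y))\<^sup>2" by simp
   then show "dist x y ^ 4 = 4 * r ^ 4 - 8 * r\<^sup>2 * (x \<bullet> y) + 4 * (y \<bullet> x)\<^sup>2"
    by (simp add: inner_commute[of y x] power2_eq_square power4_eq_xxxx algebra_simps)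
  qed
  also have "... = 4 * r ^ 4 * V - 8 * r\<^sup>2 * (x \<bullet> (\<integral>y. y \<partial>?mu)) + 4 * (r\<^sup>2 * (r\<^sup>2 * V / 3))"
  proof -
   have i: "integrable ?mu (\<lambda>y. y)" "integrable ?mu (\<lambda>y. x \<bullet> y)" "integrable ?mu (\<lambda>y. (y \<bullet> x)\<^sup>2)" by (rule int; intro continuous_intros)+
   then have "(\<integral>y. x \<bullet> y \<partial>?mu) = x \<bullet> (\<integral>y. y \<partial>?mu)" by (intro integral_inner_right)
   then show ?thesis using i(2,3) by (simp add: quad x sp V_def)
  qed
  also have "... = 16 / 3 * r ^ 4 * V"
   using sf(4) by (simp add: power2_eq_square power4_eq_xxxx)
  finally show ?thesis .
 qed
 then have "double_integral 2 S (\<lambda>s. ennreal (s ^ 4)) = (\<integral>\<^sup>+x. ennreal (16 / 3 * r ^ 4 * V) \<partial>?mu)"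
  unfolding double_integral_def using nS by (intro nn_integral_cong) simp
 also have "... = ennreal (16 / 3 * r ^ 4 * V\<^sup>2)"
  using V by (simp add: sp emeasure_eq_measure V_def[symmetric] ennreal_mult[symmetric] power2_eq_square mult_ac)
 finally show "double_integral 2 S (\<lambda>s. ennreal (s ^ 4)) <= ennreal (16 / 3 * r ^ 4 * V\<^sup>2)" by simp
qed

text \<open>In dimension at most three the second and fourth moments of the distance force \<open>\<bar>x - c\<bar>\<close> to be
 constant, by the Cauchy--Schwarz inequality for \<open>\<bar>x - c\<bar>\<^sup>2\<close> and for the eigenvalues of the inertia matrix.\<close>

lemma AE_in_sphere:
 fixes mu :: "(real^'d) measure"
 assumes fin: "finite_measure mu" and bd: "bounded (space mu)" and m: "(\<lambda>x. x) \<in> measurable mu borel"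
  and pos: "measure mu (space mu) > 0" and d: "CARD('d) <= 3" and r: "r > 0"
  and I2: "inertia mu = r\<^sup>2 * measure mu (space mu)"
  and D4: "(\<integral>\<^sup>+x. \<integral>\<^sup>+y. ennreal (dist x y ^ 4) \<partial>mu \<partial>mu) <= ennreal (16 / 3 * r ^ 4 * (measure mu (space mu))\<^sup>2)"
 shows "AE x in mu. dist x (centroid mu) = r"
proof -
 interpret finite_measure mu by fact
 let ?V = "measure mu (space mu)" and ?c = "centroid mu"
 note int = integrable_bounded_continuous[OF fin bd m]
 define I4 where "I4 = (\<integral>x. dist x ?c ^ 4 \<partial>mu)"
 define M where "M i j = (\<integral>x. ((x - ?c) \<bullet> i) * ((x - ?c) \<bullet> j) \<partial>mu)" for i j :: "real^'d"
 have "(\<Sum>i\<in>(Basis :: (real^'d) set). M i i) = (\<integral>x. (\<Sum>i\<in>Basis. ((x - ?c) \<bullet> i) * ((x - ?c) \<bullet> i)) \<partial>mu)"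
  unfolding M_def by (rule Bochner_Integration.integral_sum[symmetric]) (rule int, intro continuous_intros)
 also have "... = inertia mu" by (simp add: inertia_def dist_norm power2_norm_eq_inner flip: euclidean_inner)
 finally have "(inertia mu)\<^sup>2 / CARD('d) <= (\<Sum>i\<in>Basis. \<Sum>j\<in>Basis. (M i j)\<^sup>2)"
  using sum_squares_ge_trace[of "Basis :: (real^'d) set" M] by simp
 \<comment> \<open>The dimension enters here: with at most three coordinates the trace bound is at
   least the value attained by the 2-sphere.\<close>
 moreover have "(inertia mu)\<^sup>2 / 3 <= (inertia mu)\<^sup>2 / CARD('d)" using d by (intro divide_left_mono) auto
 ultimately have tr: "(inertia mu)\<^sup>2 / 3 <= (\<Sum>i\<in>Basis. \<Sum>j\<in>Basis. (M i j)\<^sup>2)" by linarith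
 have I4: "0 <= I4" by (simp add: I4_def)
 have "ennreal (2 * ?V * I4 + 2 * (inertia mu)\<^sup>2 + 4 * (\<Sum>i\<in>Basis. \<Sum>j\<in>Basis. (M i j)\<^sup>2)) <= ennreal (16 / 3 * r ^ 4 * ?V\<^sup>2)"
  using D4 unfolding fourth_moment[OF fin bd m pos] I4_def M_def .
 then have "2 * ?V * I4 + 2 * (inertia mu)\<^sup>2 + 4 * (\<Sum>i\<in>Basis. \<Sum>j\<in>Basis. (M i j)\<^sup>2) <= 16 / 3 * r ^ 4 * ?V\<^sup>2"
  by (subst (asm) ennreal_le_iff) auto
 moreover have "(inertia mu)\<^sup>2 = r ^ 4 * ?V\<^sup>2" unfolding I2 by (simp add: power_mult_distrib flip: power_mult)
 \<comment> \<open>Subtracting the shares 2 and \<open>4 / 3\<close> from \<open>16 / 3\<close>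
   leaves 2, the factor of \<open>?V * I4\<close>.\<close>
 ultimately have "?V * I4 <= ?V * (r ^ 4 * ?V)" using tr by (simp add: power2_eq_square mult_ac)
 then have le: "I4 <= r ^ 4 * ?V" using pos by simp
 have i: "integrable mu (\<lambda>x. dist x ?c ^ 4)" "integrable mu (\<lambda>x. (dist x ?c)\<^sup>2)" "integrable mu (\<lambda>x. ((dist x ?c)\<^sup>2 - r\<^sup>2)\<^sup>2)"
  by (rule int; intro continuous_intros)+
 \<comment> \<open>The mean square deviation of the squared distance from \<open>r\<^sup>2\<close>;
   the bound on \<open>I4\<close> and the value of the inertia make it nonpositive.\<close>
 have "(\<integral>x. ((dist x ?c)\<^sup>2 - r\<^sup>2)\<^sup>2 \<partial>mu) = (\<integral>x. dist x ?c ^ 4 - 2 * r\<^sup>2 * (dist x ?c)\<^sup>2 + r ^ 4 \<partial>mu)"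
  by (intro Bochner_Integration.integral_cong refl) (simp add: power2_eq_square power4_eq_xxxx algebra_simps)
 also have "... = I4 - 2 * r\<^sup>2 * inertia mu + r ^ 4 * ?V" using i by (simp add: I4_def inertia_def mult.commute)
 also have "... <= 0" using le unfolding I2 by (simp add: power2_eq_square power4_eq_xxxx)
 finally have "(\<integral>x. ((dist x ?c)\<^sup>2 - r\<^sup>2)\<^sup>2 \<partial>mu) = 0" by (intro antisym Bochner_Integration.integral_nonneg) auto
 then have "AE x in mu. ((dist x ?c)\<^sup>2 - r\<^sup>2)\<^sup>2 = 0" using integral_nonneg_eq_0_iff_AE[OF i(3)] by simp
 then show ?thesis by (rule AE_mp) (use r in \<open>auto simp: power2_eq_iff_nonneg\<close>)
qed

text \<open>\<open>X\<close> is closed in the sphere by compactness. In charts the inclusion is a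
  continuous injection from an open part of one coordinate subspace into another of the same
  dimension, so invariance of domain makes \<open>X\<close> open in the sphere, which is
  connected.\<close>

lemma closed_submanifold_in_sphere:
 fixes X :: "(real^'d) set"
 assumes X: "compact X" "submanifold 1 m X" "X \<noteq> {}" and m: "m = CARD('d) - 1" "2 <= CARD('d)" and r: "r > 0"
  and sub: "X \<subseteq> sphere c r"
 shows "X = sphere c r"
proof -
 let ?S = "sphere c r"
 have "openin (top_of_set ?S) X"
 proof (subst openin_subopen, intro ballI)
  fix p assume p: "p \<in> X"
  from X(2)[unfolded submanifold_def, rule_format, OF p]
  obtain B U V Ph Ps where B: "B \<subseteq> Basis" "card B = m" and pU: "p \<in> U" and ch: "adapted_chart 1 X (span B) U V Ph Ps"
   by (elim exE conjE) (rule that)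
  have pS: "p \<in> ?S" using p sub by blast
  have "submanifold 2 m ?S" using submanifold_sphere[OF r, of c] m by simp
  from this[unfolded submanifold_def, rule_format, OF pS]
  obtain B' U' V' Ph' Ps' where B': "B' \<subseteq> Basis" "card B' = m" and pU': "p \<in> U'" and ch': "adapted_chart 2 ?S (span B') U' V' Ph' Ps'"
   by (elim exE conjE) (rule that)
  have c1: "C1chart m X B (span B) U V Ph Ps" using B ch by (simp add: C1chart_def)
  have c2: "C1chart m ?S B' (span B') U' V' Ph' Ps'" using B' adapted_chart_mono[OF ch', of 1] by (simp add: C1chart_def)
  define A where "A = {h \<in> V Int span B. Ps h \<in> U'}"
  have "open (V Int Ps -` U')"
   using continuous_on_open_vimage[OF chart_open(2)[OF c1]] chart_continuous(2)[OF c1] chart_open(1)[OF c2] by (metis Int_commute)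
  then have "openin (top_of_set (span B)) (span B Int (V Int Ps -` U'))" by (rule openin_open_Int)
  moreover have "span B Int (V Int Ps -` U') = A" by (auto simp: A_def)
  ultimately have Ao: "openin (top_of_set (span B)) A" by simp
  have AX: "Ps h \<in> X" if "h \<in> A" for h using chart_H_iff(2)[OF c1, of h] that by (auto simp: A_def)
  have im: "Ph' (Ps h) \<in> span B'" if h: "h \<in> A" for h
   using chart_H_iff(1)[OF c2, of "Ps h"] AX[OF h] sub h by (auto simp: A_def)
  have "openin (top_of_set (span B')) ((\<lambda>h. Ph' (Ps h)) ` A)"
  proof (rule invariance_of_domain_subspaces[OF Ao subspace_span subspace_span])
   show "dim (span B') <= dim (span B)"
    using dim_eq_card_independent[OF independent_mono[OF independent_Basis B(1)]]
     dim_eq_card_independent[OF independent_mono[OF independent_Basis B'(1)]] B(2) B'(2) by (simp only: dim_span)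
   have "continuous_on A Ps" by (rule continuous_on_subset[OF chart_continuous(2)[OF c1]]) (auto simp: A_def)
   then show "continuous_on A (\<lambda>h. Ph' (Ps h))"
    by (rule continuous_on_compose2[OF chart_continuous(1)[OF c2]]) (auto simp: A_def)
   show "(\<lambda>h. Ph' (Ps h)) \<in> A \<rightarrow> span B'" using im by blast
   show "inj_on (\<lambda>h. Ph' (Ps h)) A"
   proof (rule inj_onI)
    fix h h' assume h: "h \<in> A" "h' \<in> A" "Ph' (Ps h) = Ph' (Ps h')"
    then have U: "Ps h \<in> U'" "Ps h' \<in> U'" and V: "h \<in> V" "h' \<in> V" by (simp_all add: A_def)
    have "Ps h = Ps h'" using chart_inverse(1)[OF c2 U(1)] chart_inverse(1)[OF c2 U(2)] h(3) by (metis (no_types))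
    then show "h = h'" using chart_inverse(2)[OF c1 V(1)] chart_inverse(2)[OF c1 V(2)] by (metis (no_types))
   qed
  qed
  then obtain T where T: "open T" "(\<lambda>h. Ph' (Ps h)) ` A = span B' Int T" by (auto simp: openin_open)
  define N where "N = ?S Int (U' Int Ph' -` T)"
  have "open (U' Int Ph' -` T)"
   using continuous_on_open_vimage[OF chart_open(1)[OF c2]] chart_continuous(1)[OF c2] T(1) by (metis Int_commute)
  then have "openin (top_of_set ?S) N" unfolding N_def by (rule openin_open_Int)
  moreover have "N \<subseteq> X"
  proof
   fix y assume y: "y \<in> N"
   then have "Ph' y \<in> span B' Int T" using chart_H_iff(1)[OF c2, of y] by (auto simp: N_def)
   then obtain h where h: "h \<in> A" "Ph' y = Ph' (Ps h)" unfolding T(2)[symmetric] by blast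
   then have U: "y \<in> U'" "Ps h \<in> U'" using y by (simp_all add: N_def A_def)
   have "y = Ps h" using chart_inverse(1)[OF c2 U(1)] chart_inverse(1)[OF c2 U(2)] h(2) by (metis (no_types))
   then show "y \<in> X" using AX[OF h(1)] by simp
  qed
  moreover have "p \<in> N"
  proof -
   have "Ph p \<in> A" using chart_inverse(1,3)[OF c1 pU] chart_H_iff(1)[OF c1 pU] p pU' by (simp add: A_def)
   then have "Ph' (Ps (Ph p)) \<in> span B' Int T" unfolding T(2)[symmetric] by (rule imageI)
   then show ?thesis using pS pU' chart_inverse(1)[OF c1 pU] by (simp add: N_def)
  qed
  ultimately show "\<exists>T. openin (top_of_set ?S) T \<and> p \<in> T \<and> T \<subseteq> X" by blast
 qed
 moreover have "closedin (top_of_set ?S) X"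
  using closed_subset[OF sub compact_imp_closed[OF X(1)]] .
 moreover have "connected ?S" using m by (intro connected_sphere) simp
 ultimately show ?thesis using X(3) connected_clopen by blast
qed

lemma congruent_copy_sphere:
 fixes c :: "real^'d"
 assumes "CARD('n) = CARD('d)"
 shows "congruent_copy (sphere c r) (sphere (0 :: real^'n) r)"
proof -
 obtain be :: "real^'n => real^'d" where be: "bij_betw be Basis Basis"
  using finite_same_card_bij[of "Basis :: (real^'n) set" "Basis :: (real^'d) set"] assms by auto
 have b: "be i \<bullet> be j = (if i = j then 1 else 0)" if "i \<in> Basis" "j \<in> Basis" for i j
 proof -
  have "be i \<in> Basis" "be j \<in> Basis" "be i = be j \<longleftrightarrow> i = j"
   using that bij_betwE[OF be] inj_on_eq_iff[OF bij_betw_imp_inj_on[OF be]] by auto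
  then show ?thesis by (simp add: inner_Basis)
 qed
 have norm: "norm (basis_map be x) = norm x" for x using inner_basis_map[of be x x] b by (simp add: norm_eq_sqrt_inner)
 have lin: "linear (basis_map be)" by (rule linear_basis_map)
 have dist: "dist (c + basis_map be x) (c + basis_map be y) = dist x y" for x y
  by (simp add: dist_norm norm linear_diff[OF lin, symmetric])
 have "x \<in> (\<lambda>z. c + basis_map be z) ` sphere 0 r" if x: "x \<in> sphere c r" for x
 proof -
  define z where "z = (\<Sum>i\<in>Basis. ((x - c) \<bullet> be i) *\<^sub>R i)"
  have "basis_map be z = (\<Sum>i\<in>Basis. ((x - c) \<bullet> be i) *\<^sub>R be i)" unfolding basis_map_def z_def by simp
  also have "... = (\<Sum>i\<in>Basis. ((x - c) \<bullet> i) *\<^sub>R i)" by (rule sum.reindex_bij_betw[OF be])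
  also have "... = x - c" by (rule euclidean_representation)
  finally have z: "x = c + basis_map be z" by simp
  then have "norm z = r" using x norm[of z] by (simp add: dist_norm)
  then show ?thesis using z by auto
 qed
 then have "sphere c r = (\<lambda>z. c + basis_map be z) ` sphere 0 r" by (auto simp: dist_norm norm)
 then show ?thesis unfolding congruent_copy_def using dist by (intro exI[of _ "\<lambda>z. c + basis_map be z"]) simp
qed

text \<open>The order at 0 gives \<open>m = 2\<close>, so the codimension bound leaves the ambient
  dimensions 2 and 3, where the moments place \<open>X\<close> in a sphere up to a null set. A body
  in the plane would then be null itself.\<close>

theorem body_or_closed_submanifold_eq_sphere:
 fixes X :: "(real^'d) set"
 assumes X: "body_or_closed_submanifold k m X" "2 <= k" "CARD('d) - m <= 1" and r: "r > 0"
  and eq: "!!t. 0 <= t ==> distance_distribution m X t = distance_distribution 2 (sphere (0 :: real^3) r) t"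
 shows "CARD('d) = 3 \<and> congruent_copy X (sphere (0 :: real^3) r)"
proof -
 have k: "1 <= k" using X(2) by simp
 note X' = charted_body_or_closed_submanifold[OF X(1) k]
 let ?Y = "sphere (0 :: real^3) r" and ?mu = "ivol m X"
 note sm = sphere_moments[OF r]
 have eqk: "double_integral m X k = double_integral 2 ?Y k" if "k \<in> borel_measurable borel" for k
  by (rule double_integral_eqI[OF X' sm(1,2) eq that])
 note vi = volume_inertia_eq[OF X' sm(1,2) eqk]
 have V: "measure ?mu X > 0" using vi(1) sm(3) by simp
 have ne: "X \<noteq> {}" using V by auto
 have sp: "space ?mu = X" by (rule space_ivol[OF X'])
 have I: "inertia ?mu = r\<^sup>2 * measure ?mu X" using vi(2)[rotated, OF sm(3)] vi(1) sm(4) by simp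
 have "double_integral m X (\<lambda>s. ennreal (s ^ 4)) <= ennreal (16 / 3 * r ^ 4 * (measure ?mu X)\<^sup>2)"
  using eqk[of "\<lambda>s. ennreal (s ^ 4)"] sm(6) vi(1) by simp
 then have D4: "(\<integral>\<^sup>+x. \<integral>\<^sup>+y. ennreal (dist x y ^ 4) \<partial>?mu \<partial>?mu) <= ennreal (16 / 3 * r ^ 4 * (measure ?mu X)\<^sup>2)"
  by (simp add: double_integral_def)
 define c where "c = centroid ?mu"
 have AE: "AE x in ?mu. dist x c = r" if d: "CARD('d) <= 3"
  unfolding c_def using AE_in_sphere[OF finite_ivol[OF X'] _ measurable_ivol[OF X'] _ d r] compact_imp_bounded[OF X'(1)] V I D4
  by (simp add: sp)
 from X(1) consider "m = CARD('d)" "compact_body k X" | "m < CARD('d)" "compact X" "submanifold k m X"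
  by (auto simp: body_or_closed_submanifold_def closed_submanifold_def)
 then show ?thesis
 proof cases
  case 1
  obtain W where W: "open W" "X = closure W" using 1(2) by (auto simp: compact_body_def)
  have "power_order m (distance_distribution m X)"
   using power_order_body[OF _ _ W ne] X' 1(1) by simp
  then have "m = 2" by (rule power_order_unique[OF _ sm(5)]) (use eq in simp)
  then have AE': "AE x in ?mu. dist x c = r" using AE 1(1) by simp
  have full: "?mu = restrict_space lborel X" using induced_volume_full X' 1(1) by simp
  note Xb = borel_X[OF X']
  have "AE x in lborel. x \<in> X --> dist x c = r" using AE' Xb unfolding full by (simp add: AE_restrict_space_iff)
  moreover have "AE x in lborel. x \<notin> sphere c r"
  proof -
   have "sphere c r \<in> null_sets lborel"
    using negligible_sphere[of c r] by (simp add: negligible_iff_null_sets null_sets_completion_iff)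
   then show ?thesis by (rule AE_not_in)
  qed
  ultimately have "AE x in lborel. x \<notin> X" by eventually_elim (auto simp: dist_commute)
  then have "emeasure lborel X = 0" using Xb by (simp add: AE_iff_measurable[of X lborel])
  then have "measure ?mu X = 0" unfolding full using measure_restrict_lborel[OF Xb] by (simp add: measure_def)
  then show ?thesis using V by simp
 next
  case 2
  have X2: "submanifold 2 m X" by (rule submanifold_mono[OF 2(3) X(2)])
  have m: "m = 2"
   by (rule power_order_unique[OF power_order_submanifold[OF 2(2) X2 V] sm(5)]) (use eq in auto)
  then have d: "CARD('d) = 3" using 2(1) X(3) by simp
  have AE': "AE x in ?mu. dist x c = r" using AE d by simp
  \<comment> \<open>A point off the sphere would have a small ball disjoint from it, which has
    positive measure by full support.\<close>
  have "X \<subseteq> sphere c r"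
  proof (rule ccontr)
   assume "\<not> X \<subseteq> sphere c r"
   then obtain x where x: "x \<in> X" "x \<in> - sphere c r" by blast
   obtain e where e: "e > 0" "cball x e \<subseteq> - sphere c r"
    using x(2) open_Compl[OF closed_sphere[of c r]] unfolding open_contains_cball by blast
   have "emeasure ?mu (X Int cball x e) > 0" by (rule emeasure_ivol_ball_pos[OF 2(2) X2 x(1) e(1)])
   moreover have "emeasure ?mu (X Int cball x e) = 0"
   proof -
    have N: "X Int cball x e \<in> sets ?mu" using sets_ivol[OF X'] borel_X[OF X'] by auto
    have E: "{y \<in> space ?mu. \<not> y \<notin> X Int cball x e} = X Int cball x e" by (auto simp: sp)
    have "AE y in ?mu. y \<notin> X Int cball x e"
     using AE'
    proof (rule AE_mp, intro AE_I2 impI)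
     fix y assume y: "dist y c = r"
     show "y \<notin> X Int cball x e"
     proof
      assume "y \<in> X Int cball x e"
      then have "y \<in> cball x e" by auto
      then have "y \<in> - sphere c r" using e(2) by blast
      then show False using y by (simp add: dist_commute)
     qed
    qed
    with AE_iff_measurable[OF N E] show ?thesis by (rule iffD1)
   qed
   ultimately show False by simp
  qed
  then have "X = sphere c r"
   using closed_submanifold_in_sphere[OF 2(2) submanifold_mono[OF X2, of 1] ne _ _ r] m d by simp
  then show ?thesis using congruent_copy_sphere[of c r, where 'n = 3] d by simp
 qed
qed

theorem corollary3p5:
  fixes X :: "(real ^ 'd) set" and m :: nat and r :: real
  assumes "r > 0"
  shows
    "(compact_body 2 X \<and>
        (\<forall>t\<ge>0. distance_distribution CARD('d) X t
              = distance_distribution CARD('d) (cball (0 :: real ^ 'd) r) t)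
      \<longrightarrow> congruent_copy X (cball (0 :: real ^ 'd) r)) \<and>
     (body_or_closed_submanifold 3 m X \<and>
        (\<forall>t\<ge>0. distance_distribution m X t
              = distance_distribution CARD('n) (cball (0 :: real ^ 'n) r) t)
      \<longrightarrow> CARD('n) = CARD('d) \<and> congruent_copy X (cball (0 :: real ^ 'd) r)) \<and>
     (body_or_closed_submanifold 3 m X \<and>
        (\<forall>t\<ge>0. distance_distribution m X t
              = distance_distribution 1 (sphere (0 :: real ^ 2) r) t)
      \<longrightarrow> congruent_copy X (sphere (0 :: real ^ 2) r)) \<and>
     (body_or_closed_submanifold 4 m X \<and> CARD('d) - m \<le> 1 \<and>
        (\<forall>t\<ge>0. distance_distribution m X t
              = distance_distribution 2 (sphere (0 :: real ^ 3) r) t)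
      \<longrightarrow> CARD('d) = 3 \<and> congruent_copy X (sphere (0 :: real ^ 3) r))"
  by (intro conjI; rule impI; elim conjE)
    (rule body_eq_ball_congruent[OF _ _ assms refl] body_or_closed_submanifold_eq_ball[OF _ _ assms]
      body_or_closed_submanifold_eq_circle[OF _ _ assms] body_or_closed_submanifold_eq_sphere[OF _ _ _ assms],
      assumption, simp_all)+

end
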